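(* Let $\Lambda\subset\mathbb R^d$ be a Bravais lattice and let $\mathcal Z_{G_1},\mathcal Z_{G_2}$ be semi-analytic graph lattice sums with representations $(a_\eta,\boldsymbol b_\eta,\boldsymbol\nu_\eta)$, $\boldsymbol b_\eta,\boldsymbol\nu_\eta\in\mathbb C^{N_\eta}$, $\eta\in\{1,2\}$, where $\mathrm{Re}(\nu_{i\eta})>d$ and $\nu_{i1},\nu_{j2}\notin d+2\mathbb N_0$ for all indices. Let the regular parts satisfy $|a_\eta(\boldsymbol x)|\le C_\eta|\boldsymbol x|^{-\gamma_\eta}$ on $\Lambda\setminus\{\boldsymbol 0\}$ with $\gamma_\eta>d$. Then $\mathcal Z_{G_1}\mathcal Z_{G_2}$ is semi-analytic, and $$\begin{aligned}\mathcal Z_{G_1}(\boldsymbol k)\,\mathcal Z_{G_2}(\boldsymbol k)&=\sum_{\boldsymbol x\in\Lambda}a_3(\boldsymbol x)\,e^{-2\pi i\boldsymbol x\cdot\boldsymbol k}+\sum_{i=1}^{N_1}\sum_{j=1}^{N_2}b_{i1}b_{j2}\frac{c_{\nu_{i1}}\,c_{\nu_{j2}}}{V_\Lambda\,c_{\nu_{i1}+\nu_{j2}-d}}\,Z_{\Lambda,\nu_{i1}+\nu_{j2}-d}(\boldsymbol k)\\&\quad+\mathcal Z_{G_2}(\boldsymbol 0)\sum_{i=1}^{N_1}b_{i1}\,Z_{\Lambda,\nu_{i1}}(\boldsymbol k)+\mathcal Z_{G_1}(\boldsymbol 0)\sum_{j=1}^{N_2}b_{j2}\,Z_{\Lambda,\nu_{j2}}(\boldsymbol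 k),\end{aligned}$$ where $1/c_{\nu_{i1}+\nu_{j2}-d}$ is set to $0$ when $\nu_{i1}+\nu_{j2}-d\in d+2\mathbb N_0$. The exponents of the Epstein terms satisfy $\mathrm{Re}(\nu_{i1}+\nu_{j2}-d)>d$. The regular part $a_3$ is even and obeys $|a_3(\boldsymbol x)|\le C_3|\boldsymbol x|^{-\gamma_3}$ on $\Lambda\setminus\{\boldsymbol 0\}$ for some $C_3>0$, with $$\gamma_3=\min\Big(\gamma_1,\ \gamma_2,\ \min_i\mathrm{Re}(\nu_{i1})+2,\ \min_j\mathrm{Re}(\nu_{j2})+2\Big),$$ with minima over empty index sets taken as $\infty$. In particular, $\gamma_3\ge d+2$ if $\gamma_1,\gamma_2\ge d+2$, so that semi-analyticity is preserved.
   Context: Lattice: $\Lambda=A\mathbb Z^d$ with $A\in\mathbb R^{d\times d}$ invertible, $V_\Lambda=|\det A|$, $\mathrm{BZ}=A^{-T}[0,1)^d$. Power-law kernel: $\mathcal K_\nu(\boldsymbol x)=|\boldsymbol x|^{-\nu}$ for $\boldsymbol x\neq\boldsymbol 0$, $\mathcal K_\nu(\boldsymbol 0)=0$. Epstein zeta function: $Z_{\Lambda,\nu}(\boldsymbol k)=\sum_{\boldsymbol x\in\Lambda}e^{-2\pi i\boldsymbol x\cdot\boldsymbol k}\mathcal K_\nu(\boldsymbol x)$ for $\mathrm{Re}(\nu)>d$. The constant $c_\nu$ is $$c_\nu=\pi^{\nu-d/2}\,\frac{\Gamma((d-\nu)/2)}{\Gamma(\nu/2)},\qquad \nu\notin d+2\mathbb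 N_0.$$ Graph lattice sum of a finite connected multigraph $G=(V,E)$ with oriented edges $e=(e^-,e^+)$, $e^-\ne e^+$, kernels $K_e\in\ell^1(\Lambda)$ and terminals $s,t\in V$: $\mathcal Z_G(\boldsymbol k)=\sum_{\{\boldsymbol x_v\in\Lambda\}_{v\neq p}}e^{-2\pi i(\boldsymbol x_t-\boldsymbol x_s)\cdot\boldsymbol k}\prod_{e\in E}K_e(\boldsymbol x_{e^+}-\boldsymbol x_{e^-})$, with an arbitrary pinned node $p$ at fixed position. Semi-analytic: a kernel $K\in\ell^1(\Lambda)$ is semi-analytic if it admits a representation $K(\boldsymbol x)=a(\boldsymbol x)+\sum_{j=1}^N b_j\mathcal K_{\nu_j}(\boldsymbol x)$ with $N\in\mathbb N_0$, $b_j,\nu_j\in\mathbb C$, $\mathrm{Re}(\nu_j)>d$, and $a:\Lambda\to\mathbb C$ even (the "regular part") with $|a(\boldsymbol x)|\le C|\boldsymbol x|^{-(d+2)}$ for all $\boldsymbol x\in\Lambda\setminus\{\boldsymbol 0\}$ and some $C>0$. The representation is denoted $(a,\boldsymbol b,\boldsymbol\nu)$; it is not unique, and the statement refers to given representations. A graph lattice sum $\mathcal Z_G$ is semi-analytic if it is the lattice Fourier transform of a semi-analytic kernel, i.e. $\mathcal Z_G(\boldsymbol k)=\sum_{\boldsymbol x\in\Lambda}a(\boldsymbol x)e^{-2\pi i\boldsymbol x\cdot\boldsymbol k}+\sum_{j=1}^N b_jZ_{\Lambda,\nu_j}(\boldsymbol k)$. *)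

theory Defs
  imports "HOL-Analysis.Analysis" "Graph_Theory.Digraph_Component"
begin

definition lattice :: "real^'n^'n \<Rightarrow> (real^'n) set" where
  "lattice A = range (\<lambda>z::int^'n. A *v (\<chi> i. of_int (z $ i)))"

definition covolume :: "real^'n^'n \<Rightarrow> real" where
  "covolume A = \<bar>det A\<bar>"

definition power_kernel :: "complex \<Rightarrow> real^'n \<Rightarrow> complex" where
  "power_kernel \<nu> x = (if x = 0 then 0 else complex_of_real (norm x) powr (- \<nu>))"

definition lattice_character :: "real^'n \<Rightarrow> real^'n \<Rightarrow> complex" where
  "lattice_character x k = exp (- (2 * of_real pi * \<i> * of_real (x \<bullet> k)))"

text \<open>Used only for lattice-summable kernels (\<^const>\<open>infsum\<close> is 0 otherwise).\<close>

definition lattice_fourier :: "real^'n^'n \<Rightarrow> (real^'n \<Rightarrow> complex) \<Rightarrow> real^'n \<Rightarrow> complex" where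
  "lattice_fourier A K k = (\<Sum>\<^sub>\<infinity>x\<in>lattice A. K x * lattice_character x k)"

text \<open>The defining series; it is only used in its region of convergence, where the real part of
  the exponent exceeds the dimension.\<close>

definition epstein_zeta :: "real^'n^'n \<Rightarrow> complex \<Rightarrow> real^'n \<Rightarrow> complex" where
  "epstein_zeta A \<nu> = lattice_fourier A (power_kernel \<nu>)"

definition polar_exponents :: "nat \<Rightarrow> complex set" where
  "polar_exponents d = {of_nat d + 2 * of_nat m | m. True}"

definition c_const :: "nat \<Rightarrow> complex \<Rightarrow> complex" where
  "c_const d \<nu> = of_real pi powr (\<nu> - of_nat d / 2)
     * Gamma ((of_nat d - \<nu>) / 2) / Gamma (\<nu> / 2)"

text \<open>The reciprocal of the constant above, extended by 0 to the exponents where that constant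
  has a pole.\<close>

definition inv_c_const :: "nat \<Rightarrow> complex \<Rightarrow> complex" where
  "inv_c_const d \<nu> = (if \<nu> \<in> polar_exponents d then 0 else 1 / c_const d \<nu>)"

text \<open>Kernels and regular parts are functions on the lattice; their values at other points of the
  ambient space are irrelevant.\<close>

definition ell1 :: "real^'n^'n \<Rightarrow> (real^'n \<Rightarrow> complex) \<Rightarrow> bool" where
  "ell1 A K \<longleftrightarrow> (\<lambda>x. norm (K x)) summable_on lattice A"

definition even_on_lattice :: "real^'n^'n \<Rightarrow> (real^'n \<Rightarrow> complex) \<Rightarrow> bool" where
  "even_on_lattice A a \<longleftrightarrow> (\<forall>x\<in>lattice A. a (- x) = a x)"

definition decays :: "real^'n^'n \<Rightarrow> real \<Rightarrow> (real^'n \<Rightarrow> complex) \<Rightarrow> bool" where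
  "decays A \<gamma> a \<longleftrightarrow>
     (\<exists>C>0. \<forall>x\<in>lattice A - {0}. norm (a x) \<le> C * norm x powr (- \<gamma>))"

definition semi_analytic_kernel :: "real^'n^'n \<Rightarrow> (real^'n \<Rightarrow> complex) \<Rightarrow> bool" where
  "semi_analytic_kernel A K \<longleftrightarrow> ell1 A K \<and>
     (\<exists>(a :: real^'n \<Rightarrow> complex) (N::nat) (b :: nat \<Rightarrow> complex) (\<nu> :: nat \<Rightarrow> complex).
        even_on_lattice A a \<and> decays A (real CARD('n) + 2) a \<and>
        (\<forall>j<N. Re (\<nu> j) > real CARD('n)) \<and>
        (\<forall>x\<in>lattice A. K x = a x + (\<Sum>j<N. b j * power_kernel (\<nu> j) x)))"

definition semi_analytic :: "real^'n^'n \<Rightarrow> (real^'n \<Rightarrow> complex) \<Rightarrow> bool" where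
  "semi_analytic A Z \<longleftrightarrow> (\<exists>K. semi_analytic_kernel A K \<and> (\<forall>k. Z k = lattice_fourier A K k))"

text \<open>Arcs of the underlying digraph are the oriented edges of the multigraph, from tail to head.\<close>

record ('v, 'e, 'n::finite) kernel_graph =
  digraph_of :: "('v, 'e) pre_digraph"
  edge_kernel :: "'e \<Rightarrow> real^'n \<Rightarrow> complex"
  source_node :: 'v
  target_node :: 'v

text \<open>\<^const>\<open>Digraph_Component.connected\<close> is connectedness of the underlying undirected graph.\<close>

definition kernel_graph :: "real^'n^'n \<Rightarrow> ('v, 'e, 'n) kernel_graph \<Rightarrow> bool" where
  "kernel_graph A G \<longleftrightarrow>
     fin_digraph (digraph_of G) \<and> loopfree_digraph (digraph_of G) \<and>
     Digraph_Component.connected (digraph_of G) \<and>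
     source_node G \<in> verts (digraph_of G) \<and> target_node G \<in> verts (digraph_of G) \<and>
     (\<forall>e\<in>arcs (digraph_of G). ell1 A (edge_kernel G e))"

text \<open>The sum with node \<open>p\<close> pinned at the lattice point \<open>q\<close>.\<close>

definition graph_lattice_sum ::
    "real^'n^'n \<Rightarrow> ('v, 'e, 'n) kernel_graph \<Rightarrow> 'v \<Rightarrow> real^'n \<Rightarrow> real^'n \<Rightarrow> complex" where
  "graph_lattice_sum A G p q k =
     (\<Sum>\<^sub>\<infinity>x\<in>{x \<in> verts (digraph_of G) \<rightarrow>\<^sub>E lattice A. x p = q}.
        lattice_character (x (target_node G) - x (source_node G)) k *
        (\<Prod>e\<in>arcs (digraph_of G).
           edge_kernel G e (x (head (digraph_of G) e) - x (tail (digraph_of G) e))))"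

text \<open>Natural numbers suffice as names for the nodes and edges of a finite multigraph.\<close>

definition is_graph_lattice_sum :: "real^'n^'n \<Rightarrow> (real^'n \<Rightarrow> complex) \<Rightarrow> bool" where
  "is_graph_lattice_sum A Z \<longleftrightarrow>
     (\<exists>(G :: (nat, nat, 'n) kernel_graph) p q.
        kernel_graph A G \<and> p \<in> verts (digraph_of G) \<and> q \<in> lattice A \<and>
        (\<forall>k. Z k = graph_lattice_sum A G p q k))"

end

theory Submission
  imports Defs "HOL-Probability.Distributions" "HOL-Real_Asymp.Real_Asymp"
begin

text \<open>
  Multiplying two transforms means convolving the kernels on the lattice, so the theorem is a statement about
  the behaviour of \<open>lattice_conv A K1 K2 x\<close> for large \<open>x\<close>. Write \<open>d\<close> for the dimension. Each kernel is a
  sum of an even regular part and of powers \<open>\<bar>x\<bar> powr (- \<nu>)\<close>, and the convolution is expanded bilinearly.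

  When one factor is a regular part \<open>a\<close> and the other a power \<open>f\<close>, the mass of \<open>a\<close> sits near the origin, where
  \<open>f (x - y)\<close> is close to \<open>f x\<close>; since \<open>a\<close> is even, only the second difference of \<open>f\<close> enters the error,
  and that is two orders smaller than \<open>f\<close>. Hence the convolution is \<open>(\<Sum> a) * f x\<close> up to an error of order
  \<open>min \<gamma> (Re \<nu> + 2)\<close>, where \<open>\<gamma>\<close> is the order of \<open>a\<close> (\<open>regular_conv\<close>). Two regular parts convolve to a regular part (\<open>lattice_conv_decay\<close>).

  For two powers there are three concentrations: near \<open>y = 0\<close>, near \<open>y = x\<close> and the bulk at scale \<open>\<bar>x\<bar>\<close>. The
  bulk is the homogeneous convolution on \<open>\<real>\<^sup>d\<close>, of order \<open>\<nu> + \<mu> - d\<close>, whose constant is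
  \<open>c_\<nu> * c_\<mu> / c_{\<nu> + \<mu> - d}\<close>, while the first two contribute the masses of the kernels. The proof avoids
  the Fourier transforms of powers and analytic continuation. The power is replaced by \<open>smooth_kernel \<nu>\<close>, the superposition of the Gaussians
  \<open>exp (- \<bar>x\<bar>\<^sup>2 / p)\<close> over \<open>p \<ge> 1\<close> only. It is smooth, and it differs from the power by an error two orders smaller
  (\<open>power_kernel_error\<close>). Gaussians convolve to Gaussians and their times add, so the convolution of two such superpositions
  is a superposition over the total time \<open>P\<close> whose density is a Beta integral with both ends cut off
  (\<open>profile_convolution\<close>). As \<open>P\<close> grows that density has three leading terms, one from the complete (continued)
  Beta function and one from each cut (\<open>beta_asymp_nonpos_Ints\<close>); they produce exactly the bulk term and the two mass
  terms (\<open>smooth_kernel_convolution\<close>).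

  It remains to compare the lattice sum with the integral to the same accuracy. The sums of a function over the translates
  \<open>lattice A + p\<close>, averaged over \<open>p\<close> in a unit cell, give its integral (\<open>integral_tiling\<close>). For a fixed shift \<open>p\<close> split
  the shifted kernels into even and odd parts. The even part differs from the power by a regular even function, so that
  \<open>regular_conv\<close> applies and only sums over the lattice are exchanged; the product of the odd parts is negligible
  because each odd part is one order smaller and cancels against itself (\<open>odd_conv\<close>). Averaging replaces
  the integrals of the smooth kernels in the mass terms by the lattice masses (\<open>averaged_conv_error\<close>), which gives
  \<open>power_kernel_lattice_conv\<close>; collecting terms gives \<open>product_kernel_expansion\<close>.

  The product is a graph lattice sum because every summable kernel is the kernel of a graph with a single edge. It is
  semi-analytic because an exponent above \<open>d\<close> at which \<open>c_\<nu>\<close> has a pole is at least \<open>d + 2\<close>, and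
  the corresponding power may be moved into the regular part before the expansion is applied.
\<close>

section \<open>Lattice sums and polynomial weights\<close>

text \<open>Shifting the norm by 1 makes the weight finite at the origin, so that one bound covers all lattice points; away
  from the origin it is comparable to the pure power.\<close>

definition wt :: "real \<Rightarrow> 'a::real_normed_vector \<Rightarrow> real" where
  "wt s x = (1 + norm x) powr (- s)"

lemma wt_pos: "wt s x > 0"
  unfolding wt_def using norm_ge_zero[of x] powr_gt_zero[of "1 + norm x" "- s"] by linarith

lemma wt_nonneg [simp]: "wt s x \<ge> 0"
  using wt_pos[of s x] by simp

lemma wt_minus [simp]: "wt s (- x) = wt s x"
  by (simp add: wt_def)

lemma wt_add_exponent: "wt (s + t) x = wt s x * wt t x"
  by (simp add: wt_def flip: powr_add)

lemma wt_mono_exponent: "s \<le> t \<Longrightarrow> wt t x \<le> wt s x"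
  unfolding wt_def by (intro powr_mono) auto

lemma wt_le_1: "s \<ge> 0 \<Longrightarrow> wt s x \<le> 1"
  using wt_mono_exponent[of 0 s x] norm_ge_zero[of x] by (simp add: wt_def split: if_splits)

lemma wt_compare:
  assumes "1 + norm x \<le> c * (1 + norm y)" "s \<ge> 0" "c > 0"
  shows "wt s y \<le> c powr s * wt s x"
proof -
  have "wt s y = c powr s * (c * (1 + norm y)) powr (- s)"
    using assms by (simp add: wt_def powr_mult powr_add[symmetric] flip: mult.assoc)
  also have "\<dots> \<le> c powr s * (1 + norm x) powr (- s)"
    using assms by (intro mult_left_mono powr_mono2') (auto intro: add_pos_nonneg)
  finally show ?thesis by (simp add: wt_def)
qed

lemma lattice_iff: "x \<in> lattice A \<longleftrightarrow> (\<exists>z::int^'n. x = A *v (\<chi> i. of_int (z $ i)))"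
  for A :: "real^'n^'n"
  by (auto simp: lattice_def)

lemma lattice_0 [simp]: "0 \<in> lattice A" for A :: "real^'n^'n"
proof -
  have "A *v (\<chi> i. of_int ((0::int^'n) $ i)) = 0" by (simp add: zero_vec_def[symmetric])
  then show ?thesis unfolding lattice_iff by metis
qed

lemma lattice_diff [intro]:
  fixes A :: "real^'n^'n"
  assumes "x \<in> lattice A" "y \<in> lattice A" shows "x - y \<in> lattice A"
proof -
  obtain z w :: "int^'n" where "x = A *v (\<chi> i. of_int (z $ i))" "y = A *v (\<chi> i. of_int (w $ i))"
    using assms unfolding lattice_iff by blast
  then have "x - y = A *v (\<chi> i. of_int ((z - w) $ i))"
    by (simp only: matrix_vector_mult_diff_distrib[symmetric]) (simp add: minus_vec_def)
  then show ?thesis unfolding lattice_iff by blast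
qed

lemma lattice_uminus [intro]: "x \<in> lattice A \<Longrightarrow> - x \<in> lattice A" for A :: "real^'n^'n"
  using lattice_diff[OF lattice_0] by fastforce

lemma lattice_add [intro]:
  "x \<in> lattice A \<Longrightarrow> y \<in> lattice A \<Longrightarrow> x + y \<in> lattice A" for A :: "real^'n^'n"
  using lattice_diff[OF _ lattice_uminus, of x A y] by simp

lemma bij_lattice_reflect: "x \<in> lattice A \<Longrightarrow> bij_betw (\<lambda>y. x - y) (lattice A) (lattice A)"
  for A :: "real^'n^'n"
  by (rule bij_betwI[where g="\<lambda>y. x - y"]) auto

lemma bij_lattice_add: "x \<in> lattice A \<Longrightarrow> bij_betw (\<lambda>y. x + y) (lattice A) (lattice A)"
  for A :: "real^'n^'n"
  by (rule bij_betwI[where g="\<lambda>y. y - x"]) auto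

lemma bij_lattice_uminus: "bij_betw uminus (lattice A) (lattice A)"
  for A :: "real^'n^'n"
  by (rule bij_betwI[where g=uminus]) auto

lemma countable_lattice: "countable (lattice (A :: real^'n^'n))"
proof -
  have inj: "inj (\<lambda>z::int^'n. vec_nth z)" by (simp add: inj_def vec_nth_inject)
  have "countable (PiE (UNIV::'n set) (\<lambda>_. UNIV :: int set))" by (intro countable_PiE) auto
  then have "countable (range (\<lambda>z::int^'n. vec_nth z))"
    by (rule countable_subset[rotated]) (auto simp: PiE_def)
  with inj have "countable (UNIV :: (int^'n) set)" using countable_image_inj_on by blast
  then show ?thesis unfolding lattice_def by (rule countable_image)
qed

lemma invertible_norm_lower_bound:
  fixes A :: "real^'n^'n"
  assumes "invertible A"
  obtains c where "c > 0" "\<And>v. norm (A *v v) \<ge> c * norm v"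
proof -
  have "inj ((*v) A)" using assms by (simp add: inj_matrix_vector_mult)
  then obtain c where "c > 0" "\<And>x. norm (A *v x) \<ge> c * norm x"
    using linear_inj_bounded_below_pos[of "(*v) A"] by (metis matrix_vector_mul_linear)
  then show ?thesis using that by (simp add: mult.commute)
qed

lemma lattice_min_norm:
  fixes A :: "real^'n^'n"
  assumes "invertible A"
  obtains c where "c > 0" "\<And>x. x \<in> lattice A \<Longrightarrow> x \<noteq> 0 \<Longrightarrow> norm x \<ge> c"
proof -
  obtain c where c: "c > 0" "\<And>v. norm (A *v v) \<ge> c * norm v"
    using invertible_norm_lower_bound[OF assms] by blast
  have "norm x \<ge> c" if x: "x \<in> lattice A" "x \<noteq> 0" for x
  proof -
    obtain z :: "int^'n" where z: "x = A *v (\<chi> i. of_int (z $ i))" using x lattice_iff by blast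
    define v :: "real^'n" where "v = (\<chi> i. of_int (z $ i))"
    have "v \<noteq> 0" using x z by (auto simp: v_def)
    then obtain i where "v $ i \<noteq> 0" by (auto simp: vec_eq_iff)
    then have "\<bar>v $ i\<bar> \<ge> 1" by (simp add: v_def)
    then have "norm v \<ge> 1" using component_le_norm_cart[of v i] by linarith
    then have "c * norm v \<ge> c" using c(1) by simp
    then show ?thesis using c(2)[of v] z by (simp add: v_def)
  qed
  with c(1) show ?thesis using that by blast
qed

lemma int_powr_summable:
  assumes "t > 1"
  shows "(\<lambda>z::int. (1 + \<bar>of_int z\<bar>) powr (- t) :: real) summable_on UNIV"
proof -
  define f where "f = (\<lambda>z::int. (1 + \<bar>of_int z\<bar>) powr (- t) :: real)"
  have "summable (\<lambda>n. real n powr (- t))" using assms by (simp add: summable_real_powr_iff)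
  then have "summable (\<lambda>n. real (Suc n) powr (- t))" by (subst summable_Suc_iff)
  then have s: "(\<lambda>n. f (int n)) summable_on UNIV"
    by (subst summable_on_UNIV_nonneg_real_iff) (auto simp: f_def add.commute)
  have 1: "f summable_on range int"
    using s by (subst summable_on_reindex) (auto simp: o_def)
  have 2: "f summable_on range (\<lambda>n. - int n)"
    using s by (subst summable_on_reindex) (auto simp: o_def inj_def f_def)
  have "range int \<union> range (\<lambda>n. - int n) = UNIV"
    by auto (metis int_cases2 rangeI)
  then show ?thesis using summable_on_union[OF 1 2] unfolding f_def by simp
qed

text \<open>The weight is dominated by a product of one-dimensional weights, so that its lattice sum
  factorizes; the exponent shared out over the coordinates exceeds 1 in each of them.\<close>

lemma wt_summable:
  fixes A :: "real^'n^'n"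
  assumes inv: "invertible A" and s: "s > real CARD('n)"
  shows "wt s summable_on lattice A"
proof -
  define d where "d = real CARD('n)"
  have d: "d > 0" by (simp add: d_def)
  define t where "t = s / d"
  have t: "t > 1" using s d by (simp add: t_def d_def)
  obtain c where c: "c > 0" "\<And>v. norm (A *v v) \<ge> c * norm v"
    using invertible_norm_lower_bound[OF inv] by blast
  \<comment> \<open>at most 1, so that it may also be put in front of the constant 1 in the weight\<close>
  define c' where "c' = min c 1"
  have c': "c' > 0" "c' \<le> c" "c' \<le> 1" using c by (auto simp: c'_def)
  define g where "g = (\<lambda>z::int. (1 + \<bar>of_int z\<bar>) powr (- t) :: real)"
  have "(\<lambda>z. norm (g z)) summable_on UNIV"
    using int_powr_summable[OF t] by (simp add: g_def)
  then have "Infinite_Set_Sum.abs_summable_on g UNIV"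
    by (simp only: abs_summable_equivalent)
  then have "Infinite_Set_Sum.abs_summable_on (\<lambda>h. \<Prod>i\<in>UNIV. g (h i)) (PiE (UNIV::'n set) (\<lambda>_. UNIV))"
    by (intro abs_summable_on_prod_PiE) (auto simp: g_def)
  then have "(\<lambda>h::'n\<Rightarrow>int. norm (\<Prod>i\<in>UNIV. g (h i))) summable_on UNIV"
    by (simp only: abs_summable_equivalent[symmetric] PiE_UNIV_domain Pi_UNIV)
  then have "(\<lambda>h::'n\<Rightarrow>int. \<Prod>i\<in>UNIV. g (h i)) summable_on UNIV"
    by (rule abs_summable_summable)
  moreover have "bij (\<lambda>z::int^'n. vec_nth z)"
    by (rule bijI') (auto simp: vec_nth_inject intro!: exI[of _ "vec_lambda y" for y])
  ultimately have S: "(\<lambda>z::int^'n. \<Prod>i\<in>UNIV. g (z $ i)) summable_on UNIV"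
    using summable_on_reindex_bij_betw[of vec_nth UNIV UNIV "\<lambda>h::'n\<Rightarrow>int. \<Prod>i\<in>UNIV. g (h i)"]
    by simp
  define e where "e = (\<lambda>z::int^'n. A *v (\<chi> i. of_int (z $ i)))"
  have "inj ((*v) A)" using inv by (simp add: inj_matrix_vector_mult)
  then have inj: "inj e"
  proof (intro injI)
    fix x y assume "e x = e y"
    then have "(\<chi> i. real_of_int (x $ i)) = (\<chi> i. of_int (y $ i))"
      using \<open>inj ((*v) A)\<close> unfolding e_def by (rule injD[rotated])
    then show "x = y" by (simp add: vec_eq_iff)
  qed
  have key: "(x powr (- t)) ^ CARD('n) = x powr (- s)" if "x > 0" for x
    using powr_realpow[of "x powr (- t)" "CARD('n)"] that by (simp add: powr_powr t_def d_def)
  have bd: "wt s (e z) \<le> c' powr (- s) * (\<Prod>i\<in>UNIV. g (z $ i))" for z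
  proof -
    define v :: "real^'n" where "v = (\<chi> i. of_int (z $ i))"
    have "wt s (e z) = (\<Prod>i\<in>(UNIV::'n set). (1 + norm (e z)) powr (- t))"
      using key[of "1 + norm (e z)"] norm_ge_zero[of "e z"] by (simp add: wt_def)
    also have "\<dots> \<le> (\<Prod>i\<in>UNIV. c' powr (- t) * g (z $ i))"
    proof (intro prod_mono conjI)
      fix i :: 'n
      have "c' * (1 + \<bar>v $ i\<bar>) \<le> 1 + c * \<bar>v $ i\<bar>"
        using c' by (simp add: distrib_left add_mono mult_right_mono)
      also have "\<dots> \<le> 1 + norm (e z)"
      proof -
        have "c * \<bar>v $ i\<bar> \<le> c * norm v"
          using c(1) component_le_norm_cart[of v i] by (intro mult_left_mono) auto
        also have "\<dots> \<le> norm (e z)" using c(2)[of v] by (simp add: e_def v_def)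
        finally show ?thesis by simp
      qed
      finally have "(1 + norm (e z)) powr (- t) \<le> (c' * (1 + \<bar>v $ i\<bar>)) powr (- t)"
        using c' t by (intro powr_mono2') (auto intro!: mult_pos_pos)
      also have "\<dots> = c' powr (- t) * g (z $ i)"
        using c' by (simp add: powr_mult g_def v_def)
      finally show "(1 + norm (e z)) powr (- t) \<le> c' powr (- t) * g (z $ i)" .
    qed auto
    also have "\<dots> = c' powr (- s) * (\<Prod>i\<in>UNIV. g (z $ i))"
      using c' key[of c'] by (simp add: prod.distrib)
    finally show ?thesis .
  qed
  have "(\<lambda>z. wt s (e z)) summable_on UNIV"
    by (rule summable_on_comparison_test[OF summable_on_cmult_right[OF S, of "c' powr (-s)"]])
       (simp_all only: bd wt_nonneg)
  then have "wt s summable_on range e"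
    using summable_on_reindex[OF inj, of "wt s"] by (simp only: o_def)
  moreover have "lattice A = range e" unfolding lattice_def e_def by (rule refl)
  ultimately show ?thesis by simp
qed

lemma wt_summable_shift:
  fixes A :: "real^'n^'n"
  assumes "invertible A" "s > real CARD('n)" "x \<in> lattice A"
  shows "(\<lambda>y. wt s (x - y)) summable_on lattice A" "(\<lambda>y. wt s (x + y)) summable_on lattice A"
    "(\<Sum>\<^sub>\<infinity>y\<in>lattice A. wt s (x - y)) = infsum (wt s) (lattice A)"
    "(\<Sum>\<^sub>\<infinity>y\<in>lattice A. wt s (x + y)) = infsum (wt s) (lattice A)"
proof -
  note S = wt_summable[OF assms(1,2)]
  show "(\<lambda>y. wt s (x - y)) summable_on lattice A"
    using summable_on_reindex_bij_betw[OF bij_lattice_reflect[OF assms(3)], of "wt s"] S by (rule iffD2)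
  show "(\<lambda>y. wt s (x + y)) summable_on lattice A"
    using summable_on_reindex_bij_betw[OF bij_lattice_add[OF assms(3)], of "wt s"] S by (rule iffD2)
  show "(\<Sum>\<^sub>\<infinity>y\<in>lattice A. wt s (x - y)) = infsum (wt s) (lattice A)"
    by (rule infsum_reindex_bij_betw[OF bij_lattice_reflect[OF assms(3)]])
  show "(\<Sum>\<^sub>\<infinity>y\<in>lattice A. wt s (x + y)) = infsum (wt s) (lattice A)"
    by (rule infsum_reindex_bij_betw[OF bij_lattice_add[OF assms(3)]])
qed

section \<open>Convolution on the lattice\<close>

definition lattice_conv ::
    "real^'n^'n \<Rightarrow> (real^'n \<Rightarrow> complex) \<Rightarrow> (real^'n \<Rightarrow> complex) \<Rightarrow> real^'n \<Rightarrow> complex" where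
  "lattice_conv A f g x = (\<Sum>\<^sub>\<infinity>y\<in>lattice A. f y * g (x - y))"

lemma infsum_norm_le:
  fixes f :: "'a \<Rightarrow> 'b::banach"
  assumes "g summable_on S" "\<And>x. x \<in> S \<Longrightarrow> norm (f x) \<le> g x"
  shows "(\<lambda>x. norm (f x)) summable_on S" "f summable_on S" "norm (infsum f S) \<le> infsum g S"
proof -
  show "(\<lambda>x. norm (f x)) summable_on S"
    by (rule summable_on_comparison_test[OF assms(1)]) (auto simp: assms(2))
  then show "f summable_on S" by (rule abs_summable_summable)
  then show "norm (infsum f S) \<le> infsum g S"
    using norm_infsum_le[OF has_sum_infsum has_sum_infsum[OF assms(1)], of f] assms(2) by blast
qed

lemma ell1_bounded_by_wt:
  fixes A :: "real^'n^'n"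
  assumes "invertible A" "s > real CARD('n)" "\<And>y. y \<in> lattice A \<Longrightarrow> norm (f y) \<le> C * wt s y"
  shows "ell1 A f"
  unfolding ell1_def
  by (rule infsum_norm_le(1)[OF summable_on_cmult_right[OF wt_summable[OF assms(1,2)]] assms(3)])

lemma ell1_summable: "ell1 A f \<Longrightarrow> f summable_on lattice A"
  unfolding ell1_def by (rule abs_summable_summable)

lemma ell1_bounded:
  assumes "ell1 A f"
  obtains B where "\<And>y. y \<in> lattice A \<Longrightarrow> norm (f y) \<le> B"
proof -
  have "norm (f y) \<le> (\<Sum>\<^sub>\<infinity>y\<in>lattice A. norm (f y))" if "y \<in> lattice A" for y
    using finite_sum_le_infsum[of "\<lambda>y. norm (f y)" "lattice A" "{y}"] assms that by (simp add: ell1_def)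
  then show ?thesis using that by blast
qed

lemma ell1_add: "ell1 A f \<Longrightarrow> ell1 A g \<Longrightarrow> ell1 A (\<lambda>x. f x + g x)"
  unfolding ell1_def
  by (rule infsum_norm_le(1)[OF summable_on_add[of "\<lambda>x. norm (f x)" _ "\<lambda>x. norm (g x)"]])
    (auto intro: norm_triangle_ineq)

lemma ell1_cmult: "ell1 A f \<Longrightarrow> ell1 A (\<lambda>x. c * f x)"
  unfolding ell1_def by (simp add: norm_mult summable_on_cmult_right)

lemma ell1_sum: "(\<And>i. i \<in> I \<Longrightarrow> ell1 A (f i)) \<Longrightarrow> ell1 A (\<lambda>x. \<Sum>i\<in>I. f i x)"
proof (induction I rule: infinite_finite_induct)
  case (insert i I)
  then show ?case using ell1_add[of A "f i" "\<lambda>x. \<Sum>i\<in>I. f i x"] by simp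
qed (auto simp: ell1_def)

lemma ell1_conv_summable:
  fixes A :: "real^'n^'n"
  assumes "ell1 A f" "ell1 A g" "x \<in> lattice A"
  shows "(\<lambda>y. f y * g (x - y)) summable_on lattice A"
proof -
  obtain B where B: "\<And>y. y \<in> lattice A \<Longrightarrow> norm (g y) \<le> B" using ell1_bounded[OF assms(2)] by blast
  have "(\<lambda>y. norm (f y) * B) summable_on lattice A"
    using assms(1) unfolding ell1_def by (rule summable_on_cmult_left)
  then show ?thesis
    by (rule infsum_norm_le(2)) (auto simp: norm_mult intro!: mult_left_mono B lattice_diff assms(3))
qed

lemma lattice_conv_commute:
  fixes A :: "real^'n^'n"
  assumes "x \<in> lattice A"
  shows "lattice_conv A f g x = lattice_conv A g f x"
  unfolding lattice_conv_def
  using infsum_reindex_bij_betw[OF bij_lattice_reflect[OF assms], of "\<lambda>y. f y * g (x - y)"]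
  by (simp add: mult.commute[of "g _"])

lemma lattice_conv_add_left:
  fixes A :: "real^'n^'n"
  assumes "ell1 A f" "ell1 A f'" "ell1 A g" "x \<in> lattice A"
  shows "lattice_conv A (\<lambda>y. f y + f' y) g x = lattice_conv A f g x + lattice_conv A f' g x"
  unfolding lattice_conv_def
  by (simp add: distrib_right infsum_add ell1_conv_summable assms)

lemma lattice_conv_add_right:
  fixes A :: "real^'n^'n"
  assumes "ell1 A f" "ell1 A g" "ell1 A g'" "x \<in> lattice A"
  shows "lattice_conv A f (\<lambda>y. g y + g' y) x = lattice_conv A f g x + lattice_conv A f g' x"
  unfolding lattice_conv_def
  by (simp add: distrib_left infsum_add ell1_conv_summable assms)

lemma lattice_conv_cmult_left:
  "lattice_conv A (\<lambda>y. c * f y) g x = c * lattice_conv A f g x"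
  unfolding lattice_conv_def by (simp add: mult.assoc infsum_cmult_right')

lemma lattice_conv_cmult_right:
  "lattice_conv A f (\<lambda>y. c * g y) x = c * lattice_conv A f g x"
  unfolding lattice_conv_def by (simp add: mult.left_commute infsum_cmult_right')

lemma lattice_conv_sum_left:
  fixes A :: "real^'n^'n"
  assumes "\<And>i. i \<in> I \<Longrightarrow> ell1 A (f i)" "ell1 A g" "x \<in> lattice A"
  shows "lattice_conv A (\<lambda>y. \<Sum>i\<in>I. f i y) g x = (\<Sum>i\<in>I. lattice_conv A (f i) g x)"
  using assms(1)
proof (induction I rule: infinite_finite_induct)
  case (insert i I)
  then show ?case
    using lattice_conv_add_left[OF _ ell1_sum assms(2,3), of "f i" I f] by simp
qed (auto simp: lattice_conv_def)

lemma lattice_conv_sum_right: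
  fixes A :: "real^'n^'n"
  assumes "ell1 A f" "\<And>i. i \<in> I \<Longrightarrow> ell1 A (g i)" "x \<in> lattice A"
  shows "lattice_conv A f (\<lambda>y. \<Sum>i\<in>I. g i y) x = (\<Sum>i\<in>I. lattice_conv A f (g i) x)"
  using lattice_conv_sum_left[OF assms(2,1,3)] assms(3) by (simp add: lattice_conv_commute[of x A f])

lemma lattice_conv_even:
  fixes A :: "real^'n^'n"
  assumes "even_on_lattice A f" "even_on_lattice A g"
  shows "even_on_lattice A (lattice_conv A f g)"
proof -
  have "lattice_conv A f g (- x) = lattice_conv A f g x" if x: "x \<in> lattice A" for x
  proof -
    have "lattice_conv A f g (- x) = (\<Sum>\<^sub>\<infinity>y\<in>lattice A. f (- y) * g (- x - (- y)))"
      unfolding lattice_conv_def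
      using infsum_reindex_bij_betw[OF bij_lattice_uminus[of A], of "\<lambda>y. f y * g (- x - y)"] by simp
    also have "\<dots> = lattice_conv A f g x"
      unfolding lattice_conv_def
    proof (rule infsum_cong)
      fix y assume y: "y \<in> lattice A"
      have "g (- (x - y)) = g (x - y)" "f (- y) = f y"
        using assms lattice_diff[OF x y] y unfolding even_on_lattice_def by blast+
      moreover have "- x - (- y) = - (x - y)" by simp
      ultimately show "f (- y) * g (- x - (- y)) = f y * g (x - y)" by (simp only:)
    qed
    finally show ?thesis .
  qed
  then show ?thesis by (simp add: even_on_lattice_def)
qed

lemma norm_lattice_character [simp]: "norm (lattice_character x k) = 1"
proof -
  have "lattice_character x k = cis (- (2 * pi * (x \<bullet> k)))"
    by (simp add: lattice_character_def cis_conv_exp mult_ac)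
  then show ?thesis by (simp only: norm_cis)
qed

lemma lattice_character_add: "lattice_character (x + y) k = lattice_character x k * lattice_character y k"
  unfolding lattice_character_def exp_add[symmetric] inner_add_left of_real_add
  by (rule arg_cong[where f=exp]) (simp only: ring_distribs minus_add_distrib)

text \<open>Both assertions come from the summability of
  \<open>f y * g z\<close> over pairs of lattice points, reparametrized by \<open>(y, y + z)\<close>.\<close>

lemma lattice_conv_fourier:
  fixes A :: "real^'n^'n"
  assumes f: "ell1 A f" and g: "ell1 A g"
  shows "ell1 A (lattice_conv A f g)"
    and "lattice_fourier A (lattice_conv A f g) k = lattice_fourier A f k * lattice_fourier A g k"
proof -
  let ?L = "lattice A"
  let ?\<chi> = "\<lambda>x. lattice_character x k"
  have bij: "bij_betw (\<lambda>(x, y). (y, x - y)) (?L \<times> ?L) (?L \<times> ?L)"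
    by (rule bij_betwI[where g="\<lambda>(y, z). (y + z, y)"]) auto
  have N: "(\<lambda>(y, z). norm (f y * g z)) summable_on ?L \<times> ?L"
    using Infinite_Sum.abs_summable_on_Sigma_iff[where f="\<lambda>(y, z). f y * g z" and A="?L" and B="\<lambda>_. ?L"] f g
    by (simp add: ell1_def case_prod_unfold norm_mult summable_on_cmult_right infsum_cmult_right'
      summable_on_cmult_left abs_mult)
  have N': "(\<lambda>(x, y). norm (f y * g (x - y))) summable_on ?L \<times> ?L"
    using summable_on_reindex_bij_betw[OF bij, of "\<lambda>(y, z). norm (f y * g z)"] N
    by (simp add: case_prod_unfold)
  then have "(\<lambda>x. norm (\<Sum>\<^sub>\<infinity>y\<in>?L. norm (f y * g (x - y)))) summable_on ?L"
    using Infinite_Sum.abs_summable_on_Sigma_iff[where f="\<lambda>(x, y). f y * g (x - y)" and A="?L" and B="\<lambda>_. ?L"]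
    by (simp add: case_prod_unfold)
  then have S: "(\<lambda>x. \<Sum>\<^sub>\<infinity>y\<in>?L. norm (f y * g (x - y))) summable_on ?L"
    by (subst (asm) real_norm_def, subst (asm) abs_of_nonneg) (auto intro: infsum_nonneg)
  show "ell1 A (lattice_conv A f g)"
    unfolding ell1_def
  proof (rule infsum_norm_le(1)[OF S])
    fix x assume x: "x \<in> ?L"
    have "(\<lambda>y. norm (f y * g (x - y))) summable_on ?L"
      using x Infinite_Sum.abs_summable_on_Sigma_iff[where f="\<lambda>(x, y). f y * g (x - y)" and A="?L" and B="\<lambda>_. ?L"] N'
      by (auto simp: case_prod_unfold)
    then show "norm (lattice_conv A f g x) \<le> (\<Sum>\<^sub>\<infinity>y\<in>?L. norm (f y * g (x - y)))"
      unfolding lattice_conv_def by (rule norm_infsum_bound)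
  qed
  have M: "(\<lambda>(y, z). (f y * ?\<chi> y) * (g z * ?\<chi> z)) summable_on ?L \<times> ?L"
    by (rule infsum_norm_le(2)[OF N]) (auto simp: norm_mult)
  have "lattice_fourier A f k * lattice_fourier A g k
      = (\<Sum>\<^sub>\<infinity>y\<in>?L. \<Sum>\<^sub>\<infinity>z\<in>?L. (f y * ?\<chi> y) * (g z * ?\<chi> z))"
    unfolding lattice_fourier_def infsum_cmult_right' infsum_cmult_left' by (rule refl)
  also have "\<dots> = (\<Sum>\<^sub>\<infinity>(y, z)\<in>?L \<times> ?L. (f y * ?\<chi> y) * (g z * ?\<chi> z))"
    by (rule infsum_Sigma'_banach[OF M])
  also have "\<dots> = (\<Sum>\<^sub>\<infinity>(x, y)\<in>?L \<times> ?L. (f y * ?\<chi> y) * (g (x - y) * ?\<chi> (x - y)))"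
    using infsum_reindex_bij_betw[OF bij, of "\<lambda>(y, z). (f y * ?\<chi> y) * (g z * ?\<chi> z)"]
    by (simp add: case_prod_unfold)
  also have "\<dots> = (\<Sum>\<^sub>\<infinity>(x, y)\<in>?L \<times> ?L. f y * g (x - y) * ?\<chi> x)"
  proof (rule infsum_cong, clarify)
    fix x y
    have "(f y * ?\<chi> y) * (g (x - y) * ?\<chi> (x - y)) = f y * g (x - y) * (?\<chi> y * ?\<chi> (x - y))"
      by (simp only: mult_ac)
    also have "?\<chi> y * ?\<chi> (x - y) = ?\<chi> x" using lattice_character_add[of y "x - y" k] by simp
    finally show "(f y * ?\<chi> y) * (g (x - y) * ?\<chi> (x - y)) = f y * g (x - y) * ?\<chi> x" .
  qed
  also have "\<dots> = (\<Sum>\<^sub>\<infinity>x\<in>?L. \<Sum>\<^sub>\<infinity>y\<in>?L. f y * g (x - y) * ?\<chi> x)"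
  proof (rule infsum_Sigma'_banach[symmetric])
    show "(\<lambda>(x, y). f y * g (x - y) * ?\<chi> x) summable_on ?L \<times> ?L"
      by (rule infsum_norm_le(2)[OF N']) (auto simp: norm_mult)
  qed
  also have "\<dots> = lattice_fourier A (lattice_conv A f g) k"
    unfolding lattice_fourier_def lattice_conv_def infsum_cmult_left' by (rule refl)
  finally show "lattice_fourier A (lattice_conv A f g) k = lattice_fourier A f k * lattice_fourier A g k" ..
qed

lemma ell1_fourier_summable:
  assumes "ell1 A f" shows "(\<lambda>x. f x * lattice_character x k) summable_on lattice A"
  using assms unfolding ell1_def by (rule infsum_norm_le(2)) (simp add: norm_mult)

lemma lattice_fourier_add:
  assumes "ell1 A f" "ell1 A g"
  shows "lattice_fourier A (\<lambda>x. f x + g x) k = lattice_fourier A f k + lattice_fourier A g k"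
  unfolding lattice_fourier_def
  using infsum_add[OF ell1_fourier_summable[OF assms(1)] ell1_fourier_summable[OF assms(2)], of k k]
  by (simp only: distrib_right)

lemma lattice_fourier_cmult: "lattice_fourier A (\<lambda>x. c * f x) k = c * lattice_fourier A f k"
  unfolding lattice_fourier_def mult.assoc by (rule infsum_cmult_right')

lemma lattice_fourier_sum:
  assumes "\<And>i. i \<in> I \<Longrightarrow> ell1 A (f i)"
  shows "lattice_fourier A (\<lambda>x. \<Sum>i\<in>I. f i x) k = (\<Sum>i\<in>I. lattice_fourier A (f i) k)"
  using assms
proof (induction I rule: infinite_finite_induct)
  case (insert i I)
  then show ?case
    using lattice_fourier_add[OF _ ell1_sum, of A "f i" I f] by simp
qed (auto simp: lattice_fourier_def)

lemma lattice_fourier_0: "lattice_fourier A f 0 = infsum f (lattice A)"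
  by (simp add: lattice_fourier_def lattice_character_def)

section \<open>Convolution with a regular part\<close>

text \<open>Near the origin the factor \<open>(norm y)\<^sup>2\<close> comes from a second difference. Of the decay
  available at \<open>x\<close>, just enough is moved to \<open>y\<close> to leave the summable weight \<open>wt m y\<close>.\<close>

lemma wt_trade:
  assumes "norm y \<le> norm x"
  shows "wt g y * (norm y)\<^sup>2 * wt (m + 2) x \<le> wt m y * wt (min g (m + 2)) x"
proof -
  define X Y where "X = 1 + norm x" and "Y = 1 + norm y"
  have Y: "Y \<ge> 1" "Y \<le> X" using assms by (auto simp: X_def Y_def)
  have "(norm y)\<^sup>2 \<le> Y powr 2"
    using Y by (simp add: Y_def powr_numeral power_mono)
  then have "wt g y * (norm y)\<^sup>2 * wt (m + 2) x \<le> Y powr (- g) * Y powr 2 * X powr (- (m + 2))"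
    unfolding wt_def X_def[symmetric] Y_def[symmetric]
    by (intro mult_right_mono mult_left_mono) auto
  also have "\<dots> = Y powr (2 - g) * X powr (- (m + 2))"
    using Y by (simp add: powr_add[symmetric] del: powr_numeral)
  also have "\<dots> \<le> Y powr (- m) * X powr (- min g (m + 2))"
  proof (cases "g \<le> m + 2")
    case True
    have "Y powr (2 - g) = Y powr (- m) * Y powr (m + 2 - g)"
      by (simp add: powr_add[symmetric])
    also have "\<dots> \<le> Y powr (- m) * X powr (m + 2 - g)"
      using True Y by (intro mult_left_mono powr_mono2) auto
    finally have "Y powr (2 - g) * X powr (- (m + 2)) \<le> Y powr (- m) * X powr (m + 2 - g) * X powr (- (m + 2))"
      by (intro mult_right_mono) auto
    also have "\<dots> = Y powr (- m) * X powr (- g)"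
      by (simp add: mult.assoc powr_add[symmetric])
    finally show ?thesis using True by (simp add: min_def)
  next
    case False
    then have "Y powr (2 - g) \<le> Y powr (- m)" using Y by (intro powr_mono) auto
    then show ?thesis using False by (simp add: min_def mult_right_mono)
  qed
  finally show ?thesis unfolding wt_def X_def[symmetric] Y_def[symmetric] .
qed

lemma wt_far:
  assumes "norm x / 2 \<le> norm y" "s \<ge> 0"
  shows "wt s y \<le> 2 powr s * wt s x"
  using assms by (intro wt_compare) auto

text \<open>Far from the origin the two weights may trade places: \<open>x\<close> receives the decay \<open>g\<close>, and \<open>y\<close> keeps a weight of
  order \<open>m\<close> or \<open>g\<close>, summable in either case.\<close>

lemma wt_far_product:
  assumes "norm x / 2 \<le> norm y" "g \<ge> 0" "m \<ge> 0"
  shows "wt g y * wt m x \<le> 2 powr g * wt g x * (wt m y + wt g y)"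
proof (cases "g \<ge> m")
  case True
  have "wt g y = wt m y * wt (g - m) y" by (simp flip: wt_add_exponent)
  also have "\<dots> \<le> wt m y * (2 powr (g - m) * wt (g - m) x)"
    using assms True by (intro mult_left_mono wt_far) auto
  finally have "wt g y * wt m x \<le> wt m y * (2 powr (g - m) * wt (g - m) x) * wt m x"
    by (rule mult_right_mono) simp
  also have "\<dots> = 2 powr (g - m) * (wt g x * wt m y)"
    using wt_add_exponent[of "g - m" m x] by simp
  also have "\<dots> \<le> 2 powr g * (wt g x * wt m y)"
    using assms by (intro mult_right_mono powr_mono) auto
  also have "\<dots> \<le> 2 powr g * wt g x * (wt m y + wt g y)"
    by (simp add: distrib_left)
  finally show ?thesis .
next
  case False
  then have "wt g y * wt m x \<le> wt g y * wt g x"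
    by (intro mult_left_mono wt_mono_exponent) auto
  also have "\<dots> = 1 * (wt g x * wt g y)" by simp
  also have "\<dots> \<le> 2 powr g * (wt g x * wt g y)"
    using assms by (intro mult_right_mono) (auto simp: ge_one_powr_ge_zero)
  also have "\<dots> \<le> 2 powr g * wt g x * (wt m y + wt g y)"
    by (simp add: distrib_left)
  finally show ?thesis .
qed

definition wt_sum :: "real^'n^'n \<Rightarrow> real \<Rightarrow> real" where
  "wt_sum A s = infsum (wt s) (lattice A)"

lemma wt_sum_nonneg: "wt_sum A s \<ge> 0"
  unfolding wt_sum_def by (intro infsum_nonneg) auto

text \<open>Evenness of \<open>a\<close> replaces \<open>f (x - y)\<close> by the symmetric second difference of \<open>f\<close> at \<open>x\<close>,
  which gains two powers of the distance near the origin; away from the origin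
  the decay of \<open>a\<close> itself suffices. Splitting off a summable weight before comparing \<open>y\<close> with
  \<open>x\<close> avoids the logarithm that a dyadic count would produce at \<open>g = d + 2\<close>.\<close>

lemma regular_conv:
  fixes A :: "real^'n^'n" and a f :: "real^'n \<Rightarrow> complex"
  assumes inv: "invertible A" and m: "m > real CARD('n)" and g: "g > real CARD('n)"
    and even: "even_on_lattice A a"
    and a: "\<And>y. y \<in> lattice A \<Longrightarrow> norm (a y) \<le> D * wt g y"
    and f: "\<And>y. y \<in> lattice A \<Longrightarrow> norm (f y) \<le> C * wt m y"
    and f2: "\<And>x y. x \<in> lattice A \<Longrightarrow> y \<in> lattice A \<Longrightarrow> norm y \<le> norm x / 2 \<Longrightarrow>
               norm (f (x + y) + f (x - y) - 2 * f x) \<le> C * (norm y)\<^sup>2 * wt (m + 2) x"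
    and x: "x \<in> lattice A"
  shows "norm (lattice_conv A a f x - infsum a (lattice A) * f x)
           \<le> D * C * 2 powr g * (4 * wt_sum A m + wt_sum A g) * wt (min g (m + 2)) x"
proof -
  let ?L = "lattice A" and ?k = "min g (m + 2)"
  have mg: "m \<ge> 0" "g \<ge> 0" using m g by (auto intro: order_trans[OF _ less_imp_le])
  have D: "D \<ge> 0" using a[OF lattice_0] by (simp add: wt_def) (metis norm_ge_zero order_trans)
  have C: "C \<ge> 0" using f[OF lattice_0] by (simp add: wt_def) (metis norm_ge_zero order_trans)
  have ea: "ell1 A a" by (rule ell1_bounded_by_wt[OF inv g a])
  have ef: "ell1 A f" by (rule ell1_bounded_by_wt[OF inv m f])
  have s1: "(\<lambda>y. a y * f (x - y)) summable_on ?L" by (rule ell1_conv_summable[OF ea ef x])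
  have e: "a (- y) = a y" if "y \<in> ?L" for y using even that by (simp add: even_on_lattice_def)
  have c2: "lattice_conv A a f x = (\<Sum>\<^sub>\<infinity>y\<in>?L. a (- y) * f (x - (- y)))"
    unfolding lattice_conv_def
    using infsum_reindex_bij_betw[OF bij_lattice_uminus[of A], of "\<lambda>y. a y * f (x - y)"] by simp
  also have "\<dots> = (\<Sum>\<^sub>\<infinity>y\<in>?L. a y * f (x + y))"
    by (rule infsum_cong) (simp add: e)
  finally have c2: "lattice_conv A a f x = (\<Sum>\<^sub>\<infinity>y\<in>?L. a y * f (x + y))" .
  have "(\<lambda>y. a (- y) * f (x - (- y))) summable_on ?L"
    using summable_on_reindex_bij_betw[OF bij_lattice_uminus[of A], of "\<lambda>y. a y * f (x - y)"] s1 by simp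
  then have s2: "(\<lambda>y. a y * f (x + y)) summable_on ?L"
    by (rule summable_on_cong[THEN iffD1, rotated]) (simp add: e)
  have s3: "(\<lambda>y. a y * (- 2 * f x)) summable_on ?L"
    by (rule summable_on_cmult_left[OF ell1_summable[OF ea]])
  have "2 * (lattice_conv A a f x - infsum a ?L * f x)
      = (\<Sum>\<^sub>\<infinity>y\<in>?L. a y * f (x + y)) + (\<Sum>\<^sub>\<infinity>y\<in>?L. a y * f (x - y)) + (\<Sum>\<^sub>\<infinity>y\<in>?L. a y * (- 2 * f x))"
    unfolding infsum_cmult_left' using c2 by (simp add: lattice_conv_def[symmetric] algebra_simps)
  also have "\<dots> = (\<Sum>\<^sub>\<infinity>y\<in>?L. a y * f (x + y) + a y * f (x - y) + a y * (- 2 * f x))"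
    by (simp only: infsum_add[OF s2 s1] infsum_add[OF summable_on_add[OF s2 s1] s3])
  finally have eq: "2 * (lattice_conv A a f x - infsum a ?L * f x)
      = (\<Sum>\<^sub>\<infinity>y\<in>?L. a y * (f (x + y) + f (x - y) - 2 * f x))"
    by (simp add: algebra_simps)
  define K where "K = 2 * D * C * 2 powr g * wt ?k x"
  define B where "B = (\<lambda>y. K * (2 * wt m y + wt m (x + y) + wt m (x - y) + wt g y))"
  have K: "K \<ge> 0" using C D by (simp add: K_def)
  \<comment> \<open>lets the near and the far region share one bound \<open>B\<close>\<close>
  have two: "1 \<le> 2 powr g" using mg by (simp add: ge_one_powr_ge_zero)
  have "norm (a y * (f (x + y) + f (x - y) - 2 * f x)) \<le> B y" if y: "y \<in> ?L" for y
  proof (cases "norm y \<le> norm x / 2")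
    case True
    have "norm (a y * (f (x + y) + f (x - y) - 2 * f x))
        \<le> (D * wt g y) * (C * (norm y)\<^sup>2 * wt (m + 2) x)"
      unfolding norm_mult by (intro mult_mono a f2 y x True) (use D in auto)
    also have "\<dots> = D * C * (wt g y * (norm y)\<^sup>2 * wt (m + 2) x)" by simp
    also have "\<dots> \<le> D * C * (wt m y * wt ?k x)"
      using True C D norm_ge_zero[of x] by (intro mult_left_mono wt_trade) (auto simp del: norm_ge_zero)
    also have "\<dots> = (D * C * wt ?k x) * 1 * wt m y" by simp
    also have "\<dots> \<le> (D * C * wt ?k x) * (2 powr g) * (2 * (2 * wt m y + wt m (x + y) + wt m (x - y) + wt g y))"
      using C D two by (intro mult_mono) (auto simp: add_nonneg_nonneg)
    also have "\<dots> = B y" by (simp add: B_def K_def)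
    finally show ?thesis .
  next
    case False
    then have far: "norm x / 2 \<le> norm y" by simp
    have gx: "wt g x \<le> wt ?k x" by (intro wt_mono_exponent) simp
    have "norm (f (x + y) + f (x - y) - 2 * f x) \<le> norm (f (x + y)) + norm (f (x - y)) + 2 * norm (f x)"
      using norm_triangle_ineq4[of "f (x + y) + f (x - y)" "2 * f x"] norm_triangle_ineq[of "f (x + y)" "f (x - y)"]
      by (simp add: norm_mult)
    also have "\<dots> \<le> C * wt m (x + y) + C * wt m (x - y) + 2 * (C * wt m x)"
      using f[of "x + y"] f[of "x - y"] f[of x] x y by (simp add: lattice_add lattice_diff)
    finally have "norm (a y * (f (x + y) + f (x - y) - 2 * f x))
        \<le> (D * wt g y) * (C * wt m (x + y) + C * wt m (x - y) + 2 * (C * wt m x))"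
      unfolding norm_mult by (intro mult_mono a y) (use D in auto)
    also have "\<dots> = D * C * (wt g y * (wt m (x + y) + wt m (x - y)) + 2 * (wt g y * wt m x))"
      by (simp add: algebra_simps)
    also have "\<dots> \<le> D * C * ((2 powr g * wt g x) * (wt m (x + y) + wt m (x - y))
        + 2 * (2 powr g * wt g x * (wt m y + wt g y)))"
      using C D far mg
      by (intro mult_left_mono add_mono mult_right_mono wt_far wt_far_product) (auto simp: add_nonneg_nonneg)
    also have "\<dots> = D * C * 2 powr g * (2 * wt m y + wt m (x + y) + wt m (x - y) + 2 * wt g y) * wt g x"
      by (simp add: algebra_simps)
    also have "\<dots> \<le> D * C * 2 powr g * (2 * (2 * wt m y + wt m (x + y) + wt m (x - y) + wt g y)) * wt ?k x"
      using C D gx by (intro mult_mono) (auto simp: add_nonneg_nonneg)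
    also have "\<dots> = B y" by (simp add: B_def K_def)
    finally show ?thesis .
  qed
  moreover have B: "(B has_sum K * (2 * wt_sum A m + wt_sum A m + wt_sum A m + wt_sum A g)) ?L"
    unfolding B_def
  proof (intro has_sum_cmult_right has_sum_add)
    show "(wt m has_sum wt_sum A m) ?L" "(wt g has_sum wt_sum A g) ?L"
      using wt_summable[OF inv] m g by (simp_all add: wt_sum_def)
    show "((\<lambda>y. wt m (x + y)) has_sum wt_sum A m) ?L" "((\<lambda>y. wt m (x - y)) has_sum wt_sum A m) ?L"
      using wt_summable_shift[OF inv m x] by (simp_all add: wt_sum_def has_sum_iff)
  qed
  ultimately have "norm (2 * (lattice_conv A a f x - infsum a ?L * f x)) \<le> infsum B ?L"
    unfolding eq by (intro infsum_norm_le(3)) (auto simp: has_sum_iff)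
  also have "infsum B ?L = K * (4 * wt_sum A m + wt_sum A g)"
    using B by (simp add: has_sum_iff)
  finally have "2 * norm (lattice_conv A a f x - infsum a ?L * f x) \<le> K * (4 * wt_sum A m + wt_sum A g)"
    by (simp only: norm_mult norm_numeral)
  then show ?thesis by (simp add: K_def mult_ac)
qed

text \<open>Pairing \<open>y\<close> with \<open>- y\<close> turns \<open>v (x - y)\<close> into a difference of \<open>v\<close>; its factor \<open>norm y\<close> costs exactly the extra
  order of decay of \<open>u\<close>.\<close>

lemma odd_conv_near:
  fixes A :: "real^'n^'n" and u v :: "real^'n \<Rightarrow> complex"
  assumes inv: "invertible A" and m: "m > real CARD('n)" and C: "C \<ge> 0"
    and odd: "\<And>y. y \<in> lattice A \<Longrightarrow> u (- y) = - u y"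
    and u: "\<And>y. y \<in> lattice A \<Longrightarrow> norm (u y) \<le> C * wt (m + 1) y"
    and v: "\<And>x y. x \<in> lattice A \<Longrightarrow> y \<in> lattice A \<Longrightarrow> norm y \<le> norm x / 2 \<Longrightarrow>
               norm (v (x + y) - v (x - y)) \<le> C * norm y * wt (l + 2) x"
    and x: "x \<in> lattice A" and ev: "ell1 A v"
  defines "N \<equiv> {y \<in> lattice A. norm y < norm x / 2}"
  shows "norm (\<Sum>\<^sub>\<infinity>y\<in>N. u y * v (x - y)) \<le> C\<^sup>2 * wt_sum A m * wt (l + 2) x"
proof -
  have NL: "N \<subseteq> lattice A" by (auto simp: N_def)
  have "ell1 A u"
    using ell1_bounded_by_wt[OF inv _ u] m by simp
  then have s: "(\<lambda>y. u y * v (x - y)) summable_on lattice A" by (rule ell1_conv_summable[OF _ ev x])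
  then have s1: "(\<lambda>y. u y * v (x - y)) summable_on N" using NL by (rule summable_on_subset_banach)
  have bij: "bij_betw uminus N N"
    by (rule bij_betwI[where g=uminus]) (auto simp: N_def)
  have "(\<Sum>\<^sub>\<infinity>y\<in>N. u y * v (x - y)) = (\<Sum>\<^sub>\<infinity>y\<in>N. u (- y) * v (x - (- y)))"
    using infsum_reindex_bij_betw[OF bij, of "\<lambda>y. u y * v (x - y)"] by simp
  also have "\<dots> = (\<Sum>\<^sub>\<infinity>y\<in>N. - (u y * v (x + y)))"
    by (rule infsum_cong) (use NL in \<open>auto simp: odd\<close>)
  finally have e2: "(\<Sum>\<^sub>\<infinity>y\<in>N. u y * v (x - y)) = (\<Sum>\<^sub>\<infinity>y\<in>N. - (u y * v (x + y)))" .
  have "(\<lambda>y. u (- y) * v (x - (- y))) summable_on N"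
    using summable_on_reindex_bij_betw[OF bij, of "\<lambda>y. u y * v (x - y)"] s1 by simp
  then have s2: "(\<lambda>y. - (u y * v (x + y))) summable_on N"
    by (rule summable_on_cong[THEN iffD1, rotated]) (use NL in \<open>auto simp: odd\<close>)
  have eq: "2 * (\<Sum>\<^sub>\<infinity>y\<in>N. u y * v (x - y)) = (\<Sum>\<^sub>\<infinity>y\<in>N. u y * v (x - y) + - (u y * v (x + y)))"
    using infsum_add[OF s1 s2] e2 by simp
  have "norm (u y * v (x - y) + - (u y * v (x + y))) \<le> C\<^sup>2 * wt (l + 2) x * wt m y" if y: "y \<in> N" for y
  proof -
    have yL: "y \<in> lattice A" and yn: "norm y \<le> norm x / 2" using y by (auto simp: N_def)
    have "u y * v (x - y) + - (u y * v (x + y)) = - (u y * (v (x + y) - v (x - y)))"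
      by (simp add: algebra_simps)
    then have "norm (u y * v (x - y) + - (u y * v (x + y))) = norm (u y) * norm (v (x + y) - v (x - y))"
      by (simp only: norm_minus_cancel norm_mult)
    also have "\<dots> \<le> (C * wt (m + 1) y) * (C * norm y * wt (l + 2) x)"
      by (intro mult_mono u v yL x yn) (use C in auto)
    also have "\<dots> = C\<^sup>2 * wt (l + 2) x * (wt m y * (wt 1 y * norm y))"
      by (simp add: wt_add_exponent power2_eq_square)
    also have "\<dots> \<le> C\<^sup>2 * wt (l + 2) x * (wt m y * 1)"
    proof -
      have "0 < 1 + norm y" by (rule add_pos_nonneg) auto
      then have "wt 1 y * norm y \<le> 1" by (simp add: wt_def powr_minus field_simps)
      then show ?thesis by (intro mult_left_mono) auto
    qed
    finally show ?thesis by simp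
  qed
  moreover have sw: "(\<lambda>y. C\<^sup>2 * wt (l + 2) x * wt m y) summable_on lattice A"
    by (rule summable_on_cmult_right[OF wt_summable[OF inv m]])
  ultimately have "norm (2 * (\<Sum>\<^sub>\<infinity>y\<in>N. u y * v (x - y))) \<le> (\<Sum>\<^sub>\<infinity>y\<in>N. C\<^sup>2 * wt (l + 2) x * wt m y)"
    unfolding eq by (intro infsum_norm_le(3) summable_on_subset_banach[OF sw NL])
  also have "\<dots> \<le> (\<Sum>\<^sub>\<infinity>y\<in>lattice A. C\<^sup>2 * wt (l + 2) x * wt m y)"
    by (intro infsum_mono2 sw summable_on_subset_banach[OF sw NL] NL) auto
  also have "\<dots> = C\<^sup>2 * wt_sum A m * wt (l + 2) x"
    by (simp add: infsum_cmult_right' wt_sum_def)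
  finally have h: "2 * norm (\<Sum>\<^sub>\<infinity>y\<in>N. u y * v (x - y)) \<le> C\<^sup>2 * wt_sum A m * wt (l + 2) x"
    by (simp add: norm_mult)
  then show ?thesis using norm_ge_zero[of "\<Sum>\<^sub>\<infinity>y\<in>N. u y * v (x - y)"] by linarith
qed

text \<open>A product of two odd factors gains one power of the distance from each of them, and its
  leading part cancels near both of its concentration points \<open>0\<close> and \<open>x\<close>.\<close>

lemma odd_conv:
  fixes A :: "real^'n^'n" and u v :: "real^'n \<Rightarrow> complex"
  assumes inv: "invertible A" and m: "m > real CARD('n)" and l: "l > real CARD('n)" and C: "C \<ge> 0"
    and oddu: "\<And>y. y \<in> lattice A \<Longrightarrow> u (- y) = - u y"
    and oddv: "\<And>y. y \<in> lattice A \<Longrightarrow> v (- y) = - v y"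
    and u: "\<And>y. y \<in> lattice A \<Longrightarrow> norm (u y) \<le> C * wt (m + 1) y"
    and v: "\<And>y. y \<in> lattice A \<Longrightarrow> norm (v y) \<le> C * wt (l + 1) y"
    and u1: "\<And>x y. x \<in> lattice A \<Longrightarrow> y \<in> lattice A \<Longrightarrow> norm y \<le> norm x / 2 \<Longrightarrow>
               norm (u (x + y) - u (x - y)) \<le> C * norm y * wt (m + 2) x"
    and v1: "\<And>x y. x \<in> lattice A \<Longrightarrow> y \<in> lattice A \<Longrightarrow> norm y \<le> norm x / 2 \<Longrightarrow>
               norm (v (x + y) - v (x - y)) \<le> C * norm y * wt (l + 2) x"
    and x: "x \<in> lattice A"
  shows "norm (lattice_conv A u v x)
           \<le> C\<^sup>2 * (wt_sum A m + wt_sum A l + 2 powr (l + 2) * wt_sum A m) * wt (min m l + 2) x"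
proof -
  let ?k = "min m l + 2" and ?h = "\<lambda>y. u y * v (x - y)"
  define N where "N = {y \<in> lattice A. norm y < norm x / 2}"
  define M where "M = {y \<in> lattice A. norm (x - y) < norm x / 2}"
  define F where "F = lattice A - (N \<union> M)"
  have l0: "l \<ge> 0" using l by (auto intro: order_trans[OF _ less_imp_le])
  have disj: "N \<inter> M = {}"
  proof -
    have False if "norm y < norm x / 2" "norm (x - y) < norm x / 2" for y
      using norm_triangle_ineq[of y "x - y"] that by simp
    then show ?thesis by (auto simp: N_def M_def)
  qed
  have eu: "ell1 A u" using ell1_bounded_by_wt[OF inv _ u] m by simp
  have ev: "ell1 A v" using ell1_bounded_by_wt[OF inv _ v] l by simp
  have s: "?h summable_on lattice A" by (rule ell1_conv_summable[OF eu ev x])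
  have sub: "N \<subseteq> lattice A" "M \<subseteq> lattice A" "F \<subseteq> lattice A" by (auto simp: N_def M_def F_def)
  note sub' = sub[THEN summable_on_subset_banach[OF s]]
  have "lattice A = (N \<union> M) \<union> F" using sub by (auto simp: F_def)
  then have "lattice_conv A u v x = infsum ?h ((N \<union> M) \<union> F)" by (simp add: lattice_conv_def)
  also have "\<dots> = infsum ?h N + infsum ?h M + infsum ?h F"
    using sub' disj
    by (subst infsum_Un_disjoint) (auto simp: F_def infsum_Un_disjoint intro: summable_on_Un_disjoint)
  finally have split: "lattice_conv A u v x = infsum ?h N + infsum ?h M + infsum ?h F" .
  have kl: "wt (l + 2) x \<le> wt ?k x" "wt (m + 2) x \<le> wt ?k x" by (auto intro!: wt_mono_exponent)
  have "norm (infsum ?h N) \<le> C\<^sup>2 * wt_sum A m * wt (l + 2) x"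
    unfolding N_def using odd_conv_near[OF inv m C oddu u v1 x ev] by simp
  also have "\<dots> \<le> C\<^sup>2 * wt_sum A m * wt ?k x"
    using kl wt_sum_nonneg[of A m] by (intro mult_left_mono) auto
  finally have 1: "norm (infsum ?h N) \<le> C\<^sup>2 * wt_sum A m * wt ?k x" .
  have "bij_betw (\<lambda>y. x - y) N M"
    by (rule bij_betwI[where g="\<lambda>y. x - y"]) (use x in \<open>auto simp: N_def M_def\<close>)
  then have "infsum ?h M = (\<Sum>\<^sub>\<infinity>y\<in>N. v y * u (x - y))"
    using infsum_reindex_bij_betw[of "\<lambda>y. x - y" N M ?h] by (simp add: mult.commute)
  then have "norm (infsum ?h M) \<le> C\<^sup>2 * wt_sum A l * wt (m + 2) x"
    unfolding N_def using odd_conv_near[OF inv l C oddv v u1 x eu] by simp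
  also have "\<dots> \<le> C\<^sup>2 * wt_sum A l * wt ?k x"
    using kl wt_sum_nonneg[of A l] by (intro mult_left_mono) auto
  finally have 2: "norm (infsum ?h M) \<le> C\<^sup>2 * wt_sum A l * wt ?k x" .
  define B :: "real^'n \<Rightarrow> real" where "B = (\<lambda>y. C\<^sup>2 * 2 powr (l + 2) * wt ?k x * wt m y)"
  have sB: "B summable_on lattice A"
    unfolding B_def by (rule summable_on_cmult_right[OF wt_summable[OF inv m]])
  have "norm (?h y) \<le> B y" if "y \<in> F" for y
  proof -
    have y: "y \<in> lattice A" "norm x / 2 \<le> norm y" "norm x / 2 \<le> norm (x - y)"
      using that by (auto simp: F_def N_def M_def)
    have "norm (?h y) \<le> (C * wt (m + 1) y) * (C * wt (l + 1) (x - y))"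
      unfolding norm_mult using x y C by (intro mult_mono u v) auto
    also have "\<dots> = C\<^sup>2 * (wt m y * (wt 1 y * wt (l + 1) (x - y)))"
      by (simp add: wt_add_exponent power2_eq_square)
    also have "\<dots> \<le> C\<^sup>2 * (wt m y * ((2 powr 1 * wt 1 x) * (2 powr (l + 1) * wt (l + 1) x)))"
      using y l0 by (intro mult_left_mono mult_mono wt_far) auto
    also have "\<dots> = C\<^sup>2 * 2 powr (l + 2) * wt (l + 2) x * wt m y"
      using wt_add_exponent[of 1 "l + 1" x] powr_add[of 2 1 "l + 1"] by (simp add: algebra_simps)
    also have "\<dots> \<le> C\<^sup>2 * 2 powr (l + 2) * wt ?k x * wt m y"
      using kl by (intro mult_left_mono mult_right_mono) auto
    finally show ?thesis by (simp add: B_def)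
  qed
  then have "norm (infsum ?h F) \<le> infsum B F"
    by (intro infsum_norm_le(3) summable_on_subset_banach[OF sB sub(3)])
  also have "\<dots> \<le> infsum B (lattice A)"
    by (intro infsum_mono2 sB summable_on_subset_banach[OF sB sub(3)] sub(3)) (auto simp: B_def)
  also have "\<dots> = C\<^sup>2 * 2 powr (l + 2) * wt ?k x * wt_sum A m"
    by (simp add: B_def infsum_cmult_right' wt_sum_def)
  finally have 3: "norm (infsum ?h F) \<le> C\<^sup>2 * 2 powr (l + 2) * wt ?k x * wt_sum A m" .
  have "norm (lattice_conv A u v x) \<le> norm (infsum ?h N) + norm (infsum ?h M) + norm (infsum ?h F)"
    unfolding split by (intro order_trans[OF norm_triangle_ineq] add_mono norm_triangle_ineq) auto
  with 1 2 3 show ?thesis by (simp add: algebra_simps)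
qed

section \<open>The truncated Beta integral\<close>

lemma norm_of_real_powr: "x > 0 \<Longrightarrow> norm (complex_of_real x powr z) = x powr Re z"
  by (simp add: norm_powr_real_powr)

lemma of_real_powr_add: "x > 0 \<Longrightarrow> complex_of_real x powr (y + z) = of_real x powr y * of_real x powr z"
  by (simp add: powr_add)

lemma of_real_powr_Suc: "x > 0 \<Longrightarrow> complex_of_real x powr (z + 1) = of_real x * of_real x powr z"
  by (simp add: powr_add)

text \<open>For functions of one variable, substituting the sum \<open>P = p + q\<close> for the second variable.\<close>

lemma integral_product_sum_substitution:
  fixes f g h :: "real \<Rightarrow> complex"
  assumes f: "integrable lborel f" and g: "integrable lborel g"
    and h[measurable]: "h \<in> borel_measurable borel" and B: "\<And>P. norm (h P) \<le> B"
  shows "(\<integral>p. \<integral>q. f p * g q * h (p + q) \<partial>lborel \<partial>lborel)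
           = (\<integral>P. h P * (\<integral>p. f p * g (P - p) \<partial>lborel) \<partial>lborel)"
    and "integrable lborel (\<lambda>P. h P * (\<integral>p. f p * g (P - p) \<partial>lborel))"
proof -
  have fm[measurable]: "f \<in> borel_measurable borel" using borel_measurable_integrable[OF f] by simp
  have gm[measurable]: "g \<in> borel_measurable borel" using borel_measurable_integrable[OF g] by simp
  have B0: "B \<ge> 0" using B[of 0] norm_ge_zero order_trans by blast
  have gs: "integrable lborel (\<lambda>P. g (P - p))" for p
    using lborel_integrable_real_affine[OF g, of 1 "- p"] by simp
  have gsn: "(\<integral>P. norm (g (P - p)) \<partial>lborel) = (\<integral>q. norm (g q) \<partial>lborel)" for p
    using lborel_integral_real_affine[of 1 "\<lambda>q. norm (g q)" "- p"] by simp
  have in1: "integrable lborel (\<lambda>P. f p * g (P - p) * h P)" for p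
  proof (rule Bochner_Integration.integrable_bound)
    show "integrable lborel (\<lambda>P. norm (f p) * norm (g (P - p)) * B)"
      using gs[of p] by (intro integrable_mult_left integrable_mult_right integrable_norm)
    show "AE P in lborel. norm (f p * g (P - p) * h P) \<le> norm (norm (f p) * norm (g (P - p)) * B)"
      using B B0 by (auto simp: norm_mult abs_mult intro!: mult_mono)
  qed measurable
  have I: "integrable (lborel \<Otimes>\<^sub>M lborel) (\<lambda>(p, P). f p * g (P - p) * h P)"
  proof (rule lborel_pair.Fubini_integrable)
    show "integrable lborel (\<lambda>p. \<integral>P. norm (case (p, P) of (p, P) \<Rightarrow> f p * g (P - p) * h P) \<partial>lborel)"
    proof (rule Bochner_Integration.integrable_bound)
      show "integrable lborel (\<lambda>p. norm (f p) * ((\<integral>q. norm (g q) \<partial>lborel) * B))"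
        using f by (intro integrable_mult_left integrable_norm)
      show "AE p in lborel. norm (\<integral>P. norm (case (p, P) of (p, P) \<Rightarrow> f p * g (P - p) * h P) \<partial>lborel)
          \<le> norm (norm (f p) * ((\<integral>q. norm (g q) \<partial>lborel) * B))"
      proof (rule AE_I2)
        fix p
        have "(\<integral>P. norm (f p * g (P - p) * h P) \<partial>lborel) \<le> (\<integral>P. norm (f p) * norm (g (P - p)) * B \<partial>lborel)"
          using B B0 by (intro integral_mono integrable_norm in1 integrable_mult_left
            integrable_mult_right gs) (auto simp: norm_mult intro!: mult_mono)
        also have "\<dots> = norm (f p) * ((\<integral>q. norm (g q) \<partial>lborel) * B)"
          by (simp add: gsn)
        finally show "norm (\<integral>P. norm (case (p, P) of (p, P) \<Rightarrow> f p * g (P - p) * h P) \<partial>lborel)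
          \<le> norm (norm (f p) * ((\<integral>q. norm (g q) \<partial>lborel) * B))"
          using B0 by simp
      qed
    qed measurable
    show "AE p in lborel. integrable lborel (\<lambda>P. case (p, P) of (p, P) \<Rightarrow> f p * g (P - p) * h P)"
      using in1 by simp
  qed measurable
  have "(\<integral>p. \<integral>q. f p * g q * h (p + q) \<partial>lborel \<partial>lborel) = (\<integral>p. \<integral>P. f p * g (P - p) * h P \<partial>lborel \<partial>lborel)"
  proof (rule Bochner_Integration.integral_cong)
    fix p
    show "(\<integral>q. f p * g q * h (p + q) \<partial>lborel) = (\<integral>P. f p * g (P - p) * h P \<partial>lborel)"
      using lborel_integral_real_affine[of 1 "\<lambda>P. f p * g (P - p) * h P" p] by simp
  qed simp
  also have "\<dots> = (\<integral>P. \<integral>p. f p * g (P - p) * h P \<partial>lborel \<partial>lborel)"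
    by (rule lborel_pair.Fubini_integral[OF I, symmetric])
  also have "\<dots> = (\<integral>P. h P * (\<integral>p. f p * g (P - p) \<partial>lborel) \<partial>lborel)"
    by (simp add: mult.commute[of _ "h _"] flip: mult.assoc) (simp add: mult.assoc)
  finally show "(\<integral>p. \<integral>q. f p * g q * h (p + q) \<partial>lborel \<partial>lborel)
           = (\<integral>P. h P * (\<integral>p. f p * g (P - p) \<partial>lborel) \<partial>lborel)" .
  show "integrable lborel (\<lambda>P. h P * (\<integral>p. f p * g (P - p) \<partial>lborel))"
    using lborel_pair.integrable_snd[OF I] by (simp add: mult.commute[of _ "h _"])
qed

definition gamma_integrand :: "complex \<Rightarrow> real \<Rightarrow> complex" where
  "gamma_integrand s t = indicator {0<..} t *\<^sub>R (of_real t powr (s - 1) * of_real (exp (- t)))"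

lemma gamma_integrand_integrable: "Re s > 0 \<Longrightarrow> integrable lborel (gamma_integrand s)"
  and gamma_integrand_integral: "Re s > 0 \<Longrightarrow> integral\<^sup>L lborel (gamma_integrand s) = Gamma s"
proof -
  assume s: "Re s > 0"
  have eq: "gamma_integrand s = (\<lambda>t. indicator {0<..} t *\<^sub>R (of_real t powr (s - 1) / of_real (exp t)))"
    by (auto simp: gamma_integrand_def fun_eq_iff exp_minus field_simps)
  have m: "gamma_integrand s \<in> borel_measurable borel"
    unfolding gamma_integrand_def
    by (intro borel_measurable_continuous_on_indicator) (auto intro!: continuous_intros)
  have "set_integrable lebesgue {0<..} (\<lambda>t. complex_of_real t powr (s - 1) / of_real (exp t))"
    by (rule absolutely_integrable_Gamma_integral'[OF s])
  then show i: "integrable lborel (gamma_integrand s)"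
    using m unfolding set_integrable_def eq by (simp add: integrable_completion)
  have "(gamma_integrand s has_integral integral\<^sup>L lborel (gamma_integrand s)) UNIV"
    by (rule has_integral_integral_lborel[OF i])
  then have "((\<lambda>t. if t \<in> {0<..} then of_real t powr (s - 1) / of_real (exp t) else 0)
      has_integral integral\<^sup>L lborel (gamma_integrand s)) UNIV"
    unfolding eq by (rule has_integral_eq[rotated]) (auto simp: indicator_def)
  then have "((\<lambda>t. of_real t powr (s - 1) / of_real (exp t)) has_integral integral\<^sup>L lborel (gamma_integrand s)) {0<..}"
    by (simp only: has_integral_restrict_UNIV)
  then show "integral\<^sup>L lborel (gamma_integrand s) = Gamma s"
    using Gamma_integral_complex'[OF s] has_integral_unique by blast
qed

lemma Re_pos_imp_not_nonpos_Ints: "Re z > 0 \<Longrightarrow> z \<notin> \<int>\<^sub>\<le>\<^sub>0"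
  by (metis Re_complex_of_real not_le nonpos_Ints_cases of_int_le_0_iff of_real_of_int_eq)

definition beta_integrand :: "complex \<Rightarrow> complex \<Rightarrow> real \<Rightarrow> real \<Rightarrow> complex" where
  "beta_integrand a b P p = of_real p powr (a - 1) * of_real (P - p) powr (b - 1)"

lemma beta_integral_scaling:
  assumes "P > 0"
  shows "(\<integral>p. indicator {0<..<P} p *\<^sub>R beta_integrand a b P p \<partial>lborel)
     = of_real P powr (a + b - 1) * (\<integral>p. indicator {0<..<1} p *\<^sub>R beta_integrand a b 1 p \<partial>lborel)"
proof -
  have "(\<integral>p. indicator {0<..<P} p *\<^sub>R beta_integrand a b P p \<partial>lborel)
      = P *\<^sub>R (\<integral>t. indicator {0<..<P} (P * t) *\<^sub>R beta_integrand a b P (P * t) \<partial>lborel)"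
    using lborel_integral_real_affine[of P "\<lambda>p. indicator {0<..<P} p *\<^sub>R beta_integrand a b P p" 0] assms
    by simp
  also have "\<dots> = P *\<^sub>R (\<integral>t. of_real P powr (a + b - 2) * (indicator {0<..<1} t *\<^sub>R beta_integrand a b 1 t) \<partial>lborel)"
  proof (intro arg_cong[where f="\<lambda>x. P *\<^sub>R x"] Bochner_Integration.integral_cong refl)
    fix t
    show "indicator {0<..<P} (P * t) *\<^sub>R beta_integrand a b P (P * t)
        = of_real P powr (a + b - 2) * (indicator {0<..<1} t *\<^sub>R beta_integrand a b 1 t)"
    proof (cases "t \<in> {0<..<1}")
      case True
      have "P - P * t = P * (1 - t)" by (simp add: algebra_simps)
      then have "beta_integrand a b P (P * t)
          = (of_real P powr (a - 1) * of_real P powr (b - 1)) * beta_integrand a b 1 t"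
        using True assms by (simp add: beta_integrand_def powr_times_real)
      also have "of_real P powr (a - 1) * of_real P powr (b - 1) = of_real P powr (a + b - 2)"
        using assms by (simp flip: powr_add)
      finally show ?thesis using True assms by (simp add: indicator_def mult_less_cancel_left2)
    next
      case False
      then show ?thesis using assms by (simp add: indicator_def zero_less_mult_iff)
    qed
  qed
  also have "\<dots> = of_real P * of_real P powr (a + b - 2) * (\<integral>t. indicator {0<..<1} t *\<^sub>R beta_integrand a b 1 t \<partial>lborel)"
    by (simp add: scaleR_conv_of_real)
  also have "of_real P * of_real P powr (a + b - 2) = of_real P powr (a + b - 1)"
    using of_real_powr_Suc[OF assms, of "a + b - 2"] by simp
  finally show ?thesis .
qed

text \<open>Euler's relation between the Beta and Gamma integrals, for complex arguments: the
  substitution above turns the product of two Gamma integrals into a Gamma integral times a Beta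
  integral.\<close>

lemma beta_integral:
  assumes a: "Re a > 0" and b: "Re b > 0" and P: "P > 0"
  shows "(\<integral>p. indicator {0<..<P} p *\<^sub>R beta_integrand a b P p \<partial>lborel) = of_real P powr (a + b - 1) * Beta a b"
proof -
  define J where "J = (\<integral>p. indicator {0<..<1} p *\<^sub>R beta_integrand a b 1 p \<partial>lborel)"
  have "Gamma a * Gamma b = (\<integral>p. \<integral>q. gamma_integrand a p * gamma_integrand b q * 1 \<partial>lborel \<partial>lborel)"
    by (simp add: gamma_integrand_integral a b)
  also have "\<dots> = (\<integral>P. 1 * (\<integral>p. gamma_integrand a p * gamma_integrand b (P - p) \<partial>lborel) \<partial>lborel)"
    by (rule integral_product_sum_substitution(1)[where B=1])
      (simp_all add: gamma_integrand_integrable a b)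
  also have "\<dots> = (\<integral>P. gamma_integrand (a + b) P * J \<partial>lborel)"
  proof (rule Bochner_Integration.integral_cong[OF refl])
    fix P :: real
    have e: "gamma_integrand a p * gamma_integrand b (P - p)
        = (indicator {0<..<P} p *\<^sub>R beta_integrand a b P p) * of_real (exp (- P))" for p
    proof -
      have "exp (- p) * exp (- (P - p)) = exp (- P)" by (simp flip: exp_add)
      then have ex: "complex_of_real (exp (- p)) * of_real (exp (- (P - p))) = of_real (exp (- P))"
        by (simp only: flip: of_real_mult)
      show ?thesis
      proof (cases "p \<in> {0<..<P}")
        case True
        then have "gamma_integrand a p * gamma_integrand b (P - p)
            = beta_integrand a b P p * (complex_of_real (exp (- p)) * of_real (exp (- (P - p))))"
          by (simp add: gamma_integrand_def beta_integrand_def del: of_real_exp of_real_diff)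
        then show ?thesis unfolding ex using True by simp
      next
        case False
        then show ?thesis by (auto simp: gamma_integrand_def)
      qed
    qed
    show "1 * (\<integral>p. gamma_integrand a p * gamma_integrand b (P - p) \<partial>lborel) = gamma_integrand (a + b) P * J"
    proof (cases "P > 0")
      case True
      then show ?thesis
        unfolding e integral_mult_left_zero beta_integral_scaling[OF True]
        by (simp add: gamma_integrand_def J_def)
    next
      case False
      then show ?thesis unfolding e by (simp add: gamma_integrand_def indicator_def)
    qed
  qed
  also have "\<dots> = Gamma (a + b) * J"
    using a b by (simp add: gamma_integrand_integral)
  finally have "Gamma a * Gamma b = Gamma (a + b) * J" .
  moreover have "Gamma (a + b) \<noteq> 0"
    using a b Re_pos_imp_not_nonpos_Ints[of "a + b"] by (simp add: Gamma_eq_zero_iff)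
  ultimately have "J = Beta a b" by (simp add: Beta_def)
  then show ?thesis using beta_integral_scaling[OF P, of a b] by (simp add: J_def)
qed

text \<open>The mean value inequality; for \<open>P \<ge> 2\<close> the segment from \<open>P - 1\<close> to \<open>P\<close> stays within a factor 2 of \<open>P\<close>, which
  absorbs either sign of the exponent.\<close>

lemma powr_shift_bound:
  assumes P: "P \<ge> 2" and t: "0 \<le> t" "t \<le> 1"
  shows "norm (complex_of_real (P - t) powr c - of_real P powr c)
          \<le> norm c * 2 powr \<bar>Re c - 1\<bar> * P powr (Re c - 1)"
proof -
  let ?K = "norm c * 2 powr \<bar>Re c - 1\<bar> * P powr (Re c - 1)"
  let ?f' = "\<lambda>x h. h *\<^sub>R (c * complex_of_real x powr (c - 1))"
  have "norm (complex_of_real (P - t) powr c - of_real P powr c) \<le> ?K * norm (P - t - P)"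
  proof (rule differentiable_bound[where S="{P - 1..P}" and f'="?f'"])
    fix x assume x: "x \<in> {P - 1..P}"
    then have x0: "x > 0" using P by auto
    have "((\<lambda>z. z powr c) has_field_derivative c * of_real x powr (c - 1)) (at (complex_of_real x))"
      using x0 by (intro has_field_derivative_powr) simp
    then have "((\<lambda>x. complex_of_real x powr c) has_vector_derivative c * of_real x powr (c - 1)) (at x within {P - 1..P})"
      by (rule has_vector_derivative_real_field)
    then show "((\<lambda>x. complex_of_real x powr c) has_derivative ?f' x) (at x within {P - 1..P})"
      by (simp add: has_vector_derivative_def)
    have "x powr (Re c - 1) \<le> 2 powr \<bar>Re c - 1\<bar> * P powr (Re c - 1)"
    proof (cases "Re c \<ge> 1")
      case True
      have "x powr (Re c - 1) \<le> 1 * P powr (Re c - 1)"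
        using x x0 True by (auto intro: powr_mono2)
      also have "\<dots> \<le> 2 powr \<bar>Re c - 1\<bar> * P powr (Re c - 1)"
        by (intro mult_right_mono ge_one_powr_ge_zero) auto
      finally show ?thesis .
    next
      case False
      have "x powr (Re c - 1) \<le> (P / 2) powr (Re c - 1)"
        using x P False by (intro powr_mono2') auto
      also have "\<dots> = 2 powr \<bar>Re c - 1\<bar> * P powr (Re c - 1)"
      proof -
        have "(P / 2) powr e = 2 powr (- e) * P powr e" for e
        proof -
          have "(P / 2) powr e = P powr e / 2 powr e" by (rule powr_divide)
          also have "\<dots> = 1 / 2 powr e * P powr e" by simp
          finally show ?thesis unfolding powr_minus_divide .
        qed
        moreover have "\<bar>Re c - 1\<bar> = - (Re c - 1)" using False by linarith
        ultimately show ?thesis by (simp only:)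
      qed
      finally show ?thesis .
    qed
    then have le: "norm c * x powr (Re c - 1) \<le> ?K"
      by (simp add: mult.assoc mult_left_mono)
    show "onorm (?f' x) \<le> ?K"
    proof (rule onorm_bound)
      fix h :: real
      have "norm (?f' x h) = (norm c * x powr (Re c - 1)) * norm h"
        using x0 by (simp add: norm_mult norm_of_real_powr)
      also have "\<dots> \<le> ?K * norm h" by (rule mult_right_mono[OF le]) simp
      finally show "norm (?f' x h) \<le> ?K * norm h" .
    qed simp
  qed (use t in auto)
  also have "\<dots> \<le> ?K * 1" using t by (intro mult_left_mono) auto
  finally show ?thesis by simp
qed

text \<open>Euler's Beta integral over an interval of length \<open>P\<close> without its two unit ends; unlike the complete integral
  it converges for all exponents.\<close>

definition truncated_beta :: "complex \<Rightarrow> complex \<Rightarrow> real \<Rightarrow> complex" where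
  "truncated_beta a b P = (\<integral>p. indicator {1..P - 1} p *\<^sub>R beta_integrand a b P p \<partial>lborel)"

lemma beta_integrand_continuous: "continuous_on {1..P - 1} (beta_integrand a b P)"
  unfolding beta_integrand_def by (auto intro!: continuous_intros)

lemma truncated_beta_integrable: "integrable lborel (\<lambda>p. indicator {1..P - 1} p *\<^sub>R beta_integrand a b P p)"
  using borel_integrable_compact[OF _ beta_integrand_continuous, of P a b]
  by (simp add: indicator_scaleR_eq_if)

lemma truncated_beta_commute: "truncated_beta a b P = truncated_beta b a P"
proof -
  have "truncated_beta a b P = (\<integral>p. indicator {1..P - 1} (P - p) *\<^sub>R beta_integrand a b P (P - p) \<partial>lborel)"
    unfolding truncated_beta_def
    using lborel_integral_real_affine[of "-1" "\<lambda>p. indicator {1..P - 1} p *\<^sub>R beta_integrand a b P p" P] by simp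
  also have "\<dots> = truncated_beta b a P"
    unfolding truncated_beta_def
    by (intro Bochner_Integration.integral_cong refl) (auto simp: indicator_def beta_integrand_def mult.commute)
  finally show ?thesis .
qed

text \<open>Since \<open>P = p + (P - p)\<close>.\<close>

lemma truncated_beta_sum:
  "of_real P * truncated_beta a b P = truncated_beta (a + 1) b P + truncated_beta a (b + 1) P"
proof -
  have "of_real P * truncated_beta a b P = (\<integral>p. of_real P * (indicator {1..P - 1} p *\<^sub>R beta_integrand a b P p) \<partial>lborel)"
    unfolding truncated_beta_def by (rule integral_mult_right_zero[symmetric])
  also have "\<dots> = (\<integral>p. indicator {1..P - 1} p *\<^sub>R beta_integrand (a + 1) b P p
        + indicator {1..P - 1} p *\<^sub>R beta_integrand a (b + 1) P p \<partial>lborel)"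
  proof (intro Bochner_Integration.integral_cong refl)
    fix p
    show "of_real P * (indicator {1..P - 1} p *\<^sub>R beta_integrand a b P p)
      = indicator {1..P - 1} p *\<^sub>R beta_integrand (a + 1) b P p + indicator {1..P - 1} p *\<^sub>R beta_integrand a (b + 1) P p"
    proof (cases "p \<in> {1..P - 1}")
      case True
      then have e: "complex_of_real p powr a = of_real p * of_real p powr (a - 1)"
        "complex_of_real (P - p) powr b = of_real (P - p) * of_real (P - p) powr (b - 1)"
        using of_real_powr_Suc[of p "a - 1"] of_real_powr_Suc[of "P - p" "b - 1"] by auto
      have e': "complex_of_real P = of_real p + of_real (P - p)" by simp
      have "of_real P * beta_integrand a b P p = beta_integrand (a + 1) b P p + beta_integrand a (b + 1) P p"
        unfolding beta_integrand_def add_diff_cancel_right' e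
        by (subst e') (simp only: ring_distribs mult_ac)
      then show ?thesis using True by simp
    qed auto
  qed
  also have "\<dots> = truncated_beta (a + 1) b P + truncated_beta a (b + 1) P"
    unfolding truncated_beta_def by (intro Bochner_Integration.integral_add truncated_beta_integrable)
  finally show ?thesis .
qed

text \<open>The fundamental theorem of calculus for \<open>p powr a * (P - p) powr b\<close> between \<open>1\<close> and \<open>P - 1\<close>.\<close>

lemma truncated_beta_by_parts:
  assumes P: "P \<ge> 2"
  shows "a * truncated_beta a (b + 1) P - b * truncated_beta (a + 1) b P
       = of_real (P - 1) powr a - of_real (P - 1) powr b"
proof -
  let ?F = "\<lambda>p. complex_of_real p powr a * of_real (P - p) powr b"
  let ?f = "\<lambda>p. a * beta_integrand a (b + 1) P p - b * beta_integrand (a + 1) b P p"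
  have "(\<integral>p. indicator {1..P - 1} p *\<^sub>R ?f p \<partial>lborel) = ?F (P - 1) - ?F 1"
  proof (rule integral_FTC_Icc)
    show "1 \<le> P - 1" using P by simp
    fix p assume p: "1 \<le> p" "p \<le> P - 1"
    have "((\<lambda>z. z powr a * (of_real P - z) powr b) has_field_derivative ?f p) (at (of_real p))"
      using p by (auto intro!: derivative_eq_intros simp: beta_integrand_def complex_nonpos_Reals_iff)
    then show "(?F has_vector_derivative ?f p) (at p within {1..P - 1})"
      using has_vector_derivative_real_field by fastforce
  next
    show "continuous_on {1..P - 1} ?f"
      by (intro continuous_intros beta_integrand_continuous)
  qed
  also have "(\<integral>p. indicator {1..P - 1} p *\<^sub>R ?f p \<partial>lborel)
      = (\<integral>p. a * (indicator {1..P - 1} p *\<^sub>R beta_integrand a (b + 1) P p)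
            - b * (indicator {1..P - 1} p *\<^sub>R beta_integrand (a + 1) b P p) \<partial>lborel)"
    by (intro Bochner_Integration.integral_cong refl) (simp add: scaleR_diff_right)
  also have "\<dots> = a * truncated_beta a (b + 1) P - b * truncated_beta (a + 1) b P"
    unfolding truncated_beta_def integral_mult_right_zero[symmetric]
    by (intro Bochner_Integration.integral_diff integrable_mult_right truncated_beta_integrable)
  finally show ?thesis by simp
qed

lemma truncated_beta_step:
  assumes P: "P \<ge> 2"
  shows "b * of_real P * truncated_beta a b P
       = (a + b) * truncated_beta a (b + 1) P - of_real (P - 1) powr a + of_real (P - 1) powr b"
  using truncated_beta_sum[of P a b] truncated_beta_by_parts[OF P, of a b]
  by (simp add: algebra_simps)

text \<open>The three terms of the asymptotic expansion of the truncated Beta integral as \<open>P \<rightarrow> \<infinity>\<close>: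
  the scale-invariant one and the contributions of the two truncated ends.\<close>

definition beta_main :: "complex \<Rightarrow> complex \<Rightarrow> real \<Rightarrow> complex" where
  "beta_main a b P = Beta a b * of_real P powr (a + b - 1) - of_real P powr (b - 1) / a - of_real P powr (a - 1) / b"

definition beta_asymp :: "complex \<Rightarrow> complex \<Rightarrow> bool" where
  "beta_asymp a b \<longleftrightarrow>
     (\<exists>K. \<forall>P\<ge>2. norm (truncated_beta a b P - beta_main a b P) \<le> K * P powr (max (Re a) (Re b) - 2))"

lemma beta_asymp_commute: "beta_asymp a b \<Longrightarrow> beta_asymp b a"
proof -
  have "beta_main b a P = beta_main a b P" for P
    by (simp add: beta_main_def Beta_commute[of b a] add.commute algebra_simps)
  then show "beta_asymp a b \<Longrightarrow> beta_asymp b a"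
    by (simp add: beta_asymp_def truncated_beta_commute[of b a] max.commute)
qed

text \<open>The bookkeeping of the induction step: \<open>B\<close> and \<open>B'\<close> stand for the two Beta values, \<open>pa\<close>, \<open>pb\<close>, \<open>pab\<close> for the
  three powers of \<open>P\<close>, \<open>E\<close> for the error of the hypothesis, and \<open>d1\<close>, \<open>d2\<close> for the change of a power of \<open>P\<close> under the shift
  by 1. All terms of leading order cancel except one that vanishes by the recurrence of the Beta function.\<close>

lemma beta_step_cancellation:
  fixes a b c :: complex
  assumes "a \<noteq> 0" "b \<noteq> 0" "c \<noteq> 0"
  shows "(a + b) * (E + (B' * (P * pab) - P * pb / a - pa / c)) - (d1 + P * pa) + (d2 + P * pb)
           - b * P * (B * pab - pb / a - pa / b)
       = (a + b) * E - (a + b) / c * pa - d1 + d2 + P * pab * ((a + b) * B' - b * B)"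
proof -
  have "b * P * (B * pab - pb / a - pa / b) = P * pab * (b * B) - b * (P * pb / a) - P * pa"
    using assms by (simp add: algebra_simps)
  moreover have "(a + b) * (P * pb / a) = P * pb + b * (P * pb / a)"
    using assms by (simp add: field_simps)
  moreover have "(a + b) * (pa / c) = (a + b) / c * pa" by simp
  ultimately show ?thesis by (simp add: right_diff_distrib distrib_left algebra_simps)
qed

text \<open>An integration by parts, combined with \<open>P = p + (P - p)\<close>, expresses the integral with exponents \<open>(a, b)\<close>
  through the one with exponents \<open>(a, b + 1)\<close>, and the three main terms obey the same relation up to the permitted
  error. This takes the place of analytic continuation in the exponents.\<close>

lemma beta_asymp_step:
  assumes a: "a \<noteq> 0" and b: "b \<noteq> 0" "b + 1 \<noteq> 0" and ab: "b \<notin> \<int>\<^sub>\<le>\<^sub>0"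
    and T: "beta_asymp a (b + 1)"
  shows "beta_asymp a b"
proof -
  obtain K where K: "\<And>P. P \<ge> 2 \<Longrightarrow> norm (truncated_beta a (b + 1) P - beta_main a (b + 1) P)
      \<le> K * P powr (max (Re a) (Re b + 1) - 2)"
    using T by (auto simp: beta_asymp_def)
  define k where "k = max (Re a) (Re b)"
  have K0: "K \<ge> 0"
    using order_trans[OF norm_ge_zero K[of 2]] by (simp add: zero_le_mult_iff)
  define c1 c2 where "c1 = norm a * 2 powr \<bar>Re a - 1\<bar>" and "c2 = norm b * 2 powr \<bar>Re b - 1\<bar>"
  define M where "M = (norm (a + b) * K + norm ((a + b) / (b + 1)) + c1 + c2) / norm b"
  have "norm (truncated_beta a b P - beta_main a b P) \<le> M * P powr (k - 2)" if P: "P \<ge> 2" for P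
  proof -
    define E where "E = truncated_beta a (b + 1) P - beta_main a (b + 1) P"
    define d1 d2 where "d1 = of_real (P - 1) powr a - complex_of_real P powr a"
      and "d2 = of_real (P - 1) powr b - complex_of_real P powr b"
    define pa pb pab where "pa = complex_of_real P powr (a - 1)" and "pb = complex_of_real P powr (b - 1)"
      and "pab = complex_of_real P powr (a + b - 1)"
    have P0: "P > 0" "complex_of_real P \<noteq> 0" using P by auto
    have pw: "complex_of_real P powr a = of_real P * pa" "complex_of_real P powr b = of_real P * pb"
      "complex_of_real P powr (a + b) = of_real P * pab"
      using of_real_powr_Suc[of P "a - 1"] of_real_powr_Suc[of P "b - 1"]
        of_real_powr_Suc[of P "a + b - 1"] P0 by (auto simp: pa_def pb_def pab_def)
    have Bt: "(a + b) * Beta a (b + 1) = b * Beta a b"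
      using Beta_plus1_right[OF ab, of a] by simp
    have main: "beta_main a (b + 1) P = Beta a (b + 1) * (of_real P * pab) - of_real P * pb / a - pa / (b + 1)"
      by (simp add: beta_main_def pa_def add.assoc[symmetric] flip: pw)
    have "b * of_real P * (truncated_beta a b P - beta_main a b P)
        = (a + b) * (E + beta_main a (b + 1) P) - (d1 + of_real P * pa) + (d2 + of_real P * pb)
          - b * of_real P * beta_main a b P"
      unfolding right_diff_distrib truncated_beta_step[OF P] by (simp add: E_def d1_def d2_def pw)
    also have "\<dots> = (a + b) * E - (a + b) / (b + 1) * pa - d1 + d2
        + of_real P * pab * ((a + b) * Beta a (b + 1) - b * Beta a b)"
      unfolding main beta_main_def[of a b] pa_def[symmetric] pb_def[symmetric] pab_def[symmetric]
      by (rule beta_step_cancellation[OF a b])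
    finally have eq: "b * of_real P * (truncated_beta a b P - beta_main a b P)
        = (a + b) * E - (a + b) / (b + 1) * pa - d1 + d2"
      by (simp add: Bt)
    have le: "P powr (max (Re a) (Re b + 1) - 2) \<le> P powr (k - 1)"
      "P powr (Re a - 1) \<le> P powr (k - 1)" "P powr (Re b - 1) \<le> P powr (k - 1)"
      using P by (auto intro!: powr_mono simp: k_def)
    have n1: "norm ((a + b) * E) \<le> norm (a + b) * K * P powr (k - 1)"
      using mult_left_mono[OF order_trans[OF K[OF P] mult_left_mono[OF le(1) K0]], of "norm (a + b)"]
      by (simp add: norm_mult E_def)
    have n2: "norm ((a + b) / (b + 1) * pa) \<le> norm ((a + b) / (b + 1)) * P powr (k - 1)"
      unfolding norm_mult using le(2) P0 by (intro mult_left_mono) (auto simp: pa_def norm_of_real_powr)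
    have "norm d1 \<le> c1 * P powr (Re a - 1)"
      unfolding d1_def c1_def by (rule powr_shift_bound[OF P]) auto
    also have "\<dots> \<le> c1 * P powr (k - 1)" using le(2) by (intro mult_left_mono) (auto simp: c1_def)
    finally have n3: "norm d1 \<le> c1 * P powr (k - 1)" .
    have "norm d2 \<le> c2 * P powr (Re b - 1)"
      unfolding d2_def c2_def by (rule powr_shift_bound[OF P]) auto
    also have "\<dots> \<le> c2 * P powr (k - 1)" using le(3) by (intro mult_left_mono) (auto simp: c2_def)
    finally have n4: "norm d2 \<le> c2 * P powr (k - 1)" .
    have "norm b * P * norm (truncated_beta a b P - beta_main a b P)
        = norm ((a + b) * E - (a + b) / (b + 1) * pa - d1 + d2)"
      unfolding eq[symmetric] norm_mult using P0 by simp
    also have "\<dots> \<le> norm ((a + b) * E) + norm ((a + b) / (b + 1) * pa) + norm d1 + norm d2"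
      by (intro order_trans[OF norm_triangle_ineq] add_right_mono order_trans[OF norm_triangle_ineq4] order_refl)
    also have "\<dots> \<le> (norm b * M) * P powr (k - 1)"
    proof -
      have "norm b * M = norm (a + b) * K + norm ((a + b) / (b + 1)) + c1 + c2"
        using b by (simp add: M_def)
      then show ?thesis using n1 n2 n3 n4 by (simp only: distrib_right)
    qed
    also have "P powr (k - 1) = P * P powr (k - 2)"
      using P0 by (simp add: powr_mult_base)
    finally have "(norm b * P) * norm (truncated_beta a b P - beta_main a b P) \<le> (norm b * P) * (M * P powr (k - 2))"
      by (simp add: mult_ac)
    then show ?thesis using b P0 by (simp add: mult_le_cancel_left_pos)
  qed
  then show ?thesis unfolding beta_asymp_def k_def by blast
qed

lemma integrable_indicator_Ioo: "integrable lborel (indicator {a<..<b::real} :: real \<Rightarrow> real)"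
  by (cases "a \<le> b") (auto simp: integrable_indicator_iff)

lemma beta_integrand_integrable:
  assumes "Re a \<ge> 1" "Re b \<ge> 1"
  shows "integrable lborel (\<lambda>p. indicator {0<..<P} p *\<^sub>R beta_integrand a b P p)"
proof (rule Bochner_Integration.integrable_bound)
  show "integrable lborel (\<lambda>p. indicator {0<..<P} p *\<^sub>R (P powr (Re a - 1) * P powr (Re b - 1)) :: real)"
    unfolding real_scaleR_def by (intro integrable_mult_left integrable_indicator_Ioo)
  have "(\<lambda>p. indicator {0<..<P} p *\<^sub>R beta_integrand a b P p) \<in> borel_measurable borel"
    unfolding beta_integrand_def
    by (intro borel_measurable_continuous_on_indicator) (auto intro!: continuous_intros)
  then show "(\<lambda>p. indicator {0<..<P} p *\<^sub>R beta_integrand a b P p) \<in> borel_measurable lborel" by simp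
  show "AE p in lborel. norm (indicator {0<..<P} p *\<^sub>R beta_integrand a b P p)
      \<le> norm (indicator {0<..<P} p *\<^sub>R (P powr (Re a - 1) * P powr (Re b - 1)))"
  proof (rule AE_I2)
    fix p
    show "norm (indicator {0<..<P} p *\<^sub>R beta_integrand a b P p)
      \<le> norm (indicator {0<..<P} p *\<^sub>R (P powr (Re a - 1) * P powr (Re b - 1)))"
    proof (cases "p \<in> {0<..<P}")
      case True
      then have "norm (beta_integrand a b P p) = p powr (Re a - 1) * (P - p) powr (Re b - 1)"
        by (simp add: beta_integrand_def norm_mult norm_of_real_powr del: of_real_diff)
      also have "\<dots> \<le> P powr (Re a - 1) * P powr (Re b - 1)"
        using True assms by (intro mult_mono powr_mono2) auto
      finally show ?thesis using True by simp
    qed auto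
  qed
qed

text \<open>On the unit interval at the end, \<open>(P - p) powr (b - 1)\<close> is nearly constant in \<open>p\<close>, and \<open>p powr (a - 1)\<close>
  integrates to \<open>1 / a\<close>.\<close>

lemma beta_end_bound:
  assumes a: "Re a \<ge> 1" and b: "Re b \<ge> 1" and P: "P \<ge> 2"
  shows "norm ((\<integral>p. indicator {0<..<1} p *\<^sub>R beta_integrand a b P p \<partial>lborel) - of_real P powr (b - 1) / a)
      \<le> norm (b - 1) * 2 powr \<bar>Re b - 2\<bar> * P powr (Re b - 2)"
proof -
  let ?K = "norm (b - 1) * 2 powr \<bar>Re b - 2\<bar> * P powr (Re b - 2)"
  have a0: "a \<notin> \<int>\<^sub>\<le>\<^sub>0" using a by (intro Re_pos_imp_not_nonpos_Ints) simp
  have g: "Gamma a \<noteq> 0" using a0 by (simp add: Gamma_eq_zero_iff)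
  have "Beta a 1 = 1 / a"
    using Gamma_plus1[OF a0] g by (simp add: Beta_def)
  then have one: "(\<integral>p. indicator {0<..<1} p *\<^sub>R beta_integrand a 1 1 p \<partial>lborel) = 1 / a"
    using beta_integral[of a 1 1] a by simp
  have i0: "integrable lborel (\<lambda>p. indicator {0<..<1::real} p *\<^sub>R beta_integrand a 1 1 p)"
    by (rule beta_integrand_integrable) (use a in auto)
  have i1: "integrable lborel (\<lambda>p. indicator {0<..<1} p *\<^sub>R beta_integrand a b P p)"
  proof -
    have "integrable lborel (\<lambda>p. indicator {0<..<1} p *\<^sub>R (indicator {0<..<P} p *\<^sub>R beta_integrand a b P p))"
      by (rule integrable_mult_indicator[OF _ beta_integrand_integrable[OF a b]]) simp
    also have "(\<lambda>p. indicator {0<..<1} p *\<^sub>R (indicator {0<..<P} p *\<^sub>R beta_integrand a b P p))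
        = (\<lambda>p. indicator {0<..<1} p *\<^sub>R beta_integrand a b P p)"
      using P by (auto simp: indicator_def fun_eq_iff)
    finally show ?thesis .
  qed
  have i2: "integrable lborel (\<lambda>p. indicator {0<..<1} p *\<^sub>R beta_integrand a 1 1 p * of_real P powr (b - 1))"
    using i0 by (rule integrable_mult_left)
  have "(\<integral>p. indicator {0<..<1} p *\<^sub>R beta_integrand a b P p \<partial>lborel) - of_real P powr (b - 1) / a
      = (\<integral>p. indicator {0<..<1} p *\<^sub>R beta_integrand a b P p \<partial>lborel)
        - (\<integral>p. indicator {0<..<1} p *\<^sub>R beta_integrand a 1 1 p * of_real P powr (b - 1) \<partial>lborel)"
    unfolding integral_mult_left_zero one by simp
  also have "\<dots> = (\<integral>p. indicator {0<..<1} p *\<^sub>R beta_integrand a b P p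
        - indicator {0<..<1} p *\<^sub>R beta_integrand a 1 1 p * of_real P powr (b - 1) \<partial>lborel)"
    by (rule Bochner_Integration.integral_diff[OF i1 i2, symmetric])
  finally have eq: "(\<integral>p. indicator {0<..<1} p *\<^sub>R beta_integrand a b P p \<partial>lborel) - of_real P powr (b - 1) / a
      = (\<integral>p. indicator {0<..<1} p *\<^sub>R beta_integrand a b P p
        - indicator {0<..<1} p *\<^sub>R beta_integrand a 1 1 p * of_real P powr (b - 1) \<partial>lborel)" .
  have "norm ((\<integral>p. indicator {0<..<1} p *\<^sub>R beta_integrand a b P p \<partial>lborel) - of_real P powr (b - 1) / a)
      \<le> (\<integral>p. indicator {0<..<1} p * ?K \<partial>(lborel :: real measure))"
    unfolding eq
  proof (rule Bochner_Integration.integral_norm_bound_integral)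
    show "integrable lborel (\<lambda>p. indicator {0<..<1} p *\<^sub>R beta_integrand a b P p
        - indicator {0<..<1} p *\<^sub>R beta_integrand a 1 1 p * of_real P powr (b - 1))"
      by (rule Bochner_Integration.integrable_diff[OF i1 i2])
    show "integrable lborel (\<lambda>p::real. indicator {0<..<1} p * ?K)"
      by (rule integrable_mult_left) (rule integrable_indicator_Ioo)
    fix p :: real
    show "norm (indicator {0<..<1} p *\<^sub>R beta_integrand a b P p
        - indicator {0<..<1} p *\<^sub>R beta_integrand a 1 1 p * of_real P powr (b - 1)) \<le> indicator {0<..<1} p * ?K"
    proof (cases "p \<in> {0<..<1}")
      case True
      have eq1: "beta_integrand a b P p - beta_integrand a 1 1 p * of_real P powr (b - 1)
          = of_real p powr (a - 1) * (of_real (P - p) powr (b - 1) - of_real P powr (b - 1))"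
        using True by (simp add: beta_integrand_def right_diff_distrib)
      have "norm (beta_integrand a b P p - beta_integrand a 1 1 p * of_real P powr (b - 1)) \<le> 1 * ?K"
        unfolding eq1 norm_mult
      proof (rule mult_mono)
        show "norm (complex_of_real p powr (a - 1)) \<le> 1"
          using True a by (simp add: norm_of_real_powr powr_le1)
        show "norm (complex_of_real (P - p) powr (b - 1) - of_real P powr (b - 1)) \<le> ?K"
          using powr_shift_bound[OF P, of p "b - 1"] True by simp
      qed auto
      then show ?thesis using True by simp
    qed auto
  qed
  also have "\<dots> = ?K" by simp
  finally show ?thesis .
qed

text \<open>Here the complete Beta integral converges; it exceeds the truncated one by the contributions of the two ends.\<close>

lemma beta_asymp_base:
  assumes a: "Re a \<ge> 1" and b: "Re b \<ge> 1"
  shows "beta_asymp a b"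
proof -
  define M where "M = (\<lambda>b. norm (b - 1) * 2 powr \<bar>Re b - 2\<bar>)"
  have "norm (truncated_beta a b P - beta_main a b P) \<le> (M a + M b) * P powr (max (Re a) (Re b) - 2)"
    if P: "P \<ge> 2" for P
  proof -
    let ?f = "\<lambda>S p. indicator S p *\<^sub>R beta_integrand a b P p"
    have sub: "integrable lborel (?f S)" if "S \<subseteq> {0<..<P}" "S \<in> sets borel" for S
    proof -
      have "integrable lborel (\<lambda>p. indicator S p *\<^sub>R ?f {0<..<P} p)"
        using that by (intro integrable_mult_indicator beta_integrand_integrable a b) auto
      also have "(\<lambda>p. indicator S p *\<^sub>R ?f {0<..<P} p) = ?f S"
        using that by (auto simp: indicator_def fun_eq_iff)
      finally show ?thesis .
    qed
    have "?f {0<..<P} = (\<lambda>p. ?f {0<..<1} p + ?f {1..P - 1} p + ?f {P - 1<..<P} p)"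
      using P by (auto simp: fun_eq_iff indicator_def)
    then have "(\<integral>p. ?f {0<..<P} p \<partial>lborel)
        = (\<integral>p. ?f {0<..<1} p \<partial>lborel) + (\<integral>p. ?f {1..P - 1} p \<partial>lborel) + (\<integral>p. ?f {P - 1<..<P} p \<partial>lborel)"
    proof -
      assume eq: "?f {0<..<P} = (\<lambda>p. ?f {0<..<1} p + ?f {1..P - 1} p + ?f {P - 1<..<P} p)"
      have s: "integrable lborel (?f {0<..<1})" "integrable lborel (?f {1..P - 1})"
        "integrable lborel (?f {P - 1<..<P})"
        using P by (auto intro!: sub)
      show ?thesis
        unfolding eq Bochner_Integration.integral_add[OF Bochner_Integration.integrable_add[OF s(1,2)] s(3)]
          Bochner_Integration.integral_add[OF s(1,2)] by (rule refl)
    qed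
    moreover have "(\<integral>p. ?f {P - 1<..<P} p \<partial>lborel) = (\<integral>p. indicator {0<..<1} p *\<^sub>R beta_integrand b a P p \<partial>lborel)"
    proof -
      have "(\<integral>p. ?f {P - 1<..<P} p \<partial>lborel) = (\<integral>p. ?f {P - 1<..<P} (P - p) \<partial>lborel)"
        using lborel_integral_real_affine[of "-1" "?f {P - 1<..<P}" P] by simp
      also have "\<dots> = (\<integral>p. indicator {0<..<1} p *\<^sub>R beta_integrand b a P p \<partial>lborel)"
        by (intro Bochner_Integration.integral_cong refl) (auto simp: indicator_def beta_integrand_def mult.commute)
      finally show ?thesis .
    qed
    moreover have "(\<integral>p. ?f {0<..<P} p \<partial>lborel) = of_real P powr (a + b - 1) * Beta a b"
      using a b P by (intro beta_integral) auto
    ultimately have "truncated_beta a b P - beta_main a b P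
        = - ((\<integral>p. ?f {0<..<1} p \<partial>lborel) - of_real P powr (b - 1) / a)
          - ((\<integral>p. indicator {0<..<1} p *\<^sub>R beta_integrand b a P p \<partial>lborel) - of_real P powr (a - 1) / b)"
      by (simp add: truncated_beta_def beta_main_def algebra_simps)
    then have "norm (truncated_beta a b P - beta_main a b P)
        \<le> norm ((\<integral>p. ?f {0<..<1} p \<partial>lborel) - of_real P powr (b - 1) / a)
          + norm ((\<integral>p. indicator {0<..<1} p *\<^sub>R beta_integrand b a P p \<partial>lborel) - of_real P powr (a - 1) / b)"
      by (simp only:) (rule order_trans[OF norm_triangle_ineq4], simp add: norm_minus_commute)
    also have "\<dots> \<le> M b * P powr (Re b - 2) + M a * P powr (Re a - 2)"
      unfolding M_def using beta_end_bound[OF a b P] beta_end_bound[OF b a P] by simp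
    also have "\<dots> \<le> M b * P powr (max (Re a) (Re b) - 2) + M a * P powr (max (Re a) (Re b) - 2)"
      using P by (intro add_mono mult_left_mono powr_mono) (auto simp: M_def)
    finally show ?thesis by (simp add: algebra_simps)
  qed
  then show ?thesis unfolding beta_asymp_def by blast
qed

lemma plus1_not_nonpos_Ints: "a \<notin> \<int>\<^sub>\<le>\<^sub>0 \<Longrightarrow> a + 1 \<notin> \<int>\<^sub>\<le>\<^sub>0"
  using plus_one_in_nonpos_Ints_imp[of a] by blast

text \<open>Induction on a lower bound for the real parts: raising both exponents by one leads to the case of
  real parts at least 1, and the excluded nonpositive integers are where the division in a step would fail.\<close>

theorem beta_asymp_nonpos_Ints:
  assumes "a \<notin> \<int>\<^sub>\<le>\<^sub>0" "b \<notin> \<int>\<^sub>\<le>\<^sub>0"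
  shows "beta_asymp a b"
proof -
  have "Re a \<ge> 1 - real n \<Longrightarrow> Re b \<ge> 1 - real n \<Longrightarrow> a \<notin> \<int>\<^sub>\<le>\<^sub>0 \<Longrightarrow> b \<notin> \<int>\<^sub>\<le>\<^sub>0 \<Longrightarrow> beta_asymp a b" for n a b
  proof (induction n arbitrary: a b)
    case 0
    then show ?case by (intro beta_asymp_base) auto
  next
    case (Suc n)
    note p1 = plus1_not_nonpos_Ints[OF Suc.prems(3)] plus1_not_nonpos_Ints[OF Suc.prems(4)]
    have ne: "a \<noteq> 0" "b \<noteq> 0" "a + 1 \<noteq> 0" "b + 1 \<noteq> 0"
      using Suc.prems(3,4) p1 by auto
    \<comment> \<open>lower the second exponent, then the first one by symmetry\<close>
    have "beta_asymp (a + 1) (b + 1)"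
      using Suc.prems p1 by (intro Suc.IH) auto
    then have "beta_asymp (a + 1) b"
      using ne Suc.prems(4) by (intro beta_asymp_step[of "a + 1" b]) auto
    then have "beta_asymp b (a + 1)" by (rule beta_asymp_commute)
    then have "beta_asymp b a"
      using ne Suc.prems(3) by (intro beta_asymp_step[of b a]) auto
    then show ?case by (rule beta_asymp_commute)
  qed
  moreover obtain n where n: "1 - min (Re a) (Re b) \<le> real n" using real_arch_simple by blast
  moreover have "Re a \<ge> 1 - real n" "Re b \<ge> 1 - real n" using n by linarith+
  ultimately show ?thesis using assms by blast
qed

section \<open>Inverse-Gamma integrals and the smoothed power function\<close>

text \<open>The integrand of Euler's Gamma integral in the inverse variable: the superposition with these weights of the
  Gaussians \<open>exp (- (r / p))\<close>, where \<open>r = \<bar>x\<bar>\<^sup>2\<close>, is a power of \<open>\<bar>x\<bar>\<close>.\<close>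

definition heat_integrand :: "complex \<Rightarrow> real \<Rightarrow> real \<Rightarrow> complex" where
  "heat_integrand s r p = of_real p powr (- s - 1) * of_real (exp (- (r / p)))"

lemma norm_heat_integrand: "p > 0 \<Longrightarrow> norm (heat_integrand s r p) = p powr (- Re s - 1) * exp (- (r / p))"
  by (simp add: heat_integrand_def norm_mult norm_of_real_powr del: of_real_exp)

lemma heat_integrand_measurable:
  assumes S: "S \<in> sets borel" "S \<subseteq> {0<..}"
  shows "(\<lambda>p. indicator S p *\<^sub>R heat_integrand s r p) \<in> borel_measurable borel"
proof -
  have "(\<lambda>p. indicator {0<..} p *\<^sub>R heat_integrand s r p) \<in> borel_measurable borel"
    unfolding heat_integrand_def
    by (intro borel_measurable_continuous_on_indicator) (auto intro!: continuous_intros)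
  then have "(\<lambda>p. indicator S p *\<^sub>R (indicator {0<..} p *\<^sub>R heat_integrand s r p)) \<in> borel_measurable borel"
    using S by measurable
  also have "(\<lambda>p. indicator S p *\<^sub>R (indicator {0<..} p *\<^sub>R heat_integrand s r p))
      = (\<lambda>p. indicator S p *\<^sub>R heat_integrand s r p)"
    using S by (auto simp: indicator_def fun_eq_iff)
  finally show ?thesis .
qed

lemma inversion_limits:
  "((ereal \<circ> (\<lambda>t. - (1 / t)) \<circ> real_of_ereal) \<longlongrightarrow> - \<infinity>) (at_right 0)"
  "((ereal \<circ> (\<lambda>t. - (1 / t)) \<circ> real_of_ereal) \<longlongrightarrow> 0) (at_left \<infinity>)"
proof -
  have "filterlim (\<lambda>t::real. - (1 / t)) at_bot (at_right 0)" by real_asymp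
  then show "((ereal \<circ> (\<lambda>t. - (1 / t)) \<circ> real_of_ereal) \<longlongrightarrow> - \<infinity>) (at_right 0)"
    by (simp add: zero_ereal_def ereal_tendsto_simps)
  have "((\<lambda>t::real. - (1 / t)) \<longlongrightarrow> 0) at_top" by real_asymp
  then show "((ereal \<circ> (\<lambda>t. - (1 / t)) \<circ> real_of_ereal) \<longlongrightarrow> 0) (at_left \<infinity>)"
    by (simp add: zero_ereal_def ereal_tendsto_simps)
qed

text \<open>The substitution \<open>p = 1 / t\<close> in Euler's integral for the Gamma function, carried out in the
  increasing variable \<open>- 1 / t\<close>.\<close>

lemma heat_integral_1:
  assumes s: "Re s > 0"
  shows "integrable lborel (\<lambda>p. indicator {0<..} p *\<^sub>R heat_integrand s 1 p)"
    and "(\<integral>p. indicator {0<..} p *\<^sub>R heat_integrand s 1 p \<partial>lborel) = Gamma s"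
proof -
  let ?g = "\<lambda>t::real. - (1 / t)" and ?g' = "\<lambda>t::real. 1 / t\<^sup>2"
  let ?h = "\<lambda>u. heat_integrand s 1 (- u)"
  let ?hn = "\<lambda>u. (- u) powr (- Re s - 1) * exp (1 / u)"
  have e1: "einterval 0 \<infinity> = {0<..}" "einterval (- \<infinity>) 0 = {..<0}"
    by (auto simp: einterval_def zero_ereal_def)
  have eq: "?g' t *\<^sub>R ?h (?g t) = of_real t powr (s - 1) * of_real (exp (- t))" if "t > 0" for t
  proof -
    have "complex_of_real (1 / t) powr (- s - 1) = of_real t powr (s + 1)"
      using that by (simp add: powr_def Ln_of_real ln_div algebra_simps del: of_real_divide)
    moreover have "complex_of_real t powr (s + 1) = of_real t ^ 2 * of_real t powr (s - 1)"
      using that by (simp add: powr_diff powr_add power2_eq_square)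
    ultimately show ?thesis
      using that by (simp add: heat_integrand_def scaleR_conv_of_real field_simps)
  qed
  have eqn: "?hn (?g t) * ?g' t = norm (gamma_integrand s t)" if "t > 0" for t
  proof -
    have "norm (gamma_integrand s t) = norm (?g' t *\<^sub>R ?h (?g t))"
      using eq[OF that] that by (simp add: gamma_integrand_def)
    also have "\<dots> = ?hn (?g t) * ?g' t"
      using that by (simp add: norm_heat_integrand)
    finally show ?thesis ..
  qed
  have gi: "integrable lborel (gamma_integrand s)" by (rule gamma_integrand_integrable[OF s])
  have "integrable lborel (\<lambda>t. indicator {0<..} t *\<^sub>R (?hn (?g t) * ?g' t))"
  proof (rule Bochner_Integration.integrable_cong[THEN iffD1, OF refl _ integrable_norm[OF gi]])
    fix t
    show "norm (gamma_integrand s t) = indicator {0<..} t *\<^sub>R (?hn (?g t) * ?g' t)"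
    proof (cases "t > 0")
      case True
      then show ?thesis using eqn[OF True] by simp
    next
      case False
      then show ?thesis by (simp add: gamma_integrand_def)
    qed
  qed
  then have fg: "set_integrable lborel (einterval 0 \<infinity>) (\<lambda>t. ?hn (?g t) * ?g' t)"
    by (simp add: set_integrable_def e1)
  have dg: "(?g has_field_derivative ?g' x) (at x)" if "0 < ereal x" for x
    using that by (auto intro!: derivative_eq_intros simp: zero_ereal_def power2_eq_square)
  have hni: "set_integrable lborel (einterval (- \<infinity>) 0) ?hn"
  proof (rule interval_integral_substitution_nonneg(1)[where g="?g" and g'="?g'" and a=0 and b=\<infinity>])
    show "((ereal \<circ> ?g \<circ> real_of_ereal) \<longlongrightarrow> - \<infinity>) (at_right 0)"
      "((ereal \<circ> ?g \<circ> real_of_ereal) \<longlongrightarrow> 0) (at_left \<infinity>)"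
      by (rule inversion_limits)+
    show "set_integrable lborel (einterval 0 \<infinity>) (\<lambda>x. ?hn (?g x) * ?g' x)" by (rule fg)
    show "isCont ?hn (?g x)" "isCont ?g' x" if "0 < ereal x" for x
      using that by (auto intro!: continuous_intros simp: zero_ereal_def)
  qed (auto intro!: dg)
  have hm: "(\<lambda>u. indicator {..<0} u *\<^sub>R ?h u) \<in> borel_measurable borel"
    unfolding heat_integrand_def
    by (intro borel_measurable_continuous_on_indicator) (auto intro!: continuous_intros)
  have hi: "integrable lborel (\<lambda>u. indicator {..<0} u *\<^sub>R ?h u)"
  proof (rule Bochner_Integration.integrable_bound)
    show "integrable lborel (\<lambda>u. indicator {..<0} u *\<^sub>R ?hn u)"
      using hni by (simp add: set_integrable_def e1)
    show "(\<lambda>u. indicator {..<0} u *\<^sub>R ?h u) \<in> borel_measurable lborel" using hm by simp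
    show "AE u in lborel. norm (indicator {..<0} u *\<^sub>R ?h u) \<le> norm (indicator {..<0} u *\<^sub>R ?hn u)"
      by (rule AE_I2) (auto simp: indicator_def norm_heat_integrand)
  qed
  have cong: "(\<lambda>t. indicator {0<..} t *\<^sub>R (?g' t *\<^sub>R ?h (?g t))) = gamma_integrand s"
    using eq by (auto simp: fun_eq_iff gamma_integrand_def indicator_def)
  have "(LBINT u=-\<infinity>..0. ?h u) = (LBINT t=0..\<infinity>. ?g' t *\<^sub>R ?h (?g t))"
  proof (rule interval_integral_substitution_integrable)
    show "((ereal \<circ> ?g \<circ> real_of_ereal) \<longlongrightarrow> - \<infinity>) (at_right 0)"
      "((ereal \<circ> ?g \<circ> real_of_ereal) \<longlongrightarrow> 0) (at_left \<infinity>)"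
      by (rule inversion_limits)+
    show "set_integrable lborel (einterval 0 \<infinity>) (\<lambda>x. ?g' x *\<^sub>R ?h (?g x))"
      unfolding set_integrable_def e1 cong by (rule gi)
    show "set_integrable lborel (einterval (- \<infinity>) 0) ?h"
      unfolding set_integrable_def e1 by (rule hi)
    show "isCont ?h (?g x)" "isCont ?g' x" if "0 < ereal x" for x
    proof -
      have "x > 0" using that by (simp add: zero_ereal_def)
      moreover have "1 / complex_of_real x \<notin> \<real>\<^sub>\<le>\<^sub>0"
        using \<open>x > 0\<close> by (simp add: complex_nonpos_Reals_iff Re_divide power2_eq_square)
      ultimately show "isCont ?h (?g x)" "isCont ?g' x"
        unfolding heat_integrand_def by (auto intro!: continuous_intros)
    qed
  qed (auto intro!: dg)
  then have v: "(\<integral>u. indicator {..<0} u *\<^sub>R ?h u \<partial>lborel) = Gamma s"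
    by (simp only: interval_lebesgue_integral_def set_lebesgue_integral_def e1 cong
      gamma_integrand_integral[OF s]) simp
  have ind: "(\<lambda>p. indicator {..<0} (0 + (-1) * p) *\<^sub>R ?h (0 + (-1) * p)) = (\<lambda>p. indicator {0<..} p *\<^sub>R heat_integrand s 1 p)"
    by (auto simp: fun_eq_iff indicator_def)
  show "integrable lborel (\<lambda>p. indicator {0<..} p *\<^sub>R heat_integrand s 1 p)"
    using lborel_integrable_real_affine[OF hi, of "-1" 0] unfolding ind by simp
  show "(\<integral>p. indicator {0<..} p *\<^sub>R heat_integrand s 1 p \<partial>lborel) = Gamma s"
    using lborel_integral_real_affine[of "-1" "\<lambda>u. indicator {..<0} u *\<^sub>R ?h u" 0] v unfolding ind by simp
qed

lemma heat_integral:
  assumes s: "Re s > 0" and r: "r > 0"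
  shows "integrable lborel (\<lambda>p. indicator {0<..} p *\<^sub>R heat_integrand s r p)"
    and "(\<integral>p. indicator {0<..} p *\<^sub>R heat_integrand s r p \<partial>lborel) = Gamma s * of_real r powr (- s)"
proof -
  let ?f = "\<lambda>p. indicator {0<..} p *\<^sub>R heat_integrand s r p"
  have e: "?f (0 + r * q) = of_real r powr (- s - 1) * (indicator {0<..} q *\<^sub>R heat_integrand s 1 q)" for q
  proof (cases "q > 0")
    case True
    then show ?thesis
      using r by (simp add: heat_integrand_def powr_times_real del: of_real_exp)
  next
    case False
    then show ?thesis using r by (simp add: indicator_def zero_less_mult_iff)
  qed
  have "integrable lborel (\<lambda>q. ?f (0 + r * q))"
    unfolding e by (rule integrable_mult_right[OF heat_integral_1(1)[OF s]])
  then show "integrable lborel ?f"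
    using lborel_integrable_real_affine_iff[of r ?f 0] r by simp
  have "integral\<^sup>L lborel ?f = r *\<^sub>R (\<integral>q. ?f (0 + r * q) \<partial>lborel)"
    using lborel_integral_real_affine[of r ?f 0] r by simp
  also have "\<dots> = r *\<^sub>R (of_real r powr (- s - 1) * Gamma s)"
    unfolding e integral_mult_right_zero heat_integral_1(2)[OF s] ..
  also have "\<dots> = (of_real r * of_real r powr (- s - 1)) * Gamma s"
    by (simp add: scaleR_conv_of_real)
  also have "of_real r * of_real r powr (- s - 1) = complex_of_real r powr (- s)"
    using of_real_powr_Suc[OF r, of "- s - 1"] by simp
  finally show "integral\<^sup>L lborel ?f = Gamma s * of_real r powr (- s)" by simp
qed

lemma heat_integrable_subset:
  assumes "Re s > 0" "r > 0" "S \<in> sets borel" "S \<subseteq> {0<..}"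
  shows "integrable lborel (\<lambda>p. indicator S p *\<^sub>R heat_integrand s r p)"
proof -
  have "integrable lborel (\<lambda>p. indicator S p *\<^sub>R (indicator {0<..} p *\<^sub>R heat_integrand s r p))"
    using assms by (intro integrable_mult_indicator heat_integral) auto
  also have "(\<lambda>p. indicator S p *\<^sub>R (indicator {0<..} p *\<^sub>R heat_integrand s r p))
      = (\<lambda>p. indicator S p *\<^sub>R heat_integrand s r p)"
    using assms by (auto simp: indicator_def fun_eq_iff)
  finally show ?thesis .
qed

lemma heat_integral_subset_bound:
  assumes s: "Re s > 0" and r: "r > 0" and S: "S \<in> sets borel" "S \<subseteq> {0<..}"
  shows "(\<integral>p. indicator S p *\<^sub>R norm (heat_integrand s r p) \<partial>lborel) \<le> Gamma (Re s) * r powr (- Re s)"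
proof -
  have s': "Re (complex_of_real (Re s)) > 0" using s by simp
  have n: "indicator S p *\<^sub>R norm (heat_integrand s r p) = norm (indicator S p *\<^sub>R heat_integrand s r p)" for p
    by simp
  have i: "integrable lborel (\<lambda>p. indicator {0<..} p *\<^sub>R heat_integrand (of_real (Re s)) r p)"
    by (rule heat_integral(1)[OF s' r])
  have e: "norm (indicator {0<..} p *\<^sub>R heat_integrand s r p) = Re (indicator {0<..} p *\<^sub>R heat_integrand (of_real (Re s)) r p)" for p
  proof (cases "p > 0")
    case True
    have "complex_of_real p powr (- of_real (Re s) - 1) = of_real (p powr (- Re s - 1))"
      using True by (simp add: powr_of_real[symmetric])
    then show ?thesis using True by (simp add: norm_heat_integrand) (simp add: heat_integrand_def)
  qed auto
  have "(\<integral>p. norm (indicator S p *\<^sub>R heat_integrand s r p) \<partial>lborel)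
      \<le> (\<integral>p. norm (indicator {0<..} p *\<^sub>R heat_integrand s r p) \<partial>lborel)"
    using S by (intro integral_mono integrable_norm heat_integral(1) heat_integrable_subset s r)
      (auto simp: indicator_def)
  also have "\<dots> = Re (\<integral>p. indicator {0<..} p *\<^sub>R heat_integrand (of_real (Re s)) r p \<partial>lborel)"
    unfolding e by (rule integral_Re[OF i])
  also have "\<dots> = Re (Gamma (of_real (Re s)) * complex_of_real r powr (- of_real (Re s)))"
    by (simp only: heat_integral(2)[OF s' r])
  also have "\<dots> = Gamma (Re s) * r powr (- Re s)"
    using r powr_of_real[of r "- Re s"] by (simp add: Gamma_complex_of_real)
  finally show ?thesis unfolding n .
qed

text \<open>With \<open>r = \<bar>x\<bar>\<^sup>2\<close> and the normalization \<open>1 / Gamma s\<close> this is a smooth function of \<open>x\<close> that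
  agrees with \<open>\<bar>x\<bar> powr (- 2 * s)\<close> up to an error of smaller order: only the Gaussians at times
  \<open>p \<ge> 1\<close> are retained.\<close>

definition smooth_profile :: "complex \<Rightarrow> real \<Rightarrow> complex" where
  "smooth_profile s r = (\<integral>p. indicator {1..} p *\<^sub>R heat_integrand s r p \<partial>lborel)"

lemma powr_integrable_atLeast_1:
  assumes "e > (0::real)"
  shows "integrable lborel (\<lambda>p. indicator {1..} p *\<^sub>R p powr (- e - 1) :: real)"
    and "(\<integral>p. indicator {1..} p *\<^sub>R p powr (- e - 1) \<partial>lborel) = 1 / e"
proof -
  have h: "((\<lambda>p. p powr (- e - 1)) has_integral 1 / e) {1..}"
    using has_integral_powr_to_inf[of "- e - 1" 1] assms by simp
  have m: "(\<lambda>p. indicator {1..} p *\<^sub>R p powr (- e - 1) :: real) \<in> borel_measurable borel"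
    by (intro borel_measurable_continuous_on_indicator) (auto intro!: continuous_intros)
  have "(\<lambda>p. p powr (- e - 1)) absolutely_integrable_on {1..}"
    using h by (intro nonnegative_absolutely_integrable_1) auto
  then show i: "integrable lborel (\<lambda>p. indicator {1..} p *\<^sub>R p powr (- e - 1) :: real)"
    using m unfolding set_integrable_def by (simp add: integrable_completion)
  have "((\<lambda>p. indicator {1..} p *\<^sub>R p powr (- e - 1)) has_integral
      (\<integral>p. indicator {1..} p *\<^sub>R p powr (- e - 1) \<partial>lborel)) UNIV"
    by (rule has_integral_integral_lborel[OF i])
  then have "((\<lambda>p. if p \<in> {1..} then p powr (- e - 1) else 0) has_integral
      (\<integral>p. indicator {1..} p *\<^sub>R p powr (- e - 1) \<partial>lborel)) UNIV"
    by (rule has_integral_eq[rotated]) (auto simp: indicator_def)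
  then have "((\<lambda>p. p powr (- e - 1)) has_integral
      (\<integral>p. indicator {1..} p *\<^sub>R p powr (- e - 1) \<partial>lborel)) {1..}"
    by (simp only: has_integral_restrict_UNIV)
  then show "(\<integral>p. indicator {1..} p *\<^sub>R p powr (- e - 1) \<partial>lborel) = 1 / e"
    using h has_integral_unique by blast
qed

lemma profile_bounded:
  assumes s: "Re s > 0" and r: "r \<ge> 0"
  shows "integrable lborel (\<lambda>p. indicator {1..} p *\<^sub>R heat_integrand s r p)"
    and "norm (smooth_profile s r) \<le> 1 / Re s"
proof -
  have le: "norm (indicator {1..} p *\<^sub>R heat_integrand s r p) \<le> indicator {1..} p *\<^sub>R p powr (- Re s - 1)" for p
  proof (cases "p \<ge> 1")
    case True
    then have "p powr (- Re s - 1) * exp (- (r / p)) \<le> p powr (- Re s - 1) * 1"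
      using r by (intro mult_left_mono) auto
    then show ?thesis using True by (simp add: norm_heat_integrand)
  qed auto
  show i: "integrable lborel (\<lambda>p. indicator {1..} p *\<^sub>R heat_integrand s r p)"
  proof (rule Bochner_Integration.integrable_bound[OF powr_integrable_atLeast_1(1)[OF s]])
    show "(\<lambda>p. indicator {1..} p *\<^sub>R heat_integrand s r p) \<in> borel_measurable lborel"
      using heat_integrand_measurable[of "{1..}" s r] by force
    show "AE p in lborel. norm (indicator {1..} p *\<^sub>R heat_integrand s r p) \<le> norm (indicator {1..} p *\<^sub>R p powr (- Re s - 1))"
      using le by (intro AE_I2) (simp add: abs_mult)
  qed
  have "norm (smooth_profile s r) \<le> (\<integral>p. indicator {1..} p *\<^sub>R p powr (- Re s - 1) \<partial>lborel)"
    unfolding smooth_profile_def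
    by (rule Bochner_Integration.integral_norm_bound_integral[OF i powr_integrable_atLeast_1(1)[OF s] le])
  then show "norm (smooth_profile s r) \<le> 1 / Re s"
    by (simp only: powr_integrable_atLeast_1(2)[OF s])
qed

lemma profile_decay:
  assumes s: "Re s > 0"
  obtains C where "C \<ge> 0" "\<And>r. r \<ge> 0 \<Longrightarrow> norm (smooth_profile s r) \<le> C * (1 + r) powr (- Re s)"
proof -
  \<comment> \<open>the first summand serves \<open>r \<le> 1\<close>, the second one \<open>r > 1\<close>; in both ranges \<open>1 + r\<close> is compared within a factor 2\<close>
  define C where "C = 2 powr Re s * (1 / Re s + Gamma (Re s))"
  have G: "Gamma (Re s) > 0" using s by (rule Gamma_real_pos)
  have "norm (smooth_profile s r) \<le> C * (1 + r) powr (- Re s)" if r: "r \<ge> 0" for r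
  proof (cases "r \<le> 1")
    case True
    have "norm (smooth_profile s r) \<le> 1 / Re s" by (rule profile_bounded(2)[OF s r])
    also have "\<dots> = (2 powr Re s * (1 / Re s)) * 2 powr (- Re s)"
      by (simp add: powr_minus)
    also have "\<dots> \<le> C * (1 + r) powr (- Re s)"
      unfolding C_def using s G True r by (intro mult_mono mult_left_mono powr_mono2') auto
    finally show ?thesis .
  next
    case False
    then have r0: "r > 0" by simp
    have "norm (smooth_profile s r) \<le> (\<integral>p. norm (indicator {1..} p *\<^sub>R heat_integrand s r p) \<partial>lborel)"
      unfolding smooth_profile_def by (rule integral_norm_bound)
    also have "\<dots> = (\<integral>p. indicator {1..} p *\<^sub>R norm (heat_integrand s r p) \<partial>lborel)"
      by simp
    also have "\<dots> \<le> Gamma (Re s) * r powr (- Re s)"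
      by (rule heat_integral_subset_bound[OF s r0]) auto
    also have "r powr (- Re s) = 2 powr Re s * (2 * r) powr (- Re s)"
      using r0 by (simp add: powr_mult powr_minus)
    also have "(2 * r) powr (- Re s) \<le> (1 + r) powr (- Re s)"
      using False s by (intro powr_mono2') auto
    then have "Gamma (Re s) * (2 powr Re s * (2 * r) powr (- Re s)) \<le> Gamma (Re s) * (2 powr Re s * (1 + r) powr (- Re s))"
      using G by (intro mult_left_mono) auto
    also have "\<dots> \<le> C * (1 + r) powr (- Re s)"
      unfolding C_def using s by (simp add: algebra_simps)
    finally show ?thesis .
  qed
  moreover have "C \<ge> 0" using s G by (simp add: C_def)
  ultimately show ?thesis using that by blast
qed

text \<open>The omitted times \<open>p < T\<close> contribute one power of \<open>r\<close> less than the whole: there \<open>1 \<le> T / p\<close>, and the extra factor \<open>1 / p\<close> raises the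
  exponent of the integral by one.\<close>

lemma heat_truncation_error:
  assumes s: "Re s > 0" and r: "r > 0" and T: "T > 0"
  shows "norm ((\<integral>p. indicator {T..} p *\<^sub>R heat_integrand s r p \<partial>lborel) - Gamma s * of_real r powr (- s))
      \<le> T * Gamma (Re s + 1) * r powr (- Re s - 1)"
proof -
  let ?f = "\<lambda>S p. indicator S p *\<^sub>R heat_integrand s r p"
  have i: "integrable lborel (?f {T..})" "integrable lborel (?f {0<..<T})"
    by (rule heat_integrable_subset[OF s r]; use T in auto)+
  have i1: "integrable lborel (\<lambda>p. indicator {0<..<T} p *\<^sub>R heat_integrand (s + 1) r p)"
    using s by (intro heat_integrable_subset r) auto
  have "?f {0<..} = (\<lambda>p. ?f {0<..<T} p + ?f {T..} p)"
    using T by (auto simp: fun_eq_iff indicator_def)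
  then have "Gamma s * of_real r powr (- s) = (\<integral>p. ?f {0<..<T} p + ?f {T..} p \<partial>lborel)"
    using heat_integral(2)[OF s r] by (simp only:)
  also have "\<dots> = (\<integral>p. ?f {0<..<T} p \<partial>lborel) + (\<integral>p. ?f {T..} p \<partial>lborel)"
    by (rule Bochner_Integration.integral_add[OF i(2,1)])
  finally have "norm ((\<integral>p. ?f {T..} p \<partial>lborel) - Gamma s * of_real r powr (- s)) = norm (\<integral>p. ?f {0<..<T} p \<partial>lborel)"
    by (simp add: norm_minus_commute)
  also have "\<dots> \<le> (\<integral>p. T * (indicator {0<..<T} p *\<^sub>R norm (heat_integrand (s + 1) r p)) \<partial>lborel)"
  proof (rule Bochner_Integration.integral_norm_bound_integral[OF i(2)])
    show "integrable lborel (\<lambda>p. T * (indicator {0<..<T} p *\<^sub>R norm (heat_integrand (s + 1) r p)))"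
      using integrable_mult_right[OF integrable_norm[OF i1], of T] by simp
    fix p :: real
    show "norm (?f {0<..<T} p) \<le> T * (indicator {0<..<T} p *\<^sub>R norm (heat_integrand (s + 1) r p))"
    proof (cases "p \<in> {0<..<T}")
      case True
      then have p: "0 < p" "p < T" by auto
      have "p powr (- Re s - 1) = p * p powr (- Re (s + 1) - 1)"
      proof -
        have "1 + (- Re (s + 1) - 1) = - Re s - 1" by simp
        then show ?thesis
          using powr_mult_base[OF less_imp_le[OF p(1)], of "- Re (s + 1) - 1"] by (simp only:)
      qed
      also have "\<dots> \<le> T * p powr (- Re (s + 1) - 1)"
        using p by (intro mult_right_mono) auto
      finally have "p powr (- Re s - 1) * exp (- (r / p)) \<le> T * p powr (- Re (s + 1) - 1) * exp (- (r / p))"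
        by (rule mult_right_mono) simp
      then show ?thesis using True by (simp add: norm_heat_integrand mult.assoc)
    qed auto
  qed
  also have "\<dots> \<le> T * (Gamma (Re (s + 1)) * r powr (- Re (s + 1)))"
    unfolding integral_mult_right_zero using s r T
    by (intro mult_left_mono heat_integral_subset_bound) auto
  finally show ?thesis by (simp add: mult.assoc)
qed

lemma profile_power_error:
  assumes s: "Re s > 0" and r: "r > 0"
  shows "norm (smooth_profile s r - Gamma s * of_real r powr (- s)) \<le> Gamma (Re s + 1) * r powr (- Re s - 1)"
  using heat_truncation_error[OF s r, of 1] by (simp add: smooth_profile_def)

lemma exp_quadratic_remainder:
  fixes x y :: real
  assumes "x \<ge> 0" "y \<ge> 0"
  shows "\<bar>exp (- y) - exp (- x) + (y - x) * exp (- x)\<bar> \<le> (y - x)\<^sup>2"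
proof -
  have lip: "\<bar>exp (- u) - exp (- v)\<bar> \<le> \<bar>u - v\<bar>" if "u \<ge> 0" "v \<ge> 0" for u v :: real
  proof -
    have "norm (exp (- u) - exp (- v)) \<le> 1 * norm (u - v)"
    proof (rule field_differentiable_bound[where S="{0..}" and f'="\<lambda>z. - exp (- z)"])
      show "((\<lambda>z. exp (- z)) has_field_derivative - exp (- z)) (at z within {0..})" for z :: real
        by (auto intro!: derivative_eq_intros)
    qed (use that in auto)
    then show ?thesis by simp
  qed
  have "norm ((exp (- y) + y * exp (- x)) - (exp (- x) + x * exp (- x))) \<le> \<bar>y - x\<bar> * norm (y - x)"
  proof (rule field_differentiable_bound[where S="closed_segment x y" and f'="\<lambda>z. exp (- x) - exp (- z)"])
    show "((\<lambda>z. exp (- z) + z * exp (- x)) has_field_derivative exp (- x) - exp (- z)) (at z within closed_segment x y)" for z :: real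
      by (auto intro!: derivative_eq_intros)
    fix z assume z: "z \<in> closed_segment x y"
    then have "z \<ge> 0" "\<bar>x - z\<bar> \<le> \<bar>y - x\<bar>"
      using assms by (auto simp: closed_segment_eq_real_ivl split: if_splits)
    then show "norm (exp (- x) - exp (- z)) \<le> \<bar>y - x\<bar>"
      using lip[OF assms(1), of z] by simp
  qed auto
  then show ?thesis by (simp add: algebra_simps power2_eq_square abs_mult_self_eq flip: abs_mult)
qed

text \<open>Differentiation under the integral sign, in quantitative form; the bound \<open>p \<ge> 1\<close> on the times makes the second
  derivative in \<open>r\<close> bounded down to \<open>r = 0\<close>.\<close>

lemma profile_quadratic_remainder:
  assumes s: "Re s > 0" and r: "r \<ge> 0" "r' \<ge> 0"
  shows "norm (smooth_profile s r' - smooth_profile s r + of_real (r' - r) * smooth_profile (s + 1) r)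
          \<le> 1 / Re s * (r' - r)\<^sup>2"
proof -
  let ?I = "\<lambda>s r p. indicator {1..} p *\<^sub>R heat_integrand s r p"
  have s1: "Re (s + 1) > 0" using s by simp
  note i = profile_bounded(1)[OF s r(1)] profile_bounded(1)[OF s r(2)] profile_bounded(1)[OF s1 r(1)]
  have i3: "integrable lborel (\<lambda>p. of_real (r' - r) * ?I (s + 1) r p)"
    by (rule integrable_mult_right[OF i(3)])
  have eq: "smooth_profile s r' - smooth_profile s r + of_real (r' - r) * smooth_profile (s + 1) r
      = (\<integral>p. ?I s r' p - ?I s r p + of_real (r' - r) * ?I (s + 1) r p \<partial>lborel)"
    unfolding smooth_profile_def integral_mult_right_zero[symmetric]
      Bochner_Integration.integral_diff[OF i(2,1), symmetric]
    by (rule Bochner_Integration.integral_add[symmetric, OF Bochner_Integration.integrable_diff[OF i(2,1)] i3])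
  have "norm (smooth_profile s r' - smooth_profile s r + of_real (r' - r) * smooth_profile (s + 1) r)
      \<le> (\<integral>p. (r' - r)\<^sup>2 * (indicator {1..} p *\<^sub>R p powr (- Re s - 1)) \<partial>lborel)"
    unfolding eq
  proof (rule Bochner_Integration.integral_norm_bound_integral)
    show "integrable lborel (\<lambda>p. ?I s r' p - ?I s r p + of_real (r' - r) * ?I (s + 1) r p)"
      by (rule Bochner_Integration.integrable_add[OF Bochner_Integration.integrable_diff[OF i(2,1)] i3])
    show "integrable lborel (\<lambda>p. (r' - r)\<^sup>2 * (indicator {1..} p *\<^sub>R p powr (- Re s - 1)))"
      by (rule integrable_mult_right[OF powr_integrable_atLeast_1(1)[OF s]])
    fix p :: real
    show "norm (?I s r' p - ?I s r p + of_real (r' - r) * ?I (s + 1) r p)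
        \<le> (r' - r)\<^sup>2 * (indicator {1..} p *\<^sub>R p powr (- Re s - 1))"
    proof (cases "p \<ge> 1")
      case True
      then have p: "p > 0" by simp
      let ?e = "exp (- (r' / p)) - exp (- (r / p)) + (r' / p - r / p) * exp (- (r / p))"
      define X where "X = complex_of_real p powr (- (s + 1) - 1)"
      define E E' where "E = complex_of_real (exp (- (r / p)))" and "E' = complex_of_real (exp (- (r' / p)))"
      have "- (s + 1) - 1 + 1 = - s - 1" by simp
      then have X: "complex_of_real p powr (- s - 1) = of_real p * X"
        using of_real_powr_Suc[OF p, of "- (s + 1) - 1"] by (simp only: X_def)
      have e: "complex_of_real ?e = E' - E + (of_real r' / of_real p - of_real r / of_real p) * E"
        unfolding E_def E'_def by (simp only: of_real_add of_real_diff of_real_mult of_real_divide)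
      have "of_real p * X * E' - of_real p * X * E + (of_real r' - of_real r) * (X * E)
          = of_real p * X * (E' - E + (of_real r' / of_real p - of_real r / of_real p) * E)"
        using p by (simp add: field_simps)
      then have "?I s r' p - ?I s r p + of_real (r' - r) * ?I (s + 1) r p
          = of_real p powr (- s - 1) * of_real ?e"
        unfolding e X heat_integrand_def E_def[symmetric] E'_def[symmetric] X_def[symmetric] using True by simp
      then have "norm (?I s r' p - ?I s r p + of_real (r' - r) * ?I (s + 1) r p)
          = p powr (- Re s - 1) * \<bar>?e\<bar>"
        using p by (simp only: norm_mult norm_of_real norm_of_real_powr) simp
      also have "\<dots> \<le> p powr (- Re s - 1) * (r' / p - r / p)\<^sup>2"
        using p r by (intro mult_left_mono exp_quadratic_remainder) auto
      also have "\<dots> \<le> p powr (- Re s - 1) * (r' - r)\<^sup>2"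
      proof -
        have "(r' / p - r / p)\<^sup>2 = (r' - r)\<^sup>2 / p\<^sup>2" by (simp add: power_divide flip: diff_divide_distrib)
        also have "\<dots> \<le> (r' - r)\<^sup>2 / 1"
          using True by (intro divide_left_mono) auto
        finally show ?thesis by (intro mult_left_mono) auto
      qed
      finally show ?thesis using True by (simp add: mult.commute)
    qed auto
  qed
  also have "\<dots> = 1 / Re s * (r' - r)\<^sup>2"
    unfolding integral_mult_right_zero powr_integrable_atLeast_1(2)[OF s] by simp
  finally show ?thesis .
qed

lemma profile_has_vector_derivative:
  assumes s: "Re s > 0" and r: "r \<ge> 0"
  shows "(smooth_profile s has_vector_derivative - smooth_profile (s + 1) r) (at r within {0..})"
  unfolding has_vector_derivative_def has_derivative_within_alt2
proof (intro conjI allI impI bounded_linear_scaleR_left)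
  fix e :: real assume e: "e > 0"
  show "\<forall>\<^sub>F y in at r within {0..}. norm (smooth_profile s y - smooth_profile s r - (y - r) *\<^sub>R - smooth_profile (s + 1) r)
      \<le> e * norm (y - r)"
    unfolding eventually_at
  proof (intro exI[of _ "e * Re s"] conjI ballI impI)
    fix y assume y: "y \<in> {0..}" "y \<noteq> r \<and> dist y r < e * Re s"
    have "norm (smooth_profile s y - smooth_profile s r - (y - r) *\<^sub>R - smooth_profile (s + 1) r)
        \<le> 1 / Re s * (y - r)\<^sup>2"
      using profile_quadratic_remainder[OF s r, of y] y by (simp add: scaleR_conv_of_real)
    also have "\<dots> = (\<bar>y - r\<bar> / Re s) * norm (y - r)" by (simp add: power2_eq_square flip: abs_mult)
    also have "\<dots> \<le> e * norm (y - r)"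
      using y s by (intro mult_right_mono) (auto simp: dist_real_def field_simps)
    finally show "norm (smooth_profile s y - smooth_profile s r - (y - r) *\<^sub>R - smooth_profile (s + 1) r) \<le> e * norm (y - r)" .
  qed (use e s in auto)
qed

section \<open>Smoothed powers in space\<close>

text \<open>Decay \<open>e\<close> in the squared distance is decay \<open>2 * e\<close> in the distance.\<close>

lemma radial_weight:
  fixes w :: "'a::real_normed_vector"
  assumes "e \<ge> 0"
  shows "(1 + (norm w)\<^sup>2) powr (- e) \<le> 2 powr e * wt (2 * e) w"
proof -
  have n: "1 + norm w > 0" by (simp add: add_pos_nonneg)
  have "(1 + norm w)\<^sup>2 \<le> 2 * (1 + (norm w)\<^sup>2)"
    using zero_le_power2[of "norm w - 1"] by (simp add: power2_eq_square algebra_simps)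
  then have "(2 * (1 + (norm w)\<^sup>2)) powr (- e) \<le> ((1 + norm w)\<^sup>2) powr (- e)"
    using assms n by (intro powr_mono2') auto
  also have "\<dots> = wt (2 * e) w"
    using n by (simp add: wt_def powr_powr flip: powr_numeral)
  finally have "2 powr e * (2 * (1 + (norm w)\<^sup>2)) powr (- e) \<le> 2 powr e * wt (2 * e) w"
    by (intro mult_left_mono) auto
  also have "2 powr e * (2 * (1 + (norm w)\<^sup>2)) powr (- e) = (1 + (norm w)\<^sup>2) powr (- e)"
    by (simp only: powr_mult powr_minus) simp
  finally show ?thesis .
qed

lemma onorm_scaleR_const:
  fixes v :: "'a::real_normed_vector"
  assumes "norm v \<le> K" shows "onorm (\<lambda>d::real. d *\<^sub>R v) \<le> K"
proof (rule onorm_bound)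
  show "0 \<le> K" using order_trans[OF norm_ge_zero assms] .
  show "norm (d *\<^sub>R v) \<le> K * norm d" for d
    using mult_left_mono[OF assms, of "\<bar>d\<bar>"] by (simp add: mult.commute)
qed

text \<open>Differences of a radial function are controlled by its derivatives with respect to the squared
  distance, each of which gains two powers of decay.\<close>

locale radial_symbol =
  fixes \<phi> \<phi>1 \<phi>2 :: "real \<Rightarrow> complex" and C e :: real
  assumes d1: "\<And>r. r \<ge> 0 \<Longrightarrow> (\<phi> has_vector_derivative \<phi>1 r) (at r within {0..})"
    and d2: "\<And>r. r \<ge> 0 \<Longrightarrow> (\<phi>1 has_vector_derivative \<phi>2 r) (at r within {0..})"
    and b0: "\<And>r. r \<ge> 0 \<Longrightarrow> norm (\<phi> r) \<le> C * (1 + r) powr (- e)"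
    and b1: "\<And>r. r \<ge> 0 \<Longrightarrow> norm (\<phi>1 r) \<le> C * (1 + r) powr (- e - 1)"
    and b2: "\<And>r. r \<ge> 0 \<Longrightarrow> norm (\<phi>2 r) \<le> C * (1 + r) powr (- e - 2)"
    and C: "C \<ge> 0" and e: "e \<ge> 0"
begin

definition rad :: "'a::real_inner \<Rightarrow> complex" where "rad z = \<phi> ((norm z)\<^sup>2)"

definition drad :: "'a::real_inner \<Rightarrow> 'a \<Rightarrow> complex" where
  "drad h z = (2 * (z \<bullet> h)) *\<^sub>R \<phi>1 ((norm z)\<^sup>2)"

lemma norm_square_derivative:
  "((\<lambda>t. (norm (z + t *\<^sub>R h))\<^sup>2) has_vector_derivative 2 * ((z + t *\<^sub>R h) \<bullet> h)) (at t within T)"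
  for z h :: "'a::real_inner"
  unfolding power2_norm_eq_inner
  by (auto intro!: derivative_eq_intros simp: has_vector_derivative_def inner_commute algebra_simps)

lemma rad_derivative:
  "((\<lambda>t. rad (z + t *\<^sub>R h)) has_vector_derivative drad h (z + t *\<^sub>R h)) (at t within T)"
  for z h :: "'a::real_inner"
proof -
  have "((\<phi> \<circ> (\<lambda>t. (norm (z + t *\<^sub>R h))\<^sup>2)) has_vector_derivative (2 * ((z + t *\<^sub>R h) \<bullet> h)) *\<^sub>R \<phi>1 ((norm (z + t *\<^sub>R h))\<^sup>2)) (at t within T)"
    by (intro vector_diff_chain_within norm_square_derivative has_vector_derivative_within_subset[OF d1]) auto
  then show ?thesis by (simp add: o_def rad_def drad_def)
qed

lemma drad_derivative:
  "((\<lambda>t. drad h (z + t *\<^sub>R k)) has_vector_derivative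
      ((2 * ((z + t *\<^sub>R k) \<bullet> h)) *\<^sub>R ((2 * ((z + t *\<^sub>R k) \<bullet> k)) *\<^sub>R \<phi>2 ((norm (z + t *\<^sub>R k))\<^sup>2))
        + (2 * (k \<bullet> h)) *\<^sub>R \<phi>1 ((norm (z + t *\<^sub>R k))\<^sup>2))) (at t within T)"
  for z h k :: "'a::real_inner"
proof -
  have "((\<phi>1 \<circ> (\<lambda>t. (norm (z + t *\<^sub>R k))\<^sup>2)) has_vector_derivative (2 * ((z + t *\<^sub>R k) \<bullet> k)) *\<^sub>R \<phi>2 ((norm (z + t *\<^sub>R k))\<^sup>2)) (at t within T)"
    by (intro vector_diff_chain_within norm_square_derivative has_vector_derivative_within_subset[OF d2]) auto
  then have A: "((\<lambda>t. \<phi>1 ((norm (z + t *\<^sub>R k))\<^sup>2)) has_vector_derivative (2 * ((z + t *\<^sub>R k) \<bullet> k)) *\<^sub>R \<phi>2 ((norm (z + t *\<^sub>R k))\<^sup>2)) (at t within T)"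
    by (simp add: o_def)
  have B: "((\<lambda>t. 2 * ((z + t *\<^sub>R k) \<bullet> h)) has_real_derivative 2 * (k \<bullet> h)) (at t within T)"
    by (auto intro!: derivative_eq_intros simp: has_field_derivative_def inner_add_left)
  show ?thesis unfolding drad_def by (rule has_vector_derivative_scaleR[OF B A])
qed

text \<open>The gradient of the squared distance grows like the distance, so one radial derivative gains two orders and
  loses one.\<close>

lemma norm_drad_le: "norm (drad h w) \<le> 2 * C * 2 powr (e + 1) * norm h * wt (2 * e + 1) w"
proof -
  let ?r = "(norm w)\<^sup>2"
  have "norm w \<le> (1 + ?r) powr (1/2)"
    by (simp add: powr_half_sqrt real_le_rsqrt)
  then have "norm (drad h w) \<le> (2 * ((1 + ?r) powr (1/2) * norm h)) * (C * (1 + ?r) powr (- e - 1))"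
    unfolding drad_def norm_scaleR
    by (intro mult_mono b1) (auto simp: abs_mult intro!: order_trans[OF Cauchy_Schwarz_ineq2] mult_right_mono)
  also have "\<dots> = 2 * C * norm h * (1 + ?r) powr (- (e + 1 / 2))"
    by (simp add: algebra_simps flip: powr_add)
  also have "\<dots> \<le> 2 * C * norm h * (2 powr (e + 1/2) * wt (2 * (e + 1/2)) w)"
    using C e by (intro mult_left_mono radial_weight) auto
  also have "\<dots> \<le> 2 * C * norm h * (2 powr (e + 1) * wt (2 * (e + 1/2)) w)"
    using C by (intro mult_left_mono mult_right_mono powr_mono) auto
  also have "\<dots> = 2 * C * 2 powr (e + 1) * norm h * wt (2 * e + 1) w" by (simp add: algebra_simps)
  finally show ?thesis .
qed

lemma norm_drad2_le:
  "norm ((2 * (w \<bullet> h)) *\<^sub>R ((2 * (w \<bullet> k)) *\<^sub>R \<phi>2 ((norm w)\<^sup>2)) + (2 * (k \<bullet> h)) *\<^sub>R \<phi>1 ((norm w)\<^sup>2))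
     \<le> 6 * C * 2 powr (e + 1) * norm h * norm k * wt (2 * e + 2) w"
proof -
  let ?r = "(norm w)\<^sup>2" and ?W = "(1 + (norm w)\<^sup>2) powr (- (e + 1))"
  have "norm ((2 * (w \<bullet> h)) *\<^sub>R ((2 * (w \<bullet> k)) *\<^sub>R \<phi>2 ?r))
      \<le> (2 * (norm w * norm h)) * ((2 * (norm w * norm k)) * (C * (1 + ?r) powr (- e - 2)))"
    unfolding norm_scaleR
    by (intro mult_mono b2) (use C in \<open>auto simp: abs_mult intro!: Cauchy_Schwarz_ineq2\<close>)
  also have "\<dots> = 4 * C * norm h * norm k * (?r * (1 + ?r) powr (- e - 2))"
    by (simp add: power2_eq_square)
  also have "\<dots> \<le> 4 * C * norm h * norm k * ((1 + ?r) * (1 + ?r) powr (- e - 2))"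
    using C by (intro mult_left_mono mult_right_mono) auto
  also have "(1 + ?r) * (1 + ?r) powr (- e - 2) = ?W"
    by (subst powr_mult_base) (auto simp: algebra_simps)
  finally have 1: "norm ((2 * (w \<bullet> h)) *\<^sub>R ((2 * (w \<bullet> k)) *\<^sub>R \<phi>2 ?r)) \<le> 4 * C * norm h * norm k * ?W" .
  have "norm ((2 * (k \<bullet> h)) *\<^sub>R \<phi>1 ?r) \<le> (2 * (norm k * norm h)) * (C * (1 + ?r) powr (- e - 1))"
    unfolding norm_scaleR
    by (intro mult_mono b1) (use C in \<open>auto simp: abs_mult intro!: Cauchy_Schwarz_ineq2\<close>)
  also have "- e - 1 = - (e + 1)" by simp
  finally have 2: "norm ((2 * (k \<bullet> h)) *\<^sub>R \<phi>1 ?r) \<le> 2 * C * norm h * norm k * ?W"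
    by (simp only: mult_ac)
  have "norm ((2 * (w \<bullet> h)) *\<^sub>R ((2 * (w \<bullet> k)) *\<^sub>R \<phi>2 ?r) + (2 * (k \<bullet> h)) *\<^sub>R \<phi>1 ?r)
      \<le> 6 * C * norm h * norm k * ?W"
    by (rule order_trans[OF norm_triangle_ineq]) (use add_mono[OF 1 2] in simp)
  also have "\<dots> \<le> 6 * C * norm h * norm k * (2 powr (e + 1) * wt (2 * (e + 1)) w)"
    using C e by (intro mult_left_mono radial_weight) auto
  finally show ?thesis by (simp add: algebra_simps)
qed

lemma first_difference:
  fixes z h :: "'a::real_inner"
  assumes S: "\<And>t. 0 \<le> t \<Longrightarrow> t \<le> 1 \<Longrightarrow> wt (2 * e + 1) (z + t *\<^sub>R h) \<le> S"
  shows "norm (rad (z + h) - rad z) \<le> 2 * C * 2 powr (e + 1) * norm h * S"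
proof -
  let ?K = "2 * C * 2 powr (e + 1) * norm h * S"
  have "norm (rad (z + 1 *\<^sub>R h) - rad (z + 0 *\<^sub>R h)) \<le> ?K * norm (1 - 0 :: real)"
  proof (rule differentiable_bound[where S="{0..1}" and f="\<lambda>t. rad (z + t *\<^sub>R h)" and f'="\<lambda>t d. d *\<^sub>R drad h (z + t *\<^sub>R h)"])
    fix t :: real assume t: "t \<in> {0..1}"
    show "((\<lambda>t. rad (z + t *\<^sub>R h)) has_derivative (\<lambda>d. d *\<^sub>R drad h (z + t *\<^sub>R h))) (at t within {0..1})"
      using rad_derivative by (simp add: has_vector_derivative_def)
    have "norm (drad h (z + t *\<^sub>R h)) \<le> ?K"
      by (rule order_trans[OF norm_drad_le]) (use t C in \<open>auto intro!: mult_left_mono S\<close>)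
    then show "onorm (\<lambda>d. d *\<^sub>R drad h (z + t *\<^sub>R h)) \<le> ?K"
      by (rule onorm_scaleR_const)
  qed auto
  then show ?thesis by simp
qed

lemma mixed_difference:
  fixes z h k :: "'a::real_inner"
  assumes S: "\<And>s t. 0 \<le> s \<Longrightarrow> s \<le> 1 \<Longrightarrow> 0 \<le> t \<Longrightarrow> t \<le> 1 \<Longrightarrow> wt (2 * e + 2) (z + s *\<^sub>R h + t *\<^sub>R k) \<le> S"
  shows "norm (rad (z + h + k) - rad (z + h) - rad (z + k) + rad z) \<le> 6 * C * 2 powr (e + 1) * norm h * norm k * S"
proof -
  let ?K = "6 * C * 2 powr (e + 1) * norm h * norm k * S"
  have d: "norm (drad h (w + k) - drad h w) \<le> ?K"
    if w: "\<And>t. 0 \<le> t \<Longrightarrow> t \<le> 1 \<Longrightarrow> wt (2 * e + 2) (w + t *\<^sub>R k) \<le> S" for w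
  proof -
    let ?f' = "\<lambda>t. (2 * ((w + t *\<^sub>R k) \<bullet> h)) *\<^sub>R ((2 * ((w + t *\<^sub>R k) \<bullet> k)) *\<^sub>R \<phi>2 ((norm (w + t *\<^sub>R k))\<^sup>2))
        + (2 * (k \<bullet> h)) *\<^sub>R \<phi>1 ((norm (w + t *\<^sub>R k))\<^sup>2)"
    have "norm (drad h (w + 1 *\<^sub>R k) - drad h (w + 0 *\<^sub>R k)) \<le> ?K * norm (1 - 0 :: real)"
    proof (rule differentiable_bound[where S="{0..1}" and f="\<lambda>t. drad h (w + t *\<^sub>R k)" and f'="\<lambda>t d. d *\<^sub>R ?f' t"])
      fix t :: real assume t: "t \<in> {0..1}"
      show "((\<lambda>t. drad h (w + t *\<^sub>R k)) has_derivative (\<lambda>d. d *\<^sub>R ?f' t)) (at t within {0..1})"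
        using drad_derivative by (simp add: has_vector_derivative_def)
      have "norm (?f' t) \<le> ?K"
        by (rule order_trans[OF norm_drad2_le]) (use t C in \<open>auto intro!: mult_left_mono w\<close>)
      then show "onorm (\<lambda>d. d *\<^sub>R ?f' t) \<le> ?K"
        by (rule onorm_scaleR_const)
    qed auto
    then show ?thesis by simp
  qed
  have "norm ((rad (z + 1 *\<^sub>R h + k) - rad (z + 1 *\<^sub>R h)) - (rad (z + 0 *\<^sub>R h + k) - rad (z + 0 *\<^sub>R h)))
      \<le> ?K * norm (1 - 0 :: real)"
  proof (rule differentiable_bound[where S="{0..1}" and f="\<lambda>t. rad (z + t *\<^sub>R h + k) - rad (z + t *\<^sub>R h)"
        and f'="\<lambda>t d. d *\<^sub>R (drad h (z + t *\<^sub>R h + k) - drad h (z + t *\<^sub>R h))"])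
    fix t :: real assume t: "t \<in> {0..1}"
    have "((\<lambda>t. rad ((z + k) + t *\<^sub>R h) - rad (z + t *\<^sub>R h)) has_vector_derivative
        (drad h ((z + k) + t *\<^sub>R h) - drad h (z + t *\<^sub>R h))) (at t within {0..1})"
      by (intro has_vector_derivative_diff rad_derivative)
    then show "((\<lambda>t. rad (z + t *\<^sub>R h + k) - rad (z + t *\<^sub>R h)) has_derivative
        (\<lambda>d. d *\<^sub>R (drad h (z + t *\<^sub>R h + k) - drad h (z + t *\<^sub>R h)))) (at t within {0..1})"
      by (simp add: has_vector_derivative_def add_ac)
    have "norm (drad h (z + t *\<^sub>R h + k) - drad h (z + t *\<^sub>R h)) \<le> ?K"
      by (rule d) (use t in \<open>auto intro!: S\<close>)
    then show "onorm (\<lambda>d. d *\<^sub>R (drad h (z + t *\<^sub>R h + k) - drad h (z + t *\<^sub>R h))) \<le> ?K"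
      by (rule onorm_scaleR_const)
  qed auto
  then show ?thesis by (simp add: algebra_simps)
qed

lemma norm_rad_le: "norm (rad z) \<le> C * 2 powr e * wt (2 * e) z"
  using order_trans[OF b0[of "(norm z)\<^sup>2"] mult_left_mono[OF radial_weight[OF e, of z] C]]
  by (simp add: rad_def mult.assoc)

lemma rad_minus [simp]: "rad (- z) = rad z" by (simp add: rad_def)

lemma continuous_on_rad: "continuous_on (UNIV :: 'a::real_inner set) rad"
proof -
  have "continuous_on {0..} \<phi>"
    using d1 by (auto simp: continuous_on_eq_continuous_within intro: has_vector_derivative_continuous)
  then show ?thesis
    unfolding rad_def by (rule continuous_on_compose2) (auto intro!: continuous_intros)
qed

end

text \<open>The properties of a smooth even kernel of decay order \<open>m\<close> that the comparison of its lattice sums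
  with integrals uses; \<open>\<rho>\<close> bounds the displacements within a lattice cell.\<close>

definition symbol :: "real \<Rightarrow> real \<Rightarrow> (real^'n \<Rightarrow> complex) \<Rightarrow> real \<Rightarrow> bool" where
  "symbol \<rho> m f C \<longleftrightarrow> C \<ge> 0 \<and> (\<forall>x. f (- x) = f x) \<and> continuous_on UNIV f \<and>
     (\<forall>x. norm (f x) \<le> C * wt m x) \<and>
     (\<forall>x p. norm p \<le> \<rho> \<longrightarrow> norm (f (x + p) - f (x - p)) \<le> C * wt (m + 1) x) \<and>
     (\<forall>x p. norm p \<le> \<rho> \<longrightarrow> norm (f (x + p) + f (x - p) - 2 * f x) \<le> C * wt (m + 2) x) \<and>
     (\<forall>x y. norm y \<le> norm x / 2 \<longrightarrow> norm (f (x + y) + f (x - y) - 2 * f x) \<le> C * (norm y)\<^sup>2 * wt (m + 2) x) \<and>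
     (\<forall>x y p. norm p \<le> \<rho> \<longrightarrow> norm y \<le> norm x / 2 \<longrightarrow>
        norm (f (x + y + p) - f (x + y - p) - f (x - y + p) + f (x - y - p)) \<le> C * norm y * wt (m + 2) x)"

lemma wt_near:
  assumes "norm z \<ge> norm x / 2 - \<rho>" "\<rho> \<ge> 0" "s \<ge> 0"
  shows "wt s z \<le> (2 * (1 + \<rho>)) powr s * wt s x"
proof (rule wt_compare)
  have "0 \<le> \<rho> * norm z" using assms by (intro mult_nonneg_nonneg) auto
  moreover have "2 * (1 + \<rho>) * (1 + norm z) = 2 + 2 * \<rho> + 2 * norm z + 2 * (\<rho> * norm z)"
    by (simp add: algebra_simps)
  ultimately show "1 + norm x \<le> 2 * (1 + \<rho>) * (1 + norm z)" using assms by linarith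
qed (use assms in auto)

text \<open>Every segment that the differences run along stays away from the origin on the scale of \<open>\<bar>x\<bar>\<close>, up to the fixed distance
  \<open>\<rho>\<close>, so that the derivative bounds there may be evaluated at \<open>x\<close>.\<close>

lemma (in radial_symbol) symbol_rad:
  assumes "\<rho> \<ge> 0"
  obtains D where "symbol \<rho> (2 * e) (rad :: real^'n \<Rightarrow> complex) D"
proof -
  define q where "q = 1 + \<rho>"
  \<comment> \<open>the loss in moving a weight of the highest order that occurs along a displacement by \<open>\<rho>\<close>\<close>
  define W where "W = (2 * q) powr (2 * e + 2)"
  have q: "q \<ge> 1" using assms by (simp add: q_def)
  define K where "K = 6 * C * 2 powr (e + 1)"
  have K: "K \<ge> 0" using C by (simp add: K_def)
  have W: "W \<ge> 0" by (simp add: W_def)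
  have W1: "W \<ge> 1" unfolding W_def using q e by (intro ge_one_powr_ge_zero) auto
  define D where "D = 4 * (q * q) * (K * W)"
  have D0: "D \<ge> 0" using K W q by (simp add: D_def)
  have KD: "c * (K * W) \<le> D" if "c \<le> 4 * (q * q)" for c
    unfolding D_def using that K W by (intro mult_right_mono) auto
  have qq: "q \<le> q * q" "1 \<le> q * q" using q mult_mono[of 1 q 1 q] by auto
  have near2: "wt (2 * e + 2) z \<le> W * wt (2 * e + 2) x" if "norm z \<ge> norm x / 2 - \<rho>" for z x :: "real^'n"
    using wt_near[OF that assms, of "2 * e + 2"] e by (simp add: W_def q_def)
  have near1: "wt (2 * e + 1) z \<le> W * wt (2 * e + 1) x" if "norm z \<ge> norm x / 2 - \<rho>" for z x :: "real^'n"
  proof -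
    have "wt (2 * e + 1) z \<le> (2 * q) powr (2 * e + 1) * wt (2 * e + 1) x"
      using wt_near[OF that assms, of "2 * e + 1"] e by (simp add: q_def)
    also have "\<dots> \<le> W * wt (2 * e + 1) x"
      unfolding W_def using q by (intro mult_right_mono powr_mono) auto
    finally show ?thesis .
  qed
  have ncomb: "norm (x + a *\<^sub>R y + b *\<^sub>R p) \<ge> norm x - norm y - norm p"
    if "\<bar>a\<bar> \<le> 1" "\<bar>b\<bar> \<le> 1" for x y p :: "real^'n" and a b :: real
  proof -
    have "norm x \<le> norm (x + a *\<^sub>R y + b *\<^sub>R p) + norm (a *\<^sub>R y) + norm (b *\<^sub>R p)"
      using norm_triangle_ineq4[of "x + a *\<^sub>R y + b *\<^sub>R p" "a *\<^sub>R y + b *\<^sub>R p"] norm_triangle_ineq[of "a *\<^sub>R y" "b *\<^sub>R p"]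
      by (simp add: algebra_simps)
    moreover have "norm (a *\<^sub>R y) \<le> 1 * norm y" "norm (b *\<^sub>R p) \<le> 1 * norm p"
      unfolding norm_scaleR by (rule mult_right_mono[OF that(1)], simp, rule mult_right_mono[OF that(2)], simp)
    ultimately show ?thesis by simp
  qed
  have "symbol \<rho> (2 * e) (rad :: real^'n \<Rightarrow> complex) D"
    unfolding symbol_def
  proof (intro conjI allI impI)
    fix x y p :: "real^'n"
    show "rad (- x) = rad x" by simp
    have "norm (rad x) \<le> (C * 2 powr e) * wt (2 * e) x" by (rule norm_rad_le)
    also have "C * 2 powr e \<le> K" using C by (simp add: K_def powr_add)
    also have "K \<le> 1 * (K * W)" using W1 K by (simp add: mult_le_cancel_left1)
    also have "\<dots> \<le> D" using qq by (intro KD) auto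
    finally show "norm (rad x) \<le> D * wt (2 * e) x" by (simp add: mult_right_mono)
  next
    fix x p :: "real^'n" assume p: "norm p \<le> \<rho>"
    have "norm (rad ((x - p) + 2 *\<^sub>R p) - rad (x - p)) \<le> 2 * C * 2 powr (e + 1) * norm (2 *\<^sub>R p) * (W * wt (2 * e + 1) x)"
    proof (rule first_difference, rule near1)
      fix t :: real assume t: "0 \<le> t" "t \<le> 1"
      have "(x - p) + t *\<^sub>R (2 *\<^sub>R p) = x + 0 *\<^sub>R 0 + (2 * t - 1) *\<^sub>R p" by (simp add: algebra_simps)
      moreover have "\<bar>0\<bar> \<le> (1 :: real)" "\<bar>2 * t - 1\<bar> \<le> (1 :: real)" using t by auto
      ultimately have "norm x - norm (0::real^'n) - norm p \<le> norm ((x - p) + t *\<^sub>R (2 *\<^sub>R p))"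
        using ncomb[of 0 "2 * t - 1" x 0 p] by (simp only:)
      then show "norm x / 2 - \<rho> \<le> norm ((x - p) + t *\<^sub>R (2 *\<^sub>R p))"
        using norm_ge_zero[of x] t p assms norm_zero[where 'a="real^'n"] by linarith
    qed
    also have "\<dots> \<le> 2 * C * 2 powr (e + 1) * (2 * q) * (W * wt (2 * e + 1) x)"
      using p W C by (intro mult_right_mono mult_left_mono) (auto simp: q_def)
    also have "\<dots> = ((2/3) * q * (K * W)) * wt (2 * e + 1) x" by (simp add: K_def)
    also have "\<dots> \<le> D * wt (2 * e + 1) x" using qq q by (intro mult_right_mono KD) auto
    finally show "norm (rad (x + p) - rad (x - p)) \<le> D * wt (2 * e + 1) x"
      by (simp add: scaleR_2 algebra_simps)
  next
    fix x p :: "real^'n" assume p: "norm p \<le> \<rho>"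
    have "norm (rad ((x - p) + p + p) - rad ((x - p) + p) - rad ((x - p) + p) + rad (x - p))
        \<le> 6 * C * 2 powr (e + 1) * norm p * norm p * (W * wt (2 * e + 2) x)"
    proof (rule mixed_difference, rule near2)
      fix s t :: real assume st: "0 \<le> s" "s \<le> 1" "0 \<le> t" "t \<le> 1"
      have "(x - p) + s *\<^sub>R p + t *\<^sub>R p = x + 0 *\<^sub>R 0 + (s + t - 1) *\<^sub>R p" by (simp add: algebra_simps)
      moreover have "\<bar>0\<bar> \<le> (1 :: real)" "\<bar>s + t - 1\<bar> \<le> (1 :: real)" using st by auto
      ultimately have "norm x - norm (0::real^'n) - norm p \<le> norm ((x - p) + s *\<^sub>R p + t *\<^sub>R p)"
        using ncomb[of 0 "s + t - 1" x 0 p] by (simp only:)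
      then show "norm x / 2 - \<rho> \<le> norm ((x - p) + s *\<^sub>R p + t *\<^sub>R p)"
        using norm_ge_zero[of x] st p assms norm_zero[where 'a="real^'n"] by linarith
    qed
    also have "\<dots> = (norm p * norm p * (K * W)) * wt (2 * e + 2) x" by (simp add: K_def)
    also have "\<dots> \<le> D * wt (2 * e + 2) x"
    proof (intro mult_right_mono KD)
      have "norm p * norm p \<le> q * q" using p q by (intro mult_mono) (auto simp: q_def)
      then show "norm p * norm p \<le> 4 * (q * q)" using qq by linarith
    qed auto
    finally show "norm (rad (x + p) + rad (x - p) - 2 * rad x) \<le> D * wt (2 * e + 2) x"
      by (simp add: algebra_simps)
  next
    fix x y :: "real^'n" assume y: "norm y \<le> norm x / 2"
    have "norm (rad ((x - y) + y + y) - rad ((x - y) + y) - rad ((x - y) + y) + rad (x - y))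
        \<le> 6 * C * 2 powr (e + 1) * norm y * norm y * (W * wt (2 * e + 2) x)"
    proof (rule mixed_difference, rule near2)
      fix s t :: real assume st: "0 \<le> s" "s \<le> 1" "0 \<le> t" "t \<le> 1"
      have "(x - y) + s *\<^sub>R y + t *\<^sub>R y = x + (s + t - 1) *\<^sub>R y + 0 *\<^sub>R 0" by (simp add: algebra_simps)
      moreover have "\<bar>s + t - 1\<bar> \<le> 1" "\<bar>0\<bar> \<le> (1 :: real)" using st by auto
      ultimately have "norm x - norm y - norm (0::real^'n) \<le> norm ((x - y) + s *\<^sub>R y + t *\<^sub>R y)"
        using ncomb[of "s + t - 1" 0 x y 0] by (simp only:)
      then show "norm x / 2 - \<rho> \<le> norm ((x - y) + s *\<^sub>R y + t *\<^sub>R y)"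
        using norm_ge_zero[of x] st y assms assms norm_zero[where 'a="real^'n"] by linarith
    qed
    also have "\<dots> = (1 * (K * W)) * ((norm y)\<^sup>2 * wt (2 * e + 2) x)" by (simp add: K_def power2_eq_square)
    also have "\<dots> \<le> D * ((norm y)\<^sup>2 * wt (2 * e + 2) x)" using qq by (intro mult_right_mono KD) auto
    finally show "norm (rad (x + y) + rad (x - y) - 2 * rad x) \<le> D * (norm y)\<^sup>2 * wt (2 * e + 2) x"
      by (simp add: algebra_simps)
  next
    fix x y p :: "real^'n" assume p: "norm p \<le> \<rho>" and y: "norm y \<le> norm x / 2"
    have "norm (rad ((x - y - p) + 2 *\<^sub>R y + 2 *\<^sub>R p) - rad ((x - y - p) + 2 *\<^sub>R y) - rad ((x - y - p) + 2 *\<^sub>R p) + rad (x - y - p))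
        \<le> 6 * C * 2 powr (e + 1) * norm (2 *\<^sub>R y) * norm (2 *\<^sub>R p) * (W * wt (2 * e + 2) x)"
    proof (rule mixed_difference, rule near2)
      fix s t :: real assume st: "0 \<le> s" "s \<le> 1" "0 \<le> t" "t \<le> 1"
      have "(x - y - p) + s *\<^sub>R (2 *\<^sub>R y) + t *\<^sub>R (2 *\<^sub>R p) = x + (2 * s - 1) *\<^sub>R y + (2 * t - 1) *\<^sub>R p"
        by (simp add: algebra_simps)
      moreover have "\<bar>2 * s - 1\<bar> \<le> 1" "\<bar>2 * t - 1\<bar> \<le> (1 :: real)" using st by auto
      ultimately have "norm x - norm y - norm p \<le> norm ((x - y - p) + s *\<^sub>R (2 *\<^sub>R y) + t *\<^sub>R (2 *\<^sub>R p))"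
        using ncomb[of "2 * s - 1" "2 * t - 1" x y p] by (simp only:)
      then show "norm x / 2 - \<rho> \<le> norm ((x - y - p) + s *\<^sub>R (2 *\<^sub>R y) + t *\<^sub>R (2 *\<^sub>R p))"
        using norm_ge_zero[of x] st y p assms norm_zero[where 'a="real^'n"] by linarith
    qed
    also have "\<dots> = (4 * norm p * (K * W)) * (norm y * wt (2 * e + 2) x)" by (simp add: K_def)
    also have "\<dots> \<le> D * (norm y * wt (2 * e + 2) x)"
    proof (intro mult_right_mono KD)
      show "4 * norm p \<le> 4 * (q * q)" using p qq by (simp add: q_def)
    qed auto
    finally show "norm (rad (x + y + p) - rad (x + y - p) - rad (x - y + p) + rad (x - y - p)) \<le> D * norm y * wt (2 * e + 2) x"
      by (simp add: scaleR_2 algebra_simps)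
  qed (auto intro: continuous_on_rad D0)
  then show ?thesis using that by blast
qed

definition smooth_kernel :: "complex \<Rightarrow> real^'n \<Rightarrow> complex" where
  "smooth_kernel \<nu> x = smooth_profile (\<nu> / 2) ((norm x)\<^sup>2) / Gamma (\<nu> / 2)"

lemma smooth_kernel_symbol:
  assumes "Re \<nu> > 0" "\<rho> \<ge> 0"
  obtains C where "symbol \<rho> (Re \<nu>) (smooth_kernel \<nu> :: real^'n \<Rightarrow> complex) C"
proof -
  let ?s = "\<nu> / 2" and ?g = "Gamma (\<nu> / 2)"
  have s: "Re ?s > 0" "Re (?s + 1) > 0" "Re (?s + 1 + 1) > 0" using assms by auto
  obtain C0 where C0: "C0 \<ge> 0" "\<And>r. r \<ge> 0 \<Longrightarrow> norm (smooth_profile ?s r) \<le> C0 * (1 + r) powr (- Re ?s)"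
    using profile_decay[OF s(1)] by blast
  obtain C1 where C1: "C1 \<ge> 0" "\<And>r. r \<ge> 0 \<Longrightarrow> norm (smooth_profile (?s + 1) r) \<le> C1 * (1 + r) powr (- Re (?s + 1))"
    using profile_decay[OF s(2)] by blast
  obtain C2 where C2: "C2 \<ge> 0" "\<And>r. r \<ge> 0 \<Longrightarrow> norm (smooth_profile (?s + 1 + 1) r) \<le> C2 * (1 + r) powr (- Re (?s + 1 + 1))"
    using profile_decay[OF s(3)] by blast
  define C where "C = (C0 + C1 + C2) / norm ?g"
  have le: "norm (z / ?g) \<le> C * w" if "norm z \<le> c * w" "c \<in> {C0, C1, C2}" "w \<ge> 0" for z c w
  proof -
    have "norm z \<le> (C0 + C1 + C2) * w"
      using that C0(1) C1(1) C2(1) by (intro order_trans[OF that(1)] mult_right_mono) auto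
    then show ?thesis by (simp add: C_def norm_divide divide_right_mono)
  qed
  interpret radial_symbol "\<lambda>r. smooth_profile ?s r / ?g" "\<lambda>r. - smooth_profile (?s + 1) r / ?g"
    "\<lambda>r. smooth_profile (?s + 1 + 1) r / ?g" C "Re ?s"
  proof
    fix r :: real assume r: "r \<ge> 0"
    show "((\<lambda>r. smooth_profile ?s r / ?g) has_vector_derivative - smooth_profile (?s + 1) r / ?g) (at r within {0..})"
      by (intro has_vector_derivative_divide profile_has_vector_derivative s r)
    have "((\<lambda>r. - smooth_profile (?s + 1) r / ?g) has_vector_derivative - (- smooth_profile (?s + 1 + 1) r) / ?g) (at r within {0..})"
      by (intro has_vector_derivative_divide has_vector_derivative_minus profile_has_vector_derivative s r)
    then show "((\<lambda>r. - smooth_profile (?s + 1) r / ?g) has_vector_derivative smooth_profile (?s + 1 + 1) r / ?g) (at r within {0..})"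
      by simp
    show "norm (smooth_profile ?s r / ?g) \<le> C * (1 + r) powr (- Re ?s)"
      using C0(2)[OF r] by (rule le) auto
    have "norm (- smooth_profile (?s + 1) r / ?g) \<le> C * (1 + r) powr (- Re (?s + 1))"
      by (rule le[of _ C1]) (use C1(2)[OF r] in auto)
    moreover have "- Re (?s + 1) = - Re ?s - 1" by simp
    ultimately show "norm (- smooth_profile (?s + 1) r / ?g) \<le> C * (1 + r) powr (- Re ?s - 1)"
      by (simp only:)
    have "norm (smooth_profile (?s + 1 + 1) r / ?g) \<le> C * (1 + r) powr (- Re (?s + 1 + 1))"
      using C2(2)[OF r] by (rule le) auto
    moreover have "- Re (?s + 1 + 1) = - Re ?s - 2" by simp
    ultimately show "norm (smooth_profile (?s + 1 + 1) r / ?g) \<le> C * (1 + r) powr (- Re ?s - 2)"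
      by (simp only:)
  qed (use assms C0 C1 C2 in \<open>auto simp: C_def\<close>)
  obtain D where "symbol \<rho> (2 * Re ?s) (rad :: real^'n \<Rightarrow> complex) D"
    using symbol_rad[OF assms(2)] by blast
  moreover have "(rad :: real^'n \<Rightarrow> complex) = smooth_kernel \<nu>"
    by (simp add: fun_eq_iff rad_def smooth_kernel_def)
  ultimately show ?thesis using that by simp
qed

text \<open>The omitted times \<open>p < 1\<close> contribute less than the power itself by a factor \<open>\<bar>x\<bar>\<^sup>2\<close>.\<close>

lemma power_kernel_error:
  fixes x :: "real^'n"
  assumes "Re \<nu> > 0" "x \<noteq> 0"
  shows "norm (power_kernel \<nu> x - smooth_kernel \<nu> x)
           \<le> Gamma (Re \<nu> / 2 + 1) / norm (Gamma (\<nu> / 2)) * norm x powr (- Re \<nu> - 2)"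
proof -
  let ?r = "(norm x)\<^sup>2" and ?g = "Gamma (\<nu> / 2)"
  have r: "?r > 0" "norm x > 0" using assms by auto
  have "\<nu> / 2 \<notin> \<int>\<^sub>\<le>\<^sub>0" using assms by (intro Re_pos_imp_not_nonpos_Ints) simp
  then have g: "?g \<noteq> 0" by (simp add: Gamma_eq_zero_iff)
  have "complex_of_real ?r powr (- (\<nu> / 2)) = complex_of_real (norm x) powr (- \<nu>)"
    using r by (simp add: powr_def Ln_of_real ln_realpow del: of_real_power)
  then have "power_kernel \<nu> x - smooth_kernel \<nu> x = - ((smooth_profile (\<nu> / 2) ?r - ?g * of_real ?r powr (- (\<nu> / 2))) / ?g)"
    using g assms by (simp add: power_kernel_def smooth_kernel_def field_simps)
  then have "norm (power_kernel \<nu> x - smooth_kernel \<nu> x) = norm (smooth_profile (\<nu> / 2) ?r - ?g * of_real ?r powr (- (\<nu> / 2))) / norm ?g"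
    by (simp only: norm_minus_cancel norm_divide)
  also have "\<dots> \<le> (Gamma (Re (\<nu> / 2) + 1) * ?r powr (- Re (\<nu> / 2) - 1)) / norm ?g"
    using profile_power_error[of "\<nu> / 2" ?r] assms r by (intro divide_right_mono) auto
  also have "?r powr (- Re (\<nu> / 2) - 1) = norm x powr (- Re \<nu> - 2)"
    using r by (simp add: powr_def ln_realpow algebra_simps)
  finally show ?thesis by simp
qed

section \<open>The volume of a lattice cell\<close>

text \<open>The elementary shear, for an index type without an order; with the next two lemmas this gives the
  change of volume under a linear map for every finite index type.\<close>

lemma det_shear:
  fixes m n :: "'n::finite"
  assumes "m \<noteq> n"
  shows "det (matrix (\<lambda>v::real^'n. \<chi> i. if i = m then v $ m + v $ n else v $ i)) = 1"
proof -
  have "matrix (\<lambda>v::real^'n. \<chi> i. if i = m then v $ m + v $ n else v $ i)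
      = (\<chi> k. if k = m then row m (mat 1) + 1 *s row n (mat 1) else row k (mat 1))"
    by (simp add: matrix_def vec_eq_iff row_def mat_def axis_def)
  then show ?thesis using det_row_operation[OF assms, of "mat 1" 1] by simp
qed

lemma measure_shear_cbox:
  fixes m n :: "'n::finite" and a b :: "real^'n"
  assumes mn: "m \<noteq> n"
  shows "measure lebesgue ((\<lambda>v. \<chi> i. if i = m then v $ m + v $ n else v $ i) ` cbox a b) = measure lebesgue (cbox a b)"
    (is "measure lebesgue (?h ` _) = _")
proof (cases "cbox a b = {}")
  case False
  \<comment> \<open>a translation makes the coordinate that is added nonnegative\<close>
  define w :: "real^'n" where "w = (\<chi> i. if i = n then - a $ n else 0)"
  have lin: "linear ?h" by (rule linearI) (simp_all add: vec_eq_iff algebra_simps)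
  have tr: "(+) w ` cbox a b = cbox (w + a) (w + b)" by (rule cbox_translation[symmetric])
  have "?h ` cbox (w + a) (w + b) = (+) (?h w) ` (?h ` cbox a b)"
    unfolding tr[symmetric] image_image by (intro image_cong refl linear_add[OF lin])
  then have "measure lebesgue (?h ` cbox a b) = measure lebesgue (?h ` cbox (w + a) (w + b))"
    by (simp only: measure_translation)
  also have "\<dots> = measure lebesgue (cbox (w + a) (w + b))"
    using False tr by (intro measure_shear_interval mn) (auto simp: w_def)
  also have "\<dots> = measure lebesgue (cbox a b)"
    unfolding tr[symmetric] by (rule measure_translation)
  finally show ?thesis .
qed simp

text \<open>Every linear map is a composition of singular maps, coordinate scalings, transpositions and elementary shears.\<close>

lemma measure_linear_image_det:
  fixes f :: "real^'n \<Rightarrow> real^'n"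
  assumes "linear f" "S \<in> lmeasurable"
  shows "f ` S \<in> lmeasurable" "measure lebesgue (f ` S) = \<bar>det (matrix f)\<bar> * measure lebesgue S"
proof -
  let ?P = "\<lambda>f::real^'n \<Rightarrow> real^'n. \<forall>S\<in>lmeasurable. f ` S \<in> lmeasurable \<and>
    measure lebesgue (f ` S) = \<bar>det (matrix f)\<bar> * measure lebesgue S"
  have "?P f"
  proof (rule induct_linear_elementary[OF assms(1), where P="?P"])
    fix f g :: "real^'n \<Rightarrow> real^'n"
    assume fg: "linear f" "linear g" and f: "?P f" and g: "?P g"
    have det: "det (matrix (f \<circ> g)) = det (matrix f) * det (matrix g)"
      using fg by (simp add: matrix_compose det_mul)
    show "?P (f \<circ> g)"
    proof (intro ballI)
      fix S :: "(real^'n) set" assume S: "S \<in> lmeasurable"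
      then have "g ` S \<in> lmeasurable" using g by blast
      then show "(f \<circ> g) ` S \<in> lmeasurable \<and>
          measure lebesgue ((f \<circ> g) ` S) = \<bar>det (matrix (f \<circ> g))\<bar> * measure lebesgue S"
        unfolding det abs_mult image_comp[symmetric] using f g S by simp
    qed
  next
    fix f :: "real^'n \<Rightarrow> real^'n" and i
    assume f: "linear f" "\<And>x. f x $ i = 0"
    have ninj: "\<not> inj f"
    proof
      assume "inj f"
      then obtain x where "f x = axis i 1"
        using linear_injective_imp_surjective[OF f(1)] surjD[of f "axis i 1"] by auto
      then show False using f(2)[of x] by (simp add: axis_def)
    qed
    then have "det (matrix f) = 0" using det_nz_iff_inj[OF f(1)] by blast
    moreover have "negligible (f ` S)" for S by (rule negligible_linear_singular_image[OF f(1) ninj])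
    ultimately show "?P f" by (auto intro: negligible_imp_measurable negligible_imp_measure0)
  next
    fix c :: "'n \<Rightarrow> real"
    have "matrix (\<lambda>x::real^'n. \<chi> i. c i * x $ i) = (\<chi> i j. if i = j then c i else 0)"
      by (simp add: matrix_def vec_eq_iff axis_def)
    then have "det (matrix (\<lambda>x::real^'n. \<chi> i. c i * x $ i)) = prod c UNIV"
      by (simp add: det_diagonal)
    then show "?P (\<lambda>x. \<chi> i. c i * x $ i)"
      by (simp add: measurable_stretch measure_stretch)
  next
    fix m n :: 'n assume "m \<noteq> n"
    let ?p = "Transposition.transpose m n"
    let ?h = "\<lambda>x::real^'n. \<chi> i. x $ ?p i"
    have lin: "linear ?h" by (rule linearI) (simp_all add: vec_eq_iff)
    have "matrix ?h = (\<chi> i. mat 1 $ ?p i)"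
      by (simp add: matrix_def vec_eq_iff mat_def axis_def)
    then have det: "\<bar>det (matrix ?h)\<bar> = 1"
      by (simp add: det_permute_rows[OF permutes_swap_id] abs_mult sign_swap_id)
    have "measure lebesgue (?h ` cbox a b) = 1 * measure lebesgue (cbox a b)" for a b
    proof (cases "cbox a b = {}")
      case False
      have im: "?h ` cbox a b = cbox (?h a) (?h b)"
      proof (rule set_eqI)
        fix x
        have "x \<in> ?h ` cbox a b \<longleftrightarrow> ?h x \<in> cbox a b"
          by (auto simp: image_iff lambda_swap_Galois)
        also have "\<dots> \<longleftrightarrow> x \<in> cbox (?h a) (?h b)"
        proof -
          have "(\<forall>i. Q i (?p i)) \<longleftrightarrow> (\<forall>i. Q (?p i) i)" for Q
            by (metis transpose_involutory)
          from this[of "\<lambda>i j. a $ i \<le> x $ j \<and> x $ j \<le> b $ i"] show ?thesis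
            by (simp add: mem_box_cart)
        qed
        finally show "x \<in> ?h ` cbox a b \<longleftrightarrow> x \<in> cbox (?h a) (?h b)" .
      qed
      then have "cbox (?h a) (?h b) \<noteq> {}" using False by auto
      then have "measure lebesgue (cbox (?h a) (?h b)) = (\<Prod>i\<in>UNIV. (b - a) $ ?p i)"
        by (simp add: content_cbox_cart)
      also have "\<dots> = (\<Prod>i\<in>UNIV. (b - a) $ i)"
        using prod.permute[OF permutes_swap_id[of m UNIV n], of "\<lambda>i. (b - a) $ i"] by (simp add: o_def)
      also have "\<dots> = measure lebesgue (cbox a b)"
        using False by (simp add: content_cbox_cart)
      finally show ?thesis by (simp add: im)
    qed simp
    then have "?h ` S \<in> lmeasurable \<and> measure lebesgue (?h ` S) = 1 * measure lebesgue S"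
      if "S \<in> lmeasurable" for S
      using measure_linear_sufficient[OF lin that] by (simp only: conj_ac)
    then show "?P ?h" unfolding det by blast
  next
    fix m n :: 'n assume mn: "m \<noteq> n"
    let ?h = "\<lambda>v::real^'n. \<chi> i. if i = m then v $ m + v $ n else v $ i"
    have lin: "linear ?h" by (rule linearI) (simp_all add: vec_eq_iff algebra_simps)
    have "measure lebesgue (?h ` cbox a b) = 1 * measure lebesgue (cbox a b)" for a b
      using measure_shear_cbox[OF mn] by simp
    then have "?h ` S \<in> lmeasurable \<and> measure lebesgue (?h ` S) = 1 * measure lebesgue S"
      if "S \<in> lmeasurable" for S
      using measure_linear_sufficient[OF lin that] by (simp only: conj_ac)
    then show "?P ?h" unfolding det_shear[OF mn] abs_one by blast
  qed
  then show "f ` S \<in> lmeasurable" "measure lebesgue (f ` S) = \<bar>det (matrix f)\<bar> * measure lebesgue S"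
    using assms(2) by auto
qed

text \<open>Centring the half-open cell at the origin makes it a set of representatives by rounding coordinates.\<close>

definition unit_cell :: "(real^'n) set" where
  "unit_cell = {u. \<forall>i. - (1/2) \<le> u $ i \<and> u $ i < 1/2}"

definition lattice_cell :: "real^'n^'n \<Rightarrow> (real^'n) set" where
  "lattice_cell A = (*v) A ` unit_cell"

lemma unit_cell_borel: "(unit_cell :: (real^'n) set) \<in> sets borel"
proof -
  have eq: "unit_cell = (\<Inter>i. {u::real^'n. - (1/2) \<le> u $ i} \<inter> {u. u $ i < 1/2})"
    by (auto simp: unit_cell_def)
  have "closed {u::real^'n. - (1/2) \<le> u $ i}" "open {u::real^'n. u $ i < 1/2}" for i
    by (rule closed_halfspace_component_ge_cart open_halfspace_component_lt_cart)+
  then show ?thesis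
    unfolding eq by (intro sets.finite_INT sets.Int borel_closed borel_open) auto
qed

lemma unit_cell_measure: "(unit_cell :: (real^'n) set) \<in> lmeasurable" "measure lebesgue (unit_cell :: (real^'n) set) = 1"
proof -
  let ?a = "(\<chi> i. - (1/2)) :: real^'n" and ?b = "(\<chi> i. 1/2) :: real^'n"
  have sub: "box ?a ?b \<subseteq> unit_cell" "unit_cell \<subseteq> cbox ?a ?b"
    by (auto simp: unit_cell_def mem_box_cart less_imp_le)
  have ne: "cbox ?a ?b \<noteq> {}" by (simp add: interval_ne_empty_cart)
  have c: "measure lebesgue (cbox ?a ?b) = 1"
    using ne by (simp add: content_cbox_cart)
  have "bounded (unit_cell :: (real^'n) set)" using sub(2) bounded_cbox bounded_subset by blast
  moreover have cell: "(unit_cell :: (real^'n) set) \<in> sets lebesgue"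
    using unit_cell_borel by (intro sets_completionI_sets) simp
  ultimately show l: "(unit_cell :: (real^'n) set) \<in> lmeasurable" by (rule bounded_set_imp_lmeasurable)
  have "negligible (cbox ?a ?b - unit_cell)"
    by (rule negligible_subset[OF negligible_frontier_interval[of ?a ?b]]) (use sub in auto)
  then have "measure lebesgue (cbox ?a ?b - (cbox ?a ?b - unit_cell)) = measure lebesgue (cbox ?a ?b)"
    by (intro measure_Diff_null_set) (auto simp: negligible_iff_null_sets)
  moreover have "cbox ?a ?b - (cbox ?a ?b - unit_cell) = unit_cell" using sub by auto
  ultimately show "measure lebesgue (unit_cell :: (real^'n) set) = 1" using c by simp
qed

lemma lattice_cell_borel:
  fixes A :: "real^'n^'n"
  assumes "invertible A"
  shows "lattice_cell A \<in> sets borel"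
proof -
  obtain B where B: "A ** B = mat 1" "B ** A = mat 1" using assms unfolding invertible_def by blast
  have "lattice_cell A = (*v) B -` unit_cell"
  proof (intro equalityI subsetI)
    fix x assume "x \<in> (*v) B -` unit_cell"
    moreover have "x = A *v (B *v x)" by (simp add: matrix_vector_mul_assoc B)
    ultimately show "x \<in> lattice_cell A" unfolding lattice_cell_def by blast
  qed (auto simp: lattice_cell_def matrix_vector_mul_assoc B)
  moreover have "(*v) B \<in> borel_measurable borel"
    by (intro borel_measurable_continuous_onI matrix_vector_mult_linear_continuous_on)
  ultimately show ?thesis using measurable_sets[OF _ unit_cell_borel, of "(*v) B" borel] by simp
qed

lemma lattice_cell_measure:
  fixes A :: "real^'n^'n"
  assumes "invertible A"
  shows "emeasure lborel (lattice_cell A) = ennreal (covolume A)"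
    and "measure lborel (lattice_cell A) = covolume A"
proof -
  have u: "measure lebesgue (unit_cell :: (real^'n) set) = 1" by (rule unit_cell_measure(2))
  have l: "lattice_cell A \<in> lmeasurable" "measure lebesgue (lattice_cell A) = covolume A"
    unfolding lattice_cell_def covolume_def
    using measure_linear_image_det[OF matrix_vector_mul_linear unit_cell_measure(1), of A] u
    by (simp_all add: matrix_of_matrix_vector_mul)
  have "emeasure lebesgue (lattice_cell A) = ennreal (covolume A)"
    using emeasure_eq_measure2[OF l(1)] unfolding l(2) .
  then show e: "emeasure lborel (lattice_cell A) = ennreal (covolume A)"
    using lattice_cell_borel[OF assms] by simp
  then show "measure lborel (lattice_cell A) = covolume A"
    by (simp add: measure_def covolume_def)
qed

lemma lattice_cell_bounded:
  fixes A :: "real^'n^'n"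
  obtains \<rho> where "\<rho> \<ge> 0" "\<And>p. p \<in> lattice_cell A \<Longrightarrow> norm p \<le> \<rho>"
proof -
  have "unit_cell \<subseteq> cbox ((\<chi> i. - (1/2)) :: real^'n) (\<chi> i. 1/2)"
    by (auto simp: unit_cell_def mem_box_cart less_imp_le)
  then have "bounded (lattice_cell A)"
    unfolding lattice_cell_def
    by (intro bounded_linear_image matrix_vector_mul_bounded_linear) (rule bounded_subset[OF bounded_cbox])
  then obtain r where "\<And>p. p \<in> lattice_cell A \<Longrightarrow> norm p \<le> r" by (auto simp: bounded_iff)
  then show ?thesis by (intro that[of "max r 0"]) (simp_all add: le_max_iff_disj)
qed

text \<open>Rounding the coordinates of \<open>x\<close> with respect to the columns of \<open>A\<close>.\<close>

lemma lattice_cell_decomposition: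
  fixes A :: "real^'n^'n"
  assumes "invertible A"
  shows "\<exists>!y. y \<in> lattice A \<and> x - y \<in> lattice_cell A"
proof -
  obtain B where B: "A ** B = mat 1" "B ** A = mat 1" using assms unfolding invertible_def by blast
  define v where "v = B *v x"
  have x: "x = A *v v" by (simp add: v_def matrix_vector_mul_assoc B)
  define e :: "int^'n \<Rightarrow> real^'n" where "e = (\<lambda>z. \<chi> i. of_int (z $ i))"
  have inj: "inj ((*v) A)" using assms by (simp add: inj_matrix_vector_mult)
  have cell: "x - A *v e z \<in> lattice_cell A \<longleftrightarrow> (\<forall>i. z $ i = \<lfloor>v $ i + 1/2\<rfloor>)" for z
  proof -
    have "x - A *v e z = A *v (v - e z)" by (simp add: x matrix_vector_mult_diff_distrib)
    then have "x - A *v e z \<in> lattice_cell A \<longleftrightarrow> v - e z \<in> unit_cell"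
      unfolding lattice_cell_def using inj by (simp add: inj_image_mem_iff)
    also have "\<dots> \<longleftrightarrow> (\<forall>i. z $ i = \<lfloor>v $ i + 1/2\<rfloor>)"
      unfolding unit_cell_def mem_Collect_eq
    proof (rule all_cong1)
      fix i
      have "- (1/2) \<le> (v - e z) $ i \<and> (v - e z) $ i < 1/2 \<longleftrightarrow> of_int (z $ i) \<le> v $ i + 1/2 \<and> v $ i + 1/2 < of_int (z $ i) + 1"
        by (auto simp: e_def)
      then show "(- (1/2) \<le> (v - e z) $ i \<and> (v - e z) $ i < 1/2) = (z $ i = \<lfloor>v $ i + 1/2\<rfloor>)"
        using floor_eq_iff[of "v $ i + 1/2" "z $ i"] by auto
    qed
    finally show ?thesis .
  qed
  have mem: "y \<in> lattice A \<longleftrightarrow> (\<exists>z. y = A *v e z)" for y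
    by (simp add: lattice_iff e_def)
  define z0 :: "int^'n" where "z0 = (\<chi> i. \<lfloor>v $ i + 1/2\<rfloor>)"
  show ?thesis
  proof (rule ex1I[of _ "A *v e z0"])
    show "A *v e z0 \<in> lattice A \<and> x - A *v e z0 \<in> lattice_cell A"
      unfolding cell mem by (auto simp: z0_def)
    fix y assume y: "y \<in> lattice A \<and> x - y \<in> lattice_cell A"
    then have "y \<in> lattice A" by (rule conjunct1)
    then obtain z where z: "y = A *v e z" unfolding mem by (rule exE)
    have "x - A *v e z \<in> lattice_cell A" using y unfolding z by (rule conjunct2)
    then have "\<forall>i. z $ i = \<lfloor>v $ i + 1/2\<rfloor>" unfolding cell .
    then show "y = A *v e z0" by (simp add: z e_def z0_def)
  qed
qed

section \<open>Integrals over space as integrals of lattice sums over a cell\<close>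

lemma nn_integral_translate:
  fixes f :: "real^'n \<Rightarrow> ennreal"
  assumes [measurable]: "f \<in> borel_measurable borel"
  shows "(\<integral>\<^sup>+x. f (c + x) \<partial>lborel) = (\<integral>\<^sup>+x. f x \<partial>lborel)"
proof -
  have "(\<integral>\<^sup>+x. f x \<partial>distr lborel borel ((+) c)) = (\<integral>\<^sup>+x. f (c + x) \<partial>lborel)"
    by (rule nn_integral_distr) auto
  then show ?thesis by (simp add: lborel_distr_plus)
qed

lemma integral_translate:
  fixes f :: "real^'n \<Rightarrow> complex"
  assumes [measurable]: "f \<in> borel_measurable borel"
  shows "(\<integral>x. f (c + x) \<partial>lborel) = (\<integral>x. f x \<partial>lborel)"
proof -
  have "(\<integral>x. f x \<partial>distr lborel borel ((+) c)) = (\<integral>x. f (c + x) \<partial>lborel)"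
    by (rule integral_distr) auto
  then show ?thesis by (simp add: lborel_distr_plus)
qed

locale tiling =
  fixes A :: "real^'n^'n"
  assumes inv: "invertible A"
begin

abbreviation "L \<equiv> lattice A"
abbreviation "cell \<equiv> lattice_cell A"

lemma cell_borel [measurable]: "cell \<in> sets borel" by (rule lattice_cell_borel[OF inv])

sublocale LM: pair_sigma_finite "count_space L" "lborel :: (real^'n) measure"
  by (intro pair_sigma_finite.intro sigma_finite_measure_count_space_countable countable_lattice
    lborel.sigma_finite_measure_axioms)

lemma measurable_on_lattice_product:
  assumes "\<And>y. y \<in> L \<Longrightarrow> (\<lambda>x. f y x) \<in> borel_measurable borel"
  shows "case_prod f \<in> borel_measurable (count_space L \<Otimes>\<^sub>M lborel)"
  by (rule measurable_pair_measure_countable1[OF countable_lattice]) (use assms in simp)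

lemma sum_cell_indicator: "(\<integral>\<^sup>+y. indicator cell (x - y) * c \<partial>count_space L) = (c :: ennreal)"
proof -
  obtain y0 where y0: "y0 \<in> L" "x - y0 \<in> cell" and z: "\<And>y. y \<in> L \<Longrightarrow> y \<noteq> y0 \<Longrightarrow> x - y \<notin> cell"
    using lattice_cell_decomposition[OF inv, of x] by blast
  have "(\<integral>\<^sup>+y. indicator cell (x - y) * c \<partial>count_space L) = (\<Sum>y\<in>{y0}. indicator cell (x - y) * c)"
    by (intro nn_integral_count_space') (simp_all add: y0 z)
  then show ?thesis using y0 by simp
qed

lemma nn_integral_tiling:
  assumes F[measurable]: "F \<in> borel_measurable borel"
  shows "(\<integral>\<^sup>+y. \<integral>\<^sup>+p. indicator cell p * F (y + p) \<partial>lborel \<partial>count_space L) = (\<integral>\<^sup>+x. F x \<partial>lborel)"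
    and "(\<integral>\<^sup>+p. \<integral>\<^sup>+y. indicator cell p * F (y + p) \<partial>count_space L \<partial>lborel) = (\<integral>\<^sup>+x. F x \<partial>lborel)"
proof -
  have "(\<integral>\<^sup>+p. indicator cell p * F (y + p) \<partial>lborel) = (\<integral>\<^sup>+x. indicator cell (x - y) * F x \<partial>lborel)" for y
    using nn_integral_translate[of "\<lambda>x. indicator cell (x - y) * F x" y] by simp
  then have "(\<integral>\<^sup>+y. \<integral>\<^sup>+p. indicator cell p * F (y + p) \<partial>lborel \<partial>count_space L)
      = (\<integral>\<^sup>+y. \<integral>\<^sup>+x. indicator cell (x - y) * F x \<partial>lborel \<partial>count_space L)"
    by (simp only:)
  also have "\<dots> = (\<integral>\<^sup>+x. \<integral>\<^sup>+y. indicator cell (x - y) * F x \<partial>count_space L \<partial>lborel)"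
    by (rule LM.Fubini'[symmetric]) (rule measurable_on_lattice_product, measurable)
  also have "\<dots> = (\<integral>\<^sup>+x. F x \<partial>lborel)"
    by (simp add: sum_cell_indicator)
  finally show 1: "(\<integral>\<^sup>+y. \<integral>\<^sup>+p. indicator cell p * F (y + p) \<partial>lborel \<partial>count_space L) = (\<integral>\<^sup>+x. F x \<partial>lborel)" .
  have "(\<integral>\<^sup>+p. \<integral>\<^sup>+y. indicator cell p * F (y + p) \<partial>count_space L \<partial>lborel)
      = (\<integral>\<^sup>+y. \<integral>\<^sup>+p. indicator cell p * F (y + p) \<partial>lborel \<partial>count_space L)"
    by (rule LM.Fubini') (rule measurable_on_lattice_product, measurable)
  with 1 show "(\<integral>\<^sup>+p. \<integral>\<^sup>+y. indicator cell p * F (y + p) \<partial>count_space L \<partial>lborel) = (\<integral>\<^sup>+x. F x \<partial>lborel)"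
    by simp
qed

text \<open>Fubini for the sum over the lattice and the integral over the cell; summability for each shift identifies the
  Bochner integral over the counting measure with the unordered sum.\<close>

lemma integral_tiling:
  fixes F :: "real^'n \<Rightarrow> complex"
  assumes F: "integrable lborel F"
    and S: "\<And>p. p \<in> cell \<Longrightarrow> (\<lambda>y. norm (F (y + p))) summable_on L"
  shows "integrable lborel (\<lambda>p. indicator cell p *\<^sub>R (\<Sum>\<^sub>\<infinity>y\<in>L. F (y + p)))"
    and "(\<integral>p. indicator cell p *\<^sub>R (\<Sum>\<^sub>\<infinity>y\<in>L. F (y + p)) \<partial>lborel) = (\<integral>x. F x \<partial>lborel)"
proof -
  have [measurable]: "F \<in> borel_measurable borel" using borel_measurable_integrable[OF F] by simp
  let ?h = "\<lambda>y p. indicator cell p *\<^sub>R F (y + p)"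
  let ?k = "\<lambda>y x. indicator cell (x - y) *\<^sub>R F x"
  have fin: "(\<integral>\<^sup>+x. ennreal (norm (F x)) \<partial>lborel) < \<infinity>"
    using F unfolding integrable_iff_bounded by blast
  have measurable_translated_cell: "(\<lambda>x. ?k y x) \<in> borel_measurable borel" for y by measurable
  have I: "integrable (count_space L \<Otimes>\<^sub>M lborel) (case_prod ?h)"
    unfolding integrable_iff_bounded
  proof (intro conjI measurable_on_lattice_product)
    show "(\<lambda>p. ?h y p) \<in> borel_measurable borel" for y by measurable
    have m: "(\<lambda>(y, p). indicator cell p * ennreal (norm (F (y + p)))) \<in> borel_measurable (count_space L \<Otimes>\<^sub>M lborel)"
      by (rule measurable_on_lattice_product) measurable
    have "(\<integral>\<^sup>+z. norm (case_prod ?h z) \<partial>(count_space L \<Otimes>\<^sub>M lborel))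
        = (\<integral>\<^sup>+z. (case z of (y, p) \<Rightarrow> indicator cell p * ennreal (norm (F (y + p)))) \<partial>(count_space L \<Otimes>\<^sub>M lborel))"
      by (intro nn_integral_cong) (auto simp: indicator_def split: prod.split)
    also have "\<dots> = (\<integral>\<^sup>+y. \<integral>\<^sup>+p. indicator cell p * ennreal (norm (F (y + p))) \<partial>lborel \<partial>count_space L)"
      using lborel.nn_integral_fst[OF m] by simp
    also have "\<dots> = (\<integral>\<^sup>+x. ennreal (norm (F x)) \<partial>lborel)"
      by (rule nn_integral_tiling(1)) measurable
    finally show "(\<integral>\<^sup>+z. norm (case_prod ?h z) \<partial>(count_space L \<Otimes>\<^sub>M lborel)) < \<infinity>" using fin by simp
  qed
  have J: "integrable (count_space L \<Otimes>\<^sub>M lborel) (case_prod ?k)"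
    unfolding integrable_iff_bounded
  proof (intro conjI measurable_on_lattice_product)
    show "(\<lambda>p. ?k y p) \<in> borel_measurable borel" for y by measurable
    have m: "(\<lambda>(y, x). indicator cell (x - y) * ennreal (norm (F x))) \<in> borel_measurable (count_space L \<Otimes>\<^sub>M lborel)"
      by (rule measurable_on_lattice_product) measurable
    have "(\<integral>\<^sup>+z. norm (case_prod ?k z) \<partial>(count_space L \<Otimes>\<^sub>M lborel))
        = (\<integral>\<^sup>+z. (case z of (y, x) \<Rightarrow> indicator cell (x - y) * ennreal (norm (F x))) \<partial>(count_space L \<Otimes>\<^sub>M lborel))"
      by (intro nn_integral_cong) (auto simp: indicator_def split: prod.split)
    also have "\<dots> = (\<integral>\<^sup>+x. \<integral>\<^sup>+y. indicator cell (x - y) * ennreal (norm (F x)) \<partial>count_space L \<partial>lborel)"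
      using LM.nn_integral_snd[OF m] by simp
    also have "\<dots> = (\<integral>\<^sup>+x. ennreal (norm (F x)) \<partial>lborel)"
      by (simp add: sum_cell_indicator)
    finally show "(\<integral>\<^sup>+z. norm (case_prod ?k z) \<partial>(count_space L \<Otimes>\<^sub>M lborel)) < \<infinity>" using fin by simp
  qed
  have sumh: "(\<integral>y. ?h y p \<partial>count_space L) = indicator cell p *\<^sub>R (\<Sum>\<^sub>\<infinity>y\<in>L. F (y + p))" for p
  proof (cases "p \<in> cell")
    case True
    have "infsetsum (\<lambda>y. F (y + p)) L = (\<Sum>\<^sub>\<infinity>y\<in>L. F (y + p))"
      using S[OF True] by (rule infsetsum_infsum[OF abs_summable_equivalent[THEN iffD1]])
    then show ?thesis using True by (simp add: infsetsum_def)
  qed auto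
  have sumk: "(\<integral>y. ?k y x \<partial>count_space L) = F x" for x
  proof -
    obtain y0 where y0: "y0 \<in> L" "x - y0 \<in> cell" and z: "\<And>y. y \<in> L \<Longrightarrow> y \<noteq> y0 \<Longrightarrow> x - y \<notin> cell"
      using lattice_cell_decomposition[OF inv, of x] by blast
    have sub: "{y \<in> L. ?k y x \<noteq> 0} \<subseteq> {y0}"
      by (rule subsetI, rule ccontr) (auto simp: z)
    have "(\<integral>y. ?k y x \<partial>count_space L) = (\<Sum>y | y \<in> L \<and> ?k y x \<noteq> 0. ?k y x)"
      by (rule lebesgue_integral_count_space_finite_support) (rule finite_subset[OF sub], simp)
    also have "\<dots> = (\<Sum>y\<in>{y0}. ?k y x)"
      by (rule sum.mono_neutral_left[OF _ sub]) (auto simp: y0)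
    finally show ?thesis using y0 by simp
  qed
  show "integrable lborel (\<lambda>p. indicator cell p *\<^sub>R (\<Sum>\<^sub>\<infinity>y\<in>L. F (y + p)))"
    using LM.integrable_snd[OF I] unfolding sumh .
  have "(\<integral>p. indicator cell p *\<^sub>R (\<Sum>\<^sub>\<infinity>y\<in>L. F (y + p)) \<partial>lborel) = (\<integral>p. \<integral>y. ?h y p \<partial>count_space L \<partial>lborel)"
    unfolding sumh ..
  also have "\<dots> = (\<integral>y. \<integral>p. ?h y p \<partial>lborel \<partial>count_space L)"
    by (rule LM.Fubini_integral[OF I])
  also have "\<dots> = (\<integral>y. \<integral>x. ?k y x \<partial>lborel \<partial>count_space L)"
  proof (rule Bochner_Integration.integral_cong[OF refl])
    fix y
    show "(\<integral>p. ?h y p \<partial>lborel) = (\<integral>x. ?k y x \<partial>lborel)"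
      using integral_translate[of "\<lambda>x. ?k y x" y] by (simp add: measurable_translated_cell)
  qed
  also have "\<dots> = (\<integral>x. \<integral>y. ?k y x \<partial>count_space L \<partial>lborel)"
    by (rule LM.Fubini_integral[OF J, symmetric])
  also have "\<dots> = (\<integral>x. F x \<partial>lborel)" unfolding sumk ..
  finally show "(\<integral>p. indicator cell p *\<^sub>R (\<Sum>\<^sub>\<infinity>y\<in>L. F (y + p)) \<partial>lborel) = (\<integral>x. F x \<partial>lborel)" .
qed

end

section \<open>Gaussian integrals\<close>

lemma gaussian_nn_integral_1d:
  assumes "p > 0"
  shows "(\<integral>\<^sup>+t. ennreal (exp (- (t\<^sup>2 / p))) \<partial>lborel) = ennreal (sqrt (pi * p))"
proof -
  define \<sigma> where "\<sigma> = sqrt (p / 2)"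
  have s: "\<sigma> > 0" "\<sigma>\<^sup>2 = p / 2" using assms by (auto simp: \<sigma>_def)
  have e: "exp (- (t\<^sup>2 / p)) = sqrt (pi * p) * normal_density 0 \<sigma> t" for t
    using assms by (simp add: normal_density_def s(2))
  have "(\<integral>\<^sup>+t. ennreal (exp (- (t\<^sup>2 / p))) \<partial>lborel) = ennreal (\<integral>t. sqrt (pi * p) * normal_density 0 \<sigma> t \<partial>lborel)"
    unfolding e using assms s(1)
    by (intro nn_integral_eq_integral integrable_mult_right integrable_normal_density) auto
  then show ?thesis using s(1) by simp
qed

lemma gaussian_nn_integral:
  assumes p: "p > 0"
  shows "(\<integral>\<^sup>+y. ennreal (exp (- ((norm (y :: real^'n))\<^sup>2 / p))) \<partial>lborel) = ennreal ((pi * p) powr (real CARD('n) / 2))"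
proof -
  have "exp (- ((norm y)\<^sup>2 / p)) = (\<Prod>b\<in>Basis. exp (- ((y \<bullet> b)\<^sup>2 / p)))" for y :: "real^'n"
    unfolding exp_sum[OF finite_Basis, symmetric] power2_norm_eq_inner
    by (subst euclidean_inner) (simp add: sum_divide_distrib sum_negf power2_eq_square)
  then have "(\<integral>\<^sup>+y. ennreal (exp (- ((norm (y :: real^'n))\<^sup>2 / p))) \<partial>lborel)
      = (\<integral>\<^sup>+y. (\<Prod>b\<in>Basis. ennreal (exp (- (((y :: real^'n) \<bullet> b)\<^sup>2 / p)))) \<partial>lborel)"
    by (simp add: prod_ennreal)
  also have "\<dots> = (\<Prod>b\<in>(Basis :: (real^'n) set). (\<integral>\<^sup>+t. ennreal (exp (- (t\<^sup>2 / p))) \<partial>lborel))"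
    by (rule nn_integral_lborel_prod[where f="\<lambda>_ t. ennreal (exp (- (t\<^sup>2 / p)))"]) auto
  also have "\<dots> = ennreal (sqrt (pi * p) ^ CARD('n))"
    using p by (simp add: gaussian_nn_integral_1d[OF p] ennreal_power)
  also have "sqrt (pi * p) ^ CARD('n) = (pi * p) powr (real CARD('n) / 2)"
    using p by (simp add: powr_half_sqrt[symmetric] powr_power)
  finally show ?thesis .
qed

text \<open>Completing the square: the product of two Gaussians is a Gaussian around an intermediate
  point.\<close>

lemma gaussian_product:
  fixes x y :: "'a::real_inner"
  assumes "p > 0" "q > 0"
  shows "(norm y)\<^sup>2 / p + (norm (x - y))\<^sup>2 / q
       = (norm x)\<^sup>2 / (p + q) + (norm (- ((p / (p + q)) *\<^sub>R x) + y))\<^sup>2 / (p * q / (p + q))"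
proof -
  define X Y Z where "X = x \<bullet> x" and "Y = y \<bullet> y" and "Z = x \<bullet> y"
  have pq: "p + q \<noteq> 0" "p \<noteq> 0" "q \<noteq> 0" using assms by auto
  have 1: "(norm (x - y))\<^sup>2 = X - 2 * Z + Y"
    by (simp add: power2_norm_eq_inner inner_diff_left inner_diff_right inner_commute X_def Y_def Z_def)
  have "(norm (- (c *\<^sub>R x) + y))\<^sup>2 = c\<^sup>2 * X - 2 * c * Z + Y" for c
    unfolding power2_norm_eq_inner X_def Y_def Z_def
    by (simp add: inner_diff_left inner_diff_right inner_commute[of y x] power2_eq_square algebra_simps)
  note 2 = this[of "p / (p + q)"]
  have 3: "(norm y)\<^sup>2 = Y" "(norm x)\<^sup>2 = X" by (simp_all add: power2_norm_eq_inner X_def Y_def)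
  define s where "s = p + q"
  have s: "s \<noteq> 0" "q = s - p" using pq by (auto simp: s_def)
  have "Y / p + (X - 2 * Z + Y) / q = X / s + ((p / s)\<^sup>2 * X - 2 * (p / s) * Z + Y) / (p * q / s)"
  proof -
    have "((p / s)\<^sup>2 * X - 2 * (p / s) * Z + Y) / (p * q / s) = p * X / (s * q) - 2 * Z / q + Y * s / (p * q)"
      using pq(2,3) s(1) by (simp add: field_simps power2_eq_square)
    moreover have "X / s + p * X / (s * q) = X / q"
    proof -
      have "X / s + p * X / (s * q) = X * (p + q) / (s * q)"
        using pq(2,3) s(1) by (simp add: field_simps)
      then show ?thesis using s(1) by (simp add: s_def)
    qed
    moreover have "Y * s / (p * q) = Y / p + Y / q"
      using pq by (simp add: field_simps s_def)
    ultimately show ?thesis by (simp add: add_divide_distrib diff_divide_distrib)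
  qed
  then show ?thesis unfolding 1 2 3 s_def .
qed

lemma has_integral_gaussian_product:
  fixes x :: "real^'n"
  assumes p: "p > 0" and q: "q > 0"
  shows "has_bochner_integral lborel (\<lambda>y. exp (- ((norm y)\<^sup>2 / p)) * exp (- ((norm (x - y))\<^sup>2 / q)))
    ((pi * (p * q / (p + q))) powr (real CARD('n) / 2) * exp (- ((norm x)\<^sup>2 / (p + q))))"
proof (rule has_bochner_integral_nn_integral)
  define P c where "P = p * q / (p + q)" and "c = (p / (p + q)) *\<^sub>R x"
  have P: "P > 0" using p q by (simp add: P_def)
  have e: "exp (- ((norm y)\<^sup>2 / p)) * exp (- ((norm (x - y))\<^sup>2 / q))
      = exp (- ((norm x)\<^sup>2 / (p + q))) * exp (- ((norm (- c + y))\<^sup>2 / P))" for y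
    using gaussian_product[OF p q, of y x] by (simp add: P_def c_def flip: exp_add)
  have "(\<integral>\<^sup>+y. ennreal (exp (- ((norm y)\<^sup>2 / p)) * exp (- ((norm (x - y))\<^sup>2 / q))) \<partial>lborel)
      = ennreal (exp (- ((norm x)\<^sup>2 / (p + q)))) * (\<integral>\<^sup>+y. ennreal (exp (- ((norm (- c + y))\<^sup>2 / P))) \<partial>lborel)"
    unfolding e by (simp add: ennreal_mult nn_integral_cmult)
  also have "(\<integral>\<^sup>+y. ennreal (exp (- ((norm (- c + y))\<^sup>2 / P))) \<partial>lborel) = (\<integral>\<^sup>+y. ennreal (exp (- ((norm (y :: real^'n))\<^sup>2 / P))) \<partial>lborel)"
    by (rule nn_integral_translate) measurable
  also have "\<dots> = ennreal ((pi * P) powr (real CARD('n) / 2))"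
    by (rule gaussian_nn_integral[OF P])
  finally show "(\<integral>\<^sup>+y. ennreal (exp (- ((norm y)\<^sup>2 / p)) * exp (- ((norm (x - y))\<^sup>2 / q))) \<partial>lborel)
      = ennreal ((pi * (p * q / (p + q))) powr (real CARD('n) / 2) * exp (- ((norm x)\<^sup>2 / (p + q))))"
    by (simp add: P_def ennreal_mult mult.commute)
qed auto

lemma has_integral_gaussian:
  assumes p: "p > 0"
  shows "has_bochner_integral lborel (\<lambda>y :: real^'n. exp (- ((norm y)\<^sup>2 / p))) ((pi * p) powr (real CARD('n) / 2))"
  by (rule has_bochner_integral_nn_integral) (auto simp: gaussian_nn_integral[OF p])

section \<open>Convolution of two smoothed powers\<close>

text \<open>The weight with which the Gaussian of time \<open>q\<close> enters the smoothed profile.\<close>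

definition tail_power :: "complex \<Rightarrow> real \<Rightarrow> complex" where
  "tail_power s q = indicator {1..} q *\<^sub>R of_real q powr (- s - 1)"

lemma tail_power_measurable [measurable]: "tail_power s \<in> borel_measurable borel"
  unfolding tail_power_def
  by (intro borel_measurable_continuous_on_indicator) (auto intro!: continuous_intros)

lemma norm_tail_power: "norm (tail_power s q) = indicator {1..} q *\<^sub>R q powr (- Re s - 1)"
  by (auto simp: tail_power_def indicator_def norm_of_real_powr)

lemma tail_power_integrable: "Re s > 0 \<Longrightarrow> integrable lborel (tail_power s)"
  by (rule Bochner_Integration.integrable_bound[OF powr_integrable_atLeast_1(1)[of "Re s"]])
    (auto simp: norm_tail_power)

lemma heat_tail_power: "indicator {1..} q *\<^sub>R heat_integrand s r q = tail_power s q * of_real (exp (- (r / q)))"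
  by (simp add: tail_power_def heat_integrand_def)

lemma smooth_profile_tail_power: "smooth_profile s r = (\<integral>q. tail_power s q * of_real (exp (- (r / q))) \<partial>lborel)"
  unfolding smooth_profile_def heat_tail_power ..

lemma smooth_profile_0:
  assumes s: "Re s > 0"
  shows "smooth_profile s 0 = 1 / s"
proof -
  let ?f = "\<lambda>p. complex_of_real p powr (- s - 1)"
  let ?F = "\<lambda>p. - (complex_of_real p powr (- s)) / s"
  have s0: "s \<noteq> 0" using s by auto
  have h: "heat_integrand s 0 = ?f" by (simp add: heat_integrand_def fun_eq_iff)
  have i: "set_integrable lborel {1..} ?f"
    using profile_bounded(1)[OF s order_refl] unfolding set_integrable_def h .
  have "((\<lambda>b. LINT p:{1..b}|lborel. ?f p) \<longlongrightarrow> (LINT p:{1..}|lborel. ?f p)) at_top"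
    by (rule tendsto_set_lebesgue_integral_at_top[OF _ i]) simp
  then have lim: "((\<lambda>b. LINT p:{1..b}|lborel. ?f p) \<longlongrightarrow> smooth_profile s 0) at_top"
    by (simp only: smooth_profile_def set_lebesgue_integral_def h)
  have ftc: "(LINT p:{1..b}|lborel. ?f p) = ?F b + 1 / s" if b: "b \<ge> 1" for b
  proof -
    have "(\<integral>p. indicator {1..b} p *\<^sub>R ?f p \<partial>lborel) = ?F b - ?F 1"
    proof (rule integral_FTC_Icc[OF b])
      fix p assume p: "1 \<le> p" "p \<le> b"
      have "((\<lambda>z. - (z powr (- s)) / s) has_field_derivative ?f p) (at (complex_of_real p))"
        using p s0 by (auto intro!: derivative_eq_intros simp: complex_nonpos_Reals_iff)
      then show "(?F has_vector_derivative ?f p) (at p within {1..b})"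
        by (rule has_vector_derivative_real_field)
    next
      show "continuous_on {1..b} ?f" by (auto intro!: continuous_intros)
    qed
    then show ?thesis by (simp add: set_lebesgue_integral_def)
  qed
  have "((\<lambda>b. b powr (- Re s)) \<longlongrightarrow> 0) at_top"
    using s by (intro tendsto_neg_powr filterlim_ident) simp
  then have "(?F \<longlongrightarrow> 0) at_top"
  proof (rule Lim_null_comparison[OF _ tendsto_mult_left_zero[of _ _ "1 / norm s"], rotated])
    show "\<forall>\<^sub>F b in at_top. norm (?F b) \<le> b powr (- Re s) * (1 / norm s)"
      by (rule eventually_mono[OF eventually_gt_at_top[of 0]])
        (simp add: norm_divide norm_of_real_powr)
  qed
  then have "((\<lambda>b. ?F b + 1 / s) \<longlongrightarrow> 0 + 1 / s) at_top"
    by (intro tendsto_add tendsto_const)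
  then have "((\<lambda>b. LINT p:{1..b}|lborel. ?f p) \<longlongrightarrow> 0 + 1 / s) at_top"
    by (rule Lim_transform_eventually)
      (rule eventually_mono[OF eventually_ge_at_top[of 1]], simp only: ftc)
  then show ?thesis using lim tendsto_unique[OF trivial_limit_at_top_linorder] by fastforce
qed

text \<open>Integrating a function against the smoothed profile superposes its integrals against Gaussians.\<close>

lemma profile_fubini:
  fixes u :: "real^'n \<Rightarrow> complex"
  assumes u[measurable]: "u \<in> borel_measurable borel"
    and i: "\<And>q. q \<ge> 1 \<Longrightarrow> integrable lborel (\<lambda>y. u y * of_real (exp (- ((norm (x - y))\<^sup>2 / q))))"
    and b: "\<And>q. q \<ge> 1 \<Longrightarrow> norm (tail_power s q) * (\<integral>y. norm (u y * of_real (exp (- ((norm (x - y))\<^sup>2 / q)))) \<partial>lborel) \<le> B q"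
    and B: "integrable lborel (\<lambda>q. indicator {1..} q *\<^sub>R B q :: real)"
  shows "(\<integral>y. u y * smooth_profile s ((norm (x - y))\<^sup>2) \<partial>lborel)
       = (\<integral>q. tail_power s q * (\<integral>y. u y * of_real (exp (- ((norm (x - y))\<^sup>2 / q))) \<partial>lborel) \<partial>lborel)"
proof -
  let ?k = "\<lambda>q y. u y * of_real (exp (- ((norm (x - y))\<^sup>2 / q)))"
  have I: "integrable (lborel \<Otimes>\<^sub>M lborel) (\<lambda>(q, y). tail_power s q * ?k q y)"
  proof (rule lborel_pair.Fubini_integrable)
    show "(\<lambda>(q, y). tail_power s q * ?k q y) \<in> borel_measurable (lborel \<Otimes>\<^sub>M lborel)" by measurable
    show "AE q in lborel. integrable lborel (\<lambda>y. case (q, y) of (q, y) \<Rightarrow> tail_power s q * ?k q y)"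
    proof (rule AE_I2)
      fix q
      show "integrable lborel (\<lambda>y. case (q, y) of (q, y) \<Rightarrow> tail_power s q * ?k q y)"
        using i[of q] by (cases "q \<ge> 1") (auto simp: tail_power_def)
    qed
    show "integrable lborel (\<lambda>q. \<integral>y. norm (case (q, y) of (q, y) \<Rightarrow> tail_power s q * ?k q y) \<partial>lborel)"
    proof (rule Bochner_Integration.integrable_bound[OF B])
      show "(\<lambda>q. \<integral>y. norm (case (q, y) of (q, y) \<Rightarrow> tail_power s q * ?k q y) \<partial>lborel) \<in> borel_measurable lborel"
        by measurable
      show "AE q in lborel. norm (\<integral>y. norm (case (q, y) of (q, y) \<Rightarrow> tail_power s q * ?k q y) \<partial>lborel)
          \<le> norm (indicator {1..} q *\<^sub>R B q)"
      proof (rule AE_I2)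
        fix q :: real
        have e: "(\<integral>y. norm (case (q, y) of (q, y) \<Rightarrow> tail_power s q * ?k q y) \<partial>lborel)
            = norm (tail_power s q) * (\<integral>y. norm (?k q y) \<partial>lborel)"
          unfolding integral_mult_right_zero[symmetric] by (simp add: norm_mult)
        have "0 \<le> norm (tail_power s q) * (\<integral>y. norm (?k q y) \<partial>lborel)" by simp
        then show "norm (\<integral>y. norm (case (q, y) of (q, y) \<Rightarrow> tail_power s q * ?k q y) \<partial>lborel)
          \<le> norm (indicator {1..} q *\<^sub>R B q)"
          unfolding e using b[of q] by (cases "q \<ge> 1") (simp_all add: tail_power_def)
      qed
    qed
  qed
  have "(\<integral>y. u y * smooth_profile s ((norm (x - y))\<^sup>2) \<partial>lborel) = (\<integral>y. \<integral>q. tail_power s q * ?k q y \<partial>lborel \<partial>lborel)"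
    unfolding smooth_profile_tail_power integral_mult_right_zero[symmetric]
    by (simp add: mult_ac)
  also have "\<dots> = (\<integral>q. \<integral>y. tail_power s q * ?k q y \<partial>lborel \<partial>lborel)"
    by (rule lborel_pair.Fubini_integral[OF I])
  also have "\<dots> = (\<integral>q. tail_power s q * (\<integral>y. ?k q y \<partial>lborel) \<partial>lborel)"
    by (simp only: integral_mult_right_zero)
  finally show ?thesis .
qed

lemma tail_power_gaussian_bound:
  assumes d: "Re s > e"
  shows "integrable lborel (\<lambda>q. indicator {1..} q *\<^sub>R (c * q powr (- (Re s - e) - 1)) :: real)"
proof -
  have "integrable lborel (\<lambda>q. c * (indicator {1..} q *\<^sub>R q powr (- (Re s - e) - 1)))"
    using d by (intro integrable_mult_right powr_integrable_atLeast_1) simp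
  then show ?thesis by (simp add: mult_ac)
qed

text \<open>The integral of the Gaussian of time \<open>q\<close> contributes \<open>q powr (d / 2)\<close>, which lowers the exponent; what
  remains is the profile at the origin.\<close>

lemma smooth_profile_integral:
  assumes s: "Re s > real CARD('n) / 2"
  shows "(\<integral>y. smooth_profile s ((norm (y :: real^'n))\<^sup>2) \<partial>lborel)
       = of_real (pi powr (real CARD('n) / 2)) / (s - of_real (real CARD('n) / 2))"
proof -
  let ?d = "real CARD('n) / 2"
  have g: "(\<integral>y. complex_of_real (exp (- ((norm (0 - y :: real^'n))\<^sup>2 / q))) \<partial>lborel) = of_real ((pi * q) powr ?d)"
    "integrable lborel (\<lambda>y. complex_of_real (exp (- ((norm (0 - y :: real^'n))\<^sup>2 / q))))"
    "(\<integral>y. (exp (- ((norm (0 - y :: real^'n))\<^sup>2 / q))) \<partial>lborel) = (pi * q) powr ?d" if "q \<ge> 1" for q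
    using has_integral_gaussian[where 'n='n, of q] that
    by (auto simp: has_bochner_integral_iff simp del: of_real_exp)
  have "(\<integral>y. 1 * smooth_profile s ((norm (0 - y :: real^'n))\<^sup>2) \<partial>lborel)
      = (\<integral>q. tail_power s q * (\<integral>y. 1 * of_real (exp (- ((norm (0 - y :: real^'n))\<^sup>2 / q))) \<partial>lborel) \<partial>lborel)"
  proof (rule profile_fubini[where B="\<lambda>q. pi powr ?d * q powr (- (Re s - ?d) - 1)"])
    fix q :: real assume q: "q \<ge> 1"
    show "integrable lborel (\<lambda>y. 1 * complex_of_real (exp (- ((norm (0 - y :: real^'n))\<^sup>2 / q))))" using g(2)[OF q] by simp
    have "norm (tail_power s q) * (\<integral>y. norm (1 * complex_of_real (exp (- ((norm (0 - y :: real^'n))\<^sup>2 / q)))) \<partial>lborel)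
        = q powr (- Re s - 1) * (pi * q) powr ?d"
      using q g(3)[OF q] by (simp add: norm_tail_power)
    also have "\<dots> = pi powr ?d * (q powr (- Re s - 1) * q powr ?d)" using q by (simp add: powr_mult)
    also have "\<dots> = pi powr ?d * q powr (- (Re s - ?d) - 1)"
      by (simp flip: powr_add add: algebra_simps)
    finally show "norm (tail_power s q) * (\<integral>y. norm (1 * complex_of_real (exp (- ((norm (0 - y :: real^'n))\<^sup>2 / q)))) \<partial>lborel)
        \<le> pi powr ?d * q powr (- (Re s - ?d) - 1)" by simp
  qed (use tail_power_gaussian_bound[OF s] in auto)
  then have "(\<integral>y. smooth_profile s ((norm (y :: real^'n))\<^sup>2) \<partial>lborel)
      = (\<integral>q. tail_power s q * (\<integral>y. complex_of_real (exp (- ((norm (0 - y :: real^'n))\<^sup>2 / q))) \<partial>lborel) \<partial>lborel)"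
    by simp
  also have "\<dots> = (\<integral>q. of_real (pi powr ?d) * (indicator {1..} q *\<^sub>R heat_integrand (s - of_real ?d) 0 q) \<partial>lborel)"
  proof (rule Bochner_Integration.integral_cong[OF refl])
    fix q :: real
    show "tail_power s q * (\<integral>y. complex_of_real (exp (- ((norm (0 - y :: real^'n))\<^sup>2 / q))) \<partial>lborel)
        = of_real (pi powr ?d) * (indicator {1..} q *\<^sub>R heat_integrand (s - of_real ?d) 0 q)"
    proof (cases "q \<ge> 1")
      case True
      have "complex_of_real q powr (- s - 1) * of_real (q powr ?d) = of_real q powr (- (s - of_real ?d) - 1)"
        using True powr_of_real[of q ?d] of_real_powr_add[of q "- s - 1" "of_real ?d"]
        by (simp add: algebra_simps)
      then show ?thesis
        using True unfolding g(1)[OF True] by (simp add: tail_power_def heat_integrand_def powr_mult mult_ac)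
    qed (simp add: tail_power_def)
  qed
  also have "\<dots> = of_real (pi powr ?d) * smooth_profile (s - of_real ?d) 0"
    by (simp only: integral_mult_right_zero smooth_profile_def)
  also have "smooth_profile (s - of_real ?d) 0 = 1 / (s - of_real ?d)"
    by (rule smooth_profile_0) (use s in simp)
  finally show ?thesis by simp
qed

lemma tail_power_shift:
  "tail_power s q * of_real (q powr e) = tail_power (s - of_real e) q"
proof (cases "q \<ge> 1")
  case True
  have "complex_of_real q powr (- s - 1) * of_real (q powr e) = of_real q powr (- (s - of_real e) - 1)"
    using True powr_of_real[of q e] of_real_powr_add[of q "- s - 1" "of_real e"]
    by (simp add: algebra_simps)
  then show ?thesis using True by (simp add: tail_power_def)
qed (simp add: tail_power_def)

text \<open>The Gaussian of total time \<open>P\<close>, normalized; \<open>P \<ge> 2\<close> since both summands of \<open>P\<close> are at least 1.\<close>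

definition heat_cutoff :: "real \<Rightarrow> real \<Rightarrow> real \<Rightarrow> complex" where
  "heat_cutoff e r P = of_real (indicator {2..} P * (P powr (- e) * exp (- (r / P))))"

lemma heat_cutoff_measurable [measurable]: "heat_cutoff e r \<in> borel_measurable borel"
  unfolding heat_cutoff_def by measurable

lemma heat_cutoff_le_1: "e \<ge> 0 \<Longrightarrow> r \<ge> 0 \<Longrightarrow> norm (heat_cutoff e r P) \<le> 1"
proof (cases "P \<ge> 2")
  case True
  assume "e \<ge> 0" "r \<ge> 0"
  then have "P powr (- e) \<le> 1" "exp (- (r / P)) \<le> 1"
    using True powr_mono[of "- e" 0 P] by auto
  then have "P powr (- e) * exp (- (r / P)) \<le> 1" by (intro mult_le_one) auto
  then show ?thesis unfolding heat_cutoff_def norm_of_real using True by (simp add: abs_mult)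
qed (simp add: heat_cutoff_def)

lemma heat_cutoff_powr:
  "heat_cutoff e r P * of_real P powr (c - 1) = indicator {2..} P *\<^sub>R heat_integrand (of_real e - c) r P"
proof (cases "P \<ge> 2")
  case True
  have "complex_of_real (P powr (- e)) * of_real P powr (c - 1) = of_real P powr (- (of_real e - c) - 1)"
    using True powr_of_real[of P "- e"] of_real_powr_add[of P "- of_real e" "c - 1"]
    by (simp add: algebra_simps)
  then show ?thesis using True by (simp add: heat_cutoff_def heat_integrand_def mult_ac)
qed (simp add: heat_cutoff_def)

text \<open>The convolution of two superpositions of heat kernels is again one: times add up, and the
  density of the total time is a truncated Beta integral.\<close>

lemma profile_convolution:
  fixes x :: "real^'n"
  assumes \<alpha>: "Re \<alpha> > real CARD('n) / 2" and \<beta>: "Re \<beta> > real CARD('n) / 2"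
  defines "\<delta> \<equiv> real CARD('n) / 2"
  shows "(\<integral>y. smooth_profile \<alpha> ((norm y)\<^sup>2) * smooth_profile \<beta> ((norm (x - y))\<^sup>2) \<partial>lborel)
    = of_real (pi powr \<delta>) * (\<integral>P. heat_cutoff \<delta> ((norm x)\<^sup>2) P * truncated_beta (of_real \<delta> - \<alpha>) (of_real \<delta> - \<beta>) P \<partial>lborel)"
    and "integrable lborel (\<lambda>P. heat_cutoff \<delta> ((norm x)\<^sup>2) P * truncated_beta (of_real \<delta> - \<alpha>) (of_real \<delta> - \<beta>) P)"
proof -
  have \<delta>: "\<delta> \<ge> 0" by (simp add: \<delta>_def)
  have pos: "Re \<alpha> > 0" "Re \<beta> > 0" using \<alpha> \<beta> \<delta> by (auto simp: \<delta>_def)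
  let ?v = "\<lambda>y::real^'n. smooth_profile \<beta> ((norm (x - y))\<^sup>2)"
  let ?g = "\<lambda>p y::real^'n. complex_of_real (exp (- ((norm y)\<^sup>2 / p)))"
  have cont: "continuous_on {0..} (smooth_profile \<beta>)"
    using profile_has_vector_derivative[OF pos(2)]
    by (auto simp: continuous_on_eq_continuous_within intro: has_vector_derivative_continuous)
  have "continuous_on UNIV ?v"
    by (rule continuous_on_compose2[OF cont]) (auto intro!: continuous_intros)
  then have vm[measurable]: "?v \<in> borel_measurable borel" by (rule borel_measurable_continuous_onI)
  have gi: "integrable lborel (?g p)" "(\<integral>y. norm (?g p y) \<partial>lborel) = (pi * p) powr \<delta>" if "p \<ge> 1" for p
    using has_integral_gaussian[where 'n='n, of p] that
    by (auto simp: has_bochner_integral_iff \<delta>_def simp del: of_real_exp)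
  have vb: "norm (?v y * ?g p y) \<le> 1 / Re \<beta> * norm (?g p y)" for p y
    unfolding norm_mult using profile_bounded(2)[OF pos(2), of "(norm (x - y))\<^sup>2"] by (intro mult_right_mono) auto
  have vi: "integrable lborel (\<lambda>y. ?v y * ?g p y)" if "p \<ge> 1" for p
  proof (rule Bochner_Integration.integrable_bound)
    show "integrable lborel (\<lambda>y. 1 / Re \<beta> * norm (?g p y))"
      by (rule integrable_mult_right[OF integrable_norm[OF gi(1)[OF that]]])
    show "AE y in lborel. norm (?v y * ?g p y) \<le> norm (1 / Re \<beta> * norm (?g p y))"
      using order_trans[OF vb abs_ge_self] by (intro AE_I2) (simp only: real_norm_def)
  qed measurable
  have "(\<integral>y. ?v y * smooth_profile \<alpha> ((norm (0 - y))\<^sup>2) \<partial>lborel)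
      = (\<integral>p. tail_power \<alpha> p * (\<integral>y. ?v y * of_real (exp (- ((norm (0 - y))\<^sup>2 / p))) \<partial>lborel) \<partial>lborel)"
  proof (rule profile_fubini[OF vm, where B="\<lambda>p. (1 / Re \<beta> * pi powr \<delta>) * p powr (- (Re \<alpha> - \<delta>) - 1)"])
    fix p :: real assume p: "p \<ge> 1"
    show "integrable lborel (\<lambda>y. ?v y * of_real (exp (- ((norm (0 - y))\<^sup>2 / p))))" using vi[OF p] by simp
    have "(\<integral>y. norm (?v y * ?g p y) \<partial>lborel) \<le> (\<integral>y. 1 / Re \<beta> * norm (?g p y) \<partial>lborel)"
      by (intro integral_mono integrable_norm vi[OF p] integrable_mult_right gi(1)[OF p] vb)
    also have "\<dots> = 1 / Re \<beta> * (pi * p) powr \<delta>" by (simp only: integral_mult_right_zero gi(2)[OF p])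
    finally have le: "(\<integral>y. norm (?v y * ?g p y) \<partial>lborel) \<le> 1 / Re \<beta> * (pi * p) powr \<delta>" .
    have "norm (tail_power \<alpha> p) = p powr (- Re \<alpha> - 1)" using p by (simp add: norm_tail_power)
    then have "norm (tail_power \<alpha> p) * (\<integral>y. norm (?v y * ?g p y) \<partial>lborel)
        \<le> p powr (- Re \<alpha> - 1) * (1 / Re \<beta> * (pi * p) powr \<delta>)"
      using mult_left_mono[OF le, of "p powr (- Re \<alpha> - 1)"] by (simp only:) simp
    also have "\<dots> = (1 / Re \<beta> * pi powr \<delta>) * (p powr (- Re \<alpha> - 1) * p powr \<delta>)"
      by (simp add: powr_mult)
    also have "p powr (- Re \<alpha> - 1) * p powr \<delta> = p powr (- (Re \<alpha> - \<delta>) - 1)"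
      by (simp flip: powr_add add: algebra_simps)
    finally show "norm (tail_power \<alpha> p) * (\<integral>y. norm (?v y * of_real (exp (- ((norm (0 - y))\<^sup>2 / p)))) \<partial>lborel)
        \<le> (1 / Re \<beta> * pi powr \<delta>) * p powr (- (Re \<alpha> - \<delta>) - 1)" by simp
  qed (use tail_power_gaussian_bound[of \<delta> \<alpha>] \<alpha> in \<open>simp add: \<delta>_def\<close>)
  then have 1: "(\<integral>y. smooth_profile \<alpha> ((norm y)\<^sup>2) * ?v y \<partial>lborel)
      = (\<integral>p. tail_power \<alpha> p * (\<integral>y. ?g p y * ?v y \<partial>lborel) \<partial>lborel)"
    by (simp add: mult.commute)
  let ?E = "\<lambda>p q. (pi * (p * q / (p + q))) powr \<delta> * exp (- ((norm x)\<^sup>2 / (p + q)))"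
  have hb: "has_bochner_integral lborel (\<lambda>y. ?g p y * of_real (exp (- ((norm (x - y))\<^sup>2 / q)))) (of_real (?E p q))"
    if "p \<ge> 1" "q \<ge> 1" for p q
    using has_bochner_integral_of_real[OF has_integral_gaussian_product[of p q x]] that
    by (simp add: \<delta>_def del: of_real_exp)
  have 2: "(\<integral>y. ?g p y * ?v y \<partial>lborel) = (\<integral>q. tail_power \<beta> q * of_real (?E p q) \<partial>lborel)" if p: "p \<ge> 1" for p
  proof -
    have gm: "?g p \<in> borel_measurable borel" by measurable
    have "(\<integral>y. ?g p y * ?v y \<partial>lborel)
        = (\<integral>q. tail_power \<beta> q * (\<integral>y. ?g p y * of_real (exp (- ((norm (x - y))\<^sup>2 / q))) \<partial>lborel) \<partial>lborel)"
    proof (rule profile_fubini[OF gm, where B="\<lambda>q. (pi * p) powr \<delta> * q powr (- (Re \<beta> - 0) - 1)"])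
      fix q :: real assume q: "q \<ge> 1"
      show i: "integrable lborel (\<lambda>y. ?g p y * of_real (exp (- ((norm (x - y))\<^sup>2 / q))))"
        using hb[OF p q] by (simp add: has_bochner_integral_iff)
      have "(\<integral>y. norm (?g p y * of_real (exp (- ((norm (x - y))\<^sup>2 / q)))) \<partial>lborel) \<le> (\<integral>y. norm (?g p y) \<partial>lborel)"
        using q by (intro integral_mono integrable_norm i gi(1)[OF p]) (auto simp: norm_mult simp del: of_real_exp)
      also have "\<dots> = (pi * p) powr \<delta>" by (rule gi(2)[OF p])
      finally show "norm (tail_power \<beta> q) * (\<integral>y. norm (?g p y * of_real (exp (- ((norm (x - y))\<^sup>2 / q)))) \<partial>lborel)
          \<le> (pi * p) powr \<delta> * q powr (- (Re \<beta> - 0) - 1)"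
        using q by (simp add: norm_tail_power mult.commute mult_left_mono)
    qed (use tail_power_gaussian_bound[of 0 \<beta>] pos in simp)
    also have "\<dots> = (\<integral>q. tail_power \<beta> q * of_real (?E p q) \<partial>lborel)"
    proof (rule Bochner_Integration.integral_cong[OF refl])
      fix q
      show "tail_power \<beta> q * (\<integral>y. ?g p y * of_real (exp (- ((norm (x - y))\<^sup>2 / q))) \<partial>lborel)
          = tail_power \<beta> q * of_real (?E p q)"
        using hb[OF p, of q] by (cases "q \<ge> 1") (auto simp: has_bochner_integral_iff tail_power_def)
    qed
    finally show ?thesis .
  qed
  let ?f = "tail_power (\<alpha> - of_real \<delta>)" and ?k = "tail_power (\<beta> - of_real \<delta>)"
  let ?h = "heat_cutoff \<delta> ((norm x)\<^sup>2)"
  have 3: "tail_power \<alpha> p * (tail_power \<beta> q * of_real (?E p q)) = of_real (pi powr \<delta>) * (?f p * ?k q * ?h (p + q))" for p q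
  proof (cases "p \<ge> 1 \<and> q \<ge> 1")
    case True
    have "?E p q = pi powr \<delta> * (p powr \<delta> * q powr \<delta> * ((p + q) powr (- \<delta>) * exp (- ((norm x)\<^sup>2 / (p + q)))))"
      using True by (simp add: powr_mult powr_divide powr_minus field_simps)
    also have "\<dots> = pi powr \<delta> * (p powr \<delta> * q powr \<delta> * (indicator {2..} (p + q) * ((p + q) powr (- \<delta>) * exp (- ((norm x)\<^sup>2 / (p + q))))))"
      using True by simp
    finally have "complex_of_real (?E p q) = of_real (pi powr \<delta>) * (of_real (p powr \<delta>) * of_real (q powr \<delta>) * ?h (p + q))"
      unfolding heat_cutoff_def by (simp only: of_real_mult)
    then show ?thesis
      unfolding tail_power_shift[symmetric] by (simp add: mult_ac)
  next
    case False
    then show ?thesis by (auto simp: tail_power_def)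
  qed
  have "(\<integral>p. tail_power \<alpha> p * (\<integral>y. ?g p y * ?v y \<partial>lborel) \<partial>lborel)
      = (\<integral>p. of_real (pi powr \<delta>) * (\<integral>q. ?f p * ?k q * ?h (p + q) \<partial>lborel) \<partial>lborel)"
  proof (rule Bochner_Integration.integral_cong[OF refl])
    fix p
    show "tail_power \<alpha> p * (\<integral>y. ?g p y * ?v y \<partial>lborel) = of_real (pi powr \<delta>) * (\<integral>q. ?f p * ?k q * ?h (p + q) \<partial>lborel)"
    proof (cases "p \<ge> 1")
      case True
      show ?thesis unfolding 2[OF True] integral_mult_right_zero[symmetric] 3 ..
    qed (simp add: tail_power_def)
  qed
  also have "\<dots> = of_real (pi powr \<delta>) * (\<integral>p. \<integral>q. ?f p * ?k q * ?h (p + q) \<partial>lborel \<partial>lborel)"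
    by (rule integral_mult_right_zero)
  finally have 4: "(\<integral>y. smooth_profile \<alpha> ((norm y)\<^sup>2) * ?v y \<partial>lborel)
      = of_real (pi powr \<delta>) * (\<integral>p. \<integral>q. ?f p * ?k q * ?h (p + q) \<partial>lborel \<partial>lborel)"
    unfolding 1 .
  have fi: "integrable lborel ?f" "integrable lborel ?k"
    by (rule tail_power_integrable; use \<alpha> \<beta> in \<open>simp add: \<delta>_def\<close>)+
  have hB: "norm (?h P) \<le> 1" for P using \<delta> by (intro heat_cutoff_le_1) auto
  \<comment> \<open>the restrictions \<open>p \<ge> 1\<close> and \<open>P - p \<ge> 1\<close> become the truncation\<close>
  have tb: "(\<integral>p. ?f p * ?k (P - p) \<partial>lborel) = truncated_beta (of_real \<delta> - \<alpha>) (of_real \<delta> - \<beta>) P" for P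
    unfolding truncated_beta_def
    by (intro Bochner_Integration.integral_cong refl)
      (auto simp: tail_power_def beta_integrand_def indicator_def)
  show "(\<integral>y. smooth_profile \<alpha> ((norm y)\<^sup>2) * ?v y \<partial>lborel)
    = of_real (pi powr \<delta>) * (\<integral>P. ?h P * truncated_beta (of_real \<delta> - \<alpha>) (of_real \<delta> - \<beta>) P \<partial>lborel)"
    unfolding 4 integral_product_sum_substitution(1)[OF fi heat_cutoff_measurable hB] tb ..
  show "integrable lborel (\<lambda>P. ?h P * truncated_beta (of_real \<delta> - \<alpha>) (of_real \<delta> - \<beta>) P)"
    using integral_product_sum_substitution(2)[OF fi heat_cutoff_measurable hB] unfolding tb .
qed

text \<open>Each of the three leading powers of \<open>P\<close> integrates to a Gamma value times a power of \<open>r\<close>, up to the truncation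
  at \<open>P = 2\<close>; the error of the density, smaller by one power of \<open>P\<close>, becomes smaller by one power of \<open>r\<close>.\<close>

lemma heat_cutoff_beta_asymptotics:
  fixes a b :: complex and \<delta> :: real
  assumes a: "a \<notin> \<int>\<^sub>\<le>\<^sub>0" "Re a < 0" and b: "b \<notin> \<int>\<^sub>\<le>\<^sub>0" "Re b < 0" and \<delta>: "\<delta> > 0"
    and i: "\<And>r. r \<ge> 0 \<Longrightarrow> integrable lborel (\<lambda>P. heat_cutoff \<delta> r P * truncated_beta a b P)"
  obtains K where "K \<ge> 0" "\<And>r. r > 0 \<Longrightarrow>
      norm ((\<integral>P. heat_cutoff \<delta> r P * truncated_beta a b P \<partial>lborel)
        - (Beta a b * (Gamma (of_real \<delta> - a - b) * of_real r powr (- (of_real \<delta> - a - b)))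
            - Gamma (of_real \<delta> - b) * of_real r powr (- (of_real \<delta> - b)) / a
            - Gamma (of_real \<delta> - a) * of_real r powr (- (of_real \<delta> - a)) / b))
      \<le> K * (r powr (- (\<delta> - Re a) - 1) + r powr (- (\<delta> - Re b) - 1) + r powr (- (\<delta> - Re a - Re b) - 1)
            + r powr (- (\<delta> - max (Re a) (Re b)) - 1))"
proof -
  define k where "k = max (Re a) (Re b)"
  obtain M where M: "\<And>P. P \<ge> 2 \<Longrightarrow> norm (truncated_beta a b P - beta_main a b P) \<le> M * P powr (k - 2)"
    using beta_asymp_nonpos_Ints[OF a(1) b(1)] by (auto simp: beta_asymp_def k_def)
  have M0: "M \<ge> 0" using order_trans[OF norm_ge_zero M[of 2]] by (simp add: zero_le_mult_iff)
  \<comment> \<open>the exponents of the heat integrals of the three leading terms; \<open>s\<close> below belongs to the error term\<close>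
  define sab sb sa where "sab = of_real \<delta> - a - b" and "sb = of_real \<delta> - b" and "sa = of_real \<delta> - a"
  define s where "s = complex_of_real (\<delta> - k + 1)"
  have Re: "Re sab > 0" "Re sb > 0" "Re sa > 0" "Re s > 0"
    using a b \<delta> by (auto simp: sab_def sb_def sa_def s_def k_def)
  define c1 c2 c3 c4 where "c1 = Gamma (Re s)" and "c2 = norm (Beta a b) * (2 * Gamma (Re sab + 1))"
    and "c3 = 2 * Gamma (Re sb + 1) / norm a" and "c4 = 2 * Gamma (Re sa + 1) / norm b"
  have G: "Gamma (Re s) > 0" "Gamma (Re sab + 1) > 0" "Gamma (Re sb + 1) > 0" "Gamma (Re sa + 1) > 0"
    using Re by (auto intro!: Gamma_real_pos)
  have c: "c1 \<ge> 0" "c2 \<ge> 0" "c3 \<ge> 0" "c4 \<ge> 0"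
    unfolding c1_def c2_def c3_def c4_def using G by (auto intro!: mult_nonneg_nonneg divide_nonneg_nonneg)
  define K where "K = M * c1 + c2 + c3 + c4"
  have K: "K \<ge> 0" using c M0 by (simp add: K_def)
  have "norm ((\<integral>P. heat_cutoff \<delta> r P * truncated_beta a b P \<partial>lborel)
        - (Beta a b * (Gamma sab * of_real r powr (- sab)) - Gamma sb * of_real r powr (- sb) / a
            - Gamma sa * of_real r powr (- sa) / b))
      \<le> K * (r powr (- (\<delta> - Re a) - 1) + r powr (- (\<delta> - Re b) - 1) + r powr (- (\<delta> - Re a - Re b) - 1)
            + r powr (- (\<delta> - k) - 1))" if r: "r > 0" for r
  proof -
    let ?h = "heat_cutoff \<delta> r" and ?H = "\<lambda>s P. indicator {2..} P *\<^sub>R heat_integrand s r P"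
    let ?I = "\<lambda>s. \<integral>P. ?H s P \<partial>lborel"
    have Hi: "integrable lborel (?H s)" if "Re s > 0" for s
      by (rule heat_integrable_subset[OF that r]) auto
    have main: "?h P * beta_main a b P = Beta a b * ?H sab P - ?H sb P / a - ?H sa P / b" for P
    proof -
      have "?h P * beta_main a b P = Beta a b * (?h P * of_real P powr ((a + b) - 1)) - (?h P * of_real P powr (b - 1)) / a
          - (?h P * of_real P powr (a - 1)) / b"
        by (simp add: beta_main_def algebra_simps)
      then show ?thesis unfolding heat_cutoff_powr by (simp add: sab_def sb_def sa_def algebra_simps)
    qed
    have mi: "integrable lborel (\<lambda>P. ?h P * beta_main a b P)"
      unfolding main using Re by (intro Bochner_Integration.integrable_diff integrable_mult_right integrable_divide Hi)
    have mI: "(\<integral>P. ?h P * beta_main a b P \<partial>lborel) = Beta a b * ?I sab - ?I sb / a - ?I sa / b"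
    proof -
      note j = integrable_mult_right[OF Hi[OF Re(1)], of "Beta a b"]
        integrable_divide[OF Hi[OF Re(2)], of a] integrable_divide[OF Hi[OF Re(3)], of b]
      show ?thesis
        unfolding main Bochner_Integration.integral_diff[OF Bochner_Integration.integrable_diff[OF j(1,2)] j(3)]
          Bochner_Integration.integral_diff[OF j(1,2)] integral_mult_right_zero integral_divide_zero ..
    qed
    have ti: "integrable lborel (\<lambda>P. ?h P * truncated_beta a b P)" using r by (intro i) simp
    have eq: "(\<integral>P. ?h P * truncated_beta a b P \<partial>lborel) - (Beta a b * ?I sab - ?I sb / a - ?I sa / b)
        = (\<integral>P. ?h P * truncated_beta a b P - ?h P * beta_main a b P \<partial>lborel)"
      unfolding mI[symmetric] by (rule Bochner_Integration.integral_diff[OF ti mi, symmetric])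
    have "norm ((\<integral>P. ?h P * truncated_beta a b P \<partial>lborel) - (Beta a b * ?I sab - ?I sb / a - ?I sa / b))
        \<le> (\<integral>P. M * (indicator {2..} P *\<^sub>R norm (heat_integrand s r P)) \<partial>lborel)"
      unfolding eq
    proof (rule Bochner_Integration.integral_norm_bound_integral)
      show "integrable lborel (\<lambda>P. ?h P * truncated_beta a b P - ?h P * beta_main a b P)"
        by (rule Bochner_Integration.integrable_diff[OF ti mi])
      show "integrable lborel (\<lambda>P. M * (indicator {2..} P *\<^sub>R norm (heat_integrand s r P)))"
        using integrable_mult_right[OF integrable_norm[OF Hi[OF Re(4)]], of M] by simp
      fix P :: real
      show "norm (?h P * truncated_beta a b P - ?h P * beta_main a b P) \<le> M * (indicator {2..} P *\<^sub>R norm (heat_integrand s r P))"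
      proof (cases "P \<ge> 2")
        case True
        have nh: "norm (?h P) = P powr (- \<delta>) * exp (- (r / P))"
          unfolding heat_cutoff_def norm_of_real using True by (simp add: abs_mult)
        have "norm (?h P * truncated_beta a b P - ?h P * beta_main a b P) \<le> norm (?h P) * (M * P powr (k - 2))"
          unfolding right_diff_distrib[symmetric] norm_mult using M[OF True] by (intro mult_left_mono) auto
        also have "\<dots> = M * ((P powr (- \<delta>) * P powr (k - 2)) * exp (- (r / P)))"
          by (simp add: nh)
        also have "P powr (- \<delta>) * P powr (k - 2) = P powr (- Re s - 1)"
          by (simp add: s_def algebra_simps flip: powr_add)
        finally show ?thesis using True by (simp add: norm_heat_integrand)
      qed (simp add: heat_cutoff_def)
    qed
    also have "\<dots> = M * (\<integral>P. indicator {2..} P *\<^sub>R norm (heat_integrand s r P) \<partial>lborel)"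
      by (rule integral_mult_right_zero)
    also have "\<dots> \<le> M * (c1 * r powr (- Re s))"
      unfolding c1_def using M0 by (intro mult_left_mono heat_integral_subset_bound Re r) auto
    finally have e1: "norm ((\<integral>P. ?h P * truncated_beta a b P \<partial>lborel) - (Beta a b * ?I sab - ?I sb / a - ?I sa / b))
        \<le> M * c1 * r powr (- Re s)" by simp
    define E where "E = (\<lambda>s. ?I s - Gamma s * of_real r powr (- s))"
    have E: "norm (E s) \<le> 2 * Gamma (Re s + 1) * r powr (- Re s - 1)" if "Re s > 0" for s
      unfolding E_def by (rule heat_truncation_error[OF that r]) simp
    have e2: "norm (Beta a b * E sab) \<le> c2 * r powr (- Re sab - 1)"
      unfolding norm_mult c2_def using mult_left_mono[OF E[OF Re(1)], of "norm (Beta a b)"] by (simp add: mult.assoc)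
    have e3: "norm (E sb / a) \<le> c3 * r powr (- Re sb - 1)"
      unfolding norm_divide c3_def using divide_right_mono[OF E[OF Re(2)], of "norm a"] by simp
    have e4: "norm (E sa / b) \<le> c4 * r powr (- Re sa - 1)"
      unfolding norm_divide c4_def using divide_right_mono[OF E[OF Re(3)], of "norm b"] by simp
    have split: "(\<integral>P. ?h P * truncated_beta a b P \<partial>lborel)
        - (Beta a b * (Gamma sab * of_real r powr (- sab)) - Gamma sb * of_real r powr (- sb) / a
            - Gamma sa * of_real r powr (- sa) / b)
        = ((\<integral>P. ?h P * truncated_beta a b P \<partial>lborel) - (Beta a b * ?I sab - ?I sb / a - ?I sa / b))
          + Beta a b * E sab - E sb / a - E sa / b"
      unfolding E_def by (simp add: algebra_simps diff_divide_distrib)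
    define R where "R = r powr (- Re sa - 1) + r powr (- Re sb - 1) + r powr (- Re sab - 1) + r powr (- Re s)"
    have R: "r powr (- Re s) \<le> R" "r powr (- Re sab - 1) \<le> R" "r powr (- Re sb - 1) \<le> R" "r powr (- Re sa - 1) \<le> R"
      by (simp_all add: R_def)
    have "norm ((\<integral>P. ?h P * truncated_beta a b P \<partial>lborel)
        - (Beta a b * (Gamma sab * of_real r powr (- sab)) - Gamma sb * of_real r powr (- sb) / a
            - Gamma sa * of_real r powr (- sa) / b))
        \<le> M * c1 * r powr (- Re s) + c2 * r powr (- Re sab - 1) + c3 * r powr (- Re sb - 1) + c4 * r powr (- Re sa - 1)"
      unfolding split
      by (intro order_trans[OF norm_triangle_ineq4] order_trans[OF norm_triangle_ineq] add_mono e1 e2 e3 e4)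
    also have "\<dots> \<le> M * c1 * R + c2 * R + c3 * R + c4 * R"
      using c M0 R by (intro add_mono mult_left_mono mult_nonneg_nonneg) auto
    also have "\<dots> = K * R" by (simp add: K_def distrib_right)
    also have "R = r powr (- (\<delta> - Re a) - 1) + r powr (- (\<delta> - Re b) - 1) + r powr (- (\<delta> - Re a - Re b) - 1)
            + r powr (- (\<delta> - k) - 1)"
      by (simp add: R_def sa_def sb_def sab_def s_def algebra_simps)
    finally show ?thesis .
  qed
  then show ?thesis using that[OF K] unfolding sab_def sb_def sa_def k_def by blast
qed

section \<open>Asymptotics of the convolution of smoothed powers\<close>

lemma power_kernel_norm_square:
  assumes "x \<noteq> 0" shows "power_kernel \<nu> x = complex_of_real ((norm x)\<^sup>2) powr (- (\<nu> / 2))"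
proof -
  have "norm x > 0" using assms by simp
  then show ?thesis
    using assms by (simp add: power_kernel_def powr_def Ln_of_real ln_realpow del: of_real_power)
qed

lemma norm_powr_le_wt:
  assumes c: "c > 0" "norm x \<ge> c" and s: "k \<ge> 0" "k \<le> s"
  shows "norm x powr (- s) \<le> (1 + 1 / c) powr s * wt k x"
proof -
  have q: "1 + 1 / c > 0" using c by (simp add: add_pos_pos)
  have n: "norm x > 0" using c by linarith
  have "1 \<le> norm x / c" using c by simp
  then have "1 + norm x \<le> (1 + 1 / c) * norm x" by (simp add: algebra_simps)
  then have "((1 + 1 / c) * norm x) powr (- s) \<le> (1 + norm x) powr (- s)"
    using s n by (intro powr_mono2') (auto intro: add_pos_nonneg)
  then have "(1 + 1 / c) powr s * ((1 + 1 / c) * norm x) powr (- s) \<le> (1 + 1 / c) powr s * wt s x"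
    unfolding wt_def by (rule mult_left_mono) simp
  also have "(1 + 1 / c) powr s * ((1 + 1 / c) * norm x) powr (- s) = norm x powr (- s)"
    using q n by (simp add: powr_mult powr_add[symmetric] flip: mult.assoc)
  also have "(1 + 1 / c) powr s * wt s x \<le> (1 + 1 / c) powr s * wt k x"
    using s by (intro mult_left_mono wt_mono_exponent) auto
  finally show ?thesis .
qed

lemma polar_exponents_iff: "\<nu> \<in> polar_exponents d \<longleftrightarrow> (of_nat d - \<nu>) / 2 \<in> \<int>\<^sub>\<le>\<^sub>0"
proof
  assume "\<nu> \<in> polar_exponents d"
  then obtain m where m: "\<nu> = of_nat d + 2 * of_nat m" unfolding polar_exponents_def by blast
  have "(of_nat d - \<nu>) / 2 = - of_nat m" unfolding m by simp
  then show "(of_nat d - \<nu>) / 2 \<in> \<int>\<^sub>\<le>\<^sub>0" by simp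
next
  assume "(of_nat d - \<nu>) / 2 \<in> \<int>\<^sub>\<le>\<^sub>0"
  then obtain m where m: "(of_nat d - \<nu>) / 2 = - of_nat m" by (rule nonpos_Ints_cases')
  have "\<nu> = of_nat d - 2 * ((of_nat d - \<nu>) / 2)" by (simp add: field_simps)
  then have "\<nu> = of_nat d + 2 * of_nat m" unfolding m by simp
  then show "\<nu> \<in> polar_exponents d" unfolding polar_exponents_def by blast
qed

text \<open>The constant of the bulk term is a Beta value. At a polar exponent the Beta function vanishes because the Gamma function
  in its denominator has a pole, which is the reason for extending the reciprocal constant by zero.\<close>

lemma c_const_product:
  fixes d :: nat and \<nu> \<mu> :: complex
  defines "a \<equiv> (of_nat d - \<nu>) / 2" and "b \<equiv> (of_nat d - \<mu>) / 2"
  shows "c_const d \<nu> * c_const d \<mu> * inv_c_const d (\<nu> + \<mu> - of_nat d)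
    = of_real (pi powr (real d / 2)) / (Gamma (\<nu> / 2) * Gamma (\<mu> / 2)) * (Beta a b * Gamma ((\<nu> + \<mu> - of_nat d) / 2))"
proof -
  let ?l = "\<nu> + \<mu> - of_nat d" and ?pi = "complex_of_real pi"
  have l: "(of_nat d - ?l) / 2 = a + b" by (simp add: a_def b_def field_simps)
  show ?thesis
  proof (cases "?l \<in> polar_exponents d")
    case True
    then have "Gamma (a + b) = 0" unfolding polar_exponents_iff l by (simp add: Gamma_eq_zero_iff)
    then show ?thesis using True by (simp add: inv_c_const_def Beta_def)
  next
    case False
    have "?pi powr (\<nu> - of_nat d / 2) * ?pi powr (\<mu> - of_nat d / 2) = ?pi powr (of_nat d / 2) * ?pi powr (?l - of_nat d / 2)"
      unfolding powr_add[symmetric] by (rule arg_cong[where f="(powr) ?pi"]) (simp add: field_simps)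
    moreover have "?pi powr (of_nat d / 2) = of_real (pi powr (real d / 2))"
      using powr_of_real[of pi "real d / 2"] by simp
    moreover have "?pi powr (?l - of_nat d / 2) \<noteq> 0" by simp
    ultimately have P: "?pi powr (\<nu> - of_nat d / 2) * ?pi powr (\<mu> - of_nat d / 2) / ?pi powr (?l - of_nat d / 2)
        = of_real (pi powr (real d / 2))" by simp
    have "c_const d \<nu> * c_const d \<mu> * inv_c_const d ?l
        = (?pi powr (\<nu> - of_nat d / 2) * ?pi powr (\<mu> - of_nat d / 2) / ?pi powr (?l - of_nat d / 2))
          / (Gamma (\<nu> / 2) * Gamma (\<mu> / 2)) * ((Gamma a * Gamma b / Gamma (a + b)) * Gamma (?l / 2))"
    proof -
      have frac: "(u * y / g) * (v * z / h) * (1 / (w * S / G)) = (u * v / w) / (g * h) * ((y * z / S) * G)"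
        for u v w y z g h S G :: complex by (simp add: mult_ac)
      show ?thesis
        using False unfolding inv_c_const_def c_const_def l a_def[symmetric] b_def[symmetric] by (simp only: if_False frac)
    qed
    then show ?thesis unfolding P Beta_def .
  qed
qed

lemma smooth_kernel_integral:
  assumes "Re \<nu> > real CARD('n)"
  shows "(\<integral>y. smooth_kernel \<nu> (y :: real^'n) \<partial>lborel)
    = - of_real (pi powr (real CARD('n) / 2)) / (Gamma (\<nu> / 2) * ((of_nat CARD('n) - \<nu>) / 2))"
proof -
  have "(\<integral>y. smooth_kernel \<nu> (y :: real^'n) \<partial>lborel)
      = (of_real (pi powr (real CARD('n) / 2)) / (\<nu> / 2 - of_real (real CARD('n) / 2))) / Gamma (\<nu> / 2)"
    unfolding smooth_kernel_def integral_divide_zero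
    using smooth_profile_integral[of "\<nu> / 2", where 'n='n] assms by simp
  also have "\<nu> / 2 - of_real (real CARD('n) / 2) = - ((of_nat CARD('n) - \<nu>) / 2)"
    by (simp add: field_simps)
  moreover have "z / (- t) / g = - z / (g * t)" for z t g :: complex by (simp add: mult.commute)
  ultimately show ?thesis by (simp only:)
qed

text \<open>With \<open>a = (d - \<nu>) / 2\<close> and \<open>b = (d - \<mu>) / 2\<close>, the term of the complete Beta function gives the bulk and the terms
  of the two ends are the masses of the smoothed kernels. Nonpolarity says that neither \<open>a\<close> nor \<open>b\<close> is a
  nonpositive integer. The bound \<open>c\<close> away from the origin turns pure powers into weights.\<close>

lemma smooth_kernel_convolution:
  fixes \<nu> \<mu> :: complex
  assumes \<nu>: "Re \<nu> > real CARD('n)" "\<nu> \<notin> polar_exponents CARD('n)"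
    and \<mu>: "Re \<mu> > real CARD('n)" "\<mu> \<notin> polar_exponents CARD('n)" and c: "c > 0"
  defines "R \<equiv> c_const CARD('n) \<nu> * c_const CARD('n) \<mu> * inv_c_const CARD('n) (\<nu> + \<mu> - of_nat CARD('n))"
  obtains C where "C \<ge> 0" "\<And>x :: real^'n. norm x \<ge> c \<Longrightarrow>
     norm ((\<integral>y. smooth_kernel \<nu> y * smooth_kernel \<mu> (x - y) \<partial>lborel)
       - (R * power_kernel (\<nu> + \<mu> - of_nat CARD('n)) x
          + (\<integral>y. smooth_kernel \<nu> (y :: real^'n) \<partial>lborel) * power_kernel \<mu> x
          + (\<integral>y. smooth_kernel \<mu> (y :: real^'n) \<partial>lborel) * power_kernel \<nu> x))
      \<le> C * wt (min (Re \<nu>) (Re \<mu>) + 2) x"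
proof -
  define \<delta> where "\<delta> = real CARD('n) / 2"
  define a b where "a = (of_nat CARD('n) - \<nu>) / 2" and "b = (of_nat CARD('n) - \<mu>) / 2"
  have ab: "a \<notin> \<int>\<^sub>\<le>\<^sub>0" "b \<notin> \<int>\<^sub>\<le>\<^sub>0" using \<nu>(2) \<mu>(2) by (simp_all only: polar_exponents_iff a_def b_def not_False_eq_True)
  have Re: "Re a < 0" "Re b < 0" using \<nu> \<mu> by (simp_all add: a_def b_def)
  have \<delta>: "\<delta> > 0" by (simp add: \<delta>_def)
  have da: "of_real \<delta> - \<nu> / 2 = a" "of_real \<delta> - \<mu> / 2 = b" by (simp_all add: \<delta>_def a_def b_def field_simps)
  have ad: "of_real \<delta> - a = \<nu> / 2" "of_real \<delta> - b = \<mu> / 2" by (simp_all flip: da)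
  have sab: "of_real \<delta> - a - b = (\<nu> + \<mu> - of_nat CARD('n)) / 2" by (simp add: \<delta>_def a_def b_def field_simps)
  have r2: "Re (\<nu> / 2) > real CARD('n) / 2" "Re (\<mu> / 2) > real CARD('n) / 2" using \<nu> \<mu> by auto
  define T where "T r = (\<integral>P. heat_cutoff \<delta> r P * truncated_beta a b P \<partial>lborel)" for r
  define E where "E r = r powr (- (\<delta> - Re a) - 1) + r powr (- (\<delta> - Re b) - 1) + r powr (- (\<delta> - Re a - Re b) - 1)
            + r powr (- (\<delta> - max (Re a) (Re b)) - 1)" for r :: real
  define M where "M r = Beta a b * (Gamma (of_real \<delta> - a - b) * of_real r powr (- (of_real \<delta> - a - b)))
            - Gamma (of_real \<delta> - b) * of_real r powr (- (of_real \<delta> - b)) / a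
            - Gamma (of_real \<delta> - a) * of_real r powr (- (of_real \<delta> - a)) / b" for r :: real
  have int: "integrable lborel (\<lambda>P. heat_cutoff \<delta> r P * truncated_beta a b P)" if r: "r \<ge> 0" for r
  proof -
    obtain x :: "real^'n" where "norm x = sqrt r" using vector_choose_size[OF real_sqrt_ge_zero[OF r]] by blast
    then have "(norm x)\<^sup>2 = r" using r by simp
    then show ?thesis using profile_convolution(2)[OF r2, of x] unfolding \<delta>_def[symmetric] da by simp
  qed
  obtain K where K: "K \<ge> 0" "\<And>r. r > 0 \<Longrightarrow> norm (T r - M r) \<le> K * E r"
    using heat_cutoff_beta_asymptotics[OF ab(1) Re(1) ab(2) Re(2) \<delta> int] unfolding T_def M_def E_def by blast
  define q where "q = of_real (pi powr \<delta>) / (Gamma (\<nu> / 2) * Gamma (\<mu> / 2))"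
  have conv: "(\<integral>y. smooth_kernel \<nu> y * smooth_kernel \<mu> (x - y) \<partial>lborel) = q * T ((norm x)\<^sup>2)" for x :: "real^'n"
  proof -
    have "(\<integral>y. smooth_kernel \<nu> y * smooth_kernel \<mu> (x - y) \<partial>lborel)
        = (\<integral>y. smooth_profile (\<nu> / 2) ((norm y)\<^sup>2) * smooth_profile (\<mu> / 2) ((norm (x - y))\<^sup>2) / (Gamma (\<nu> / 2) * Gamma (\<mu> / 2)) \<partial>lborel)"
      unfolding smooth_kernel_def by (rule arg_cong[where f="integral\<^sup>L lborel"]) (auto simp: fun_eq_iff)
    also have "\<dots> = q * T ((norm x)\<^sup>2)"
      unfolding integral_divide_zero profile_convolution(1)[OF r2, of x, folded \<delta>_def, unfolded da] T_def q_def by simp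
    finally show ?thesis .
  qed
  let ?N = "\<integral>y. smooth_kernel \<nu> (y :: real^'n) \<partial>lborel" and ?M = "\<integral>y. smooth_kernel \<mu> (y :: real^'n) \<partial>lborel"
  have g: "Gamma (\<nu> / 2) \<noteq> 0" "Gamma (\<mu> / 2) \<noteq> 0"
    using r2 by (auto simp: Gamma_eq_zero_iff intro!: Re_pos_imp_not_nonpos_Ints order_le_less_trans[OF _ r2(1)] order_le_less_trans[OF _ r2(2)] dest: Re_pos_imp_not_nonpos_Ints[rotated])
  have main: "R * power_kernel (\<nu> + \<mu> - of_nat CARD('n)) x + ?N * power_kernel \<mu> x + ?M * power_kernel \<nu> x = q * M ((norm x)\<^sup>2)"
    if "x \<noteq> 0" for x :: "real^'n"
  proof -
    let ?r = "complex_of_real ((norm x)\<^sup>2)"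
    have N: "?N = - (q * Gamma (\<mu> / 2) / a)" "?M = - (q * Gamma (\<nu> / 2) / b)"
      using smooth_kernel_integral[OF \<nu>(1)] smooth_kernel_integral[OF \<mu>(1)] g
      unfolding \<delta>_def[symmetric] a_def[symmetric] b_def[symmetric] q_def by simp_all
    have R: "R = q * (Beta a b * Gamma ((\<nu> + \<mu> - of_nat CARD('n)) / 2))"
      unfolding R_def c_const_product q_def a_def b_def \<delta>_def ..
    show ?thesis
      unfolding N R M_def sab unfolding ad power_kernel_norm_square[OF that] by (simp only: algebra_simps)
        (simp add: algebra_simps)
  qed
  define k where "k = min (Re \<nu>) (Re \<mu>) + 2"
  define Q where "Q s = (1 + 1 / c) powr s" for s
  define C where "C = norm q * (K * (Q (Re \<nu> + 2) + Q (Re \<mu> + 2) + Q (Re \<nu> + Re \<mu> - real CARD('n) + 2) + Q k))"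
  have "C \<ge> 0" unfolding C_def Q_def using K by (intro mult_nonneg_nonneg add_nonneg_nonneg) auto
  moreover have "norm ((\<integral>y. smooth_kernel \<nu> y * smooth_kernel \<mu> (x - y) \<partial>lborel)
       - (R * power_kernel (\<nu> + \<mu> - of_nat CARD('n)) x + ?N * power_kernel \<mu> x + ?M * power_kernel \<nu> x)) \<le> C * wt k x"
    if x: "norm x \<ge> c" for x :: "real^'n"
  proof -
    have n: "norm x > 0" "x \<noteq> 0" using x c by auto
    have k0: "k \<ge> 0" using \<nu> \<mu> by (auto simp: k_def)
    have e: "((norm x)\<^sup>2) powr (- t - 1) \<le> Q (2 * t + 2) * wt k x" if "k \<le> 2 * t + 2" for t
    proof -
      have "((norm x)\<^sup>2) powr (- t - 1) = norm x powr (- (2 * t + 2))"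
        using n by (simp add: powr_def ln_realpow algebra_simps)
      also have "\<dots> \<le> Q (2 * t + 2) * wt k x" unfolding Q_def by (rule norm_powr_le_wt[OF c x k0 that])
      finally show ?thesis .
    qed
    have t: "2 * (\<delta> - Re a) + 2 = Re \<nu> + 2" "2 * (\<delta> - Re b) + 2 = Re \<mu> + 2"
      "2 * (\<delta> - Re a - Re b) + 2 = Re \<nu> + Re \<mu> - real CARD('n) + 2" "2 * (\<delta> - max (Re a) (Re b)) + 2 = k"
      by (auto simp: \<delta>_def a_def b_def k_def max_def min_def field_simps)
    have "E ((norm x)\<^sup>2) \<le> Q (Re \<nu> + 2) * wt k x + Q (Re \<mu> + 2) * wt k x
        + Q (Re \<nu> + Re \<mu> - real CARD('n) + 2) * wt k x + Q k * wt k x"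
      unfolding E_def using \<nu> \<mu>
      by (intro add_mono e[of "\<delta> - Re a", unfolded t] e[of "\<delta> - Re b", unfolded t]
          e[of "\<delta> - Re a - Re b", unfolded t] e[of "\<delta> - max (Re a) (Re b)", unfolded t]) (auto simp: k_def)
    then have E: "E ((norm x)\<^sup>2) \<le> (Q (Re \<nu> + 2) + Q (Re \<mu> + 2) + Q (Re \<nu> + Re \<mu> - real CARD('n) + 2) + Q k) * wt k x"
      by (simp only: distrib_right)
    have "norm (q * T ((norm x)\<^sup>2) - q * M ((norm x)\<^sup>2)) = norm q * norm (T ((norm x)\<^sup>2) - M ((norm x)\<^sup>2))"
      by (simp only: right_diff_distrib[symmetric] norm_mult)
    also have "\<dots> \<le> norm q * (K * E ((norm x)\<^sup>2))"
      using n by (intro mult_left_mono K(2)) auto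
    also have "\<dots> \<le> norm q * (K * ((Q (Re \<nu> + 2) + Q (Re \<mu> + 2) + Q (Re \<nu> + Re \<mu> - real CARD('n) + 2) + Q k) * wt k x))"
      using K(1) by (intro mult_left_mono E) auto
    also have "\<dots> = C * wt k x" by (simp only: C_def mult.assoc)
    finally show ?thesis unfolding conv main[OF n(2)] .
  qed
  ultimately show ?thesis using that unfolding k_def by blast
qed

section \<open>Comparison of lattice convolutions with integrals\<close>

text \<open>One of \<open>y\<close> and \<open>x - y\<close> is at least half as long as \<open>x\<close>; its factor supplies the decay and the other the summability.\<close>

lemma lattice_conv_decay:
  fixes A :: "real^'n^'n" and f h :: "real^'n \<Rightarrow> complex"
  assumes inv: "invertible A" and g: "g > real CARD('n)" and k: "k > real CARD('n)"
    and f: "\<And>y. y \<in> lattice A \<Longrightarrow> norm (f y) \<le> D * wt g y"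
    and h: "\<And>y. y \<in> lattice A \<Longrightarrow> norm (h y) \<le> C * wt k y"
    and x: "x \<in> lattice A"
  shows "norm (lattice_conv A f h x) \<le> D * C * (2 powr k * wt_sum A g + 2 powr g * wt_sum A k) * wt (min g k) x"
proof -
  let ?m = "min g k"
  have gk: "g \<ge> 0" "k \<ge> 0" using g k by (auto intro: order_trans[OF _ less_imp_le])
  have D: "D \<ge> 0" using f[OF lattice_0] by (simp add: wt_def) (metis norm_ge_zero order_trans)
  have C: "C \<ge> 0" using h[OF lattice_0] by (simp add: wt_def) (metis norm_ge_zero order_trans)
  define q where "q y = D * C * 2 powr k * wt ?m x * wt g y + D * C * 2 powr g * wt ?m x * wt k (x - y)" for y
  have q: "(q has_sum (D * C * 2 powr k * wt ?m x * wt_sum A g + D * C * 2 powr g * wt ?m x * wt_sum A k)) (lattice A)"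
    unfolding q_def wt_sum_def
    using has_sum_infsum[OF wt_summable[OF inv g]] has_sum_infsum[OF wt_summable_shift(1)[OF inv k x]] wt_summable_shift(3)[OF inv k x]
    by (intro has_sum_add has_sum_cmult_right) auto
  have "norm (lattice_conv A f h x) \<le> infsum q (lattice A)"
    unfolding lattice_conv_def
  proof (rule infsum_norm_le(3)[OF has_sum_imp_summable[OF q]])
    fix y assume y: "y \<in> lattice A"
    have 1: "norm (f y * h (x - y)) \<le> (D * wt g y) * (C * wt k (x - y))"
      unfolding norm_mult using f[OF y] h[OF lattice_diff[OF x y]] D by (intro mult_mono) auto
    have nonneg: "0 \<le> D * C * 2 powr k * wt ?m x * wt g y" "0 \<le> D * C * 2 powr g * wt ?m x * wt k (x - y)"
      using D C by auto
    show "norm (f y * h (x - y)) \<le> q y"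
    proof (cases "norm x / 2 \<le> norm (x - y)")
      case True
      have "wt k (x - y) \<le> 2 powr k * wt k x" by (rule wt_far[OF True gk(2)])
      also have "\<dots> \<le> 2 powr k * wt ?m x" by (intro mult_left_mono wt_mono_exponent) auto
      finally have "(D * wt g y) * (C * wt k (x - y)) \<le> (D * wt g y) * (C * (2 powr k * wt ?m x))"
        using D C by (intro mult_left_mono) auto
      also have "\<dots> = D * C * 2 powr k * wt ?m x * wt g y" by (simp only: mult_ac)
      finally show ?thesis unfolding q_def using 1 nonneg by linarith
    next
      case False
      have "norm x / 2 \<le> norm y" using norm_triangle_ineq[of "x - y" y] False by simp
      then have "wt g y \<le> 2 powr g * wt g x" by (rule wt_far[OF _ gk(1)])
      also have "\<dots> \<le> 2 powr g * wt ?m x" by (intro mult_left_mono wt_mono_exponent) auto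
      finally have "(D * wt g y) * (C * wt k (x - y)) \<le> (D * (2 powr g * wt ?m x)) * (C * wt k (x - y))"
        using D C by (intro mult_right_mono mult_left_mono) auto
      also have "\<dots> = D * C * 2 powr g * wt ?m x * wt k (x - y)" by (simp only: mult_ac)
      finally show ?thesis unfolding q_def using 1 nonneg by linarith
    qed
  qed
  also have "infsum q (lattice A) = D * C * (2 powr k * wt_sum A g + 2 powr g * wt_sum A k) * wt ?m x"
    using infsumI[OF q] by (simp only: algebra_simps)
  finally show ?thesis .
qed

lemma symbol_mono:
  fixes f :: "real^'n \<Rightarrow> complex"
  assumes "symbol \<rho> m f C" "C \<le> D"
  shows "symbol \<rho> m f D"
proof -
  have *: "z \<le> D * wt t x" if "z \<le> C * wt t x" for z t and x :: "real^'n"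
    using that mult_right_mono[OF assms(2) wt_nonneg[of t x]] by linarith
  have **: "z \<le> D * v * wt t x" if "z \<le> C * v * wt t x" "v \<ge> 0" for z v t and x :: "real^'n"
    using that(1) mult_right_mono[OF mult_right_mono[OF assms(2) that(2)] wt_nonneg[of t x]] by linarith
  have "D \<ge> 0" using assms unfolding symbol_def by linarith
  then show ?thesis
    using assms(1) unfolding symbol_def
    by (elim conjE) (intro conjI allI impI * ** norm_ge_zero zero_le_power2; (assumption | blast))
qed

text \<open>An error two orders smaller than the kernel has second differences of the required size
  for the crude reason that nonzero lattice steps are bounded below.\<close>

lemma perturbed_second_difference:
  fixes A :: "real^'n^'n" and f h :: "real^'n \<Rightarrow> complex"
  assumes inv: "invertible A" and m: "m \<ge> 0"
    and h2: "\<And>x y. norm y \<le> norm x / 2 \<Longrightarrow> norm (h (x + y) + h (x - y) - 2 * h x) \<le> C * (norm y)\<^sup>2 * wt (m + 2) x"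
    and e: "\<And>y. y \<in> lattice A \<Longrightarrow> norm (f y - h y) \<le> D * wt (m + 2) y"
  obtains K where "K \<ge> C" "\<And>x y. x \<in> lattice A \<Longrightarrow> y \<in> lattice A \<Longrightarrow> norm y \<le> norm x / 2 \<Longrightarrow>
               norm (f (x + y) + f (x - y) - 2 * f x) \<le> K * (norm y)\<^sup>2 * wt (m + 2) x"
proof -
  obtain c where c: "c > 0" "\<And>x. x \<in> lattice A \<Longrightarrow> x \<noteq> 0 \<Longrightarrow> norm x \<ge> c"
    using lattice_min_norm[OF inv] by blast
  have D: "D \<ge> 0" using e[OF lattice_0] by (simp add: wt_def) (metis norm_ge_zero order_trans)
  \<comment> \<open>bounds the second difference of the error by crude addition; dividing by \<open>c\<^sup>2\<close> trades it for \<open>(norm y)\<^sup>2\<close>\<close>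
  define E where "E = D * (2 * 2 powr (m + 2) + 2)"
  have E: "E \<ge> 0" using D by (simp add: E_def)
  define K where "K = C + E / c\<^sup>2"
  have "norm (f (x + y) + f (x - y) - 2 * f x) \<le> K * (norm y)\<^sup>2 * wt (m + 2) x"
    if x: "x \<in> lattice A" and y: "y \<in> lattice A" and n: "norm y \<le> norm x / 2" for x y
  proof (cases "y = 0")
    case False
    let ?w = "wt (m + 2) x" and ?d = "\<lambda>z. f z - h z"
    have far: "D * wt (m + 2) z \<le> D * (2 powr (m + 2) * ?w)" if "norm x / 2 \<le> norm z" for z
      using D m that by (intro mult_left_mono wt_far) auto
    have xx: "norm x / 2 \<le> norm (x + y)" "norm x / 2 \<le> norm (x - y)"
      using norm_triangle_ineq4[of "x + y" y] norm_triangle_ineq[of "x - y" y] n by auto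
    have b: "norm (?d (x + y)) \<le> D * (2 powr (m + 2) * ?w)" "norm (?d (x - y)) \<le> D * (2 powr (m + 2) * ?w)"
      using order_trans[OF e[OF lattice_add[OF x y]] far[OF xx(1)]] order_trans[OF e[OF lattice_diff[OF x y]] far[OF xx(2)]] .
    have "norm (2 * ?d x) \<le> 2 * (D * ?w)" unfolding norm_mult using e[OF x] by simp
    then have "norm (?d (x + y) + ?d (x - y) - 2 * ?d x) \<le> D * (2 powr (m + 2) * ?w) + D * (2 powr (m + 2) * ?w) + 2 * (D * ?w)"
      by (intro order_trans[OF norm_triangle_ineq4] order_trans[OF norm_triangle_ineq] add_mono b)
    also have "\<dots> = E * ?w" by (simp add: E_def algebra_simps)
    also have "\<dots> \<le> E * ?w * ((norm y)\<^sup>2 / c\<^sup>2)"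
    proof -
      have "c\<^sup>2 \<le> (norm y)\<^sup>2" using c(1) c(2)[OF y False] by (intro power_mono) auto
      then have "1 \<le> (norm y)\<^sup>2 / c\<^sup>2" using c(1) by simp
      from mult_left_mono[OF this, of "E * ?w"] show ?thesis using E by simp
    qed
    finally have "norm (?d (x + y) + ?d (x - y) - 2 * ?d x) \<le> E * ?w * ((norm y)\<^sup>2 / c\<^sup>2)" .
    moreover have "f (x + y) + f (x - y) - 2 * f x = (h (x + y) + h (x - y) - 2 * h x) + (?d (x + y) + ?d (x - y) - 2 * ?d x)"
      by (simp add: algebra_simps)
    ultimately have "norm (f (x + y) + f (x - y) - 2 * f x) \<le> C * (norm y)\<^sup>2 * ?w + E * ?w * ((norm y)\<^sup>2 / c\<^sup>2)"
      using h2[OF n] by (simp only:) (rule order_trans[OF norm_triangle_ineq add_mono])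
    also have "\<dots> = K * (norm y)\<^sup>2 * ?w" by (simp add: K_def algebra_simps)
    finally show ?thesis .
  qed auto
  moreover have "K \<ge> C" using E by (simp add: K_def)
  ultimately show ?thesis using that by blast
qed

context tiling begin

text \<open>Tiling reduces the integral to the lattice sum of the weight, since moving within a cell changes the weight by a
  bounded factor.\<close>

lemma wt_integrable:
  assumes m: "m > real CARD('n)"
  shows "integrable lborel (wt m :: real^'n \<Rightarrow> real)"
proof -
  have cont: "continuous_on UNIV (wt m :: real^'n \<Rightarrow> real)"
    unfolding wt_def by (intro continuous_intros) (auto simp: add_nonneg_eq_0_iff)
  have [measurable]: "(wt m :: real^'n \<Rightarrow> real) \<in> borel_measurable borel"
    by (rule borel_measurable_continuous_onI[OF cont])
  obtain \<rho> where \<rho>: "\<rho> \<ge> 0" "\<And>p. p \<in> cell \<Longrightarrow> norm p \<le> \<rho>" using lattice_cell_bounded[of A] by blast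
  define q where "q = (2 * (1 + \<rho>)) powr m"
  have m0: "m \<ge> 0" using m by (auto intro: order_trans[OF _ less_imp_le])
  have "integrable (count_space L) (wt m)"
    using wt_summable[OF inv m] by (simp add: abs_summable_on_def[symmetric] abs_summable_equivalent[symmetric])
  then have "(\<integral>\<^sup>+y. ennreal (norm (wt m y)) \<partial>count_space L) < \<infinity>" unfolding integrable_iff_bounded by blast
  then have fin: "(\<integral>\<^sup>+y. ennreal (wt m y) \<partial>count_space L) < \<infinity>" by simp
  have "(\<integral>\<^sup>+x. ennreal (wt m (x :: real^'n)) \<partial>lborel) = (\<integral>\<^sup>+p. \<integral>\<^sup>+y. indicator cell p * ennreal (wt m (y + p)) \<partial>count_space L \<partial>lborel)"
    by (rule nn_integral_tiling(2)[of "\<lambda>x. ennreal (wt m x)", symmetric]) measurable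
  also have "\<dots> \<le> (\<integral>\<^sup>+p. \<integral>\<^sup>+y. indicator cell p * (ennreal q * ennreal (wt m y)) \<partial>count_space L \<partial>lborel)"
  proof (intro nn_integral_mono)
    fix p y
    show "indicator cell p * ennreal (wt m (y + p)) \<le> indicator cell p * (ennreal q * ennreal (wt m y))"
    proof (cases "p \<in> cell")
      case True
      have "norm y / 2 - \<rho> \<le> norm (y + p)"
        using norm_diff_ineq[of y p] \<rho>(2)[OF True] norm_ge_zero[of y] by linarith
      then have "wt m (y + p) \<le> q * wt m y" unfolding q_def using \<rho>(1) m0 by (rule wt_near)
      then show ?thesis using True by (simp add: q_def ennreal_leI flip: ennreal_mult'')
    qed auto
  qed
  also have "\<dots> = (\<integral>\<^sup>+p. indicator cell p * (ennreal q * (\<integral>\<^sup>+y. ennreal (wt m y) \<partial>count_space L)) \<partial>lborel)"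
    by (simp add: nn_integral_cmult)
  also have "\<dots> = ennreal q * (\<integral>\<^sup>+y. ennreal (wt m y) \<partial>count_space L) * emeasure lborel cell"
    by (subst nn_integral_multc) (auto simp: mult.commute)
  also have "\<dots> < \<infinity>" using fin lattice_cell_measure(1)[OF inv] by (simp add: ennreal_mult_less_top)
  finally show ?thesis unfolding integrable_iff_bounded by simp
qed

lemma symbol_integrable:
  assumes m: "m > real CARD('n)" and G: "symbol \<rho> m G C"
  shows "integrable lborel (G :: real^'n \<Rightarrow> complex)"
proof (rule Bochner_Integration.integrable_bound[OF integrable_mult_right[OF wt_integrable[OF m], of C]])
  have "continuous_on UNIV G" using G unfolding symbol_def by blast
  then show "G \<in> borel_measurable lborel" using borel_measurable_continuous_onI by simp
  have "norm (G x) \<le> C * wt m x" for x using G unfolding symbol_def by blast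
  then show "AE x in lborel. norm (G x) \<le> norm (C * wt m x)"
    using order_trans[OF _ abs_ge_self] by (intro AE_I2) auto
qed

lemma symbol_translate_summable:
  assumes m: "m > real CARD('n)" and G: "symbol \<rho> m G C" and \<rho>: "\<rho> \<ge> 0" and p: "norm p \<le> \<rho>"
  shows "ell1 A (\<lambda>y. G (y + p))"
proof (rule ell1_bounded_by_wt[OF inv m])
  fix y
  have m0: "m \<ge> 0" using m by (auto intro: order_trans[OF _ less_imp_le])
  have "norm y / 2 - \<rho> \<le> norm (y + p)"
    using norm_diff_ineq[of y p] p norm_ge_zero[of y] by linarith
  then have w: "wt m (y + p) \<le> (2 * (1 + \<rho>)) powr m * wt m y" using \<rho> m0 by (rule wt_near)
  have "norm (G (y + p)) \<le> C * wt m (y + p)" "C \<ge> 0" using G unfolding symbol_def by blast+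
  then show "norm (G (y + p)) \<le> (C * (2 * (1 + \<rho>)) powr m) * wt m y"
    using mult_left_mono[OF w, of C] unfolding mult.assoc by linarith
qed

text \<open>Let \<open>ev G\<close> and \<open>od G\<close> be the even and odd parts of \<open>G\<close> shifted by \<open>p\<close>, and likewise for \<open>H\<close>. Averaging over \<open>p\<close> and \<open>- p\<close>
  leaves \<open>ev G * ev H - od G * od H\<close>. The differences \<open>r = U - ev G\<close> and \<open>s = W - ev H\<close> are even and two orders smaller, and
  \<open>U * W = ev G * ev H + r * W + s * U - r * s\<close>, products being convolutions; here \<open>r\<close> and \<open>s\<close> act on \<open>W\<close> and \<open>U\<close> through their total masses. The value at \<open>- x\<close>
  stands for the shift by \<open>- p\<close>, by reflection. The constant must not depend on \<open>p\<close>, which is averaged out afterwards.\<close>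

lemma shifted_conv_error:
  fixes U W G H :: "real^'n \<Rightarrow> complex"
  assumes m: "m > real CARD('n)" and l: "l > real CARD('n)" and \<rho>: "\<rho> \<ge> 0"
    and G: "symbol \<rho> m G C" and H: "symbol \<rho> l H C"
    and even: "even_on_lattice A U" "even_on_lattice A W"
    and U: "\<And>y. y \<in> L \<Longrightarrow> norm (U y - G y) \<le> C * wt (m + 2) y"
    and W: "\<And>y. y \<in> L \<Longrightarrow> norm (W y - H y) \<le> C * wt (l + 2) y"
  obtains K where "\<And>p x. norm p \<le> \<rho> \<Longrightarrow> x \<in> L \<Longrightarrow>
    norm ((lattice_conv A (\<lambda>y. G (y + p)) (\<lambda>z. H (z - p)) x + lattice_conv A (\<lambda>y. G (y + p)) (\<lambda>z. H (z - p)) (- x)) / 2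
      - (lattice_conv A U W x - (infsum U L - (\<Sum>\<^sub>\<infinity>y\<in>L. G (y + p))) * W x - (infsum W L - (\<Sum>\<^sub>\<infinity>y\<in>L. H (y + p))) * U x))
    \<le> K * wt (min m l + 2) x"
proof -
  have C: "C \<ge> 0" using G unfolding symbol_def by blast
  have ml: "m \<ge> 0" "l \<ge> 0" using m l by (auto intro: order_trans[OF _ less_imp_le])
  have m2: "m + 2 > real CARD('n)" "l + 2 > real CARD('n)" using m l by auto
  have m1: "m + 1 > real CARD('n)" "l + 1 > real CARD('n)" using m l by auto
  have GH2: "norm (G (x + y) + G (x - y) - 2 * G x) \<le> C * (norm y)\<^sup>2 * wt (m + 2) x"
      "norm (H (x + y) + H (x - y) - 2 * H x) \<le> C * (norm y)\<^sup>2 * wt (l + 2) x"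
    if "norm y \<le> norm x / 2" for x y
    using G H that unfolding symbol_def by blast+
  obtain KU where KU: "KU \<ge> C" "\<And>x y. x \<in> L \<Longrightarrow> y \<in> L \<Longrightarrow> norm y \<le> norm x / 2 \<Longrightarrow>
               norm (U (x + y) + U (x - y) - 2 * U x) \<le> KU * (norm y)\<^sup>2 * wt (m + 2) x"
    using perturbed_second_difference[OF inv ml(1) GH2(1) U] by blast
  obtain KW where KW: "KW \<ge> C" "\<And>x y. x \<in> L \<Longrightarrow> y \<in> L \<Longrightarrow> norm y \<le> norm x / 2 \<Longrightarrow>
               norm (W (x + y) + W (x - y) - 2 * W x) \<le> KW * (norm y)\<^sup>2 * wt (l + 2) x"
    using perturbed_second_difference[OF inv ml(2) GH2(2) W] by blast
  define D where "D = 2 * C + KU + KW"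
  have D0: "D \<ge> 0" "2 * C \<le> D" "KU \<le> D" "KW \<le> D" using C KU(1) KW(1) by (auto simp: D_def)
  have weak: "norm z \<le> D * w" if "norm z \<le> c * w" "c \<le> D" "w \<ge> 0" for z :: complex and c w
    using that(1) mult_right_mono[OF that(2,3)] by linarith
  have bnd: "norm (f y) \<le> D * wt s y"
    if "norm (g y) \<le> C * wt s y" "norm (f y - g y) \<le> C * wt (s + 2) y" for f g :: "real^'n \<Rightarrow> complex" and s y
  proof (rule weak[of _ "2 * C", OF _ D0(2) wt_nonneg])
    have "C * wt (s + 2) y \<le> C * wt s y" using C by (intro mult_left_mono wt_mono_exponent) auto
    then show "norm (f y) \<le> 2 * C * wt s y" using norm_triangle_ineq[of "g y" "f y - g y"] that by simp
  qed
  have Ub: "norm (U y) \<le> D * wt m y" if "y \<in> L" for y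
    by (rule bnd[of G y m U, OF _ U[OF that]]) (use G in \<open>unfold symbol_def, blast\<close>)
  have Wb: "norm (W y) \<le> D * wt l y" if "y \<in> L" for y
    by (rule bnd[of H y l W, OF _ W[OF that]]) (use H in \<open>unfold symbol_def, blast\<close>)
  have U2: "norm (U (x + y) + U (x - y) - 2 * U x) \<le> D * (norm y)\<^sup>2 * wt (m + 2) x"
    if "x \<in> L" "y \<in> L" "norm y \<le> norm x / 2" for x y
    using weak[of _ KU "(norm y)\<^sup>2 * wt (m + 2) x"] KU(2)[OF that] D0 by (simp add: mult.assoc)
  have W2: "norm (W (x + y) + W (x - y) - 2 * W x) \<le> D * (norm y)\<^sup>2 * wt (l + 2) x"
    if "x \<in> L" "y \<in> L" "norm y \<le> norm x / 2" for x y
    using weak[of _ KW "(norm y)\<^sup>2 * wt (l + 2) x"] KW(2)[OF that] D0 by (simp add: mult.assoc)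
  have eU: "ell1 A U" by (rule ell1_bounded_by_wt[OF inv m Ub])
  have eW: "ell1 A W" by (rule ell1_bounded_by_wt[OF inv l Wb])
  define K1 where "K1 = D * D * 2 powr (m + 2) * (4 * wt_sum A l + wt_sum A (m + 2))"
  define K2 where "K2 = D * D * 2 powr (l + 2) * (4 * wt_sum A m + wt_sum A (l + 2))"
  define K3 where "K3 = D * D * (2 powr (l + 2) * wt_sum A (m + 2) + 2 powr (m + 2) * wt_sum A (l + 2))"
  define K4 where "K4 = D\<^sup>2 * (wt_sum A m + wt_sum A l + 2 powr (l + 2) * wt_sum A m)"
  let ?k = "min m l + 2"
  have k: "min (m + 2) (l + 2) = ?k" "min (l + 2) (m + 2) = ?k" by auto
  have "norm ((lattice_conv A (\<lambda>y. G (y + p)) (\<lambda>z. H (z - p)) x + lattice_conv A (\<lambda>y. G (y + p)) (\<lambda>z. H (z - p)) (- x)) / 2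
      - (lattice_conv A U W x - (infsum U L - (\<Sum>\<^sub>\<infinity>y\<in>L. G (y + p))) * W x - (infsum W L - (\<Sum>\<^sub>\<infinity>y\<in>L. H (y + p))) * U x))
    \<le> (K1 + K2 + K3 + K4) * wt ?k x" if p: "norm p \<le> \<rho>" and x: "x \<in> L" for p x
  proof -
    have p': "norm (- p) \<le> \<rho>" using p by simp
    define ev where "ev F y = (F (y + p) + F (y - p)) / 2" for F :: "real^'n \<Rightarrow> complex" and y
    define od where "od F y = (F (y + p) - F (y - p)) / 2" for F :: "real^'n \<Rightarrow> complex" and y
    have core: "ell1 A (\<lambda>y. F (y + p)) \<and> ell1 A (\<lambda>y. F (y - p)) \<and> ell1 A (ev F) \<and> ell1 A (od F)
        \<and> infsum (ev F) L = (\<Sum>\<^sub>\<infinity>y\<in>L. F (y + p))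
        \<and> even_on_lattice A (ev F)
        \<and> (\<forall>y\<in>L. od F (- y) = - od F y \<and> norm (od F y) \<le> D * wt (s + 1) y)
        \<and> (\<forall>x\<in>L. \<forall>y\<in>L. norm y \<le> norm x / 2 \<longrightarrow> norm (od F (x + y) - od F (x - y)) \<le> D * norm y * wt (s + 2) x)
        \<and> (\<forall>y. norm (ev F y - F y) \<le> C * wt (s + 2) y)"
      if F: "symbol \<rho> s F C" and s: "s > real CARD('n)" for F s
    proof -
      have Fm: "F (- y) = F y" for y using F unfolding symbol_def by blast
      have sw: "F (- y + p) = F (y - p)" "F (- y - p) = F (y + p)" for y
      proof -
        have "- y + p = - (y - p)" "- y - p = - (y + p)" by simp_all
        then show "F (- y + p) = F (y - p)" "F (- y - p) = F (y + p)" by (simp_all only: Fm)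
      qed
      have e1: "ell1 A (\<lambda>y. F (y + p))" by (rule symbol_translate_summable[OF s F \<rho> p])
      have e2: "ell1 A (\<lambda>y. F (y - p))" using symbol_translate_summable[OF s F \<rho> p'] by simp
      have ee: "ell1 A (ev F)"
        using ell1_cmult[OF ell1_add[OF e1 e2], of "1/2"] by (simp add: ev_def[abs_def])
      have eo: "ell1 A (od F)"
        using ell1_cmult[OF ell1_add[OF e1 ell1_cmult[OF e2, of "-1"]], of "1/2"] by (simp add: od_def[abs_def])
      have "(\<Sum>\<^sub>\<infinity>y\<in>L. F (y - p)) = (\<Sum>\<^sub>\<infinity>y\<in>L. F (y + p))"
        using infsum_reindex_bij_betw[OF bij_lattice_uminus[of A], of "\<lambda>y. F (y - p)"] by (simp only: sw)
      then have s2: "(\<Sum>\<^sub>\<infinity>y\<in>L. F (y + p) + F (y - p)) = 2 * (\<Sum>\<^sub>\<infinity>y\<in>L. F (y + p))"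
        unfolding infsum_add[OF ell1_summable[OF e1] ell1_summable[OF e2]] by (simp only: mult_2)
      have "infsum (ev F) L = (\<Sum>\<^sub>\<infinity>y\<in>L. (1/2) * (F (y + p) + F (y - p)))"
        by (rule infsum_cong) (simp only: ev_def, simp only: divide_inverse mult_1_left mult.commute)
      then have se: "infsum (ev F) L = (\<Sum>\<^sub>\<infinity>y\<in>L. F (y + p))"
        unfolding infsum_cmult_right' s2 by (simp only: mult.assoc[symmetric] times_divide_eq_left mult_1_left) simp
      have evn: "even_on_lattice A (ev F)" 
        unfolding even_on_lattice_def ev_def by (intro ballI) (simp only: sw add.commute[of "F (_ + p)"])
      have o1: "od F (- y) = - od F y" for y
        unfolding od_def by (simp only: sw minus_divide_left minus_diff_eq)
      have half: "norm (z / 2) \<le> c * w" if "norm z \<le> C * w" "C \<le> 2 * c" "w \<ge> 0" for z :: complex and w c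
        using that(1) mult_right_mono[OF that(2,3)] by (simp add: norm_divide)
      have o2: "norm (od F y) \<le> D * wt (s + 1) y" for y
        unfolding od_def using F p D0 C unfolding symbol_def by (intro half) auto
      have o3: "norm (od F (x + y) - od F (x - y)) \<le> D * norm y * wt (s + 2) x" if "norm y \<le> norm x / 2" for x y
      proof -
        have "norm (F (x + y + p) - F (x + y - p) - F (x - y + p) + F (x - y - p)) \<le> C * (norm y * wt (s + 2) x)"
          using F p that unfolding symbol_def mult.assoc by blast
        then have "norm ((F (x + y + p) - F (x + y - p) - F (x - y + p) + F (x - y - p)) / 2) \<le> D * (norm y * wt (s + 2) x)"
          using C D0 by (intro half) auto
        also have "(F (x + y + p) - F (x + y - p) - F (x - y + p) + F (x - y - p)) / 2 = od F (x + y) - od F (x - y)"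
          by (simp add: od_def field_simps)
        finally show ?thesis by (simp only: mult.assoc)
      qed
      have e3: "norm (ev F y - F y) \<le> C * wt (s + 2) y" for y
      proof -
        have "norm (F (y + p) + F (y - p) - 2 * F y) \<le> C * wt (s + 2) y"
          using F p unfolding symbol_def by blast
        then have "norm ((F (y + p) + F (y - p) - 2 * F y) / 2) \<le> C * wt (s + 2) y"
          using C by (intro half) auto
        also have "(F (y + p) + F (y - p) - 2 * F y) / 2 = ev F y - F y" by (simp add: ev_def field_simps)
        finally show ?thesis .
      qed
      show ?thesis using e1 e2 ee eo se evn o1 o2 o3 e3 by blast
    qed
    note g = core[OF G m] and h = core[OF H l]
    define r where "r y = U y + (-1) * ev G y" for y
    define s where "s y = W y + (-1) * ev H y" for y
    have el: "ell1 A (ev G)" "ell1 A (ev H)" "ell1 A (od G)" "ell1 A (od H)" "ell1 A r" "ell1 A s"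
      using g h unfolding r_def[abs_def] s_def[abs_def] by (blast, blast, blast, blast, intro ell1_add ell1_cmult eU, blast, intro ell1_add ell1_cmult eW, blast)
    have rb: "norm (r y) \<le> D * wt (m + 2) y" if "y \<in> L" for y
    proof (rule weak[of _ "2 * C", OF _ D0(2) wt_nonneg])
      have "norm (ev G y - G y) \<le> C * wt (m + 2) y" using g by blast
      then show "norm (r y) \<le> 2 * C * wt (m + 2) y"
        using norm_triangle_ineq4[of "U y - G y" "ev G y - G y"] U[OF that] by (simp add: r_def)
    qed
    have sb: "norm (s y) \<le> D * wt (l + 2) y" if "y \<in> L" for y
    proof (rule weak[of _ "2 * C", OF _ D0(2) wt_nonneg])
      have "norm (ev H y - H y) \<le> C * wt (l + 2) y" using h by blast
      then show "norm (s y) \<le> 2 * C * wt (l + 2) y"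
        using norm_triangle_ineq4[of "W y - H y" "ev H y - H y"] W[OF that] by (simp add: s_def)
    qed
    have reven: "even_on_lattice A r" and seven: "even_on_lattice A s"
      using even g h unfolding even_on_lattice_def r_def s_def by auto
    have rsum: "infsum r L = infsum U L - (\<Sum>\<^sub>\<infinity>y\<in>L. G (y + p))"
      using infsum_add[OF ell1_summable[OF eU] ell1_summable[OF ell1_cmult[OF el(1), of "-1"]]] g
      by (simp add: r_def[abs_def] infsum_uminus)
    have ssum: "infsum s L = infsum W L - (\<Sum>\<^sub>\<infinity>y\<in>L. H (y + p))"
      using infsum_add[OF ell1_summable[OF eW] ell1_summable[OF ell1_cmult[OF el(2), of "-1"]]] h
      by (simp add: s_def[abs_def] infsum_uminus)
    have b1: "norm (lattice_conv A r W x - infsum r L * W x) \<le> K1 * wt ?k x"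
      using regular_conv[OF inv l m2(1) reven rb Wb W2 x] unfolding K1_def k .
    have b2: "norm (lattice_conv A s U x - infsum s L * U x) \<le> K2 * wt ?k x"
      using regular_conv[OF inv m m2(2) seven sb Ub U2 x] unfolding K2_def k .
    have b3: "norm (lattice_conv A r s x) \<le> K3 * wt ?k x"
      using lattice_conv_decay[OF inv m2 rb sb x] unfolding K3_def k .
    have b4: "norm (lattice_conv A (od G) (od H) x) \<le> K4 * wt ?k x"
      unfolding K4_def using g h by (intro odd_conv[OF inv m l D0(1)] x) blast+
    let ?c = "lattice_conv A"
    have split_UW: "?c U W x = ?c (ev G) (ev H) x + ?c r W x + ?c s U x - ?c r s x"
    proof -
      have Us: "U = (\<lambda>y. ev G y + r y)" and Ws: "W = (\<lambda>y. ev H y + s y)" by (auto simp: r_def s_def)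
      have 1: "?c U W x = ?c (ev G) W x + ?c r W x"
        by (subst Us) (rule lattice_conv_add_left[OF el(1,5) eW x])
      have 2: "?c (ev G) W x = ?c (ev G) (ev H) x + ?c (ev G) s x"
        by (subst Ws) (rule lattice_conv_add_right[OF el(1,2,6) x])
      have 3: "?c s U x = ?c (ev G) s x + ?c r s x"
        unfolding lattice_conv_commute[OF x, of s U]
        by (subst Us) (rule lattice_conv_add_left[OF el(1,5,6) x])
      show ?thesis unfolding 1 2 3 by simp
    qed
    have avg: "(?c (\<lambda>y. G (y + p)) (\<lambda>z. H (z - p)) x + ?c (\<lambda>y. G (y + p)) (\<lambda>z. H (z - p)) (- x)) / 2
        = ?c (ev G) (ev H) x - ?c (od G) (od H) x"
    proof -
      note Hm = H[unfolded symbol_def, THEN conjunct2, THEN conjunct1, THEN spec]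
      note Gm = G[unfolded symbol_def, THEN conjunct2, THEN conjunct1, THEN spec]
      have "?c (\<lambda>y. G (y + p)) (\<lambda>z. H (z - p)) (- x) = (\<Sum>\<^sub>\<infinity>y\<in>L. G (- y + p) * H (- x - (- y) - p))"
        unfolding lattice_conv_def
        using infsum_reindex_bij_betw[OF bij_lattice_uminus[of A], of "\<lambda>y. G (y + p) * H (- x - y - p)"] by simp
      also have "\<dots> = (\<Sum>\<^sub>\<infinity>y\<in>L. G (y - p) * H (x - y + p))"
      proof (rule infsum_cong)
        fix y
        show "G (- y + p) * H (- x - (- y) - p) = G (y - p) * H (x - y + p)"
        proof -
          have "- y + p = - (y - p)" "- x - (- y) - p = - (x - y + p)" by simp_all
          then show ?thesis by (simp only: Gm Hm)
        qed
      qed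
      finally have neg: "?c (\<lambda>y. G (y + p)) (\<lambda>z. H (z - p)) (- x) = ?c (\<lambda>y. G (y - p)) (\<lambda>z. H (z + p)) x"
        by (simp add: lattice_conv_def)
      have sum: "(\<lambda>y. G (y + p) * H (x - y - p)) summable_on L" "(\<lambda>y. G (y - p) * H (x - y + p)) summable_on L"
        using ell1_conv_summable[of A "\<lambda>y. G (y + p)" "\<lambda>z. H (z - p)", OF _ _ x]
          ell1_conv_summable[of A "\<lambda>y. G (y - p)" "\<lambda>z. H (z + p)", OF _ _ x] g h by auto
      have sum': "(\<lambda>y. ev G y * ev H (x - y)) summable_on L" "(\<lambda>y. od G y * od H (x - y)) summable_on L"
        by (intro ell1_conv_summable el x)+
      have "?c (\<lambda>y. G (y + p)) (\<lambda>z. H (z - p)) x + ?c (\<lambda>y. G (y - p)) (\<lambda>z. H (z + p)) x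
          = (\<Sum>\<^sub>\<infinity>y\<in>L. G (y + p) * H (x - y - p) + G (y - p) * H (x - y + p))"
        unfolding lattice_conv_def by (rule infsum_add[OF sum, symmetric])
      also have "\<dots> = (\<Sum>\<^sub>\<infinity>y\<in>L. 2 * (ev G y * ev H (x - y)) + (-2) * (od G y * od H (x - y)))"
        by (rule infsum_cong) (simp add: ev_def od_def field_simps)
      also have "\<dots> = 2 * ?c (ev G) (ev H) x + (-2) * ?c (od G) (od H) x"
        unfolding lattice_conv_def infsum_cmult_right'[symmetric]
        by (rule infsum_add[OF summable_on_cmult_right[OF sum'(1)] summable_on_cmult_right[OF sum'(2)]])
      finally show ?thesis unfolding neg by simp
    qed
    have eq: "(?c (\<lambda>y. G (y + p)) (\<lambda>z. H (z - p)) x + ?c (\<lambda>y. G (y + p)) (\<lambda>z. H (z - p)) (- x)) / 2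
      - (?c U W x - (infsum U L - (\<Sum>\<^sub>\<infinity>y\<in>L. G (y + p))) * W x - (infsum W L - (\<Sum>\<^sub>\<infinity>y\<in>L. H (y + p))) * U x)
      = - (?c r W x - infsum r L * W x) - (?c s U x - infsum s L * U x) + ?c r s x - ?c (od G) (od H) x"
    proof -
      have "e - o' - (e + rw + su - rs - r0 * w - s0 * u) = - (rw - r0 * w) - (su - s0 * u) + rs - o'"
        for e o' rw su rs r0 s0 w u :: complex by simp
      then show ?thesis unfolding avg rsum ssum split_UW .
    qed
    have four: "norm (- z1 - z2 + z3 - z4) \<le> c1 + c2 + c3 + c4"
      if "norm z1 \<le> c1" "norm z2 \<le> c2" "norm z3 \<le> c3" "norm z4 \<le> c4" for z1 z2 z3 z4 :: complex and c1 c2 c3 c4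
      using norm_triangle_ineq4[of "- z1 - z2 + z3" z4] norm_triangle_ineq[of "- z1 - z2" z3] norm_triangle_ineq4[of "- z1" z2] that
      by simp
    show ?thesis unfolding eq distrib_right by (rule four[OF b1 b2 b3 b4])
  qed
  then show ?thesis using that by blast
qed

lemma has_bochner_integral_tiling:
  fixes F :: "real^'n \<Rightarrow> complex"
  assumes "integrable lborel F" "\<And>p. p \<in> cell \<Longrightarrow> (\<lambda>y. norm (F (y + p))) summable_on L"
  shows "has_bochner_integral lborel (\<lambda>p. indicator cell p *\<^sub>R (\<Sum>\<^sub>\<infinity>y\<in>L. F (y + p))) (\<integral>x. F x \<partial>lborel)"
  using integral_tiling[OF assms] by (simp add: has_bochner_integral_iff)

text \<open>The integral over the cell of the bound for fixed shift: the shifted convolution integrates to the convolution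
  integral \<open>I\<close>, the shifted masses to the integrals of \<open>G\<close> and \<open>H\<close>, and constants pick up the volume of the cell.\<close>

lemma averaged_conv_error:
  fixes U W G H :: "real^'n \<Rightarrow> complex"
  assumes m: "m > real CARD('n)" and l: "l > real CARD('n)"
    and \<rho>: "\<rho> \<ge> 0" "\<And>p. p \<in> cell \<Longrightarrow> norm p \<le> \<rho>"
    and G: "symbol \<rho> m G C" and H: "symbol \<rho> l H C"
    and even: "even_on_lattice A U" "even_on_lattice A W"
    and U: "\<And>y. y \<in> L \<Longrightarrow> norm (U y - G y) \<le> C * wt (m + 2) y"
    and W: "\<And>y. y \<in> L \<Longrightarrow> norm (W y - H y) \<le> C * wt (l + 2) y"
    and I: "\<And>x. I x = (\<integral>y. G y * H (x - y) \<partial>lborel)" "\<And>x. I (- x) = I x"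
  obtains K where "\<And>x. x \<in> L \<Longrightarrow>
    norm (of_real (covolume A) * lattice_conv A U W x
      - (I x + (of_real (covolume A) * infsum U L - (\<integral>y. G y \<partial>lborel)) * W x
             + (of_real (covolume A) * infsum W L - (\<integral>y. H y \<partial>lborel)) * U x))
    \<le> K * wt (min m l + 2) x"
proof -
  define S where "S p x = lattice_conv A (\<lambda>y. G (y + p)) (\<lambda>z. H (z - p)) x" for p x
  define sG sH where "sG p = (\<Sum>\<^sub>\<infinity>y\<in>L. G (y + p))" and "sH p = (\<Sum>\<^sub>\<infinity>y\<in>L. H (y + p))" for p
  let ?k = "min m l + 2" and ?V = "covolume A"
  obtain K where K: "\<And>p x. norm p \<le> \<rho> \<Longrightarrow> x \<in> L \<Longrightarrow>
    norm ((S p x + S p (- x)) / 2 - (lattice_conv A U W x - (infsum U L - sG p) * W x - (infsum W L - sH p) * U x))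
      \<le> K * wt ?k x"
    using shifted_conv_error[OF m l \<rho>(1) G H even U W] unfolding S_def sG_def sH_def by blast
  have intG: "integrable lborel G" and intH: "integrable lborel H"
    by (rule symbol_integrable[OF m G], rule symbol_integrable[OF l H])
  have [measurable]: "G \<in> borel_measurable borel" "H \<in> borel_measurable borel"
    using borel_measurable_integrable[OF intG] borel_measurable_integrable[OF intH] by simp_all
  have C: "C \<ge> 0" using G unfolding symbol_def by blast
  have l0: "l \<ge> 0" using l by (auto intro: order_trans[OF _ less_imp_le])
  have Hb: "norm (H y) \<le> C" for y
  proof -
    have "norm (H y) \<le> C * wt l y" using H unfolding symbol_def by blast
    also have "\<dots> \<le> C * 1" using C l0 by (intro mult_left_mono wt_le_1) auto
    finally show ?thesis by simp
  qed
  have intGH: "integrable lborel (\<lambda>y. G y * H (x - y))" for x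
  proof (rule Bochner_Integration.integrable_bound[OF integrable_mult_right[OF integrable_norm[OF intG], of C]])
    show "AE y in lborel. norm (G y * H (x - y)) \<le> norm (C * norm (G y))"
      using mult_right_mono[OF Hb norm_ge_zero] C by (intro AE_I2) (simp add: norm_mult mult.commute)
  qed measurable
  have eG: "ell1 A (\<lambda>y. G (y + p))" and eH: "ell1 A (\<lambda>y. H (y + p))" if "p \<in> cell" for p
    by (rule symbol_translate_summable[OF m G \<rho>(1) \<rho>(2)[OF that]], rule symbol_translate_summable[OF l H \<rho>(1) \<rho>(2)[OF that]])
  have hG: "has_bochner_integral lborel (\<lambda>p. indicator cell p *\<^sub>R sG p) (\<integral>y. G y \<partial>lborel)"
    unfolding sG_def by (rule has_bochner_integral_tiling[OF intG eG[unfolded ell1_def]])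
  have hH: "has_bochner_integral lborel (\<lambda>p. indicator cell p *\<^sub>R sH p) (\<integral>y. H y \<partial>lborel)"
    unfolding sH_def by (rule has_bochner_integral_tiling[OF intH eH[unfolded ell1_def]])
  have hS: "has_bochner_integral lborel (\<lambda>p. indicator cell p *\<^sub>R S p x) (I x)" for x
  proof -
    have sum: "(\<lambda>y. norm (G (y + p) * H (x - (y + p)))) summable_on L" if "p \<in> cell" for p
    proof (rule infsum_norm_le(1)[OF summable_on_cmult_left[OF eG[OF that, unfolded ell1_def], of C]])
      fix y
      show "norm (G (y + p) * H (x - (y + p))) \<le> norm (G (y + p)) * C"
        unfolding norm_mult by (rule mult_left_mono[OF Hb norm_ge_zero])
    qed
    have "S p x = (\<Sum>\<^sub>\<infinity>y\<in>L. G (y + p) * H (x - (y + p)))" for p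
      unfolding S_def lattice_conv_def by (rule infsum_cong) (simp only: diff_diff_eq)
    then show ?thesis
      using has_bochner_integral_tiling[OF intGH[of x] sum] unfolding I(1) by (simp only:)
  qed
  have hc: "has_bochner_integral lborel (\<lambda>p. indicator cell p *\<^sub>R c) (of_real ?V * c)" for c :: complex
    using has_bochner_integral_indicator[of cell lborel c] lattice_cell_measure[OF inv]
    by (simp add: scaleR_conv_of_real)
  have hk: "has_bochner_integral lborel (\<lambda>p. indicator cell p *\<^sub>R c) (?V * c)" for c :: real
    using has_bochner_integral_indicator[of cell lborel c] lattice_cell_measure[OF inv] by simp
  have "norm (of_real ?V * lattice_conv A U W x
      - (I x + (of_real ?V * infsum U L - (\<integral>y. G y \<partial>lborel)) * W x
             + (of_real ?V * infsum W L - (\<integral>y. H y \<partial>lborel)) * U x)) \<le> (?V * K) * wt ?k x" if x: "x \<in> L" for x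
  proof -
    define c where "c = lattice_conv A U W x - infsum U L * W x - infsum W L * U x"
    define E where "E p = (S p x + S p (- x)) / 2 - (lattice_conv A U W x - (infsum U L - sG p) * W x - (infsum W L - sH p) * U x)" for p
    have "has_bochner_integral lborel
        (\<lambda>p. indicator cell p *\<^sub>R S p x / 2 + indicator cell p *\<^sub>R S p (- x) / 2 - indicator cell p *\<^sub>R c
           - (indicator cell p *\<^sub>R sG p) * W x - (indicator cell p *\<^sub>R sH p) * U x)
        (I x / 2 + I (- x) / 2 - of_real ?V * c - (\<integral>y. G y \<partial>lborel) * W x - (\<integral>y. H y \<partial>lborel) * U x)"
      by (intro has_bochner_integral_diff has_bochner_integral_add has_bochner_integral_divide_zero
          has_bochner_integral_mult_left hG hH hS hc)
    moreover have "indicator cell p *\<^sub>R S p x / 2 + indicator cell p *\<^sub>R S p (- x) / 2 - indicator cell p *\<^sub>R c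
           - (indicator cell p *\<^sub>R sG p) * W x - (indicator cell p *\<^sub>R sH p) * U x = indicator cell p *\<^sub>R E p" for p
    proof (cases "p \<in> cell")
      case True
      have "s / 2 + t / 2 - (cv - u * w' - v * u') - g * w' - h * u' = (s + t) / 2 - (cv - (u - g) * w' - (v - h) * u')"
        for s t cv u w' v u' g h :: complex by (simp add: field_simps)
      then show ?thesis unfolding E_def c_def using True by simp
    qed simp
    ultimately have hE: "has_bochner_integral lborel (\<lambda>p. indicator cell p *\<^sub>R E p)
        (I x / 2 + I (- x) / 2 - of_real ?V * c - (\<integral>y. G y \<partial>lborel) * W x - (\<integral>y. H y \<partial>lborel) * U x)"
      by (simp only:)
    have eq: "of_real ?V * lattice_conv A U W x
      - (I x + (of_real ?V * infsum U L - (\<integral>y. G y \<partial>lborel)) * W x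
             + (of_real ?V * infsum W L - (\<integral>y. H y \<partial>lborel)) * U x)
      = - (\<integral>p. indicator cell p *\<^sub>R E p \<partial>lborel)"
    proof -
      have "V * cv - (i + (V * u - g) * w' + (V * v - h) * u') = - (i / 2 + i / 2 - V * (cv - u * w' - v * u') - g * w' - h * u')"
        for V cv i u g w' v h u' :: complex by (simp add: field_simps)
      then show ?thesis
        unfolding has_bochner_integral_integral_eq[OF hE] I(2) c_def .
    qed
    have "norm (\<integral>p. indicator cell p *\<^sub>R E p \<partial>lborel) \<le> (\<integral>p. norm (indicator cell p *\<^sub>R E p) \<partial>lborel)"
      by (rule integral_norm_bound)
    also have "\<dots> \<le> (\<integral>p. indicator cell p *\<^sub>R (K * wt ?k x) \<partial>lborel)"
    proof (rule integral_mono)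
      show "integrable lborel (\<lambda>p. norm (indicator cell p *\<^sub>R E p))"
        by (rule integrable_norm[OF integrable.intros[OF hE]])
      show "integrable lborel (\<lambda>p. indicator cell p *\<^sub>R (K * wt ?k x))" using hk by (rule integrable.intros)
      fix p :: "real^'n"
      show "norm (indicator cell p *\<^sub>R E p) \<le> indicator cell p *\<^sub>R (K * wt ?k x)"
        using K[OF \<rho>(2) x, of p] unfolding E_def by (cases "p \<in> cell") simp_all
    qed
    also have "(\<integral>p. indicator cell p *\<^sub>R (K * wt ?k x) \<partial>lborel) = ?V * (K * wt ?k x)"
      by (rule has_bochner_integral_integral_eq[OF hk])
    finally show ?thesis unfolding eq norm_minus_cancel mult.assoc .
  qed
  then show ?thesis using that by blast
qed

lemma covolume_pos: "covolume A > 0"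
  using inv by (simp add: covolume_def invertible_det_nz)

text \<open>At the origin the power kernel is 0 by definition, and the discrepancy there is absorbed in the constant.\<close>

lemma power_kernel_approximation:
  assumes s: "Re s > real CARD('n)" and \<rho>: "\<rho> \<ge> 0"
  obtains C where "symbol \<rho> (Re s) (smooth_kernel s :: real^'n \<Rightarrow> complex) C"
    "\<And>y. y \<in> L \<Longrightarrow> norm (power_kernel s y - smooth_kernel s y) \<le> C * wt (Re s + 2) y"
proof -
  obtain c where c: "c > 0" "\<And>x. x \<in> L \<Longrightarrow> x \<noteq> 0 \<Longrightarrow> norm x \<ge> c" using lattice_min_norm[OF inv] by blast
  have s0: "Re s > 0" using s by (auto intro: order_le_less_trans)
  obtain C where C: "symbol \<rho> (Re s) (smooth_kernel s :: real^'n \<Rightarrow> complex) C"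
    using smooth_kernel_symbol[OF s0 \<rho>] by blast
  define B where "B = Gamma (Re s / 2 + 1) / norm (Gamma (s / 2))"
  have B: "B \<ge> 0" unfolding B_def using s0 by (intro divide_nonneg_nonneg less_imp_le[OF Gamma_real_pos]) auto
  define D where "D = C + B * (1 + 1 / c) powr (Re s + 2) + norm (smooth_kernel s (0 :: real^'n))"
  have C0: "C \<ge> 0" using C unfolding symbol_def by blast
  have D: "C \<le> D" "B * (1 + 1 / c) powr (Re s + 2) \<le> D" "norm (smooth_kernel s (0 :: real^'n)) \<le> D"
    unfolding D_def using B C0 by auto
  have "norm (power_kernel s y - smooth_kernel s y) \<le> D * wt (Re s + 2) y" if y: "y \<in> L" for y
  proof (cases "y = 0")
    case True
    then show ?thesis using D(3) by (simp add: power_kernel_def wt_def)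
  next
    case False
    have "norm (power_kernel s y - smooth_kernel s y) \<le> B * norm y powr (- (Re s + 2))"
      using power_kernel_error[OF s0 False] unfolding B_def by simp
    also have "\<dots> \<le> B * ((1 + 1 / c) powr (Re s + 2) * wt (Re s + 2) y)"
      using B s0 by (intro mult_left_mono norm_powr_le_wt c y False) auto
    also have "\<dots> \<le> D * wt (Re s + 2) y"
      unfolding mult.assoc[symmetric] by (rule mult_right_mono[OF D(2) wt_nonneg])
    finally show ?thesis .
  qed
  then show ?thesis using that symbol_mono[OF C D(1)] by blast
  qed

text \<open>The integrals of the smoothed kernels appear with opposite signs in the comparison with the lattice and in the
  asymptotics of the convolution integral; they cancel, and only the lattice masses survive.\<close>

theorem power_kernel_lattice_conv:
  fixes \<nu> \<mu> :: complex
  assumes \<nu>: "Re \<nu> > real CARD('n)" "\<nu> \<notin> polar_exponents CARD('n)"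
    and \<mu>: "Re \<mu> > real CARD('n)" "\<mu> \<notin> polar_exponents CARD('n)"
  defines "R \<equiv> c_const CARD('n) \<nu> * c_const CARD('n) \<mu> / of_real (covolume A) * inv_c_const CARD('n) (\<nu> + \<mu> - of_nat CARD('n))"
  shows "\<exists>K. \<forall>x\<in>L - {0}.
     norm (lattice_conv A (power_kernel \<nu>) (power_kernel \<mu>) x
       - (R * power_kernel (\<nu> + \<mu> - of_nat CARD('n)) x
          + infsum (power_kernel \<nu>) L * power_kernel \<mu> x
          + infsum (power_kernel \<mu>) L * power_kernel \<nu> x))
      \<le> K * wt (min (Re \<nu>) (Re \<mu>) + 2) x"
proof -
  obtain \<rho> where \<rho>: "\<rho> \<ge> 0" "\<And>p. p \<in> cell \<Longrightarrow> norm p \<le> \<rho>" using lattice_cell_bounded[of A] by blast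
  obtain c where c: "c > 0" "\<And>x. x \<in> L \<Longrightarrow> x \<noteq> 0 \<Longrightarrow> norm x \<ge> c" using lattice_min_norm[OF inv] by blast
  obtain C1 where C1: "symbol \<rho> (Re \<nu>) (smooth_kernel \<nu> :: real^'n \<Rightarrow> complex) C1"
    "\<And>y. y \<in> L \<Longrightarrow> norm (power_kernel \<nu> y - smooth_kernel \<nu> y) \<le> C1 * wt (Re \<nu> + 2) y"
    using power_kernel_approximation[OF \<nu>(1) \<rho>(1)] by blast
  obtain C2 where C2: "symbol \<rho> (Re \<mu>) (smooth_kernel \<mu> :: real^'n \<Rightarrow> complex) C2"
    "\<And>y. y \<in> L \<Longrightarrow> norm (power_kernel \<mu> y - smooth_kernel \<mu> y) \<le> C2 * wt (Re \<mu> + 2) y"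
    using power_kernel_approximation[OF \<mu>(1) \<rho>(1)] by blast
  define C where "C = max C1 C2"
  define I where "I x = (\<integral>y. smooth_kernel \<nu> y * smooth_kernel \<mu> (x - y) \<partial>lborel)" for x :: "real^'n"
  have Ieven: "I (- x) = I x" for x
    using profile_convolution(1)[of "\<nu> / 2" "\<mu> / 2" x] profile_convolution(1)[of "\<nu> / 2" "\<mu> / 2" "- x"] \<nu> \<mu>
    unfolding I_def smooth_kernel_def by (simp add: norm_minus_commute)
  have ev: "even_on_lattice A (power_kernel s)" for s
    by (simp add: even_on_lattice_def power_kernel_def)
  let ?V = "complex_of_real (covolume A)" and ?k = "min (Re \<nu>) (Re \<mu>) + 2"
  let ?G = "\<integral>y. smooth_kernel \<nu> (y :: real^'n) \<partial>lborel" and ?H = "\<integral>y. smooth_kernel \<mu> (y :: real^'n) \<partial>lborel"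
  have w: "C1 * wt s y \<le> C * wt s y" "C2 * wt s y \<le> C * wt s y" for s and y :: "real^'n"
    by (auto simp: C_def intro!: mult_right_mono)
  obtain K1 where K1: "\<And>x. x \<in> L \<Longrightarrow>
    norm (?V * lattice_conv A (power_kernel \<nu>) (power_kernel \<mu>) x
      - (I x + (?V * infsum (power_kernel \<nu>) L - ?G) * power_kernel \<mu> x
             + (?V * infsum (power_kernel \<mu>) L - ?H) * power_kernel \<nu> x)) \<le> K1 * wt ?k x"
    using averaged_conv_error[OF \<nu>(1) \<mu>(1) \<rho> symbol_mono[OF C1(1)] symbol_mono[OF C2(1)] ev ev
        order_trans[OF C1(2) w(1)] order_trans[OF C2(2) w(2)] I_def Ieven]
    unfolding C_def by (metis max.cobounded1 max.cobounded2)
  define P where "P = c_const CARD('n) \<nu> * c_const CARD('n) \<mu> * inv_c_const CARD('n) (\<nu> + \<mu> - of_nat CARD('n))"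
  obtain K2 where K2: "\<And>x :: real^'n. norm x \<ge> c \<Longrightarrow>
     norm (I x - (P * power_kernel (\<nu> + \<mu> - of_nat CARD('n)) x + ?G * power_kernel \<mu> x + ?H * power_kernel \<nu> x)) \<le> K2 * wt ?k x"
    using smooth_kernel_convolution[OF \<nu> \<mu> c(1)] unfolding I_def P_def by blast
  have V: "covolume A > 0" by (rule covolume_pos)
  have "norm (lattice_conv A (power_kernel \<nu>) (power_kernel \<mu>) x
       - (R * power_kernel (\<nu> + \<mu> - of_nat CARD('n)) x
          + infsum (power_kernel \<nu>) L * power_kernel \<mu> x
          + infsum (power_kernel \<mu>) L * power_kernel \<nu> x)) \<le> (K1 + K2) / covolume A * wt ?k x"
    if x: "x \<in> L" "x \<noteq> 0" for x
  proof -
    have alg: "cv - (P / V * q + u * w' + v * u')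
        = ((V * cv - (i + (V * u - g) * w' + (V * v - h) * u')) + (i - (P * q + g * w' + h * u'))) / V"
      if "V \<noteq> 0" for cv q u w' v u' g h i V :: complex using that by (simp add: field_simps)
    have R: "R = P / ?V" by (simp add: R_def P_def)
    have V0: "?V \<noteq> 0" using V by simp
    have N: "norm ((z + t) / ?V) \<le> (K1 + K2) / covolume A * wt ?k x"
      if "norm z \<le> K1 * wt ?k x" "norm t \<le> K2 * wt ?k x" for z t
    proof -
      have "norm (z + t) \<le> (K1 + K2) * wt ?k x"
        using norm_triangle_ineq[of z t] that unfolding distrib_right by linarith
      then have "norm (z + t) / covolume A \<le> (K1 + K2) * wt ?k x / covolume A"
        using V by (intro divide_right_mono) auto
      then show ?thesis using V by (simp add: norm_divide)
    qed
    show ?thesis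
      unfolding R alg[OF V0, where i="I x" and g="?G" and h="?H"] by (rule N[OF K1[OF x(1)] K2[OF c(2)[OF x]]])
  qed
  then show ?thesis by (intro exI[of _ "(K1 + K2) / covolume A"] ballI) blast
qed

end

section \<open>Orders of decay on the lattice\<close>

definition wt_bounded :: "real^'n^'n \<Rightarrow> real \<Rightarrow> (real^'n \<Rightarrow> complex) \<Rightarrow> bool" where
  "wt_bounded A s f \<longleftrightarrow> (\<exists>C. \<forall>y\<in>lattice A. norm (f y) \<le> C * wt s y)"

lemma wt_boundedI: "(\<And>y. y \<in> lattice A \<Longrightarrow> norm (f y) \<le> C * wt s y) \<Longrightarrow> wt_bounded A s f"
  unfolding wt_bounded_def by blast

lemma wt_bounded_off_origin:
  assumes "\<And>y. y \<in> lattice A \<Longrightarrow> y \<noteq> 0 \<Longrightarrow> norm (f y) \<le> C * wt s y"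
  shows "wt_bounded A s f"
proof (rule wt_boundedI)
  fix y assume y: "y \<in> lattice A"
  show "norm (f y) \<le> max C (norm (f 0)) * wt s y"
  proof (cases "y = 0")
    case False
    have "C * wt s y \<le> max C (norm (f 0)) * wt s y" by (intro mult_right_mono) auto
    then show ?thesis using assms[OF y False] by linarith
  qed (simp add: wt_def)
qed

lemma wt_bounded_nonneg_const:
  fixes A :: "real^'n^'n"
  assumes "wt_bounded A s f"
  obtains C where "C \<ge> 0" "\<And>y. y \<in> lattice A \<Longrightarrow> norm (f y) \<le> C * wt s y"
proof -
  obtain C where C: "\<And>y. y \<in> lattice A \<Longrightarrow> norm (f y) \<le> C * wt s y" using assms unfolding wt_bounded_def by blast
  have "0 \<le> C * wt s (0 :: real^'n)" by (rule order_trans[OF norm_ge_zero C[OF lattice_0]])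
  then show ?thesis using C that by (simp add: wt_def)
qed

lemma wt_bounded_mono:
  assumes "wt_bounded A t f" "s \<le> t" shows "wt_bounded A s f"
proof -
  obtain C where C: "C \<ge> 0" "\<And>y. y \<in> lattice A \<Longrightarrow> norm (f y) \<le> C * wt t y"
    using wt_bounded_nonneg_const[OF assms(1)] by blast
  show ?thesis
    by (rule wt_boundedI[of _ _ C]) (rule order_trans[OF C(2) mult_left_mono[OF wt_mono_exponent[OF assms(2)] C(1)]])
qed

lemma wt_bounded_add:
  assumes "wt_bounded A s f" "wt_bounded A s g" shows "wt_bounded A s (\<lambda>x. f x + g x)"
proof -
  obtain C D where "\<And>y. y \<in> lattice A \<Longrightarrow> norm (f y) \<le> C * wt s y" "\<And>y. y \<in> lattice A \<Longrightarrow> norm (g y) \<le> D * wt s y"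
    using assms unfolding wt_bounded_def by blast
  then show ?thesis
    by (intro wt_boundedI[of _ _ "C + D"]) (simp only: distrib_right norm_triangle_mono)
qed

lemma wt_bounded_cmult:
  assumes "wt_bounded A s f" shows "wt_bounded A s (\<lambda>x. c * f x)"
proof -
  obtain C where "\<And>y. y \<in> lattice A \<Longrightarrow> norm (f y) \<le> C * wt s y"
    using assms unfolding wt_bounded_def by blast
  then show ?thesis
    by (intro wt_boundedI[of _ _ "norm c * C"]) (simp only: norm_mult mult.assoc mult_left_mono norm_ge_zero)
qed

lemma wt_bounded_zero: "wt_bounded A s (\<lambda>x. 0)"
  by (rule wt_boundedI[of _ _ 0]) simp

lemma wt_bounded_sum:
  assumes "\<And>i. i \<in> I \<Longrightarrow> wt_bounded A s (f i)" shows "wt_bounded A s (\<lambda>x. \<Sum>i\<in>I. f i x)"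
  using assms
proof (induction I rule: infinite_finite_induct)
  case (insert i I)
  then show ?case using wt_bounded_add[of A s "f i" "\<lambda>x. \<Sum>i\<in>I. f i x"] by simp
qed (auto simp: wt_bounded_zero)

lemma wt_bounded_cong:
  "wt_bounded A s f \<Longrightarrow> (\<And>x. x \<in> lattice A \<Longrightarrow> g x = f x) \<Longrightarrow> wt_bounded A s g"
  unfolding wt_bounded_def by simp

lemma decays_iff_wt_bounded:
  assumes inv: "invertible A" and s: "s \<ge> 0"
  shows "decays A s f \<longleftrightarrow> wt_bounded A s f"
proof
  obtain c where c: "c > 0" "\<And>x. x \<in> lattice A \<Longrightarrow> x \<noteq> 0 \<Longrightarrow> norm x \<ge> c" using lattice_min_norm[OF inv] by blast
  assume "decays A s f"
  then obtain C where C: "C > 0" "\<And>x. x \<in> lattice A - {0} \<Longrightarrow> norm (f x) \<le> C * norm x powr (- s)"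
    unfolding decays_def by blast
  show "wt_bounded A s f"
  proof (rule wt_bounded_off_origin)
    fix y assume y: "y \<in> lattice A" "y \<noteq> 0"
    have "norm (f y) \<le> C * norm y powr (- s)" using C(2) y by simp
    also have "\<dots> \<le> C * ((1 + 1 / c) powr s * wt s y)"
      using C(1) by (intro mult_left_mono norm_powr_le_wt[OF c(1) c(2)[OF y] s]) auto
    finally show "norm (f y) \<le> (C * (1 + 1 / c) powr s) * wt s y" by (simp only: mult.assoc)
  qed
next
  assume "wt_bounded A s f"
  then obtain C where C: "C \<ge> 0" "\<And>y. y \<in> lattice A \<Longrightarrow> norm (f y) \<le> C * wt s y"
    by (rule wt_bounded_nonneg_const) blast
  have "norm (f x) \<le> (C + 1) * norm x powr (- s)" if x: "x \<in> lattice A - {0}" for x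
  proof -
    have "wt s x \<le> norm x powr (- s)" unfolding wt_def using x s by (intro powr_mono2') auto
    then have "C * wt s x \<le> (C + 1) * norm x powr (- s)" using C(1) by (intro mult_mono) auto
    then show ?thesis using C(2)[of x] x by auto
  qed
  then show "decays A s f" unfolding decays_def using C(1) by (intro exI[of _ "C + 1"]) auto
qed

lemma wt_bounded_power_kernel:
  assumes inv: "invertible A" and s: "s \<ge> 0" "Re \<nu> \<ge> s"
  shows "wt_bounded A s (power_kernel \<nu> :: real^'n \<Rightarrow> complex)"
proof (rule wt_bounded_mono[OF _ s(2)])
  have "Re \<nu> \<ge> 0" using s by linarith
  then have "decays A (Re \<nu>) (power_kernel \<nu>) \<longleftrightarrow> wt_bounded A (Re \<nu>) (power_kernel \<nu>)"
    by (rule decays_iff_wt_bounded[OF inv])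
  moreover have "decays A (Re \<nu>) (power_kernel \<nu>)"
    unfolding decays_def by (intro exI[of _ 1]) (auto simp: power_kernel_def norm_of_real_powr)
  ultimately show "wt_bounded A (Re \<nu>) (power_kernel \<nu>)" by blast
qed

lemma ell1_wt_bounded:
  fixes A :: "real^'n^'n"
  assumes "invertible A" "s > real CARD('n)" "wt_bounded A s f" shows "ell1 A f"
  using assms(3) ell1_bounded_by_wt[OF assms(1,2)] unfolding wt_bounded_def by blast

lemma power_kernel_minus: "power_kernel s (- x) = power_kernel s x"
  by (simp add: power_kernel_def)

section \<open>Expansion of the product kernel\<close>

context tiling begin

lemma ell1_power_kernel: "Re \<nu> > real CARD('n) \<Longrightarrow> ell1 A (power_kernel \<nu>)"
  by (rule ell1_wt_bounded[OF inv _ wt_bounded_power_kernel[OF inv]]) auto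

lemma regular_conv_power_kernel:
  assumes a: "even_on_lattice A a" "wt_bounded A g a" "g > real CARD('n)" and \<nu>: "Re \<nu> > real CARD('n)"
  shows "wt_bounded A (min g (Re \<nu> + 2)) (\<lambda>x. lattice_conv A a (power_kernel \<nu>) x - infsum a L * power_kernel \<nu> x)"
proof -
  obtain D where D: "\<And>y. y \<in> L \<Longrightarrow> norm (a y) \<le> D * wt g y" using a(2) unfolding wt_bounded_def by blast
  have n0: "Re \<nu> \<ge> 0" using \<nu> by (auto intro: order_trans[OF _ less_imp_le])
  obtain E where E: "\<And>y. y \<in> L \<Longrightarrow> norm (power_kernel \<nu> y) \<le> E * wt (Re \<nu>) y"
    using wt_bounded_power_kernel[OF inv n0 order_refl] unfolding wt_bounded_def by blast
  obtain C where C: "symbol 0 (Re \<nu>) (smooth_kernel \<nu> :: real^'n \<Rightarrow> complex) C"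
    "\<And>y. y \<in> L \<Longrightarrow> norm (power_kernel \<nu> y - smooth_kernel \<nu> y) \<le> C * wt (Re \<nu> + 2) y"
    using power_kernel_approximation[OF \<nu> order_refl] by blast
  have h2: "norm (smooth_kernel \<nu> (x + y) + smooth_kernel \<nu> (x - y) - 2 * smooth_kernel \<nu> x) \<le> C * (norm y)\<^sup>2 * wt (Re \<nu> + 2) x"
    if "norm y \<le> norm x / 2" for x y :: "real^'n" using C(1) that unfolding symbol_def by blast
  obtain K where "K \<ge> C" and K: "\<And>x y. x \<in> L \<Longrightarrow> y \<in> L \<Longrightarrow> norm y \<le> norm x / 2 \<Longrightarrow>
     norm (power_kernel \<nu> (x + y) + power_kernel \<nu> (x - y) - 2 * power_kernel \<nu> x) \<le> K * (norm y)\<^sup>2 * wt (Re \<nu> + 2) x"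
    proof (rule perturbed_second_difference[OF inv n0 h2 C(2)])
    fix K
    assume "K \<ge> C" "\<And>x y. x \<in> L \<Longrightarrow> y \<in> L \<Longrightarrow> norm y \<le> norm x / 2 \<Longrightarrow>
       norm (power_kernel \<nu> (x + y) + power_kernel \<nu> (x - y) - 2 * power_kernel \<nu> x) \<le> K * (norm y)\<^sup>2 * wt (Re \<nu> + 2) x"
    then show ?thesis by (rule that)
  qed
  define B where "B = max E K"
  have B1: "norm (power_kernel \<nu> y) \<le> B * wt (Re \<nu>) y" if "y \<in> L" for y
    by (rule order_trans[OF E[OF that]]) (auto simp: B_def intro: mult_right_mono)
  have B2: "norm (power_kernel \<nu> (x + y) + power_kernel \<nu> (x - y) - 2 * power_kernel \<nu> x) \<le> B * (norm y)\<^sup>2 * wt (Re \<nu> + 2) x"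
    if "x \<in> L" "y \<in> L" "norm y \<le> norm x / 2" for x y
    by (rule order_trans[OF K[OF that]]) (auto simp: B_def intro!: mult_right_mono)
  show ?thesis by (rule wt_boundedI, rule regular_conv[OF inv \<nu> a(3) a(1) D B1 B2])
qed

lemma power_kernel_conv_power_kernel:
  assumes \<nu>: "Re \<nu> > real CARD('n)" "\<nu> \<notin> polar_exponents CARD('n)"
    and \<mu>: "Re \<mu> > real CARD('n)" "\<mu> \<notin> polar_exponents CARD('n)"
  shows "wt_bounded A (min (Re \<nu>) (Re \<mu>) + 2) (\<lambda>x. lattice_conv A (power_kernel \<nu>) (power_kernel \<mu>) x
       - (c_const CARD('n) \<nu> * c_const CARD('n) \<mu> / of_real (covolume A) * inv_c_const CARD('n) (\<nu> + \<mu> - of_nat CARD('n))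
            * power_kernel (\<nu> + \<mu> - of_nat CARD('n)) x
          + infsum (power_kernel \<nu>) L * power_kernel \<mu> x
          + infsum (power_kernel \<mu>) L * power_kernel \<nu> x))"
  (is "wt_bounded A ?s ?f")
proof -
  obtain K where K: "\<forall>x\<in>L - {0}. norm (?f x) \<le> K * wt ?s x"
    using power_kernel_lattice_conv[OF \<nu> \<mu>] by (rule exE)
  show ?thesis by (rule wt_bounded_off_origin[of A ?f K], rule K[rule_format]) simp
qed

text \<open>The kernel whose transform is the explicit part of the product, with \<open>z1\<close> and \<open>z2\<close> for the values of the two
  factors at zero.\<close>

definition epstein_product_kernel :: "nat \<Rightarrow> nat \<Rightarrow> (nat \<Rightarrow> complex) \<Rightarrow> (nat \<Rightarrow> complex) \<Rightarrow> (nat \<Rightarrow> complex) \<Rightarrow> (nat \<Rightarrow> complex)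
    \<Rightarrow> complex \<Rightarrow> complex \<Rightarrow> real^'n \<Rightarrow> complex" where
  "epstein_product_kernel N1 N2 b1 b2 \<nu>1 \<nu>2 z1 z2 x =
     (\<Sum>i<N1. \<Sum>j<N2. b1 i * b2 j
        * (c_const CARD('n) (\<nu>1 i) * c_const CARD('n) (\<nu>2 j) / of_real (covolume A)
           * inv_c_const CARD('n) (\<nu>1 i + \<nu>2 j - of_nat CARD('n)))
        * power_kernel (\<nu>1 i + \<nu>2 j - of_nat CARD('n)) x)
     + z2 * (\<Sum>i<N1. b1 i * power_kernel (\<nu>1 i) x) + z1 * (\<Sum>j<N2. b2 j * power_kernel (\<nu>2 j) x)"

text \<open>Expanding both kernels, every product with a regular factor is the total mass of the regular factor times the other
  kernel up to a regular error; the masses of the regular parts and of the powers add up to those of the whole kernels.\<close>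

lemma product_kernel_expansion:
  fixes N1 N2 :: nat and b1 b2 \<nu>1 \<nu>2 :: "nat \<Rightarrow> complex"
  assumes a1: "even_on_lattice A a1" "wt_bounded A \<gamma>1 a1" "\<gamma>1 > real CARD('n)"
    and a2: "even_on_lattice A a2" "wt_bounded A \<gamma>2 a2" "\<gamma>2 > real CARD('n)"
    and \<nu>1: "\<And>i. i < N1 \<Longrightarrow> Re (\<nu>1 i) > real CARD('n)" "\<And>i. i < N1 \<Longrightarrow> \<nu>1 i \<notin> polar_exponents CARD('n)"
    and \<nu>2: "\<And>j. j < N2 \<Longrightarrow> Re (\<nu>2 j) > real CARD('n)" "\<And>j. j < N2 \<Longrightarrow> \<nu>2 j \<notin> polar_exponents CARD('n)"
    and \<gamma>: "\<gamma> \<le> \<gamma>1" "\<gamma> \<le> \<gamma>2" "\<And>i. i < N1 \<Longrightarrow> \<gamma> \<le> Re (\<nu>1 i) + 2" "\<And>j. j < N2 \<Longrightarrow> \<gamma> \<le> Re (\<nu>2 j) + 2"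
  defines "K1 \<equiv> \<lambda>x. a1 x + (\<Sum>i<N1. b1 i * power_kernel (\<nu>1 i) x)"
    and "K2 \<equiv> \<lambda>x. a2 x + (\<Sum>j<N2. b2 j * power_kernel (\<nu>2 j) x)"
  defines "a3 \<equiv> \<lambda>x. lattice_conv A K1 K2 x - epstein_product_kernel N1 N2 b1 b2 \<nu>1 \<nu>2 (infsum K1 L) (infsum K2 L) x"
  shows "ell1 A K1" "ell1 A K2" "even_on_lattice A a3" "wt_bounded A \<gamma> a3"
proof -
  let ?d = "CARD('n)"
  let ?R = "\<lambda>i j. c_const ?d (\<nu>1 i) * c_const ?d (\<nu>2 j) / of_real (covolume A) * inv_c_const ?d (\<nu>1 i + \<nu>2 j - of_nat ?d)"
  let ?k1 = "\<lambda>i. power_kernel (\<nu>1 i)" and ?k2 = "\<lambda>j. power_kernel (\<nu>2 j)" and ?k3 = "\<lambda>i j. power_kernel (\<nu>1 i + \<nu>2 j - of_nat ?d)"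
  let ?c = "lattice_conv A"
  have ea: "ell1 A a1" "ell1 A a2" by (rule ell1_wt_bounded[OF inv a1(3,2)], rule ell1_wt_bounded[OF inv a2(3,2)])
  have e1: "ell1 A (\<lambda>x. b1 i * ?k1 i x)" if "i \<in> {..<N1}" for i
    using \<nu>1(1) that by (intro ell1_cmult ell1_power_kernel) simp
  have e2: "ell1 A (\<lambda>x. b2 j * ?k2 j x)" if "j \<in> {..<N2}" for j
    using \<nu>2(1) that by (intro ell1_cmult ell1_power_kernel) simp
  have p1: "ell1 A (?k1 i)" if "i \<in> {..<N1}" for i using \<nu>1(1) that by (intro ell1_power_kernel) simp
  have p2: "ell1 A (?k2 j)" if "j \<in> {..<N2}" for j using \<nu>2(1) that by (intro ell1_power_kernel) simp
  have s1: "ell1 A (\<lambda>x. \<Sum>i<N1. b1 i * ?k1 i x)" by (rule ell1_sum[OF e1])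
  have s2: "ell1 A (\<lambda>x. \<Sum>j<N2. b2 j * ?k2 j x)" by (rule ell1_sum[OF e2])
  show eK1: "ell1 A K1" unfolding K1_def by (rule ell1_add[OF ea(1) s1])
  show eK2: "ell1 A K2" unfolding K2_def by (rule ell1_add[OF ea(2) s2])
  have mass: "infsum K L = infsum a L + (\<Sum>i<N. b i * infsum (power_kernel (\<nu> i)) L)"
    if K: "K = (\<lambda>x. a x + (\<Sum>i<N. b i * power_kernel (\<nu> i) x))" and a: "ell1 A a"
      and n: "\<And>i. i < N \<Longrightarrow> Re (\<nu> i) > real CARD('n)" for K a b \<nu> and N :: nat
  proof -
    have e: "ell1 A (\<lambda>x. b i * power_kernel (\<nu> i) x)" if "i \<in> {..<N}" for i
      using n that by (intro ell1_cmult ell1_power_kernel) simp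
    show ?thesis
    proof -
      have s: "ell1 A (\<lambda>x. \<Sum>i<N. b i * power_kernel (\<nu> i) x)" by (rule ell1_sum[OF e])
      have "lattice_fourier A (\<lambda>x. \<Sum>i<N. b i * power_kernel (\<nu> i) x) 0 = (\<Sum>i<N. lattice_fourier A (\<lambda>x. b i * power_kernel (\<nu> i) x) 0)"
        by (rule lattice_fourier_sum[OF e])
      then show ?thesis
        using lattice_fourier_add[OF a s, where k=0] unfolding K lattice_fourier_cmult lattice_fourier_0 by (simp only:)
    qed
  qed
  have z1: "infsum K1 L = infsum a1 L + (\<Sum>i<N1. b1 i * infsum (?k1 i) L)"
    by (rule mass[OF _ ea(1) \<nu>1(1)]) (simp only: K1_def)
  have z2: "infsum K2 L = infsum a2 L + (\<Sum>j<N2. b2 j * infsum (?k2 j) L)"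
    by (rule mass[OF _ ea(2) \<nu>2(1)]) (simp only: K2_def)
  have evK: "even_on_lattice A K1" "even_on_lattice A K2"
    using a1(1) a2(1) unfolding even_on_lattice_def K1_def K2_def by (auto simp: power_kernel_minus)
  have "even_on_lattice A (lattice_conv A K1 K2)" by (rule lattice_conv_even[OF evK])
  then show "even_on_lattice A a3"
    unfolding even_on_lattice_def a3_def epstein_product_kernel_def by (auto simp: power_kernel_minus)
  define w1 where "w1 j x = ?c a1 (?k2 j) x - infsum a1 L * ?k2 j x" for j x
  define w2 where "w2 i x = ?c a2 (?k1 i) x - infsum a2 L * ?k1 i x" for i x
  define w3 where "w3 i j x = ?c (?k1 i) (?k2 j) x - (?R i j * ?k3 i j x + infsum (?k1 i) L * ?k2 j x + infsum (?k2 j) L * ?k1 i x)" for i j x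
  have b1: "wt_bounded A \<gamma> (w1 j)" if "j \<in> {..<N2}" for j
    unfolding w1_def[abs_def] using that \<gamma> by (intro wt_bounded_mono[OF regular_conv_power_kernel[OF a1 \<nu>2(1)]]) auto
  have b2: "wt_bounded A \<gamma> (w2 i)" if "i \<in> {..<N1}" for i
    unfolding w2_def[abs_def] using that \<gamma> by (intro wt_bounded_mono[OF regular_conv_power_kernel[OF a2 \<nu>1(1)]]) auto
  have b3: "wt_bounded A \<gamma> (w3 i j)" if "i \<in> {..<N1}" "j \<in> {..<N2}" for i j
    unfolding w3_def[abs_def] using that \<gamma>(3)[of i] \<gamma>(4)[of j]
    by (intro wt_bounded_mono[OF power_kernel_conv_power_kernel[OF \<nu>1 \<nu>2]]) auto
  have b0: "wt_bounded A \<gamma> (?c a1 a2)"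
  proof -
    obtain C D where CD: "\<And>y. y \<in> L \<Longrightarrow> norm (a1 y) \<le> C * wt \<gamma>1 y" "\<And>y. y \<in> L \<Longrightarrow> norm (a2 y) \<le> D * wt \<gamma>2 y"
      using a1(2) a2(2) unfolding wt_bounded_def by blast
    have "wt_bounded A (min \<gamma>1 \<gamma>2) (?c a1 a2)"
      by (rule wt_boundedI, rule lattice_conv_decay[OF inv a1(3) a2(3) CD])
    then show ?thesis by (rule wt_bounded_mono) (use \<gamma> in simp)
  qed
  have "wt_bounded A \<gamma> (\<lambda>x. ?c a1 a2 x + (\<Sum>j<N2. b2 j * w1 j x) + (\<Sum>i<N1. b1 i * w2 i x) + (\<Sum>i<N1. \<Sum>j<N2. b1 i * b2 j * w3 i j x))"
    by (intro wt_bounded_add wt_bounded_sum wt_bounded_cmult b0 b1 b2 b3)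
  then show "wt_bounded A \<gamma> a3"
  proof (rule wt_bounded_cong)
    fix x assume x: "x \<in> L"
    have 1: "?c K1 K2 x = ?c a1 K2 x + (\<Sum>i<N1. b1 i * ?c (?k1 i) K2 x)"
    proof -
      have "?c (\<lambda>x. \<Sum>i<N1. b1 i * ?k1 i x) K2 x = (\<Sum>i<N1. ?c (\<lambda>x. b1 i * ?k1 i x) K2 x)"
        by (rule lattice_conv_sum_left[OF e1 eK2 x])
      then show ?thesis unfolding K1_def lattice_conv_add_left[OF ea(1) s1 eK2 x] lattice_conv_cmult_left by (simp only:)
    qed
    have 2: "?c f K2 x = ?c f a2 x + (\<Sum>j<N2. b2 j * ?c f (?k2 j) x)" if f: "ell1 A f" for f
    proof -
      have "?c f (\<lambda>x. \<Sum>j<N2. b2 j * ?k2 j x) x = (\<Sum>j<N2. ?c f (\<lambda>x. b2 j * ?k2 j x) x)"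
        by (rule lattice_conv_sum_right[OF f e2 x])
      then show ?thesis unfolding K2_def lattice_conv_add_right[OF f ea(2) s2 x] lattice_conv_cmult_right by (simp only:)
    qed
    have c1: "?c a1 (?k2 j) x = w1 j x + infsum a1 L * ?k2 j x" for j by (simp add: w1_def)
    have c2: "?c (?k1 i) a2 x = w2 i x + infsum a2 L * ?k1 i x" for i
      by (simp add: w2_def lattice_conv_commute[OF x, of a2])
    have c3: "?c (?k1 i) (?k2 j) x = w3 i j x + (?R i j * ?k3 i j x + infsum (?k1 i) L * ?k2 j x + infsum (?k2 j) L * ?k1 i x)" for i j
      by (simp add: w3_def)
    have sw: "(\<Sum>i<N1. \<Sum>j<N2. b1 i * (b2 j * (infsum (?k1 i) L * ?k2 j x))) = (\<Sum>i<N1. b1 i * infsum (?k1 i) L) * (\<Sum>j<N2. b2 j * ?k2 j x)"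
      unfolding sum_product by (intro sum.cong refl) (simp only: mult_ac)
    have sw': "(\<Sum>i<N1. \<Sum>j<N2. b1 i * (b2 j * (infsum (?k2 j) L * ?k1 i x))) = (\<Sum>j<N2. b2 j * infsum (?k2 j) L) * (\<Sum>i<N1. b1 i * ?k1 i x)"
      unfolding sum_product by (subst sum.swap, intro sum.cong refl) (simp only: mult_ac)
    have "?c K1 K2 x = ?c a1 a2 x + (\<Sum>j<N2. b2 j * w1 j x) + infsum a1 L * (\<Sum>j<N2. b2 j * ?k2 j x)
        + (\<Sum>i<N1. b1 i * w2 i x) + infsum a2 L * (\<Sum>i<N1. b1 i * ?k1 i x)
        + (\<Sum>i<N1. \<Sum>j<N2. b1 i * b2 j * w3 i j x)
        + (\<Sum>i<N1. \<Sum>j<N2. b1 i * b2 j * ?R i j * ?k3 i j x)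
        + (\<Sum>i<N1. b1 i * infsum (?k1 i) L) * (\<Sum>j<N2. b2 j * ?k2 j x) + (\<Sum>j<N2. b2 j * infsum (?k2 j) L) * (\<Sum>i<N1. b1 i * ?k1 i x)"
    proof -
      have A1: "?c a1 K2 x = ?c a1 a2 x + (\<Sum>j<N2. b2 j * w1 j x) + infsum a1 L * (\<Sum>j<N2. b2 j * ?k2 j x)"
        unfolding 2[OF ea(1)] c1 distrib_left sum.distrib sum_distrib_left by (simp only: mult.left_commute add.assoc)
      have "(\<Sum>i<N1. b1 i * ?c (?k1 i) K2 x) = (\<Sum>i<N1. b1 i * w2 i x + b1 i * (infsum a2 L * ?k1 i x)
          + (\<Sum>j<N2. b1 i * b2 j * w3 i j x) + (\<Sum>j<N2. b1 i * b2 j * ?R i j * ?k3 i j x)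
          + (\<Sum>j<N2. b1 i * (b2 j * (infsum (?k1 i) L * ?k2 j x))) + (\<Sum>j<N2. b1 i * (b2 j * (infsum (?k2 j) L * ?k1 i x))))"
      proof (rule sum.cong[OF refl])
        fix i assume i: "i \<in> {..<N1}"
        show "b1 i * ?c (?k1 i) K2 x = b1 i * w2 i x + b1 i * (infsum a2 L * ?k1 i x)
          + (\<Sum>j<N2. b1 i * b2 j * w3 i j x) + (\<Sum>j<N2. b1 i * b2 j * ?R i j * ?k3 i j x)
          + (\<Sum>j<N2. b1 i * (b2 j * (infsum (?k1 i) L * ?k2 j x))) + (\<Sum>j<N2. b1 i * (b2 j * (infsum (?k2 j) L * ?k1 i x)))"
          unfolding 2[OF p1[OF i]] c2 c3 distrib_left sum.distrib sum_distrib_left by (simp only: mult.assoc add.assoc)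
      qed
      also have "\<dots> = (\<Sum>i<N1. b1 i * w2 i x) + infsum a2 L * (\<Sum>i<N1. b1 i * ?k1 i x)
          + (\<Sum>i<N1. \<Sum>j<N2. b1 i * b2 j * w3 i j x) + (\<Sum>i<N1. \<Sum>j<N2. b1 i * b2 j * ?R i j * ?k3 i j x)
          + (\<Sum>i<N1. b1 i * infsum (?k1 i) L) * (\<Sum>j<N2. b2 j * ?k2 j x) + (\<Sum>j<N2. b2 j * infsum (?k2 j) L) * (\<Sum>i<N1. b1 i * ?k1 i x)"
        unfolding sum.distrib sw sw' sum_distrib_left[of "infsum a2 L"] by (simp only: mult.left_commute)
      finally show ?thesis unfolding 1 A1 by (simp only: add.assoc)
    qed
    then show "a3 x = ?c a1 a2 x + (\<Sum>j<N2. b2 j * w1 j x) + (\<Sum>i<N1. b1 i * w2 i x) + (\<Sum>i<N1. \<Sum>j<N2. b1 i * b2 j * w3 i j x)"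
      unfolding a3_def epstein_product_kernel_def z1 z2 distrib_right
      by (simp only: mult.assoc) simp
  qed
qed

end

section \<open>Products of semi-analytic kernels\<close>

text \<open>Semi-analyticity without summability, and with the decay expressed by weights: in this form the property passes to
  finite sums.\<close>

definition representable :: "real^'n^'n \<Rightarrow> (real^'n \<Rightarrow> complex) \<Rightarrow> bool" where
  "representable A f \<longleftrightarrow> (\<exists>a (N::nat) b \<nu>. even_on_lattice A a \<and> wt_bounded A (real CARD('n) + 2) a \<and>
     (\<forall>j<N. Re (\<nu> j) > real CARD('n)) \<and> (\<forall>x\<in>lattice A. f x = a x + (\<Sum>j<N. b j * power_kernel (\<nu> j) x)))"

lemma representableI:
  fixes A :: "real^'n^'n" and N :: nat
  assumes "even_on_lattice A a" "wt_bounded A (real CARD('n) + 2) a" "\<And>j. j < N \<Longrightarrow> Re (\<nu> j) > real CARD('n)"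
    "\<And>x. x \<in> lattice A \<Longrightarrow> f x = a x + (\<Sum>j<N. b j * power_kernel (\<nu> j) x)"
  shows "representable A f"
  unfolding representable_def using assms by blast

lemma semi_analytic_kernel_iff:
  fixes A :: "real^'n^'n"
  assumes "invertible A"
  shows "semi_analytic_kernel A K \<longleftrightarrow> ell1 A K \<and> representable A K"
proof -
  have "decays A (real CARD('n) + 2) a \<longleftrightarrow> wt_bounded A (real CARD('n) + 2) a" for a
    by (rule decays_iff_wt_bounded[OF assms]) simp
  then show ?thesis unfolding semi_analytic_kernel_def representable_def by (simp only:)
qed

lemma representable_cong:
  "representable A f \<Longrightarrow> (\<And>x. x \<in> lattice A \<Longrightarrow> g x = f x) \<Longrightarrow> representable A g"
  unfolding representable_def by simp

lemma representable_regular: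
  fixes A :: "real^'n^'n"
  shows "even_on_lattice A a \<Longrightarrow> wt_bounded A (real CARD('n) + 2) a \<Longrightarrow> representable A a"
  by (rule representableI[where N=0]) simp_all

lemma representable_power_kernel:
  fixes A :: "real^'n^'n"
  shows "Re \<nu> > real CARD('n) \<Longrightarrow> representable A (\<lambda>x. c * power_kernel \<nu> x)"
  by (rule representableI[where N=1 and a="\<lambda>_. 0" and b="\<lambda>_. c" and \<nu>="\<lambda>_. \<nu>"])
    (simp_all add: even_on_lattice_def wt_bounded_zero)

lemma representable_add:
  fixes A :: "real^'n^'n"
  assumes "representable A f" "representable A g"
  shows "representable A (\<lambda>x. f x + g x)"
proof -
  obtain a N b \<nu> where 1: "even_on_lattice A a" "wt_bounded A (real CARD('n) + 2) a" "\<forall>j<N::nat. Re (\<nu> j) > real CARD('n)"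
    "\<forall>x\<in>lattice A. f x = a x + (\<Sum>j<N. b j * power_kernel (\<nu> j) x)"
    using assms(1) unfolding representable_def by (elim exE conjE) (rule that)
  obtain a' N' b' \<nu>' where 2: "even_on_lattice A a'" "wt_bounded A (real CARD('n) + 2) a'" "\<forall>j<N'::nat. Re (\<nu>' j) > real CARD('n)"
    "\<forall>x\<in>lattice A. g x = a' x + (\<Sum>j<N'. b' j * power_kernel (\<nu>' j) x)"
    using assms(2) unfolding representable_def by (elim exE conjE) (rule that)
  define B where "B j = (if j < N then b j else b' (j - N))" for j
  define M where "M j = (if j < N then \<nu> j else \<nu>' (j - N))" for j
  have s: "(\<Sum>j<N + N'. B j * power_kernel (M j) x)
      = (\<Sum>j<N. b j * power_kernel (\<nu> j) x) + (\<Sum>j<N'. b' j * power_kernel (\<nu>' j) x)" for x :: "real^'n"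
  proof -
    have "(\<Sum>j<N + N'. B j * power_kernel (M j) x)
        = (\<Sum>j=0..<N. B j * power_kernel (M j) x) + (\<Sum>j=0..<N'. B (j + N) * power_kernel (M (j + N)) x)"
      using sum.atLeastLessThan_concat[of 0 N "N + N'" "\<lambda>j. B j * power_kernel (M j) x"]
        sum.shift_bounds_nat_ivl[of "\<lambda>j. B j * power_kernel (M j) x" 0 N N']
      by (simp add: atLeast0LessThan add.commute)
    then show ?thesis by (simp add: B_def M_def atLeast0LessThan)
  qed
  show ?thesis
  proof (rule representableI[of A "\<lambda>x. a x + a' x" "N + N'" M _ B])
    show "even_on_lattice A (\<lambda>x. a x + a' x)" using 1(1) 2(1) unfolding even_on_lattice_def by simp
    show "wt_bounded A (real CARD('n) + 2) (\<lambda>x. a x + a' x)" by (rule wt_bounded_add[OF 1(2) 2(2)])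
    show "Re (M j) > real CARD('n)" if "j < N + N'" for j using 1(3) 2(3) that by (simp add: M_def)
    show "f x + g x = a x + a' x + (\<Sum>j<N + N'. B j * power_kernel (M j) x)" if "x \<in> lattice A" for x
      using 1(4) 2(4) that unfolding s by simp
  qed
qed

lemma representable_sum:
  fixes A :: "real^'n^'n"
  assumes "\<And>i. i \<in> I \<Longrightarrow> representable A (f i)"
  shows "representable A (\<lambda>x. \<Sum>i\<in>I. f i x)"
proof -
  have z: "representable A (\<lambda>x. 0)"
    by (rule representable_regular) (simp_all add: even_on_lattice_def wt_bounded_zero)
  show ?thesis using assms
  proof (induction I rule: infinite_finite_induct)
    case (insert i I)
    then show ?case using representable_add[of A "f i" "\<lambda>x. \<Sum>i\<in>I. f i x"] by simp
  qed (use z in auto)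
qed

lemma polar_exponent_Re:
  assumes "\<nu> \<in> polar_exponents d" "Re \<nu> > real d" shows "Re \<nu> \<ge> real d + 2"
proof -
  obtain m where m: "\<nu> = of_nat d + 2 * of_nat m" using assms(1) unfolding polar_exponents_def by blast
  then have "m \<ge> 1" using assms(2) by (cases m) auto
  then show ?thesis unfolding m by simp
qed

text \<open>Exponents above the dimension at which the coefficient has a pole are at least two above it, so
  the corresponding powers may be counted as regular.\<close>

lemma representable_nonpolar:
  fixes A :: "real^'n^'n"
  assumes inv: "invertible A" and K: "representable A K"
  shows "\<exists>a (N::nat) b \<nu>. even_on_lattice A a \<and> wt_bounded A (real CARD('n) + 2) a \<and>
    (\<forall>j<N. Re (\<nu> j) > real CARD('n)) \<and> (\<forall>j<N. \<nu> j \<notin> polar_exponents CARD('n)) \<and>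
    (\<forall>x\<in>lattice A. K x = a x + (\<Sum>j<N. b j * power_kernel (\<nu> j) x))"
proof -
  let ?d = "CARD('n)" and ?P = "polar_exponents CARD('n)"
  obtain a N b \<nu> where 1: "even_on_lattice A a" "wt_bounded A (real ?d + 2) a" "\<forall>j<N::nat. Re (\<nu> j) > real ?d"
    "\<forall>x\<in>lattice A. K x = a x + (\<Sum>j<N. b j * power_kernel (\<nu> j) x)"
    using K unfolding representable_def by (elim exE conjE) (rule that)
  define a' where "a' x = a x + (\<Sum>j<N. (if \<nu> j \<in> ?P then b j * power_kernel (\<nu> j) x else 0))" for x
  define b' where "b' j = (if \<nu> j \<in> ?P then 0 else b j)" for j
  \<comment> \<open>a placeholder exponent, admissible and not polar, for the terms whose coefficient is now zero\<close>
  define \<nu>' where "\<nu>' j = (if \<nu> j \<in> ?P then of_nat ?d + 1 else \<nu> j)" for j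
  have odd: "of_nat ?d + 1 \<notin> ?P"
  proof
    assume "of_nat ?d + 1 \<in> ?P"
    then have "Re (of_nat ?d + 1) \<ge> real ?d + 2" by (rule polar_exponent_Re) simp
    then show False by simp
  qed
  show ?thesis
  proof (rule exI[of _ a'], rule exI[of _ N], rule exI[of _ b'], rule exI[of _ \<nu>'], intro conjI allI impI ballI)
    show "even_on_lattice A a'"
      using 1(1) unfolding even_on_lattice_def a'_def power_kernel_minus by simp
    have "wt_bounded A (real ?d + 2) (\<lambda>x. if \<nu> j \<in> ?P then b j * power_kernel (\<nu> j) x else 0)" if "j \<in> {..<N}" for j
      using that 1(3) polar_exponent_Re[of "\<nu> j" ?d]
      by (cases "\<nu> j \<in> ?P") (auto intro!: wt_bounded_cmult wt_bounded_power_kernel[OF inv] simp: wt_bounded_zero)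
    then show "wt_bounded A (real ?d + 2) a'"
      unfolding a'_def[abs_def] by (intro wt_bounded_add wt_bounded_sum 1(2))
    show "Re (\<nu>' j) > real ?d" if "j < N" for j using 1(3) that by (simp add: \<nu>'_def)
    show "\<nu>' j \<notin> ?P" if "j < N" for j using odd by (simp add: \<nu>'_def)
    show "K x = a' x + (\<Sum>j<N. b' j * power_kernel (\<nu>' j) x)" if "x \<in> lattice A" for x
    proof -
      have "(\<Sum>j<N. b j * power_kernel (\<nu> j) x)
          = (\<Sum>j<N. (if \<nu> j \<in> ?P then b j * power_kernel (\<nu> j) x else 0)) + (\<Sum>j<N. b' j * power_kernel (\<nu>' j) x)"
        unfolding sum.distrib[symmetric] by (intro sum.cong) (auto simp: b'_def \<nu>'_def)
      then show ?thesis using 1(4) that by (simp add: a'_def)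
    qed
  qed
qed

lemma (in tiling) representable_conv:
  assumes K1: "representable A K1" and K2: "representable A K2"
  shows "representable A (lattice_conv A K1 K2)"
proof -
  let ?d = "CARD('n)"
  obtain a1 N1 b1 \<nu>1 where r1: "even_on_lattice A a1" "wt_bounded A (real ?d + 2) a1"
    "\<forall>j<N1::nat. Re (\<nu>1 j) > real ?d" "\<forall>j<N1. \<nu>1 j \<notin> polar_exponents ?d"
    "\<forall>x\<in>L. K1 x = a1 x + (\<Sum>j<N1. b1 j * power_kernel (\<nu>1 j) x)"
    using representable_nonpolar[OF inv K1] by (elim exE conjE) (rule that)
  obtain a2 N2 b2 \<nu>2 where r2: "even_on_lattice A a2" "wt_bounded A (real ?d + 2) a2"
    "\<forall>j<N2::nat. Re (\<nu>2 j) > real ?d" "\<forall>j<N2. \<nu>2 j \<notin> polar_exponents ?d"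
    "\<forall>x\<in>L. K2 x = a2 x + (\<Sum>j<N2. b2 j * power_kernel (\<nu>2 j) x)"
    using representable_nonpolar[OF inv K2] by (elim exE conjE) (rule that)
  note 1 = r1(1,2) r1(3,4,5)[rule_format] and 2 = r2(1,2) r2(3,4,5)[rule_format]
  define k1 where "k1 = (\<lambda>x. a1 x + (\<Sum>i<N1. b1 i * power_kernel (\<nu>1 i) x))"
  define k2 where "k2 = (\<lambda>x. a2 x + (\<Sum>j<N2. b2 j * power_kernel (\<nu>2 j) x))"
  define e where "e = epstein_product_kernel N1 N2 b1 b2 \<nu>1 \<nu>2 (infsum k1 L) (infsum k2 L)"
  define a3 where "a3 x = lattice_conv A k1 k2 x - e x" for x
  have g: "real ?d + 2 > real ?d" by simp
  have le: "i < N1 \<Longrightarrow> real ?d + 2 \<le> Re (\<nu>1 i) + 2" "i < N2 \<Longrightarrow> real ?d + 2 \<le> Re (\<nu>2 i) + 2" for i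
    using 1(3) 2(3) by (simp_all add: less_imp_le)
  have "even_on_lattice A a3" "wt_bounded A (real ?d + 2) a3"
    unfolding a3_def[abs_def] e_def k1_def k2_def
    by (rule product_kernel_expansion(3,4)[where ?N1.0=N1 and ?N2.0=N2 and ?\<nu>1.0=\<nu>1 and ?\<nu>2.0=\<nu>2,
          OF 1(1,2) g 2(1,2) g 1(3,4) 2(3,4) order_refl order_refl le]; assumption)+
  then have a3: "representable A a3" by (rule representable_regular)
  have e: "representable A e"
  proof -
    have r1: "representable A (\<lambda>x. c * (\<Sum>i<N1. b1 i * power_kernel (\<nu>1 i) x))" for c
      unfolding sum_distrib_left mult.assoc[symmetric]
      by (rule representable_sum, rule representable_power_kernel, rule 1(3)) simp
    have r2: "representable A (\<lambda>x. c * (\<Sum>i<N2. b2 i * power_kernel (\<nu>2 i) x))" for c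
      unfolding sum_distrib_left mult.assoc[symmetric]
      by (rule representable_sum, rule representable_power_kernel, rule 2(3)) simp
    have re: "Re (\<nu>1 i + \<nu>2 j - of_nat ?d) > real ?d" if "i \<in> {..<N1}" "j \<in> {..<N2}" for i j
      using 1(3)[of i] 2(3)[of j] that by simp
    show ?thesis
      unfolding e_def epstein_product_kernel_def[abs_def]
      by (intro representable_add r1 r2 representable_sum representable_power_kernel re)
  qed
  show ?thesis
  proof (rule representable_cong[OF representable_add[OF a3 e]])
    fix x assume x: "x \<in> L"
    have "lattice_conv A K1 K2 x = lattice_conv A k1 k2 x"
      unfolding lattice_conv_def
      by (rule infsum_cong) (simp only: k1_def k2_def 1(5) 2(5) lattice_diff[OF x])
    then show "lattice_conv A K1 K2 x = a3 x + e x" by (simp add: a3_def)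
  qed
qed

section \<open>Graph lattice sums\<close>

text \<open>A single edge carrying the kernel realizes its lattice Fourier transform as a graph lattice sum:
  pinning the source at the origin leaves the position of the target as summation variable.\<close>

lemma lattice_fourier_is_graph_lattice_sum:
  fixes A :: "real^'n^'n"
  assumes K: "ell1 A K"
  shows "is_graph_lattice_sum A (lattice_fourier A K)"
proof -
  define D where "D = \<lparr>verts = {0, 1::nat}, arcs = {0::nat}, tail = \<lambda>_. 0, head = \<lambda>_. 1\<rparr>"
  define G :: "(nat, nat, 'n) kernel_graph" where
    "G = \<lparr>digraph_of = D, edge_kernel = \<lambda>_. K, source_node = 0, target_node = 1\<rparr>"
  have D: "verts D = {0, 1}" "arcs D = {0}" "tail D = (\<lambda>_. 0)" "head D = (\<lambda>_. 1)" by (simp_all add: D_def)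
  have conn: "Digraph_Component.connected D"
    unfolding Digraph_Component.connected_def strongly_connected_def
  proof (intro conjI ballI)
    fix u v assume uv: "u \<in> verts (mk_symmetric D)" "v \<in> verts (mk_symmetric D)"
    then have "(u, v) \<in> rtrancl_on (verts (mk_symmetric D)) (arcs_ends (mk_symmetric D))"
    proof (cases "u = v")
      case False
      then have "(u, v) \<in> arcs_ends (mk_symmetric D)" using uv by (auto simp: parcs_mk_symmetric D)
      then show ?thesis using uv by (auto intro: rtrancl_on_into_rtrancl_on[OF rtrancl_on_refl])
    qed simp
    then show "u \<rightarrow>\<^sup>*\<^bsub>mk_symmetric D\<^esub> v" unfolding reachable_def .
  qed (simp add: D)
  have G: "kernel_graph A G"
    unfolding kernel_graph_def
  proof (intro conjI)
    show "fin_digraph (digraph_of G)" by unfold_locales (auto simp: G_def D)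
    show "loopfree_digraph (digraph_of G)" by unfold_locales (auto simp: G_def D)
  qed (use conn K in \<open>auto simp: G_def D\<close>)
  have sum: "lattice_fourier A K k = graph_lattice_sum A G 0 0 k" for k
  proof -
    let ?X = "{x \<in> {0, 1::nat} \<rightarrow>\<^sub>E lattice A. x 0 = 0}"
    define place :: "real^'n \<Rightarrow> nat \<Rightarrow> real^'n" where "place y = (\<lambda>v. if v = 0 then 0 else if v = 1 then y else undefined)" for y
    have bij: "bij_betw place (lattice A) ?X"
    proof (rule bij_betwI[where g="\<lambda>x. x 1"])
      show "place \<in> lattice A \<rightarrow> ?X" by (auto simp: place_def PiE_def extensional_def)
      have X: "x \<in> {0, 1} \<rightarrow>\<^sub>E lattice A" "x 0 = 0" if "x \<in> ?X" for x using that by simp_all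
      show "(\<lambda>x. x 1) \<in> ?X \<rightarrow> lattice A"
        by (rule Pi_I) (rule PiE_mem[OF X(1)], assumption, simp)
      show "place (x 1) = x" if x: "x \<in> ?X" for x
      proof
        fix v :: nat
        consider "v = 0" | "v = 1" | "v \<noteq> 0" "v \<noteq> 1" by blast
        then show "place (x 1) v = x v"
        proof cases
          case 3
          then have "x v = undefined" by (intro PiE_arb[OF X(1)[OF x]]) simp
          then show ?thesis using 3 by (simp only: place_def if_False)
        qed (simp_all add: place_def X(2)[OF x])
      qed
    qed (simp add: place_def)
    have "graph_lattice_sum A G 0 0 k = (\<Sum>\<^sub>\<infinity>x\<in>?X. lattice_character (x 1 - x 0) k * K (x 1 - x 0))"
      by (simp add: graph_lattice_sum_def G_def D)
    also have "\<dots> = (\<Sum>\<^sub>\<infinity>y\<in>lattice A. lattice_character (place y 1 - place y 0) k * K (place y 1 - place y 0))"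
      by (rule infsum_reindex_bij_betw[OF bij, symmetric])
    also have "\<dots> = lattice_fourier A K k"
      unfolding lattice_fourier_def by (rule infsum_cong) (simp add: place_def mult.commute)
    finally show ?thesis ..
  qed
  show ?thesis
    unfolding is_graph_lattice_sum_def
  proof (rule exI[of _ G], rule exI[of _ 0], rule exI[of _ 0], intro conjI allI)
    show "kernel_graph A G" by (rule G)
    show "0 \<in> verts (digraph_of G)" by (simp add: G_def D)
    show "0 \<in> lattice A" by simp
    show "lattice_fourier A K k = graph_lattice_sum A G 0 0 k" for k by (rule sum)
  qed
qed

section \<open>The product of two semi-analytic graph lattice sums\<close>

theorem theorem6p3:
  fixes A :: "real^'n^'n"
    and G1 :: "('v1, 'e1, 'n) kernel_graph" and G2 :: "('v2, 'e2, 'n) kernel_graph"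
    and p1 :: 'v1 and p2 :: 'v2 and q1 q2 :: "real^'n"
    and Z1 Z2 :: "real^'n \<Rightarrow> complex"
    and a1 a2 :: "real^'n \<Rightarrow> complex"
    and N1 N2 :: nat
    and b1 b2 \<nu>1 \<nu>2 :: "nat \<Rightarrow> complex"
    and \<gamma>1 \<gamma>2 \<gamma>3 :: real
  assumes "invertible A"
    and "kernel_graph A G1" and "p1 \<in> verts (digraph_of G1)" and "q1 \<in> lattice A"
    and "kernel_graph A G2" and "p2 \<in> verts (digraph_of G2)" and "q2 \<in> lattice A"
    and "Z1 = graph_lattice_sum A G1 p1 q1"
    and "Z2 = graph_lattice_sum A G2 p2 q2"
    and "semi_analytic A Z1" and "semi_analytic A Z2"
    and "\<forall>k. Z1 k = lattice_fourier A a1 k + (\<Sum>i<N1. b1 i * epstein_zeta A (\<nu>1 i) k)"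
    and "\<forall>k. Z2 k = lattice_fourier A a2 k + (\<Sum>j<N2. b2 j * epstein_zeta A (\<nu>2 j) k)"
    and "even_on_lattice A a1" and "even_on_lattice A a2"
    and "\<forall>i<N1. Re (\<nu>1 i) > real CARD('n) \<and> \<nu>1 i \<notin> polar_exponents CARD('n)"
    and "\<forall>j<N2. Re (\<nu>2 j) > real CARD('n) \<and> \<nu>2 j \<notin> polar_exponents CARD('n)"
    and "\<gamma>1 > real CARD('n)" and "decays A \<gamma>1 a1"
    and "\<gamma>2 > real CARD('n)" and "decays A \<gamma>2 a2"
    and "\<gamma>3 = Min ({\<gamma>1, \<gamma>2} \<union> (\<lambda>i. Re (\<nu>1 i) + 2) ` {..<N1} \<union> (\<lambda>j. Re (\<nu>2 j) + 2) ` {..<N2})"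
  shows "is_graph_lattice_sum A (\<lambda>k. Z1 k * Z2 k)
    \<and> semi_analytic A (\<lambda>k. Z1 k * Z2 k)
    \<and> (\<exists>a3. even_on_lattice A a3 \<and> decays A \<gamma>3 a3 \<and>
           (\<forall>k. Z1 k * Z2 k =
              lattice_fourier A a3 k
              + (\<Sum>i<N1. \<Sum>j<N2. b1 i * b2 j
                   * (c_const CARD('n) (\<nu>1 i) * c_const CARD('n) (\<nu>2 j) / of_real (covolume A)
                      * inv_c_const CARD('n) (\<nu>1 i + \<nu>2 j - of_nat CARD('n)))
                   * epstein_zeta A (\<nu>1 i + \<nu>2 j - of_nat CARD('n)) k)
              + Z2 0 * (\<Sum>i<N1. b1 i * epstein_zeta A (\<nu>1 i) k)
              + Z1 0 * (\<Sum>j<N2. b2 j * epstein_zeta A (\<nu>2 j) k)))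
    \<and> (\<forall>i<N1. \<forall>j<N2. Re (\<nu>1 i + \<nu>2 j - of_nat CARD('n)) > real CARD('n))
    \<and> (\<gamma>1 \<ge> real CARD('n) + 2 \<and> \<gamma>2 \<ge> real CARD('n) + 2 \<longrightarrow> \<gamma>3 \<ge> real CARD('n) + 2)"
proof -
  let ?d = "CARD('n)" and ?L = "lattice A"
  interpret tiling A by (rule tiling.intro[OF assms(1)])
  note rep1 = assms(12)[rule_format] and rep2 = assms(13)[rule_format]
  have \<nu>1: "Re (\<nu>1 i) > real ?d" "\<nu>1 i \<notin> polar_exponents ?d" if "i < N1" for i using assms(16) that by auto
  have \<nu>2: "Re (\<nu>2 j) > real ?d" "\<nu>2 j \<notin> polar_exponents ?d" if "j < N2" for j using assms(17) that by auto
  have \<nu>3: "Re (\<nu>1 i + \<nu>2 j - of_nat ?d) > real ?d" if "i < N1" "j < N2" for i j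
    using \<nu>1(1)[OF that(1)] \<nu>2(1)[OF that(2)] by simp
  define S where "S = {\<gamma>1, \<gamma>2} \<union> (\<lambda>i. Re (\<nu>1 i) + 2) ` {..<N1} \<union> (\<lambda>j. Re (\<nu>2 j) + 2) ` {..<N2}"
  have S: "finite S" "S \<noteq> {}" by (simp_all add: S_def)
  have \<gamma>3: "\<gamma>3 = Min S" using assms(22) unfolding S_def .
  have le: "\<gamma>3 \<le> t" if "t \<in> S" for t unfolding \<gamma>3 by (rule Min_le[OF S(1) that])
  have ge: "t \<le> \<gamma>3" if "\<And>u. u \<in> S \<Longrightarrow> t \<le> u" for t unfolding \<gamma>3 using S that by simp
  have S1: "\<gamma>1 \<in> S" and S2: "\<gamma>2 \<in> S" and S3: "i < N1 \<Longrightarrow> Re (\<nu>1 i) + 2 \<in> S" and S4: "j < N2 \<Longrightarrow> Re (\<nu>2 j) + 2 \<in> S" for i j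
    unfolding S_def by blast+
  have \<gamma>3_nonneg: "\<gamma>3 \<ge> 0"
  proof (rule ge)
    fix u assume "u \<in> S"
    moreover have "real ?d \<ge> 0" by simp
    ultimately show "0 \<le> u" unfolding S_def using assms(18,20) by (auto dest!: \<nu>1(1) \<nu>2(1))
  qed
  have nonneg: "\<gamma>1 \<ge> 0" "\<gamma>2 \<ge> 0" using assms(18,20) by (auto intro: order_trans[OF _ less_imp_le])
  have wa: "wt_bounded A \<gamma>1 a1" "wt_bounded A \<gamma>2 a2"
    using assms(19,21) decays_iff_wt_bounded[OF assms(1)] nonneg by blast+
  define K1 where "K1 = (\<lambda>x. a1 x + (\<Sum>i<N1. b1 i * power_kernel (\<nu>1 i) x))"
  define K2 where "K2 = (\<lambda>x. a2 x + (\<Sum>j<N2. b2 j * power_kernel (\<nu>2 j) x))"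
  define E where "E = epstein_product_kernel N1 N2 b1 b2 \<nu>1 \<nu>2 (infsum K1 ?L) (infsum K2 ?L)"
  define a3 where "a3 = (\<lambda>x. lattice_conv A K1 K2 x - E x)"
  note expansion = product_kernel_expansion[where ?N1.0=N1 and ?N2.0=N2 and ?\<nu>1.0=\<nu>1 and ?\<nu>2.0=\<nu>2,
      OF assms(14) wa(1) assms(18) assms(15) wa(2) assms(20) \<nu>1 \<nu>2 le[OF S1] le[OF S2] le[OF S3] le[OF S4]]
  have eK1: "ell1 A K1" unfolding K1_def by (rule expansion(1); assumption)
  have eK2: "ell1 A K2" unfolding K2_def by (rule expansion(2); assumption)
  have a3_even: "even_on_lattice A a3" unfolding a3_def E_def K1_def K2_def by (rule expansion(3); assumption)
  have a3_bound: "wt_bounded A \<gamma>3 a3" unfolding a3_def E_def K1_def K2_def by (rule expansion(4); assumption)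
  have transform: "lattice_fourier A (\<lambda>x. a x + (\<Sum>i<N. b i * power_kernel (\<nu> i) x)) k
      = lattice_fourier A a k + (\<Sum>i<N. b i * epstein_zeta A (\<nu> i) k)"
    if a: "ell1 A a" and n: "\<And>i. i < N \<Longrightarrow> Re (\<nu> i) > real ?d" for a b \<nu> and N :: nat and k
  proof -
    have e: "ell1 A (\<lambda>x. b i * power_kernel (\<nu> i) x)" if "i \<in> {..<N}" for i
      using n that by (intro ell1_cmult ell1_power_kernel) simp
    have "lattice_fourier A (\<lambda>x. \<Sum>i<N. b i * power_kernel (\<nu> i) x) k = (\<Sum>i<N. lattice_fourier A (\<lambda>x. b i * power_kernel (\<nu> i) x) k)"
      by (rule lattice_fourier_sum[OF e])
    moreover have "ell1 A (\<lambda>x. \<Sum>i<N. b i * power_kernel (\<nu> i) x)" by (rule ell1_sum[OF e])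
    ultimately show ?thesis
      using lattice_fourier_add[OF a] unfolding lattice_fourier_cmult epstein_zeta_def by simp
  qed
  have ea: "ell1 A a1" "ell1 A a2"
    by (rule ell1_wt_bounded[OF assms(1,18) wa(1)], rule ell1_wt_bounded[OF assms(1,20) wa(2)])
  have Z1: "Z1 k = lattice_fourier A K1 k" for k
    unfolding rep1 K1_def by (rule transform[OF ea(1) \<nu>1(1), symmetric])
  have Z2: "Z2 k = lattice_fourier A K2 k" for k
    unfolding rep2 K2_def by (rule transform[OF ea(2) \<nu>2(1), symmetric])
  have prod: "(\<lambda>k. Z1 k * Z2 k) = lattice_fourier A (lattice_conv A K1 K2)"
    unfolding Z1 Z2 lattice_conv_fourier(2)[OF eK1 eK2] ..
  have graph: "is_graph_lattice_sum A (\<lambda>k. Z1 k * Z2 k)"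
    unfolding prod by (rule lattice_fourier_is_graph_lattice_sum[OF lattice_conv_fourier(1)[OF eK1 eK2]])
  have semi: "semi_analytic A (\<lambda>k. Z1 k * Z2 k)"
  proof -
    obtain J1 J2 where J1: "semi_analytic_kernel A J1" "\<And>k. Z1 k = lattice_fourier A J1 k"
      and J2: "semi_analytic_kernel A J2" "\<And>k. Z2 k = lattice_fourier A J2 k"
      using assms(10,11) unfolding semi_analytic_def by blast
    have J: "ell1 A J1" "ell1 A J2" "representable A J1" "representable A J2"
      using J1(1) J2(1) unfolding semi_analytic_kernel_iff[OF assms(1)] by simp_all
    have "semi_analytic_kernel A (lattice_conv A J1 J2)"
      unfolding semi_analytic_kernel_iff[OF assms(1)]
      by (intro conjI lattice_conv_fourier(1) representable_conv J)
    then show ?thesis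
      unfolding semi_analytic_def J1(2) J2(2) using lattice_conv_fourier(2)[OF J(1,2)] by metis
  qed
  have expand: "Z1 k * Z2 k = lattice_fourier A a3 k
              + (\<Sum>i<N1. \<Sum>j<N2. b1 i * b2 j
                   * (c_const CARD('n) (\<nu>1 i) * c_const CARD('n) (\<nu>2 j) / of_real (covolume A)
                      * inv_c_const CARD('n) (\<nu>1 i + \<nu>2 j - of_nat CARD('n)))
                   * epstein_zeta A (\<nu>1 i + \<nu>2 j - of_nat CARD('n)) k)
              + Z2 0 * (\<Sum>i<N1. b1 i * epstein_zeta A (\<nu>1 i) k)
              + Z1 0 * (\<Sum>j<N2. b2 j * epstein_zeta A (\<nu>2 j) k)" for k
  proof -
    define B where "B i j = b1 i * b2 j * (c_const CARD('n) (\<nu>1 i) * c_const CARD('n) (\<nu>2 j) / of_real (covolume A)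
                      * inv_c_const CARD('n) (\<nu>1 i + \<nu>2 j - of_nat CARD('n)))" for i j
    define M where "M i j = \<nu>1 i + \<nu>2 j - of_nat CARD('n)" for i j
    have z: "infsum K1 ?L = Z1 0" "infsum K2 ?L = Z2 0" by (simp_all add: Z1 Z2 lattice_fourier_0)
    have z0: "ell1 A (\<lambda>x. 0 :: complex)" by (simp add: ell1_def)
    have F0: "lattice_fourier A (\<lambda>x. 0) k = 0" by (simp add: lattice_fourier_def)
    have single: "lattice_fourier A (\<lambda>x. \<Sum>i<N. b i * power_kernel (\<nu> i) x) k = (\<Sum>i<N. b i * epstein_zeta A (\<nu> i) k)"
      if "\<And>i. i < N \<Longrightarrow> Re (\<nu> i) > real ?d" for b \<nu> and N :: nat
    proof -
      have "lattice_fourier A (\<lambda>x. 0 + (\<Sum>i<N. b i * power_kernel (\<nu> i) x)) k = lattice_fourier A (\<lambda>x. 0) k + (\<Sum>i<N. b i * epstein_zeta A (\<nu> i) k)"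
        by (rule transform[OF z0 that])
      then show ?thesis unfolding F0 by (simp only: add_0)
    qed
    have esum: "ell1 A (\<lambda>x. \<Sum>i<N. b i * power_kernel (\<nu> i) x)" if "\<And>i. i < N \<Longrightarrow> Re (\<nu> i) > real ?d" for b \<nu> and N :: nat
      by (rule ell1_sum, rule ell1_cmult, rule ell1_power_kernel, rule that) simp
    have e2: "ell1 A (\<lambda>x. \<Sum>j<N2. B i j * power_kernel (M i j) x)" if "i \<in> {..<N1}" for i
      by (rule esum) (use \<nu>3 that in \<open>simp add: M_def\<close>)
    have f2: "lattice_fourier A (\<lambda>x. \<Sum>j<N2. B i j * power_kernel (M i j) x) k = (\<Sum>j<N2. B i j * epstein_zeta A (M i j) k)" if "i \<in> {..<N1}" for i
      by (rule single) (use \<nu>3 that in \<open>simp add: M_def\<close>)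
    have e3: "ell1 A (\<lambda>x. \<Sum>i<N1. \<Sum>j<N2. B i j * power_kernel (M i j) x)" by (rule ell1_sum[OF e2])
    have f3: "lattice_fourier A (\<lambda>x. \<Sum>i<N1. \<Sum>j<N2. B i j * power_kernel (M i j) x) k = (\<Sum>i<N1. \<Sum>j<N2. B i j * epstein_zeta A (M i j) k)"
      using lattice_fourier_sum[of "{..<N1}" A "\<lambda>i x. \<Sum>j<N2. B i j * power_kernel (M i j) x" k, OF e2] f2 by simp
    have e4: "ell1 A (\<lambda>x. Z2 0 * (\<Sum>i<N1. b1 i * power_kernel (\<nu>1 i) x))" by (rule ell1_cmult, rule esum, rule \<nu>1(1))
    have e5: "ell1 A (\<lambda>x. Z1 0 * (\<Sum>j<N2. b2 j * power_kernel (\<nu>2 j) x))" by (rule ell1_cmult, rule esum, rule \<nu>2(1))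
    have f4: "lattice_fourier A (\<lambda>x. Z2 0 * (\<Sum>i<N1. b1 i * power_kernel (\<nu>1 i) x)) k = Z2 0 * (\<Sum>i<N1. b1 i * epstein_zeta A (\<nu>1 i) k)"
      unfolding lattice_fourier_cmult by (rule arg_cong[where f="(*) (Z2 0)"], rule single, rule \<nu>1(1))
    have f5: "lattice_fourier A (\<lambda>x. Z1 0 * (\<Sum>j<N2. b2 j * power_kernel (\<nu>2 j) x)) k = Z1 0 * (\<Sum>j<N2. b2 j * epstein_zeta A (\<nu>2 j) k)"
      unfolding lattice_fourier_cmult by (rule arg_cong[where f="(*) (Z1 0)"], rule single, rule \<nu>2(1))
    have Eeq: "E = (\<lambda>x. (\<Sum>i<N1. \<Sum>j<N2. B i j * power_kernel (M i j) x) + Z2 0 * (\<Sum>i<N1. b1 i * power_kernel (\<nu>1 i) x)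
        + Z1 0 * (\<Sum>j<N2. b2 j * power_kernel (\<nu>2 j) x))"
      unfolding E_def epstein_product_kernel_def[abs_def] z B_def M_def ..
    have eE: "ell1 A E" unfolding Eeq by (rule ell1_add[OF ell1_add[OF e3 e4] e5])
    have fE: "lattice_fourier A E k = (\<Sum>i<N1. \<Sum>j<N2. B i j * epstein_zeta A (M i j) k)
        + Z2 0 * (\<Sum>i<N1. b1 i * epstein_zeta A (\<nu>1 i) k) + Z1 0 * (\<Sum>j<N2. b2 j * epstein_zeta A (\<nu>2 j) k)"
      unfolding Eeq lattice_fourier_add[OF ell1_add[OF e3 e4] e5] lattice_fourier_add[OF e3 e4] f3 f4 f5 ..
    have ec: "ell1 A (lattice_conv A K1 K2)" by (rule lattice_conv_fourier(1)[OF eK1 eK2])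
    have e_a3: "ell1 A a3"
      using ell1_add[OF ec ell1_cmult[OF eE, of "-1"]] by (simp add: a3_def)
    have "lattice_conv A K1 K2 = (\<lambda>x. a3 x + E x)" by (simp add: a3_def)
    then have "lattice_fourier A (lattice_conv A K1 K2) k = lattice_fourier A a3 k + lattice_fourier A E k"
      using lattice_fourier_add[OF e_a3 eE, of k] by (simp only:)
    then show ?thesis
      unfolding fun_cong[OF prod, of k] fE B_def M_def by (simp only: add.assoc)
  qed
  have "decays A \<gamma>3 a3" unfolding decays_iff_wt_bounded[OF assms(1) \<gamma>3_nonneg] by (rule a3_bound)
  moreover have "\<gamma>3 \<ge> real ?d + 2" if "\<gamma>1 \<ge> real ?d + 2 \<and> \<gamma>2 \<ge> real ?d + 2"
    by (rule ge) (use that \<nu>1(1) \<nu>2(1) in \<open>auto simp: S_def less_imp_le\<close>)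
  ultimately show ?thesis using graph semi a3_even expand \<nu>3 by (intro conjI exI[of _ a3]) auto
qed

end
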